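(* Let $d=1$ and let the triangular array $X_{t,n}=G_n(t/n,\boldsymbol{\epsilon}_t)$, $t=1,\dots,n$, satisfy assumptions (A.1), (A.2) and (A.3) below for some $q>2$ and some $p\ge 1$. Define the local long-run variance $$\sigma^2(u)=\sum_{h=-\infty}^{\infty}\operatorname{Cov}\big[G(u,\boldsymbol{\epsilon}_h),G(u,\boldsymbol{\epsilon}_0)\big],\qquad u\in[0,1].$$ Then, as $n\to\infty$, $$\frac{1}{\sqrt n}\sum_{t=1}^{\lfloor nv\rfloor}\big[X_{t,n}-\mathbb{E}X_{t,n}\big]\ \rightsquigarrow\ B\Big(\int_0^v\sigma^2(u)\,du\Big),$$ where $B$ is a standard Brownian motion, and the weak convergence holds in the Skorokhod space $D[0,1]$ (as processes in $v\in[0,1]$).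
   Context: Let $(\epsilon_i)_{i\in\mathbb Z}$ be i.i.d. random variables and $(\epsilon_i^* )_{i\in\mathbb Z}$ an independent copy of them. Write $\boldsymbol{\epsilon}_t=(\epsilon_t,\epsilon_{t-1},\dots)\in\mathbb R^\infty$ and, for $j\ge 0$, $\tilde{\boldsymbol{\epsilon}}_{t,j}=(\epsilon_t,\dots,\epsilon_{t-j+1},\epsilon^*_{t-j},\epsilon_{t-j-1},\dots)$ (only the coordinate $\epsilon_{t-j}$ is replaced by its copy). $\mathbb R^\infty$ carries the $\sigma$-algebra generated by finite-dimensional projections. For each $n$, $G_n:\mathbb R\times\mathbb R^\infty\to\mathbb R^d$ is measurable, and $G:\mathbb R\times\mathbb R^\infty\to\mathbb R^d$ is a measurable limiting kernel; $X_{t,n}=G_n(t/n,\boldsymbol{\epsilon}_t)$. For a random vector $Y$, $\|Y\|_{L_q}=(\mathbb E\|Y\|^q)^{1/q}$. The $p$-variation of $G_n$ is $$\|G_n\|_{p\text{-var}}=\sup_{m\in\mathbb N,\,0=u_0<u_1<\dots<u_m=1}\Big(\sum_{i=1}^m\|G_n(u_i,\boldsymbol{\epsilon}_0)-G_n(u_{i-1},\boldsymbol{\epsilon}_0)\|_{L_q}^p\Big)^{1/p}.$$ Assumptions: (A.1) $\sup_{u\in[0,1]}\|G_n(u,\boldsymbol{\epsilon}_0)-G(u,\boldsymbol{\epsilon}_0)\|_{L_q}\to0$ as $n\to\infty$. (A.2) $\sup_n\sup_{u\in[0,1]}\|G_n(u,\boldsymbol{\epsilon}_0)\|_{L_q}+\sup_n\|G_n\|_{p\text{-var}}\le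 C_G<\infty$. (A.3) There is $\rho\in(0,1)$ such that $\|G_n(u,\boldsymbol{\epsilon}_t)-G_n(u,\tilde{\boldsymbol{\epsilon}}_{t,j})\|_{L_q}\le C_G\rho^j$ for all $j,n\in\mathbb N$, $u\in[0,1]$. *)

theory Defs
  imports "HOL-Probability.Probability"
begin

definition shift_vec :: "(int \<Rightarrow> 'a \<Rightarrow> real) \<Rightarrow> int \<Rightarrow> 'a \<Rightarrow> (nat \<Rightarrow> real)" where
  "shift_vec eps t \<omega> = (\<lambda>k. eps (t - int k) \<omega>)"

definition shift_vec_coupled ::
  "(int \<Rightarrow> 'a \<Rightarrow> real) \<Rightarrow> (int \<Rightarrow> 'a \<Rightarrow> real) \<Rightarrow> int \<Rightarrow> nat \<Rightarrow> 'a \<Rightarrow> (nat \<Rightarrow> real)" where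
  "shift_vec_coupled eps eps' t j \<omega> =
     (\<lambda>k. if k = j then eps' (t - int j) \<omega> else eps (t - int k) \<omega>)"

abbreviation Rinf :: "(nat \<Rightarrow> real) measure" where
  "Rinf \<equiv> PiM UNIV (\<lambda>_. borel)"

definition Lq_norm :: "'a measure \<Rightarrow> real \<Rightarrow> ('a \<Rightarrow> real) \<Rightarrow> real" where
  "Lq_norm M q Y = (\<integral>\<omega>. \<bar>Y \<omega>\<bar> powr q \<partial>M) powr (1 / q)"

definition covariance :: "'a measure \<Rightarrow> ('a \<Rightarrow> real) \<Rightarrow> ('a \<Rightarrow> real) \<Rightarrow> real" where
  "covariance M X Y =
     (\<integral>\<omega>. (X \<omega> - (\<integral>\<omega>'. X \<omega>' \<partial>M)) * (Y \<omega> - (\<integral>\<omega>'. Y \<omega>' \<partial>M)) \<partial>M)"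

definition is_partition01 :: "nat \<Rightarrow> (nat \<Rightarrow> real) \<Rightarrow> bool" where
  "is_partition01 m u \<longleftrightarrow> m \<ge> 1 \<and> u 0 = 0 \<and> u m = 1 \<and> (\<forall>i<m. u i < u (Suc i))"

definition pvar_sum :: "'a measure \<Rightarrow> real \<Rightarrow> real \<Rightarrow> (real \<Rightarrow> 'a \<Rightarrow> real) \<Rightarrow> nat \<Rightarrow> (nat \<Rightarrow> real) \<Rightarrow> real" where
  "pvar_sum M q p F m u =
     (\<Sum>i=1..m. (Lq_norm M q (\<lambda>\<omega>. F (u i) \<omega> - F (u (i - 1)) \<omega>)) powr p) powr (1 / p)"

definition cadlag01 :: "(real \<Rightarrow> real) \<Rightarrow> bool" where
  "cadlag01 x \<longleftrightarrow> (\<forall>t\<in>{0..<1}. continuous (at_right t) x) \<and>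
                   (\<forall>t\<in>{0<..1}. \<exists>l. (x \<longlongrightarrow> l) (at_left t))"

definition time_changes01 :: "(real \<Rightarrow> real) set" where
  "time_changes01 = {l. strict_mono_on {0..1} l \<and> continuous_on {0..1} l \<and> l 0 = 0 \<and> l 1 = 1}"

definition skorokhod_dist :: "(real \<Rightarrow> real) \<Rightarrow> (real \<Rightarrow> real) \<Rightarrow> real" where
  "skorokhod_dist x y = Inf {max (SUP t\<in>{0..1}. \<bar>l t - t\<bar>) (SUP t\<in>{0..1}. \<bar>x t - y (l t)\<bar>) | l. l \<in> time_changes01}"

definition D_bounded_continuous :: "((real \<Rightarrow> real) \<Rightarrow> real) \<Rightarrow> bool" where
  "D_bounded_continuous h \<longleftrightarrow>
     (\<exists>K. \<forall>x. cadlag01 x \<longrightarrow> \<bar>h x\<bar> \<le> K) \<and>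
     (\<forall>x xs. cadlag01 x \<longrightarrow> (\<forall>k. cadlag01 (xs k)) \<longrightarrow>
        (\<lambda>k. skorokhod_dist (xs k) x) \<longlonglongrightarrow> 0 \<longrightarrow> (\<lambda>k. h (xs k)) \<longlonglongrightarrow> h x)"

definition weak_conv_D ::
  "'a measure \<Rightarrow> (nat \<Rightarrow> 'a \<Rightarrow> real \<Rightarrow> real) \<Rightarrow> 'b measure \<Rightarrow> ('b \<Rightarrow> real \<Rightarrow> real) \<Rightarrow> bool" where
  "weak_conv_D M S N Z \<longleftrightarrow>
     (\<forall>h. D_bounded_continuous h \<longrightarrow>
        (\<lambda>n. \<integral>\<omega>. h (S n \<omega>) \<partial>M) \<longlonglongrightarrow> (\<integral>\<omega>. h (Z \<omega>) \<partial>N))"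

definition std_brownian_motion :: "'b measure \<Rightarrow> (real \<Rightarrow> 'b \<Rightarrow> real) \<Rightarrow> bool" where
  "std_brownian_motion N B \<longleftrightarrow>
     prob_space N \<and>
     (\<forall>t\<ge>0. B t \<in> borel_measurable N) \<and>
     (\<forall>\<omega>\<in>space N. B 0 \<omega> = 0 \<and> continuous_on {0..} (\<lambda>t. B t \<omega>)) \<and>
     (\<forall>s t. 0 \<le> s \<longrightarrow> s < t \<longrightarrow>
        distributed N lborel (\<lambda>\<omega>. B t \<omega> - B s \<omega>) (normal_density 0 (sqrt (t - s)))) \<and>
     (\<forall>(ts :: nat \<Rightarrow> real) k. 0 \<le> ts 0 \<longrightarrow> (\<forall>i<k. ts i < ts (Suc i)) \<longrightarrow>
        prob_space.indep_vars N (\<lambda>_. borel) (\<lambda>i \<omega>. B (ts (Suc i)) \<omega> - B (ts i) \<omega>) {..<k})"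

end

theory Submission
  imports Defs
begin

text \<open>
  Write \<open>head_mean j f\<close> for the conditional expectation of a kernel \<open>f\<close> given its first \<open>j\<close>
  coordinates. Replacing one innovation by its copy bounds the increments
  \<open>head_mean (Suc j) f - head_mean j f\<close> by \<open>C * \<rho> ^ j\<close>, so a maximal inequality for finitely
  dependent arrays, applied to each increment, makes the partial-sum process uniformly close to that
  of an \<open>m\<close>-dependent kernel. Bounded \<open>p\<close>-variation forces the mean square of the increments of \<open>G\<close>
  over a grid of mesh \<open>1/n\<close> to vanish, hence the time variable may be frozen on blocks of length
  \<open>L + m\<close>. After truncation and removal of the last \<open>m\<close> terms of each block one is left with bounded
  independent block sums, for which a Donsker theorem holds with variance function the integral of a
  block variance. Taking \<open>L = m ^ 4\<close> and letting \<open>m\<close> grow, the block variances converge uniformly to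
  the long-run variance. Since the limit paths are continuous, it suffices throughout to test with
  bounded functionals that are Lipschitz for the uniform distance.
\<close>

section \<open>Weak convergence in D[0,1] by Lipschitz functionals\<close>

text \<open>Bounded \<open>p\<close>-variation lets \<open>G\<close> jump in its time argument, and
  for \<open>p > 2\<close> it gives no uniform bound on sums of squared increments. What it does
  bound is a count: in any chain of times at most \<open>Vp / \<eta> powr p\<close> increments
  exceed \<open>\<eta>\<close>. Time regularity is therefore used only on average over a grid, never
  at a fixed time, and Riemann sums are compared with integrals over all cells at a common offset.

  The exponent 4 balances two costs. The maximal inequality for kernels with a window of length
  \<open>m\<close> loses a factor of order \<open>m^2\<close>, and discarding the gaps leaves a mean
  square error of order \<open>m / L\<close>; hence \<open>L\<close> must outgrow
  \<open>m^3\<close>. The truncation error is multiplied by \<open>L\<close> in the block variance,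
  so it is taken of order \<open>m\<close> to the power \<open>-5\<close>; the margin
  \<open>q > 2\<close> makes such a choice possible uniformly in time.

  Test functionals come without any measurability on the path space. It is derived by rounding the
  coefficients of step paths, so that only countably many paths occur, and by sampling continuous
  paths on a grid.\<close>

definition sup_near :: "(real \<Rightarrow> real) \<Rightarrow> (real \<Rightarrow> real) \<Rightarrow> real \<Rightarrow> bool" where
  "sup_near x y c \<longleftrightarrow> (\<forall>t\<in>{0..1}. \<bar>x t - y t\<bar> \<le> c)"

text \<open>Uniform convergence implies Skorokhod convergence, so this class contains the Skorokhod
  continuous functionals. The rates \<open>e\<close> are explicit data, so that no supremum over a
  possibly unbounded set has to be formed.\<close>

definition sup_continuous_D :: "((real \<Rightarrow> real) \<Rightarrow> real) \<Rightarrow> bool" where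
  "sup_continuous_D h \<longleftrightarrow>
     (\<forall>x xs e. cadlag01 x \<longrightarrow> (\<forall>k. cadlag01 (xs k)) \<longrightarrow> (\<forall>k. sup_near (xs k) x (e k)) \<longrightarrow>
        e \<longlonglongrightarrow> (0::real) \<longrightarrow> (\<lambda>k::nat. h (xs k)) \<longlonglongrightarrow> h x)"

definition bounded_lipschitz_D :: "real \<Rightarrow> real \<Rightarrow> ((real \<Rightarrow> real) \<Rightarrow> real) \<Rightarrow> bool" where
  "bounded_lipschitz_D L K h \<longleftrightarrow> 0 \<le> L \<and> (\<forall>x. cadlag01 x \<longrightarrow> \<bar>h x\<bar> \<le> K) \<and>
     (\<forall>x y c. cadlag01 x \<longrightarrow> cadlag01 y \<longrightarrow> sup_near x y c \<longrightarrow> \<bar>h x - h y\<bar> \<le> L * c)"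

lemma sup_continuous_DD:
  assumes "sup_continuous_D h" "cadlag01 x" "\<And>k. cadlag01 (xs k)" "\<And>k. sup_near (xs k) x (e k)" "e \<longlonglongrightarrow> 0"
  shows "(\<lambda>k. h (xs k)) \<longlonglongrightarrow> h x"
  using assms unfolding sup_continuous_D_def by blast

lemma sup_near_refl: "sup_near x x 0"
  by (simp add: sup_near_def)

lemma sup_near_nonneg: "sup_near x y c \<Longrightarrow> 0 \<le> c"
  unfolding sup_near_def by (metis abs_ge_zero atLeastAtMost_iff order.refl order_trans zero_le_one)

lemma sup_near_sym: "sup_near x y c \<Longrightarrow> sup_near y x c"
  by (simp add: sup_near_def abs_minus_commute)

lemma sup_near_trans: "sup_near x y c \<Longrightarrow> sup_near y z d \<Longrightarrow> sup_near x z (c + d)"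
  unfolding sup_near_def by (smt (verit))

lemma bounded_lipschitz_imp_sup_continuous:
  assumes "bounded_lipschitz_D L K h"
  shows "sup_continuous_D h"
  unfolding sup_continuous_D_def
proof (intro allI impI)
  fix x xs e
  assume *: "cadlag01 x" "\<forall>k. cadlag01 (xs k)" "\<forall>k. sup_near (xs k) x (e k)" "e \<longlonglongrightarrow> 0"
  have "(\<lambda>k. L * e k) \<longlonglongrightarrow> 0"
    using tendsto_mult_left[OF *(4), of L] by simp
  moreover have "\<forall>\<^sub>F k in sequentially. norm (h (xs k) - h x) \<le> L * e k"
    using assms * by (auto simp: bounded_lipschitz_D_def)
  ultimately have "(\<lambda>k. h (xs k) - h x) \<longlonglongrightarrow> 0"
    by (rule Lim_null_comparison[rotated])
  then show "(\<lambda>k. h (xs k)) \<longlonglongrightarrow> h x"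
    by (simp add: LIM_zero_iff)
qed

text \<open>The identity is an admissible time change, which gives the upper bound. For the lower
  bound the first supremum is enough: a time change maps the unit interval into itself, so that
  supremum is over a bounded set and is nonnegative, whatever the value of the second one.\<close>

lemma skorokhod_dist_le_sup:
  assumes "sup_near x y c"
  shows "0 \<le> skorokhod_dist x y" "skorokhod_dist x y \<le> c"
proof -
  let ?f = "\<lambda>l. max (SUP t\<in>{0..1}. \<bar>l t - t\<bar>) (SUP t\<in>{0..1}. \<bar>x t - y (l t)\<bar>)"
  have nonneg: "0 \<le> ?f l" if l: "l \<in> time_changes01" for l
  proof -
    have "\<bar>l t - t\<bar> \<le> 1" if "t \<in> {0..1}" for t
    proof -
      have "mono_on {0..1} l"
        using l by (auto simp: time_changes01_def intro: strict_mono_on_imp_mono_on)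
      then have "l 0 \<le> l t" "l t \<le> l 1"
        using that by (auto intro: mono_onD)
      then show ?thesis
        using l that by (auto simp: time_changes01_def)
    qed
    then have "bdd_above ((\<lambda>t. \<bar>l t - t\<bar>) ` {0..1})"
      by (meson bdd_aboveI2)
    then have "\<bar>l 0 - 0\<bar> \<le> (SUP t\<in>{0..1}. \<bar>l t - t\<bar>)"
      by (rule cSUP_upper[rotated]) simp
    then show ?thesis by simp
  qed
  have id: "(\<lambda>t. t) \<in> time_changes01"
    by (auto simp: time_changes01_def strict_mono_on_def)
  show "0 \<le> skorokhod_dist x y"
    unfolding skorokhod_dist_def
    by (rule cInf_greatest) (use id nonneg in auto)
  have "skorokhod_dist x y \<le> ?f (\<lambda>t. t)"
    unfolding skorokhod_dist_def
  proof (rule cInf_lower)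
    show "?f (\<lambda>t. t) \<in> {?f l | l. l \<in> time_changes01}"
      by (intro CollectI exI[of _ "\<lambda>t. t"] conjI refl id)
    show "bdd_below {?f l | l. l \<in> time_changes01}" using nonneg by (intro bdd_belowI[of _ 0]) blast
  qed
  also have "\<dots> \<le> c"
    using assms sup_near_nonneg[OF assms] by (auto simp: sup_near_def intro!: cSUP_least)
  finally show "skorokhod_dist x y \<le> c" .
qed

lemma D_bounded_continuous_imp_sup_continuous:
  assumes "D_bounded_continuous h"
  shows "sup_continuous_D h"
  unfolding sup_continuous_D_def
proof (intro allI impI)
  fix x xs e
  assume *: "cadlag01 x" "\<forall>k. cadlag01 (xs k)" "\<forall>k. sup_near (xs k) x (e k)" "e \<longlonglongrightarrow> (0::real)"
  have "(\<lambda>k. skorokhod_dist (xs k) x) \<longlonglongrightarrow> 0"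
    by (rule real_tendsto_sandwich[OF _ _ tendsto_const *(4)])
       (use *(3) skorokhod_dist_le_sup in \<open>blast intro: always_eventually\<close>)+
  then show "(\<lambda>k. h (xs k)) \<longlonglongrightarrow> h x"
    using assms * by (auto simp: D_bounded_continuous_def)
qed

section \<open>Lipschitz envelopes of bounded functionals\<close>

definition inf_convolution :: "((real \<Rightarrow> real) \<Rightarrow> real) \<Rightarrow> nat \<Rightarrow> (real \<Rightarrow> real) \<Rightarrow> real" where
  "inf_convolution h k x = Inf {h y + real k * c | y c. cadlag01 y \<and> sup_near x y c}"

context
  fixes h :: "(real \<Rightarrow> real) \<Rightarrow> real" and K :: real
  assumes bnd: "\<And>x. cadlag01 x \<Longrightarrow> \<bar>h x\<bar> \<le> K"
begin

lemma inf_convolution_bdd_below: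
  "bdd_below {h y + real k * c | y c. cadlag01 y \<and> sup_near x y c}"
proof (rule bdd_belowI[of _ "- K"])
  fix a assume "a \<in> {h y + real k * c | y c. cadlag01 y \<and> sup_near x y c}"
  then obtain y c where a: "a = h y + real k * c" "cadlag01 y" "sup_near x y c" by auto
  have "0 \<le> real k * c" using sup_near_nonneg[OF a(3)] by simp
  then show "- K \<le> a" using bnd[OF a(2)] a(1) by linarith
qed

lemma inf_convolution_lower:
  assumes "cadlag01 y" "sup_near x y c"
  shows "inf_convolution h k x \<le> h y + real k * c"
  unfolding inf_convolution_def
  by (rule cInf_lower[OF _ inf_convolution_bdd_below]) (use assms in auto)

lemma inf_convolution_le: "cadlag01 x \<Longrightarrow> inf_convolution h k x \<le> h x"
  using inf_convolution_lower[OF _ sup_near_refl, of x k] by simp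

lemma inf_convolution_greatest:
  assumes "cadlag01 x" "\<And>y c. cadlag01 y \<Longrightarrow> sup_near x y c \<Longrightarrow> a \<le> h y + real k * c"
  shows "a \<le> inf_convolution h k x"
  unfolding inf_convolution_def
  by (rule cInf_greatest) (use assms sup_near_refl in blast)+

text \<open>\<open>inf_convolution h k\<close> is the Lipschitz envelope of \<open>h\<close> from
  below, the cost \<open>c\<close> ranging over all bounds of the uniform distance. The lower bound
  \<open>- K\<close> holds because costs are nonnegative; the Lipschitz bound is the triangle
  inequality inside the infimum.\<close>

lemma bounded_lipschitz_inf_convolution: "bounded_lipschitz_D (real k) K (inf_convolution h k)"
proof -
  have "\<bar>inf_convolution h k x\<bar> \<le> K" if x: "cadlag01 x" for x
  proof -
    have "- K \<le> inf_convolution h k x"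
      by (rule inf_convolution_greatest[OF x])
         (smt (verit) bnd mult_nonneg_nonneg of_nat_0_le_iff sup_near_nonneg)
    then show ?thesis
      using inf_convolution_le[OF x, of k] bnd[OF x] by linarith
  qed
  moreover have "inf_convolution h k x \<le> inf_convolution h k y + real k * c"
    if "cadlag01 x" "cadlag01 y" "sup_near x y c" for x y c
  proof -
    have "inf_convolution h k x - real k * c \<le> inf_convolution h k y"
    proof (rule inf_convolution_greatest[OF that(2)])
      fix z d assume "cadlag01 z" "sup_near y z d"
      then have "inf_convolution h k x \<le> h z + real k * (c + d)"
        using that by (intro inf_convolution_lower) (auto intro: sup_near_trans)
      then show "inf_convolution h k x - real k * c \<le> h z + real k * d"
        by (simp add: algebra_simps)
    qed
    then show ?thesis by simp
  qed
  ultimately show ?thesis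
    unfolding bounded_lipschitz_D_def using sup_near_sym by (smt (verit, best) of_nat_0_le_iff)
qed

text \<open>A near-minimiser for the penalty \<open>k\<close> costs at most
  \<open>2 * K / k\<close>, since \<open>h\<close> varies by at most \<open>2 * K\<close>. If the
  infima stayed below \<open>h x - r\<close>, near-minimisers would converge uniformly to
  \<open>x\<close> with values below \<open>h x - r / 2\<close>, against continuity.\<close>

lemma inf_convolution_tendsto:
  assumes cont: "sup_continuous_D h" and x: "cadlag01 x"
  shows "(\<lambda>k. inf_convolution h k x) \<longlonglongrightarrow> h x"
proof (rule LIMSEQ_I)
  fix r :: real assume r: "0 < r"
  have "\<exists>k0. \<forall>k\<ge>k0. h x - r < inf_convolution h k x"
  proof (rule ccontr)
    assume "\<not> ?thesis"
    then have *: "\<forall>k0. \<exists>k\<ge>k0. inf_convolution h k x \<le> h x - r" by (auto simp: not_less)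
    \<comment> \<open>Weakening \<open>r\<close> to \<open>r / 2\<close> leaves room for an infimum
      that is not attained; the penalty \<open>Suc k0\<close> is positive, so the cost can be solved
      for.\<close>
    define P where "P k0 y c \<longleftrightarrow> cadlag01 y \<and> sup_near x y c \<and> h y + real (Suc k0) * c < h x - r / 2"
      for k0 :: nat and y c
    have "\<exists>y c. P k0 y c" for k0
    proof (rule ccontr)
      assume "\<not> ?thesis"
      then have **: "\<And>y c. cadlag01 y \<Longrightarrow> sup_near x y c \<Longrightarrow> h x - r / 2 \<le> h y + real (Suc k0) * c"
        by (auto simp: P_def not_less)
      obtain k where k: "k \<ge> Suc k0" "inf_convolution h k x \<le> h x - r" using * by blast
      have "h x - r / 2 \<le> inf_convolution h k x"
      proof (rule inf_convolution_greatest[OF x])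
        fix y c assume yc: "cadlag01 y" "sup_near x y c"
        have "real (Suc k0) * c \<le> real k * c"
          using k(1) sup_near_nonneg[OF yc(2)] by (intro mult_right_mono) auto
        then show "h x - r / 2 \<le> h y + real k * c" using **[OF yc] by linarith
      qed
      then show False using k(2) r by linarith
    qed
    then obtain y c where "\<And>k0. P k0 (y k0) (c k0)" by metis
    then have yc: "\<And>k0. cadlag01 (y k0)" "\<And>k0. sup_near x (y k0) (c k0)"
      "\<And>k0. h (y k0) + real (Suc k0) * c k0 < h x - r / 2" by (auto simp: P_def)
    have "c k0 \<le> 2 * K * inverse (real (Suc k0))" for k0
    proof -
      have "real (Suc k0) * c k0 \<le> 2 * K"
        using yc(3)[of k0] bnd[OF yc(1)[of k0]] bnd[OF x] r by linarith
      then show ?thesis by (simp add: field_simps)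
    qed
    moreover have lim0: "(\<lambda>k0. 2 * K * inverse (real (Suc k0))) \<longlonglongrightarrow> 0"
      using tendsto_mult_left[OF LIMSEQ_inverse_real_of_nat, of "2 * K"] by simp
    ultimately have "c \<longlonglongrightarrow> 0"
      using sup_near_nonneg[OF yc(2)]
      by (intro tendsto_sandwich[OF always_eventually always_eventually tendsto_const lim0]) auto
    then have "(\<lambda>k. h (y k)) \<longlonglongrightarrow> h x"
      by (rule sup_continuous_DD[OF cont x yc(1) sup_near_sym[OF yc(2)]])
    moreover have "h (y k) \<le> h x - r / 2" for k
      using yc(3)[of k] sup_near_nonneg[OF yc(2)[of k]]
      by (smt (verit) mult_nonneg_nonneg of_nat_0_le_iff)
    ultimately have "h x \<le> h x - r / 2"
      by (intro LIMSEQ_le_const2) auto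
    then show False using r by simp
  qed
  then obtain k0 where k0: "\<And>k. k \<ge> k0 \<Longrightarrow> h x - r < inf_convolution h k x" by blast
  have "norm (inf_convolution h k x - h x) < r" if "k \<ge> k0" for k
    using k0[OF that] inf_convolution_le[OF x, of k] r by (simp add: abs_if)
  then show "\<exists>no. \<forall>n\<ge>no. norm (inf_convolution h n x - h x) < r" by blast
qed

end

text \<open>Approximating a continuous functional from below by inf-convolutions, and its negative
  likewise, reduces weak convergence to Lipschitz functionals without any compactness.\<close>

lemma weak_conv_D_if_lipschitz:
  fixes S :: "nat \<Rightarrow> 'a \<Rightarrow> real \<Rightarrow> real" and Z :: "'b \<Rightarrow> real \<Rightarrow> real"
  assumes M: "prob_space M" and N: "prob_space N"
    and cS: "\<And>n \<omega>. \<omega> \<in> space M \<Longrightarrow> cadlag01 (S n \<omega>)"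
    and cZ: "\<And>\<omega>. \<omega> \<in> space N \<Longrightarrow> cadlag01 (Z \<omega>)"
    and mS: "\<And>f n. sup_continuous_D f \<Longrightarrow> (\<lambda>\<omega>. f (S n \<omega>)) \<in> borel_measurable M"
    and mZ: "\<And>f. sup_continuous_D f \<Longrightarrow> (\<lambda>\<omega>. f (Z \<omega>)) \<in> borel_measurable N"
    and lip: "\<And>f L K. bounded_lipschitz_D L K f \<Longrightarrow>
       (\<lambda>n. \<integral>\<omega>. f (S n \<omega>) \<partial>M) \<longlonglongrightarrow> (\<integral>\<omega>. f (Z \<omega>) \<partial>N)"
  shows "weak_conv_D M S N Z"
proof -
  interpret M: prob_space M by fact
  interpret N: prob_space N by fact
  \<comment> \<open>A one-sided bound is enough: applied to \<open>h\<close> and to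
    \<open>- h\<close> it gives both halves of the limit.\<close>
  have lower: "\<forall>\<^sub>F n in sequentially. (\<integral>\<omega>. h (Z \<omega>) \<partial>N) - r < (\<integral>\<omega>. h (S n \<omega>) \<partial>M)"
    if cont: "sup_continuous_D h" and bnd: "\<And>x. cadlag01 x \<Longrightarrow> \<bar>h x\<bar> \<le> K" and r: "0 < r" for h K r
  proof -
    have ic: "\<And>x k. cadlag01 x \<Longrightarrow> inf_convolution h k x \<le> h x"
      "\<And>k. bounded_lipschitz_D (real k) K (inf_convolution h k)"
      "\<And>x. cadlag01 x \<Longrightarrow> (\<lambda>k. inf_convolution h k x) \<longlonglongrightarrow> h x"
      using inf_convolution_le[of h K] bounded_lipschitz_inf_convolution[of h K]
        inf_convolution_tendsto[of h K] bnd cont by blast+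
    have sc: "sup_continuous_D (inf_convolution h k)" for k
      by (rule bounded_lipschitz_imp_sup_continuous) (rule ic(2))
    have icb: "\<bar>inf_convolution h k x\<bar> \<le> K" if "cadlag01 x" for k x
      using ic(2)[of k] that by (auto simp: bounded_lipschitz_D_def)
    have "(\<lambda>k. \<integral>\<omega>. inf_convolution h k (Z \<omega>) \<partial>N) \<longlonglongrightarrow> (\<integral>\<omega>. h (Z \<omega>) \<partial>N)"
      by (rule integral_dominated_convergence[where w="\<lambda>_. K"])
         (use mZ sc cont ic(3) cZ icb in auto)
    then have "\<forall>\<^sub>F k in sequentially. (\<integral>\<omega>. h (Z \<omega>) \<partial>N) - r < (\<integral>\<omega>. inf_convolution h k (Z \<omega>) \<partial>N)"
      by (rule order_tendstoD) (use r in simp)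
    \<comment> \<open>The level \<open>k\<close> is fixed by the limit law alone, before
      \<open>n\<close> varies. Since the envelope lies below \<open>h\<close>, its lower bound is
      also one for \<open>h\<close> at every \<open>n\<close>.\<close>
    then obtain k where k: "(\<integral>\<omega>. h (Z \<omega>) \<partial>N) - r < (\<integral>\<omega>. inf_convolution h k (Z \<omega>) \<partial>N)"
      by (auto simp: eventually_sequentially)
    have "\<forall>\<^sub>F n in sequentially. (\<integral>\<omega>. h (Z \<omega>) \<partial>N) - r < (\<integral>\<omega>. inf_convolution h k (S n \<omega>) \<partial>M)"
      by (rule order_tendstoD[OF lip[OF ic(2)]]) (use k in simp)
    moreover have "(\<integral>\<omega>. inf_convolution h k (S n \<omega>) \<partial>M) \<le> (\<integral>\<omega>. h (S n \<omega>) \<partial>M)" for n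
    proof (rule integral_mono)
      show "integrable M (\<lambda>\<omega>. inf_convolution h k (S n \<omega>))"
        by (rule M.integrable_const_bound[where B=K]) (use mS sc icb cS in auto)
      show "integrable M (\<lambda>\<omega>. h (S n \<omega>))"
        by (rule M.integrable_const_bound[where B=K]) (use mS cont bnd cS in auto)
    qed (use ic(1) cS in auto)
    ultimately show ?thesis
      by (auto elim!: eventually_mono intro: less_le_trans)
  qed
  show ?thesis
    unfolding weak_conv_D_def
  proof (intro allI impI)
    fix h assume h: "D_bounded_continuous h"
    then obtain K where K: "\<And>x. cadlag01 x \<Longrightarrow> \<bar>h x\<bar> \<le> K" by (auto simp: D_bounded_continuous_def)
    have cont: "sup_continuous_D h" by (rule D_bounded_continuous_imp_sup_continuous[OF h])
    then have cont': "sup_continuous_D (\<lambda>x. - h x)"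
      unfolding sup_continuous_D_def by (auto intro: tendsto_minus)
    show "(\<lambda>n. \<integral>\<omega>. h (S n \<omega>) \<partial>M) \<longlonglongrightarrow> (\<integral>\<omega>. h (Z \<omega>) \<partial>N)"
    proof (rule order_tendstoI)
      fix a assume "a < (\<integral>\<omega>. h (Z \<omega>) \<partial>N)"
      then show "\<forall>\<^sub>F n in sequentially. a < (\<integral>\<omega>. h (S n \<omega>) \<partial>M)"
        using lower[OF cont K, of "(\<integral>\<omega>. h (Z \<omega>) \<partial>N) - a"] by simp
    next
      fix a assume "(\<integral>\<omega>. h (Z \<omega>) \<partial>N) < a"
      then show "\<forall>\<^sub>F n in sequentially. (\<integral>\<omega>. h (S n \<omega>) \<partial>M) < a"
        using lower[OF cont', of K "a - (\<integral>\<omega>. h (Z \<omega>) \<partial>N)"] K by simp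
    qed
  qed
qed

section \<open>Step paths and measurability of functionals\<close>

definition psum :: "real \<Rightarrow> (nat \<Rightarrow> real) \<Rightarrow> real \<Rightarrow> real" where
  "psum c a v = (\<Sum>t = 1..nat \<lfloor>c * v\<rfloor>. a t)"

text \<open>To the right of \<open>t\<close> the floor of \<open>c * t\<close> is locally constant;
  to the left it is the ceiling minus one, which also covers integer values of \<open>c * t\<close>.
  The rate \<open>c\<close> is a real number because the block process runs at rate
  \<open>n / b\<close>.\<close>

lemma cadlag01_psum:
  assumes c: "c \<ge> 0"
  shows "cadlag01 (psum c a)"
proof (cases "c = 0")
  case True
  then have "psum c a = (\<lambda>_. 0)" by (auto simp: psum_def)
  then show ?thesis by (auto simp: cadlag01_def)
next
  case False
  with c have c: "c > 0" by simp
  have "continuous (at_right t) (psum c a)" for t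
  proof -
    have "\<forall>\<^sub>F v in at_right t. v < (of_int \<lfloor>c * t\<rfloor> + 1) / c"
      using c by (intro eventually_at_rightI[of t "(of_int \<lfloor>c * t\<rfloor> + 1) / c"])
        (auto simp: field_simps, linarith)
    moreover have "\<forall>\<^sub>F v in at_right t. t < v" by (rule eventually_at_right_less)
    ultimately have "\<forall>\<^sub>F v in at_right t. psum c a v = psum c a t"
    proof eventually_elim
      case (elim v)
      have "\<lfloor>c * v\<rfloor> = \<lfloor>c * t\<rfloor>"
      proof (rule floor_unique)
        have "c * t \<le> c * v" using elim c by simp
        then show "of_int \<lfloor>c * t\<rfloor> \<le> c * v" by linarith
        show "c * v < of_int \<lfloor>c * t\<rfloor> + 1" using elim c by (simp add: field_simps)
      qed
      then show ?case by (simp add: psum_def)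
    qed
    then show ?thesis
      unfolding continuous_within by (rule tendsto_eventually)
  qed
  moreover have "\<exists>l. (psum c a \<longlongrightarrow> l) (at_left t)" for t
  proof -
    have "\<forall>\<^sub>F v in at_left t. (of_int \<lceil>c * t\<rceil> - 1) / c < v"
      using c by (intro eventually_at_leftI[of "(of_int \<lceil>c * t\<rceil> - 1) / c" t])
        (auto simp: field_simps, linarith)
    moreover have "\<forall>\<^sub>F v in at_left t. v < t" by (simp add: eventually_at_filter)
    ultimately have "\<forall>\<^sub>F v in at_left t. psum c a v = (\<Sum>t = 1..nat (\<lceil>c * t\<rceil> - 1). a t)"
    proof eventually_elim
      case (elim v)
      have "\<lfloor>c * v\<rfloor> = \<lceil>c * t\<rceil> - 1"
      proof (rule floor_unique)
        show "of_int (\<lceil>c * t\<rceil> - 1) \<le> c * v" using elim c by (simp add: field_simps)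
        have "c * v < c * t" using elim c by simp
        then show "c * v < of_int (\<lceil>c * t\<rceil> - 1) + 1" by simp linarith
      qed
      then show ?case by (simp add: psum_def)
    qed
    then show ?thesis by (blast intro: tendsto_eventually)
  qed
  ultimately show ?thesis by (auto simp: cadlag01_def)
qed

text \<open>For \<open>v\<close> in the unit interval at most \<open>nat \<lfloor>c\<rfloor>\<close>
  summands occur, so the uniform distance of two step paths is a maximum over finitely many partial
  sums. This is where maximal inequalities meet the path space.\<close>

lemma sup_near_psum:
  assumes c: "c \<ge> 0" and ab: "\<And>k. k \<le> nat \<lfloor>c\<rfloor> \<Longrightarrow> \<bar>(\<Sum>t = 1..k. a t) - (\<Sum>t = 1..k. b t)\<bar> \<le> e"
  shows "sup_near (psum c a) (psum c b) e"
  unfolding sup_near_def psum_def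
proof
  fix v :: real assume "v \<in> {0..1}"
  then have "c * v \<le> c" using c by (simp add: mult_left_le)
  then have "nat \<lfloor>c * v\<rfloor> \<le> nat \<lfloor>c\<rfloor>" by (intro nat_mono floor_mono)
  then show "\<bar>(\<Sum>t = 1..nat \<lfloor>c * v\<rfloor>. a t) - (\<Sum>t = 1..nat \<lfloor>c * v\<rfloor>. b t)\<bar> \<le> e" by (rule ab)
qed

text \<open>Paths are functions on the whole line; a constant sequence with rate \<open>0\<close>
  shows that a functional continuous in this sense reads only the unit interval.\<close>

lemma sup_continuous_D_cong:
  assumes "sup_continuous_D f" "cadlag01 x" "cadlag01 y" "\<And>t. t \<in> {0..1} \<Longrightarrow> x t = y t"
  shows "f x = f y"
proof -
  have "(\<lambda>k::nat. f x) \<longlonglongrightarrow> f y"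
    by (rule sup_continuous_DD[OF assms(1,3,2), of "\<lambda>_. 0"]) (auto simp: sup_near_def assms(4))
  then show ?thesis by (simp add: LIMSEQ_const_iff)
qed

lemma floor_divide_near:
  fixes c x :: real
  assumes "c > 0"
  shows "\<bar>of_int \<lfloor>c * x\<rfloor> / c - x\<bar> \<le> inverse c"
proof -
  have "of_int \<lfloor>c * x\<rfloor> / c - x = (of_int \<lfloor>c * x\<rfloor> - c * x) * inverse c"
    using assms by (simp add: field_simps)
  moreover have "\<bar>of_int \<lfloor>c * x\<rfloor> - c * x\<bar> \<le> 1" by linarith
  ultimately show ?thesis
    using assms mult_right_mono[of "\<bar>of_int \<lfloor>c * x\<rfloor> - c * x\<bar>" 1 "inverse c"] by (simp add: abs_mult)
qed

text \<open>Rounding the coefficients down to multiples of \<open>1 / Suc m\<close> makes the path a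
  function of a list of integers. Such lists are countable, so every function of them is measurable,
  even though nothing is known about \<open>f\<close>; continuity of \<open>f\<close> then passes to
  the limit of the rounded paths.\<close>

lemma measurable_sup_continuous_psum:
  fixes a :: "nat \<Rightarrow> 'a \<Rightarrow> real"
  assumes f: "sup_continuous_D f" and c: "c \<ge> 0"
    and a [measurable]: "\<And>t. t \<in> {1..nat \<lfloor>c\<rfloor>} \<Longrightarrow> a t \<in> borel_measurable M"
  shows "(\<lambda>\<omega>. f (psum c (\<lambda>t. a t \<omega>))) \<in> borel_measurable M"
proof -
  define n where "n = nat \<lfloor>c\<rfloor>"
  define code where "code m \<omega> = map (\<lambda>t. \<lfloor>real (Suc m) * a t \<omega>\<rfloor>) [1..<Suc n]" for m \<omega>
  \<comment> \<open>List positions start at 0 and coefficients at 1, hence the shift.\<close>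
  define dec where "dec m xs t = real_of_int (xs ! (t - 1)) / real (Suc m)" for m and xs :: "int list" and t
  have code: "code m \<in> measurable M (count_space UNIV)" for m
  proof (rule measurable_count_space_eq2_countable[THEN iffD2], intro conjI ballI)
    fix xs :: "int list"
    have "(code m \<omega> = xs) = (length xs = n \<and> (\<forall>i\<in>{..<n}. \<lfloor>real (Suc m) * a (Suc i) \<omega>\<rfloor> = xs ! i))" for \<omega>
      by (auto simp: code_def list_eq_iff_nth_eq simp del: upt_Suc of_nat_Suc)
    then have "code m -` {xs} \<inter> space M =
      {\<omega> \<in> space M. length xs = n \<and> (\<forall>i\<in>{..<n}. \<lfloor>real (Suc m) * a (Suc i) \<omega>\<rfloor> = xs ! i)}"
      by auto
    also have "\<dots> \<in> sets M"
    proof -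
      have [measurable]: "a (Suc i) \<in> borel_measurable M" if "i \<in> {..<n}" for i
        using a that by (simp add: n_def)
      show ?thesis by measurable
    qed
    finally show "code m -` {xs} \<inter> space M \<in> sets M" .
  qed auto
  have step: "(\<lambda>\<omega>. f (psum c (dec m (code m \<omega>)))) \<in> borel_measurable M" for m
    by (rule measurable_compose[OF code, of "\<lambda>xs. f (psum c (dec m xs))"]) simp
  show ?thesis
  proof (rule borel_measurable_LIMSEQ_real[OF _ step])
    fix \<omega>
    have near: "sup_near (psum c (dec m (code m \<omega>))) (psum c (\<lambda>t. a t \<omega>)) (real n * inverse (real (Suc m)))" for m
    proof (rule sup_near_psum[OF c])
      fix k assume k: "k \<le> nat \<lfloor>c\<rfloor>"
      have "\<bar>(\<Sum>t = 1..k. dec m (code m \<omega>) t) - (\<Sum>t = 1..k. a t \<omega>)\<bar>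
          \<le> (\<Sum>t = 1..k. \<bar>dec m (code m \<omega>) t - a t \<omega>\<bar>)"
        by (simp flip: sum_subtractf)
      also have "\<dots> \<le> (\<Sum>t = 1..k. inverse (real (Suc m)))"
      proof (rule sum_mono)
        fix t assume t: "t \<in> {1..k}"
        then have "code m \<omega> ! (t - 1) = \<lfloor>real (Suc m) * a t \<omega>\<rfloor>"
          using k by (auto simp: code_def n_def simp del: upt_Suc of_nat_Suc)
        then have "dec m (code m \<omega>) t = of_int \<lfloor>real (Suc m) * a t \<omega>\<rfloor> / real (Suc m)"
          by (simp add: dec_def)
        then show "\<bar>dec m (code m \<omega>) t - a t \<omega>\<bar> \<le> inverse (real (Suc m))"
          using floor_divide_near[of "real (Suc m)" "a t \<omega>"] by simp
      qed
      also have "\<dots> \<le> real n * inverse (real (Suc m))"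
        using k by (simp add: n_def mult_right_mono del: of_nat_Suc)
      finally show "\<bar>(\<Sum>t = 1..k. dec m (code m \<omega>) t) - (\<Sum>t = 1..k. a t \<omega>)\<bar> \<le> real n * inverse (real (Suc m))" .
    qed
    have "(\<lambda>m. real n * inverse (real (Suc m))) \<longlonglongrightarrow> 0"
      using tendsto_mult_left[OF LIMSEQ_inverse_real_of_nat, of "real n"] by simp
    then show "(\<lambda>m. f (psum c (dec m (code m \<omega>)))) \<longlonglongrightarrow> f (psum c (\<lambda>t. a t \<omega>))"
      by (rule sup_continuous_DD[OF f cadlag01_psum[OF c] cadlag01_psum[OF c] near])
  qed
qed

section \<open>Sampling continuous paths on a grid\<close>

definition grid_increments :: "(real \<Rightarrow> real) \<Rightarrow> nat \<Rightarrow> nat \<Rightarrow> real" where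
  "grid_increments x k i = x (real i / real k) - x ((real i - 1) / real k)"

lemma psum_grid_increments:
  assumes x0: "x 0 = 0"
  shows "psum (real k) (grid_increments x k) v = x (real (nat \<lfloor>real k * v\<rfloor>) / real k)"
proof -
  have "(\<Sum>i = 1..m. grid_increments x k i) = x (real m / real k)" for m
    by (induction m) (auto simp: grid_increments_def x0)
  then show ?thesis by (simp add: psum_def)
qed

text \<open>The step path built from grid increments is the path sampled at the last grid point
  before \<open>v\<close>, so uniform continuity controls the error. The error \<open>d k\<close> is
  a supremum; boundedness of a continuous function on the unit interval makes it a genuine
  one.\<close>

lemma sup_near_grid_increments:
  assumes x0: "x 0 = 0" and cont: "continuous_on {0..1} x"
  obtains e where "e \<longlonglongrightarrow> 0" "\<And>k. sup_near (psum (real (Suc k)) (grid_increments x (Suc k))) x (e k)"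
proof -
  define d where "d k = (SUP v\<in>{0..1}. \<bar>psum (real (Suc k)) (grid_increments x (Suc k)) v - x v\<bar>)" for k
  have uc: "uniformly_continuous_on {0..1} x"
    using cont by (rule compact_uniformly_continuous) simp
  have grid: "real (nat \<lfloor>real (Suc k) * v\<rfloor>) / real (Suc k) \<in> {0..1}
      \<and> \<bar>real (nat \<lfloor>real (Suc k) * v\<rfloor>) / real (Suc k) - v\<bar> \<le> inverse (real (Suc k))"
    if "v \<in> {0..1}" for k v
  proof -
    have "0 \<le> real (Suc k) * v" "real (Suc k) * v \<le> real (Suc k)"
      using that by (auto intro: mult_left_le)
    then have *: "0 \<le> \<lfloor>real (Suc k) * v\<rfloor>" "real_of_int \<lfloor>real (Suc k) * v\<rfloor> \<le> real (Suc k)"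
      by (auto simp del: of_nat_Suc intro: order_trans[OF of_int_floor_le])
    moreover have "\<bar>real_of_int \<lfloor>real (Suc k) * v\<rfloor> / real (Suc k) - v\<bar> \<le> inverse (real (Suc k))"
      by (rule floor_divide_near) simp
    ultimately show ?thesis
      by (auto simp del: of_nat_Suc)
  qed
  have bound: "\<exists>k0. \<forall>k\<ge>k0. \<forall>v\<in>{0..1}. \<bar>psum (real (Suc k)) (grid_increments x (Suc k)) v - x v\<bar> \<le> r"
    if r: "r > 0" for r
  proof -
    obtain \<delta> where \<delta>: "\<delta> > 0" "\<And>u v. u \<in> {0..1} \<Longrightarrow> v \<in> {0..1} \<Longrightarrow> \<bar>u - v\<bar> < \<delta> \<Longrightarrow> \<bar>x u - x v\<bar> < r"
      using uc r unfolding uniformly_continuous_on_def dist_real_def by metis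
    obtain k0 where k0: "inverse (real (Suc k0)) < \<delta>" using reals_Archimedean[OF \<delta>(1)] by blast
    have "\<bar>psum (real (Suc k)) (grid_increments x (Suc k)) v - x v\<bar> \<le> r"
      if "k \<ge> k0" "v \<in> {0..1}" for k v
    proof -
      have "inverse (real (Suc k)) \<le> inverse (real (Suc k0))" using that by simp
      then have "\<bar>real (nat \<lfloor>real (Suc k) * v\<rfloor>) / real (Suc k) - v\<bar> < \<delta>"
        using grid[OF that(2), of k] k0 by linarith
      then show ?thesis
        unfolding psum_grid_increments[of x, OF x0] using \<delta>(2) grid[OF that(2), of k] that(2)
        by (meson less_imp_le)
    qed
    then show ?thesis by blast
  qed
  obtain C where "\<forall>y\<in>x ` {0..1}. norm y \<le> C"
    using compact_imp_bounded[OF compact_continuous_image[OF cont]] by (auto simp: bounded_iff)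
  then have C: "\<bar>x v\<bar> \<le> C" if "v \<in> {0..1}" for v
    using that by simp
  have bdd: "bdd_above ((\<lambda>v. \<bar>psum (real (Suc k)) (grid_increments x (Suc k)) v - x v\<bar>) ` {0..1})" for k
  proof (rule bdd_aboveI2[where M = "2 * C"])
    fix v :: real assume v: "v \<in> {0..1}"
    show "\<bar>psum (real (Suc k)) (grid_increments x (Suc k)) v - x v\<bar> \<le> 2 * C"
      unfolding psum_grid_increments[of x, OF x0]
      using C[OF v] C[of "real (nat \<lfloor>real (Suc k) * v\<rfloor>) / real (Suc k)"] grid[OF v, of k] by linarith
  qed
  show thesis
  proof
    show "sup_near (psum (real (Suc k)) (grid_increments x (Suc k))) x (d k)" for k
      unfolding sup_near_def d_def by (intro ballI cSUP_upper bdd)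
    then have d0: "0 \<le> d k" for k by (rule sup_near_nonneg)
    show "d \<longlonglongrightarrow> 0"
    proof (rule LIMSEQ_I)
      fix r :: real assume "0 < r"
      then obtain k0 where "\<forall>k\<ge>k0. \<forall>v\<in>{0..1}. \<bar>psum (real (Suc k)) (grid_increments x (Suc k)) v - x v\<bar> \<le> r / 2"
        using bound[of "r / 2"] by auto
      then have "d k \<le> r / 2" if "k \<ge> k0" for k
        unfolding d_def using that by (intro cSUP_least) auto
      then have "norm (d k - 0) < r" if "k \<ge> k0" for k
        using d0[of k] that \<open>0 < r\<close> by fastforce
      then show "\<exists>no. \<forall>n\<ge>no. norm (d n - 0) < r" by blast
    qed
  qed
qed

lemma cadlag01_continuous:
  assumes "continuous_on {0..1} x"
  shows "cadlag01 x"
  unfolding cadlag01_def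
proof (intro conjI ballI)
  fix t :: real assume t: "t \<in> {0..<1}"
  have "continuous (at t within {0..1}) x"
    using assms t by (simp add: continuous_on_eq_continuous_within)
  then have "continuous (at t within {t..1}) x"
    by (rule continuous_within_subset) (use t in auto)
  moreover have "at t within {t..1} = at_right t"
    by (rule at_within_Icc_at_right) (use t in auto)
  ultimately show "continuous (at_right t) x" by simp
next
  fix t :: real assume t: "t \<in> {0<..1}"
  have "(x \<longlongrightarrow> x t) (at t within {0..1})"
    using assms t by (simp add: continuous_on_def)
  then have "(x \<longlongrightarrow> x t) (at t within {0..t})"
    by (rule tendsto_within_subset) (use t in auto)
  moreover have "at t within {0..t} = at_left t"
    by (rule at_within_Icc_at_left) (use t in auto)
  ultimately show "\<exists>l. (x \<longlongrightarrow> l) (at_left t)" by auto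
qed

lemma sup_continuous_grid_tendsto:
  assumes f: "sup_continuous_D f" and x: "x 0 = 0" "continuous_on {0..1} x"
  shows "(\<lambda>k. f (psum (real (Suc k)) (grid_increments x (Suc k)))) \<longlonglongrightarrow> f x"
proof -
  obtain e where "e \<longlonglongrightarrow> 0" "\<And>k. sup_near (psum (real (Suc k)) (grid_increments x (Suc k))) x (e k)"
    using sup_near_grid_increments[OF x] by blast
  then show ?thesis
    by (intro sup_continuous_DD[OF f cadlag01_continuous[OF x(2)]] cadlag01_psum) auto
qed

text \<open>\<open>f (Z \<omega>)\<close> is the limit of \<open>f\<close> at sampled step paths,
  each of which involves finitely many coordinates of \<open>Z\<close>; measurability is inherited
  without a sigma-algebra on paths.\<close>

lemma measurable_sup_continuous_path:
  fixes Z :: "'b \<Rightarrow> real \<Rightarrow> real"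
  assumes f: "sup_continuous_D f"
    and Z: "\<And>v. v \<in> {0..1} \<Longrightarrow> (\<lambda>\<omega>. Z \<omega> v) \<in> borel_measurable N"
    and Z0: "\<And>\<omega>. \<omega> \<in> space N \<Longrightarrow> Z \<omega> 0 = 0"
    and cont: "\<And>\<omega>. \<omega> \<in> space N \<Longrightarrow> continuous_on {0..1} (Z \<omega>)"
  shows "(\<lambda>\<omega>. f (Z \<omega>)) \<in> borel_measurable N"
proof (rule borel_measurable_LIMSEQ_real)
  show "(\<lambda>k. f (psum (real (Suc k)) (grid_increments (Z \<omega>) (Suc k)))) \<longlonglongrightarrow> f (Z \<omega>)"
    if "\<omega> \<in> space N" for \<omega>
    using sup_continuous_grid_tendsto[OF f Z0 cont] that by blast
  show "(\<lambda>\<omega>. f (psum (real (Suc k)) (grid_increments (Z \<omega>) (Suc k)))) \<in> borel_measurable N" for k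
  proof (rule measurable_sup_continuous_psum[OF f])
    fix t assume t: "t \<in> {1..nat \<lfloor>real (Suc k)\<rfloor>}"
    then show "(\<lambda>\<omega>. grid_increments (Z \<omega>) (Suc k) t) \<in> borel_measurable N"
      unfolding grid_increments_def by (intro borel_measurable_diff Z) (auto simp: field_simps)
  qed simp
qed

section \<open>Moment and maximal inequalities\<close>

context prob_space
begin

lemma prob_less_sq_le:
  assumes [measurable]: "X \<in> borel_measurable M" and int: "integrable M (\<lambda>\<omega>. (X \<omega>)\<^sup>2)" and l: "l > 0"
  shows "prob {\<omega>\<in>space M. l < \<bar>X \<omega>\<bar>} \<le> expectation (\<lambda>\<omega>. (X \<omega>)\<^sup>2) / l\<^sup>2"
proof -
  have "prob {\<omega>\<in>space M. l < \<bar>X \<omega>\<bar>} \<le> prob {\<omega>\<in>space M. l\<^sup>2 \<le> (X \<omega>)\<^sup>2}"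
  proof (rule finite_measure_mono)
    show "{\<omega> \<in> space M. l < \<bar>X \<omega>\<bar>} \<subseteq> {\<omega> \<in> space M. l\<^sup>2 \<le> (X \<omega>)\<^sup>2}"
      using l by (auto simp: abs_le_square_iff[symmetric])
  qed measurable
  also have "\<dots> \<le> expectation (\<lambda>\<omega>. (X \<omega>)\<^sup>2) / l\<^sup>2"
    by (rule integral_Markov_inequality_measure[OF int sets.top]) (use l in auto)
  finally show ?thesis .
qed

lemma prob_less_fourth_le:
  assumes [measurable]: "X \<in> borel_measurable M" and int: "integrable M (\<lambda>\<omega>. (X \<omega>) ^ 4)" and l: "l > 0"
  shows "prob {\<omega>\<in>space M. l < \<bar>X \<omega>\<bar>} \<le> expectation (\<lambda>\<omega>. (X \<omega>) ^ 4) / l ^ 4"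
proof -
  have "prob {\<omega>\<in>space M. l < \<bar>X \<omega>\<bar>} \<le> prob {\<omega>\<in>space M. l ^ 4 \<le> (X \<omega>) ^ 4}"
  proof (rule finite_measure_mono)
    show "{\<omega> \<in> space M. l < \<bar>X \<omega>\<bar>} \<subseteq> {\<omega> \<in> space M. l ^ 4 \<le> (X \<omega>) ^ 4}"
    proof safe
      fix \<omega> assume "l < \<bar>X \<omega>\<bar>"
      then have "l ^ 4 \<le> \<bar>X \<omega>\<bar> ^ 4" using l by (intro power_mono) auto
      then show "l ^ 4 \<le> X \<omega> ^ 4" by simp
    qed
  qed measurable
  also have "\<dots> \<le> expectation (\<lambda>\<omega>. (X \<omega>) ^ 4) / l ^ 4"
    by (rule integral_Markov_inequality_measure[OF int sets.top]) (use l in auto)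
  finally show ?thesis .
qed

text \<open>Decompose by the first index \<open>j\<close> at which the partial sum passes
  \<open>2 * l\<close>. The remaining sum is independent of that event and is at most
  \<open>l\<close> with probability at least one half, and then the full sum still exceeds
  \<open>l\<close>. So passing at all is at most twice as likely as the full sum exceeding
  \<open>l\<close>. For \<open>\<beta> \<ge> 1 / 2\<close> the bound is trivial.\<close>

lemma ottaviani_inequality:
  fixes X :: "nat \<Rightarrow> 'a \<Rightarrow> real"
  assumes ind: "indep_vars (\<lambda>_. borel) X {1..N}"
    and tail: "\<And>j. j \<le> N \<Longrightarrow> prob {\<omega>\<in>space M. l < \<bar>\<Sum>t = Suc j..N. X t \<omega>\<bar>} \<le> \<beta>"
  shows "prob {\<omega>\<in>space M. \<exists>k\<le>N. 2 * l < \<bar>\<Sum>t = 1..k. X t \<omega>\<bar>} \<le> 2 * \<beta>"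
proof (cases "\<beta> < 1 / 2")
  case False
  then show ?thesis using prob_le_1[of "{\<omega>\<in>space M. \<exists>k\<le>N. 2 * l < \<bar>\<Sum>t = 1..k. X t \<omega>\<bar>}"] by linarith
next
  case True
  have X [measurable]: "X t \<in> borel_measurable M" if "t \<in> {1..N}" for t
    using ind that by (auto simp: indep_vars_def)
  have mS [measurable]: "(\<lambda>\<omega>. \<Sum>t = 1..k. X t \<omega>) \<in> borel_measurable M" if "k \<le> N" for k
    by (rule borel_measurable_sum) (use that in \<open>auto intro!: X\<close>)
  have mR [measurable]: "(\<lambda>\<omega>. \<Sum>t = Suc k..N. X t \<omega>) \<in> borel_measurable M" for k
    by (rule borel_measurable_sum) (auto intro!: X)
  \<comment> \<open>First passage events: disjoint in \<open>j\<close>, and determined by the first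
    \<open>j\<close> variables.\<close>
  define A where "A j = {\<omega>\<in>space M. 2 * l < \<bar>\<Sum>t = 1..j. X t \<omega>\<bar> \<and> (\<forall>i\<in>{..<j}. \<bar>\<Sum>t = 1..i. X t \<omega>\<bar> \<le> 2 * l)}" for j
  define C where "C j = {\<omega>\<in>space M. \<bar>\<Sum>t = Suc j..N. X t \<omega>\<bar> \<le> l}" for j
  have Am [measurable]: "A j \<in> sets M" if "j \<le> N" for j
  proof -
    have [measurable]: "(\<lambda>\<omega>. \<Sum>t = 1..i. X t \<omega>) \<in> borel_measurable M" if "i \<in> {..<j}" for i
      using that \<open>j \<le> N\<close> by (intro mS) auto
    note [measurable] = mS[OF \<open>j \<le> N\<close>]
    show ?thesis unfolding A_def by measurable
  qed
  have Cm [measurable]: "C j \<in> sets M" for j unfolding C_def by measurable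
  have disj: "disjoint_family_on A {..N}"
  proof -
    have "A i \<inter> A j = {}" if "i < j" for i j
      using that by (force simp: A_def)
    then show ?thesis unfolding disjoint_family_on_def by (metis inf_commute linorder_neqE_nat)
  qed
  have ex: "{\<omega>\<in>space M. \<exists>k\<le>N. 2 * l < \<bar>\<Sum>t = 1..k. X t \<omega>\<bar>} = (\<Union>j\<le>N. A j)"
  proof (intro equalityI subsetI)
    fix \<omega> assume "\<omega> \<in> {\<omega>\<in>space M. \<exists>k\<le>N. 2 * l < \<bar>\<Sum>t = 1..k. X t \<omega>\<bar>}"
    then obtain k where k: "\<omega> \<in> space M" "k \<le> N" "2 * l < \<bar>\<Sum>t = 1..k. X t \<omega>\<bar>" by auto
    define j where "j = (LEAST k. 2 * l < \<bar>\<Sum>t = 1..k. X t \<omega>\<bar>)"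
    have "2 * l < \<bar>\<Sum>t = 1..j. X t \<omega>\<bar>" unfolding j_def by (rule LeastI) (rule k)
    moreover have "j \<le> k" unfolding j_def by (rule Least_le) (rule k)
    moreover have "\<bar>\<Sum>t = 1..i. X t \<omega>\<bar> \<le> 2 * l" if "i < j" for i
      using not_less_Least[of i "\<lambda>k. 2 * l < \<bar>\<Sum>t = 1..k. X t \<omega>\<bar>"] that by (auto simp: j_def)
    ultimately show "\<omega> \<in> (\<Union>j\<le>N. A j)" using k by (auto simp: A_def)
  qed (auto simp: A_def)
  have half: "prob (A j) \<le> 2 * prob (A j \<inter> C j)" if j: "j \<le> N" for j
  proof -
    \<comment> \<open>Past and future become two random vectors, so that independence of the family
      yields independence of the two events.\<close>
    let ?A = "\<lambda>\<omega>. \<lambda>i\<in>{1..j}. X i \<omega>" and ?B = "\<lambda>\<omega>. \<lambda>i\<in>{Suc j..N}. X i \<omega>"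
    define A' where "A' = {f\<in>space (\<Pi>\<^sub>M i\<in>{1..j}. (borel :: real measure)).
        2 * l < \<bar>\<Sum>t = 1..j. f t\<bar> \<and> (\<forall>i\<in>{..<j}. \<bar>\<Sum>t = 1..i. f t\<bar> \<le> 2 * l)}"
    define C' where "C' = {f\<in>space (\<Pi>\<^sub>M i\<in>{Suc j..N}. (borel :: real measure)). \<bar>\<Sum>t = Suc j..N. f t\<bar> \<le> l}"
    have ind2: "indep_var (PiM {1..j} (\<lambda>_. borel)) ?A (PiM {Suc j..N} (\<lambda>_. borel)) ?B"
      by (rule indep_var_restrict[OF ind]) (use j in auto)
    have [measurable]: "(\<lambda>f. \<Sum>t = 1..i. f t) \<in> borel_measurable (\<Pi>\<^sub>M i\<in>{1..j}. (borel :: real measure))" if "i \<le> j" for i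
      by (rule borel_measurable_sum) (use that in \<open>auto intro!: measurable_component_singleton\<close>)
    have A': "A' \<in> sets (\<Pi>\<^sub>M i\<in>{1..j}. (borel :: real measure))"
    proof -
      have [measurable]: "(\<lambda>f. \<Sum>t = 1..i. f t) \<in> borel_measurable (\<Pi>\<^sub>M i\<in>{1..j}. (borel :: real measure))"
        if "i \<in> {..<j}" for i
        by (rule borel_measurable_sum) (use that in \<open>auto intro!: measurable_component_singleton\<close>)
      show ?thesis unfolding A'_def by measurable
    qed
    have C': "C' \<in> sets (\<Pi>\<^sub>M i\<in>{Suc j..N}. (borel :: real measure))"
      unfolding C'_def by measurable
    have A_eq: "A j = ?A -` A' \<inter> space M"
    proof -
      have *: "(\<Sum>t = 1..i. ?A \<omega> t) = (\<Sum>t = 1..i. X t \<omega>)" if "i \<le> j" for i \<omega>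
        by (rule sum.cong) (use that in auto)
      show ?thesis
        unfolding A_def A'_def using * by (auto simp: space_PiM)
    qed
    have C_eq: "C j = ?B -` C' \<inter> space M"
      unfolding C_def C'_def by (auto simp: space_PiM)
    have "prob (A j \<inter> C j) = prob ((\<lambda>x. (?A x, ?B x)) -` (A' \<times> C') \<inter> space M)"
      unfolding A_eq C_eq by (rule arg_cong[where f=prob]) auto
    also have "\<dots> = prob (A j) * prob (C j)"
      unfolding A_eq C_eq by (rule indep_varD[OF ind2 A' C'])
    finally have eq: "prob (A j \<inter> C j) = prob (A j) * prob (C j)" .
    have "prob (C j) = 1 - prob (space M - C j)"
      by (simp add: prob_compl)
    also have "space M - C j = {\<omega>\<in>space M. l < \<bar>\<Sum>t = Suc j..N. X t \<omega>\<bar>}"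
      by (auto simp: C_def)
    finally have "1 / 2 \<le> prob (C j)" using tail[OF j] True by linarith
    then show ?thesis
      unfolding eq using mult_left_mono[of "1/2" "prob (C j)" "prob (A j)"] by simp
  qed
  have "prob (\<Union>j\<le>N. A j) = (\<Sum>j\<le>N. prob (A j))"
    by (rule finite_measure_finite_Union) (use disj in auto)
  also have "\<dots> \<le> (\<Sum>j\<le>N. 2 * prob (A j \<inter> C j))"
    by (rule sum_mono) (use half in auto)
  also have "\<dots> = 2 * prob (\<Union>j\<le>N. A j \<inter> C j)"
  proof -
    have "prob (\<Union>j\<le>N. A j \<inter> C j) = (\<Sum>j\<le>N. prob (A j \<inter> C j))"
      by (rule finite_measure_finite_Union) (use disj in \<open>auto simp: disjoint_family_on_def\<close>)
    then show ?thesis by (simp add: sum_distrib_left)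
  qed
  also have "prob (\<Union>j\<le>N. A j \<inter> C j) \<le> prob {\<omega>\<in>space M. l < \<bar>\<Sum>t = Suc 0..N. X t \<omega>\<bar>}"
  proof (rule finite_measure_mono)
    show "(\<Union>j\<le>N. A j \<inter> C j) \<subseteq> {\<omega>\<in>space M. l < \<bar>\<Sum>t = Suc 0..N. X t \<omega>\<bar>}"
    proof safe
      fix \<omega> j assume j: "j \<le> N" and \<omega>: "\<omega> \<in> A j" "\<omega> \<in> C j"
      have "{Suc 0..N} = {1..j} \<union> {Suc j..N}" using j by auto
      then have "(\<Sum>t = Suc 0..N. X t \<omega>) = (\<Sum>t = 1..j. X t \<omega>) + (\<Sum>t = Suc j..N. X t \<omega>)"
        by (simp add: sum.union_disjoint)
      moreover have "2 * l < \<bar>\<Sum>t = 1..j. X t \<omega>\<bar>" "\<bar>\<Sum>t = Suc j..N. X t \<omega>\<bar> \<le> l"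
        using \<omega> by (auto simp: A_def C_def)
      ultimately show "l < \<bar>\<Sum>t = Suc 0..N. X t \<omega>\<bar>" by linarith
    qed (auto simp: A_def)
  qed measurable
  also have "\<dots> \<le> \<beta>" by (rule tail) simp
  finally show ?thesis unfolding ex by simp
qed

lemma indep_sum_second_moment:
  fixes X :: "'i \<Rightarrow> 'a \<Rightarrow> real"
  assumes "finite I" and ind: "indep_vars (\<lambda>_. borel) X I"
    and sq: "\<And>i. i \<in> I \<Longrightarrow> integrable M (\<lambda>\<omega>. (X i \<omega>)\<^sup>2)"
    and mean: "\<And>i. i \<in> I \<Longrightarrow> expectation (X i) = 0"
  shows "integrable M (\<lambda>\<omega>. (\<Sum>i\<in>I. X i \<omega>)\<^sup>2)
    \<and> expectation (\<lambda>\<omega>. (\<Sum>i\<in>I. X i \<omega>)\<^sup>2) = (\<Sum>i\<in>I. expectation (\<lambda>\<omega>. (X i \<omega>)\<^sup>2))"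
  using assms
proof (induction I rule: finite_induct)
  case empty
  then show ?case by simp
next
  case (insert i I)
  let ?S = "\<lambda>\<omega>. \<Sum>i\<in>I. X i \<omega>"
  have [measurable]: "X j \<in> borel_measurable M" if "j \<in> insert i I" for j
    using insert.prems(1) that by (auto simp: indep_vars_def)
  note [measurable] = this[of i, simplified]
  have S [measurable]: "?S \<in> borel_measurable M" by (rule borel_measurable_sum) simp
  have IH: "integrable M (\<lambda>\<omega>. (?S \<omega>)\<^sup>2)"
     "expectation (\<lambda>\<omega>. (?S \<omega>)\<^sup>2) = (\<Sum>i\<in>I. expectation (\<lambda>\<omega>. (X i \<omega>)\<^sup>2))"
    using insert.IH insert.prems indep_vars_subset[OF insert.prems(1), of I] by auto
  have iX: "integrable M (X i)"
    by (rule square_integrable_imp_integrable) (use insert.prems in auto)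
  have iS: "integrable M ?S"
    by (rule square_integrable_imp_integrable) (use IH in auto)
  have iv: "indep_var borel (X i) borel ?S"
    using indep_vars_sum[OF insert.hyps insert.prems(1)] .
  have "expectation (\<lambda>\<omega>. X i \<omega> * ?S \<omega>) = 0"
    using indep_var_lebesgue_integral[OF iv iX iS] insert.prems(3) by simp
  moreover have "integrable M (\<lambda>\<omega>. X i \<omega> * ?S \<omega>)"
    using indep_var_integrable[OF iv iX iS] .
  moreover have "(\<Sum>j\<in>insert i I. X j \<omega>)\<^sup>2 = (X i \<omega>)\<^sup>2 + 2 * (X i \<omega> * ?S \<omega>) + (?S \<omega>)\<^sup>2" for \<omega>
    using insert.hyps by (simp add: power2_eq_square algebra_simps)
  ultimately show ?case
    using IH insert.prems(2)[of i] insert.hyps by simp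
qed

text \<open>In the expansion of \<open>(X + S) ^ 4\<close> the terms with odd exponents vanish, both
  variables being centred. The induction closes because
  \<open>3 * n^2 + 6 * n + 1 \<le> 3 * (n + 1)^2\<close>.\<close>

lemma indep_sum_fourth_moment:
  fixes X :: "'i \<Rightarrow> 'a \<Rightarrow> real"
  assumes "finite I" and ind: "indep_vars (\<lambda>_. borel) X I"
    and bnd: "\<And>i \<omega>. i \<in> I \<Longrightarrow> \<omega> \<in> space M \<Longrightarrow> \<bar>X i \<omega>\<bar> \<le> c"
    and mean: "\<And>i. i \<in> I \<Longrightarrow> expectation (X i) = 0"
  shows "expectation (\<lambda>\<omega>. (\<Sum>i\<in>I. X i \<omega>) ^ 4) \<le> 3 * (real (card I))\<^sup>2 * c ^ 4"
  using assms
proof (induction I rule: finite_induct)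
  case empty
  then show ?case by simp
next
  case (insert i I)
  let ?S = "\<lambda>\<omega>. \<Sum>i\<in>I. X i \<omega>" and ?n = "real (card I)"
  have mX: "X j \<in> borel_measurable M" if "j \<in> insert i I" for j
    using insert.prems(1) that by (auto simp: indep_vars_def)
  note [measurable] = mX[of i, simplified]
  have S [measurable]: "?S \<in> borel_measurable M" by (rule borel_measurable_sum) (simp add: mX)
  have bX: "\<bar>X i \<omega>\<bar> \<le> c" if "\<omega> \<in> space M" for \<omega> using insert.prems(2) that by simp
  have c0: "0 \<le> c" using bX not_empty by (meson abs_ge_zero ex_in_conv order_trans)
  have bS: "\<bar>?S \<omega>\<bar> \<le> ?n * c" if "\<omega> \<in> space M" for \<omega>
    by (rule order_trans[OF sum_abs sum_bounded_above]) (use insert.prems(2) that in auto)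
  have iX: "integrable M (\<lambda>\<omega>. X i \<omega> ^ k)" for k
    by (rule integrable_const_bound[where B = "c ^ k"])
       (auto simp: power_abs intro!: power_mono bX)
  have iS: "integrable M (\<lambda>\<omega>. ?S \<omega> ^ k)" for k
    by (rule integrable_const_bound[where B = "(?n * c) ^ k"])
       (auto simp: power_abs intro!: power_mono bS)
  have iv: "indep_var borel (X i) borel ?S"
    using indep_vars_sum[OF insert.hyps insert.prems(1)] .
  have ivp: "indep_var borel (\<lambda>\<omega>. X i \<omega> ^ a) borel (\<lambda>\<omega>. ?S \<omega> ^ b)" for a b
    using indep_var_compose[OF iv, of "\<lambda>x. x ^ a" borel "\<lambda>x. x ^ b" borel] by (simp add: comp_def)
  note E = indep_var_lebesgue_integral[OF ivp iX iS] and I = indep_var_integrable[OF ivp iX iS]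
  have ind': "indep_vars (\<lambda>_. borel) X I"
    using indep_vars_subset[OF insert.prems(1), of I] by auto
  have ES: "expectation ?S = 0"
  proof -
    have "integrable M (X j)" if "j \<in> I" for j
      by (rule integrable_const_bound[where B = c])
         (use that insert.prems(2) mX in auto)
    then show ?thesis using insert.prems(3) by simp
  qed
  have sq: "expectation (\<lambda>\<omega>. (X j \<omega>)\<^sup>2) \<le> c\<^sup>2" if "j \<in> insert i I" for j
  proof -
    have "\<bar>X j \<omega>\<bar>\<^sup>2 \<le> c\<^sup>2" if "\<omega> \<in> space M" for \<omega>
      using insert.prems(2) \<open>j \<in> insert i I\<close> that by (intro power_mono) auto
    then show ?thesis
      using mX[OF that] by (intro integral_le_const integrable_const_bound[where B = "c\<^sup>2"]) auto
  qed
  have ES2: "expectation (\<lambda>\<omega>. (?S \<omega>)\<^sup>2) \<le> ?n * c\<^sup>2"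
  proof -
    have "integrable M (\<lambda>\<omega>. (X j \<omega>)\<^sup>2)" if "j \<in> I" for j
    proof (rule integrable_const_bound[where B = "c\<^sup>2"])
      show "AE x in M. norm ((X j x)\<^sup>2) \<le> c\<^sup>2"
        using insert.prems(2)[of j] that c0 by (auto simp: abs_le_square_iff[symmetric])
    qed (use mX that in auto)
    then have "expectation (\<lambda>\<omega>. (?S \<omega>)\<^sup>2) = (\<Sum>i\<in>I. expectation (\<lambda>\<omega>. (X i \<omega>)\<^sup>2))"
      using indep_sum_second_moment[OF insert.hyps(1) ind'] insert.prems(3) by auto
    also have "\<dots> \<le> ?n * c\<^sup>2"
      by (rule sum_bounded_above) (use sq in auto)
    finally show ?thesis .
  qed
  have EX4: "expectation (\<lambda>\<omega>. (X i \<omega>) ^ 4) \<le> c ^ 4"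
  proof (rule integral_le_const[OF iX])
    have "\<bar>X i \<omega>\<bar> ^ 4 \<le> c ^ 4" if "\<omega> \<in> space M" for \<omega>
      using bX[OF that] by (intro power_mono) auto
    then show "AE \<omega> in M. X i \<omega> ^ 4 \<le> c ^ 4" by auto
  qed
  have "expectation (\<lambda>\<omega>. (\<Sum>j\<in>insert i I. X j \<omega>) ^ 4) =
    expectation (\<lambda>\<omega>. X i \<omega> ^ 4 + 4 * (X i \<omega> ^ 3 * ?S \<omega> ^ 1) + 6 * (X i \<omega> ^ 2 * ?S \<omega> ^ 2)
      + 4 * (X i \<omega> ^ 1 * ?S \<omega> ^ 3) + ?S \<omega> ^ 4)"
    using insert.hyps by (intro Bochner_Integration.integral_cong) (auto simp: eval_nat_numeral algebra_simps)
  also have "\<dots> = expectation (\<lambda>\<omega>. X i \<omega> ^ 4) + 4 * (expectation (\<lambda>\<omega>. X i \<omega> ^ 3) * expectation (\<lambda>\<omega>. ?S \<omega> ^ 1))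
      + 6 * (expectation (\<lambda>\<omega>. X i \<omega> ^ 2) * expectation (\<lambda>\<omega>. ?S \<omega> ^ 2))
      + 4 * (expectation (\<lambda>\<omega>. X i \<omega> ^ 1) * expectation (\<lambda>\<omega>. ?S \<omega> ^ 3)) + expectation (\<lambda>\<omega>. ?S \<omega> ^ 4)"
    unfolding E[symmetric]
    using I[of 3 1] I[of 2 2] I[of 1 3] iX[of 4] iS[of 4] by simp
  also have "\<dots> = expectation (\<lambda>\<omega>. X i \<omega> ^ 4)
      + 6 * (expectation (\<lambda>\<omega>. X i \<omega> ^ 2) * expectation (\<lambda>\<omega>. ?S \<omega> ^ 2)) + expectation (\<lambda>\<omega>. ?S \<omega> ^ 4)"
    using ES insert.prems(3) by simp
  also have "\<dots> \<le> c ^ 4 + 6 * (c\<^sup>2 * (?n * c\<^sup>2)) + 3 * ?n\<^sup>2 * c ^ 4"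
    using EX4 insert.IH[OF ind'] insert.prems sq[of i] ES2
    by (intro add_mono mult_left_mono mult_mono) (auto simp: c0)
  also have "\<dots> \<le> 3 * (real (card (insert i I)))\<^sup>2 * c ^ 4"
  proof -
    have "3 * (?n + 1)\<^sup>2 * c ^ 4 - (c ^ 4 + 6 * (c\<^sup>2 * (?n * c\<^sup>2)) + 3 * ?n\<^sup>2 * c ^ 4) = 2 * c ^ 4"
      by (simp add: eval_nat_numeral algebra_simps)
    moreover have "0 \<le> c ^ 4" by simp
    ultimately have "c ^ 4 + 6 * (c\<^sup>2 * (?n * c\<^sup>2)) + 3 * ?n\<^sup>2 * c ^ 4 \<le> 3 * (?n + 1)\<^sup>2 * c ^ 4"
      by linarith
    moreover have "real (card (insert i I)) = ?n + 1" using insert.hyps by simp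
    ultimately show ?thesis by simp
  qed
  finally show ?case .
qed

text \<open>The square of \<open>N\<close> is the point: for summands scaled by
  \<open>1 / sqrt n\<close>, the bounds for \<open>k\<close> cells of length of order
  \<open>n / k\<close> add up to order \<open>1 / k\<close>, while second moments would only keep
  the total bounded.\<close>

lemma indep_sum_maximal_fourth:
  fixes X :: "nat \<Rightarrow> 'a \<Rightarrow> real"
  assumes ind: "indep_vars (\<lambda>_. borel) X {1..N}" and l: "l > 0"
    and bnd: "\<And>i \<omega>. i \<in> {1..N} \<Longrightarrow> \<omega> \<in> space M \<Longrightarrow> \<bar>X i \<omega>\<bar> \<le> c"
    and mean: "\<And>i. i \<in> {1..N} \<Longrightarrow> expectation (X i) = 0"
  shows "prob {\<omega>\<in>space M. \<exists>k\<le>N. 2 * l < \<bar>\<Sum>t = 1..k. X t \<omega>\<bar>} \<le> 2 * (3 * (real N)\<^sup>2 * c ^ 4 / l ^ 4)"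
proof (rule ottaviani_inequality[OF ind])
  fix j assume "j \<le> N"
  let ?S = "\<lambda>\<omega>. \<Sum>t = Suc j..N. X t \<omega>"
  have mX: "X i \<in> borel_measurable M" if "i \<in> {1..N}" for i
    using ind that by (auto simp: indep_vars_def)
  have [measurable]: "?S \<in> borel_measurable M"
    by (rule borel_measurable_sum) (auto intro!: mX)
  have bS: "\<bar>?S \<omega>\<bar> \<le> real (card {Suc j..N}) * c" if "\<omega> \<in> space M" for \<omega>
    by (rule order_trans[OF sum_abs sum_bounded_above]) (use bnd that in auto)
  have "expectation (\<lambda>\<omega>. ?S \<omega> ^ 4) \<le> 3 * (real (card {Suc j..N}))\<^sup>2 * c ^ 4"
    by (rule indep_sum_fourth_moment) (use assms indep_vars_subset[OF ind, of "{Suc j..N}"] in auto)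
  also have "\<dots> \<le> 3 * (real N)\<^sup>2 * c ^ 4"
    by (intro mult_right_mono mult_left_mono power_mono) auto
  finally have E: "expectation (\<lambda>\<omega>. ?S \<omega> ^ 4) \<le> 3 * (real N)\<^sup>2 * c ^ 4" .
  have "integrable M (\<lambda>\<omega>. ?S \<omega> ^ 4)"
    by (rule integrable_const_bound[where B = "(real (card {Suc j..N}) * c) ^ 4"])
       (auto simp: power_abs simp del: card_atLeastAtMost power_even_abs_numeral power_even_abs intro!: power_mono bS)
  then have "prob {\<omega>\<in>space M. l < \<bar>?S \<omega>\<bar>} \<le> expectation (\<lambda>\<omega>. ?S \<omega> ^ 4) / l ^ 4"
    by (rule prob_less_fourth_le[rotated]) (use l in auto)
  also have "\<dots> \<le> 3 * (real N)\<^sup>2 * c ^ 4 / l ^ 4"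
    using E l by (intro divide_right_mono) auto
  finally show "prob {\<omega>\<in>space M. l < \<bar>?S \<omega>\<bar>} \<le> 3 * (real N)\<^sup>2 * c ^ 4 / l ^ 4" .
qed

lemma indep_sum_maximal_sq:
  fixes X :: "nat \<Rightarrow> 'a \<Rightarrow> real"
  assumes ind: "indep_vars (\<lambda>_. borel) X {1..N}" and l: "l > 0"
    and sq: "\<And>i. i \<in> {1..N} \<Longrightarrow> integrable M (\<lambda>\<omega>. (X i \<omega>)\<^sup>2)"
    and mean: "\<And>i. i \<in> {1..N} \<Longrightarrow> expectation (X i) = 0"
  shows "prob {\<omega>\<in>space M. \<exists>k\<le>N. 2 * l < \<bar>\<Sum>t = 1..k. X t \<omega>\<bar>}
    \<le> 2 * ((\<Sum>t = 1..N. expectation (\<lambda>\<omega>. (X t \<omega>)\<^sup>2)) / l\<^sup>2)"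
proof (rule ottaviani_inequality[OF ind])
  fix j assume "j \<le> N"
  let ?S = "\<lambda>\<omega>. \<Sum>t = Suc j..N. X t \<omega>"
  have mX: "X i \<in> borel_measurable M" if "i \<in> {1..N}" for i
    using ind that by (auto simp: indep_vars_def)
  have [measurable]: "?S \<in> borel_measurable M"
    by (rule borel_measurable_sum) (auto intro!: mX)
  have S: "integrable M (\<lambda>\<omega>. (?S \<omega>)\<^sup>2)"
      "expectation (\<lambda>\<omega>. (?S \<omega>)\<^sup>2) = (\<Sum>i\<in>{Suc j..N}. expectation (\<lambda>\<omega>. (X i \<omega>)\<^sup>2))"
    using indep_sum_second_moment[of "{Suc j..N}" X] indep_vars_subset[OF ind, of "{Suc j..N}"] sq mean by auto
  have "prob {\<omega>\<in>space M. l < \<bar>?S \<omega>\<bar>} \<le> expectation (\<lambda>\<omega>. (?S \<omega>)\<^sup>2) / l\<^sup>2"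
    by (rule prob_less_sq_le[OF _ S(1) l]) measurable
  also have "expectation (\<lambda>\<omega>. (?S \<omega>)\<^sup>2) \<le> (\<Sum>t = 1..N. expectation (\<lambda>\<omega>. (X t \<omega>)\<^sup>2))"
    unfolding S(2) by (rule sum_mono2) auto
  finally show "prob {\<omega>\<in>space M. l < \<bar>?S \<omega>\<bar>} \<le> (\<Sum>t = 1..N. expectation (\<lambda>\<omega>. (X t \<omega>)\<^sup>2)) / l\<^sup>2"
    using l by (simp add: divide_right_mono)
qed

text \<open>Each \<open>F r\<close> factors through the coordinates in \<open>K r\<close>, the
  others being filled with \<open>0\<close>; by \<open>dep\<close> the filling does not change the
  value. Independence of disjoint groups of coordinates then passes to the
  \<open>F r\<close>.\<close>

lemma indep_vars_local:
  fixes X :: "'i \<Rightarrow> 'a \<Rightarrow> real"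
  assumes ind: "indep_vars (\<lambda>_. borel) X UNIV" and disj: "disjoint_family_on K L"
    and F: "\<And>r. r \<in> L \<Longrightarrow> F r \<in> borel_measurable (PiM UNIV (\<lambda>_. borel))"
    and dep: "\<And>r x y. r \<in> L \<Longrightarrow> (\<And>i. i \<in> K r \<Longrightarrow> x i = y i) \<Longrightarrow> F r x = F r y"
  shows "indep_vars (\<lambda>_. borel) (\<lambda>r \<omega>. F r (\<lambda>i. X i \<omega>) :: real) L"
proof -
  have "indep_vars (\<lambda>j. PiM (K j) (\<lambda>_. borel)) (\<lambda>j \<omega>. restrict (\<lambda>i. X i \<omega>) (K j)) L"
    by (rule indep_vars_restrict[OF ind _ disj]) auto
  then have *: "indep_vars (\<lambda>_. borel)
     (\<lambda>r \<omega>. F r (\<lambda>i. if i \<in> K r then restrict (\<lambda>i. X i \<omega>) (K r) i else 0)) L"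
  proof (rule indep_vars_compose2[where Y = "\<lambda>r f. F r (\<lambda>i. if i \<in> K r then f i else 0)"])
    fix r assume r: "r \<in> L"
    have "(\<lambda>f i. if i \<in> K r then f i else 0) \<in> measurable (PiM (K r) (\<lambda>_. borel)) (PiM UNIV (\<lambda>_. borel))"
    proof (rule measurable_PiM_single')
      show "(\<lambda>f. if i \<in> K r then f i else 0) \<in> measurable (PiM (K r) (\<lambda>_. borel)) borel" for i
        by (cases "i \<in> K r") auto
    qed (auto simp: space_PiM)
    then show "(\<lambda>f. F r (\<lambda>i. if i \<in> K r then f i else 0)) \<in> borel_measurable (PiM (K r) (\<lambda>_. borel))"
      using F[OF r] by (rule measurable_compose)
  qed
  show ?thesis
    by (rule indep_vars_cong[THEN iffD1, OF refl _ refl *]) (auto intro!: ext dep)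
qed

end

text \<open>The index \<open>m\<close> itself is included, so the window has length
  \<open>Suc m\<close>. This differs from a head mean of order \<open>j\<close>, which reads only
  indices below \<open>j\<close>.\<close>

definition depends_on_first :: "nat \<Rightarrow> ((nat \<Rightarrow> real) \<Rightarrow> real) \<Rightarrow> bool" where
  "depends_on_first m f \<longleftrightarrow> (\<forall>x y. (\<forall>k\<le>m. x k = y k) \<longrightarrow> f x = f y)"

lemma measurable_shift_coords [measurable]:
  "(\<lambda>x k. x (t - int k)) \<in> measurable (PiM UNIV (\<lambda>_::int. borel :: real measure)) Rinf"
  by (rule measurable_PiM_single') (auto simp: space_PiM)

text \<open>Times in one residue class modulo \<open>Suc m\<close> have disjoint windows, so the
  terms of a class are independent. If every class stays below its share \<open>l / Suc m\<close>,
  the total stays below \<open>l\<close>; the union bound over the classes gives the factor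
  \<open>8 * (Suc m)^2\<close>, while the second moments of the classes add up to the full
  sum.\<close>

lemma (in prob_space) m_dependent_maximal_sq:
  fixes eps :: "int \<Rightarrow> 'a \<Rightarrow> real"
  assumes ind: "indep_vars (\<lambda>_. borel) eps UNIV" and l: "l > 0"
    and f: "\<And>t. t \<in> {1..n} \<Longrightarrow> f t \<in> borel_measurable Rinf"
    and dep: "\<And>t. t \<in> {1..n} \<Longrightarrow> depends_on_first m (f t)"
    and sq: "\<And>t. t \<in> {1..n} \<Longrightarrow> integrable M (\<lambda>\<omega>. (f t (shift_vec eps (int t) \<omega>))\<^sup>2)"
    and mean: "\<And>t. t \<in> {1..n} \<Longrightarrow> expectation (\<lambda>\<omega>. f t (shift_vec eps (int t) \<omega>)) = 0"
  shows "prob {\<omega>\<in>space M. \<exists>k\<le>n. l < \<bar>\<Sum>t = 1..k. f t (shift_vec eps (int t) \<omega>)\<bar>}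
    \<le> 8 * (real (Suc m))\<^sup>2 * (\<Sum>t = 1..n. expectation (\<lambda>\<omega>. (f t (shift_vec eps (int t) \<omega>))\<^sup>2)) / l\<^sup>2"
proof -
  let ?Y = "\<lambda>t \<omega>. f t (shift_vec eps (int t) \<omega>)"
  \<comment> \<open>One share per residue class; the factor 2 is the one in the maximal inequality
    for independent sums.\<close>
  define l' where "l' = l / (2 * real (Suc m))"
  have l': "l' > 0" using l by (simp add: l'_def)
  \<comment> \<open>Terms outside the class are replaced by \<open>0\<close>, so every class keeps
    the index set \<open>{1..n}\<close> and partial sums at the same \<open>k\<close> add up over
    the classes.\<close>
  define Y where "Y c t \<omega> = (if t mod Suc m = c then ?Y t \<omega> else 0)" for c t \<omega>
  define A where "A c = {\<omega>\<in>space M. \<exists>k\<le>n. 2 * l' < \<bar>\<Sum>t = 1..k. Y c t \<omega>\<bar>}" for c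
  have mY: "?Y t \<in> borel_measurable M" if "t \<in> {1..n}" for t
    using sq[OF that] mean[OF that] f[OF that] ind
    by (auto intro!: measurable_compose[OF _ f[OF that]] measurable_PiM_single' simp: shift_vec_def indep_vars_def)
  have indY: "indep_vars (\<lambda>_. borel) (Y c) {1..n}" for c
  proof -
    define K where "K t = (if t mod Suc m = c then {int t - int m..int t} else {})" for t
    define F where "F t x = (if t mod Suc m = c then f t (\<lambda>k. x (int t - int k)) else 0)" for t and x :: "int \<Rightarrow> real"
    have "indep_vars (\<lambda>_. borel) (\<lambda>t \<omega>. F t (\<lambda>i. eps i \<omega>)) {1..n}"
    proof (rule indep_vars_local[OF ind, where K = K])
      show "disjoint_family_on K {1..n}"
      proof -
        have "K s \<inter> K t = {}" if "s < t" for s t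
        proof (cases "s mod Suc m = c \<and> t mod Suc m = c")
          case True
          then have "(t - s) mod Suc m = 0"
            using that by (metis mod_eq_dvd_iff_nat mod_0_imp_dvd dvd_imp_mod_0 less_imp_le)
          then have "Suc m dvd t - s" by auto
          then have "Suc m \<le> t - s" using that by (simp add: dvd_imp_le)
          then show ?thesis by (auto simp: K_def)
        qed (auto simp: K_def)
        then show ?thesis unfolding disjoint_family_on_def by (metis inf_commute linorder_neqE_nat)
      qed
      show "F t \<in> borel_measurable (PiM UNIV (\<lambda>_. borel))" if "t \<in> {1..n}" for t
        unfolding F_def using measurable_compose[OF measurable_shift_coords f[OF that]]
        by (cases "t mod Suc m = c") auto
      show "F t x = F t y" if t: "t \<in> {1..n}" and xy: "\<And>i. i \<in> K t \<Longrightarrow> x i = y i" for t x y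
      proof (cases "t mod Suc m = c")
        case True
        then have "\<forall>k\<le>m. x (int t - int k) = y (int t - int k)"
          by (auto intro!: xy simp: K_def)
        then show ?thesis using dep[OF t] True by (auto simp: F_def depends_on_first_def)
      qed (simp add: F_def)
    qed
    then show ?thesis
      by (rule indep_vars_cong[THEN iffD1, rotated 3]) (auto simp: F_def Y_def shift_vec_def)
  qed
  have PA: "prob (A c) \<le> 2 * ((\<Sum>t = 1..n. expectation (\<lambda>\<omega>. (Y c t \<omega>)\<^sup>2)) / l'\<^sup>2)" for c
    unfolding A_def
  proof (rule indep_sum_maximal_sq[OF indY l'])
    show "integrable M (\<lambda>\<omega>. (Y c i \<omega>)\<^sup>2)" if "i \<in> {1..n}" for i
      using sq[OF that] by (cases "i mod Suc m = c") (auto simp: Y_def)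
    show "expectation (Y c i) = 0" if "i \<in> {1..n}" for i
      using mean[OF that] by (cases "i mod Suc m = c") (auto simp: Y_def[abs_def])
  qed
  have mA: "A c \<in> sets M" for c
  proof -
    have "(\<lambda>\<omega>. \<Sum>t = 1..k. Y c t \<omega>) \<in> borel_measurable M" if "k \<in> {..n}" for k
    proof (rule borel_measurable_sum)
      fix t assume "t \<in> {1..k}"
      with that have "?Y t \<in> borel_measurable M" by (intro mY) auto
      then show "Y c t \<in> borel_measurable M" unfolding Y_def[abs_def] by auto
    qed
    note [measurable] = this
    have eq: "A c = {\<omega>\<in>space M. \<exists>k\<in>{..n}. 2 * l' < \<bar>\<Sum>t = 1..k. Y c t \<omega>\<bar>}"
      by (auto simp: A_def)
    show ?thesis unfolding eq by measurable
  qed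
  have "{\<omega>\<in>space M. \<exists>k\<le>n. l < \<bar>\<Sum>t = 1..k. ?Y t \<omega>\<bar>} \<subseteq> (\<Union>c\<le>m. A c)"
  proof (rule subsetI, rule ccontr)
    fix \<omega> assume "\<omega> \<in> {\<omega>\<in>space M. \<exists>k\<le>n. l < \<bar>\<Sum>t = 1..k. ?Y t \<omega>\<bar>}" and nA: "\<omega> \<notin> (\<Union>c\<le>m. A c)"
    then obtain k where k: "\<omega> \<in> space M" "k \<le> n" "l < \<bar>\<Sum>t = 1..k. ?Y t \<omega>\<bar>" by auto
    have "(\<Sum>t = 1..k. ?Y t \<omega>) = (\<Sum>t = 1..k. \<Sum>c\<le>m. Y c t \<omega>)"
    proof (rule sum.cong[OF refl])
      fix t
      have "t mod Suc m \<in> {..m}" using mod_less_divisor[of "Suc m" t] by simp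
      then show "?Y t \<omega> = (\<Sum>c\<le>m. Y c t \<omega>)"
        unfolding Y_def by (simp add: sum.delta)
    qed
    also have "\<dots> = (\<Sum>c\<le>m. \<Sum>t = 1..k. Y c t \<omega>)" by (rule sum.swap)
    finally have "\<bar>\<Sum>t = 1..k. ?Y t \<omega>\<bar> \<le> (\<Sum>c\<le>m. \<bar>\<Sum>t = 1..k. Y c t \<omega>\<bar>)" by simp
    also have "\<dots> \<le> (\<Sum>c\<le>m. 2 * l')"
    proof (rule sum_mono)
      fix c assume "c \<in> {..m}"
      then show "\<bar>\<Sum>t = 1..k. Y c t \<omega>\<bar> \<le> 2 * l'" using nA k by (auto simp: A_def not_less)
    qed
    also have "\<dots> = l" by (simp add: l'_def del: of_nat_Suc)
    finally show False using k(3) by simp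
  qed
  then have "prob {\<omega>\<in>space M. \<exists>k\<le>n. l < \<bar>\<Sum>t = 1..k. ?Y t \<omega>\<bar>} \<le> prob (\<Union>c\<le>m. A c)"
    by (rule finite_measure_mono) (use mA in auto)
  also have "\<dots> \<le> (\<Sum>c\<le>m. prob (A c))"
    by (rule finite_measure_subadditive_finite) (use mA in auto)
  also have "\<dots> \<le> (\<Sum>c\<le>m. 2 * ((\<Sum>t = 1..n. expectation (\<lambda>\<omega>. (Y c t \<omega>)\<^sup>2)) / l'\<^sup>2))"
    by (rule sum_mono) (rule PA)
  also have "\<dots> = 2 / l'\<^sup>2 * (\<Sum>t = 1..n. \<Sum>c\<le>m. expectation (\<lambda>\<omega>. (Y c t \<omega>)\<^sup>2))"
    by (subst sum.swap) (simp add: sum_distrib_left sum_divide_distrib)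
  also have "(\<Sum>t = 1..n. \<Sum>c\<le>m. expectation (\<lambda>\<omega>. (Y c t \<omega>)\<^sup>2)) = (\<Sum>t = 1..n. expectation (\<lambda>\<omega>. (?Y t \<omega>)\<^sup>2))"
  proof (rule sum.cong[OF refl])
    fix t
    have t: "t mod Suc m \<in> {..m}" using mod_less_divisor[of "Suc m" t] by simp
    have "expectation (\<lambda>\<omega>. (Y c t \<omega>)\<^sup>2) = (if c = t mod Suc m then expectation (\<lambda>\<omega>. (?Y t \<omega>)\<^sup>2) else 0)" for c
      by (auto simp: Y_def)
    then show "(\<Sum>c\<le>m. expectation (\<lambda>\<omega>. (Y c t \<omega>)\<^sup>2)) = expectation (\<lambda>\<omega>. (?Y t \<omega>)\<^sup>2)"
      using t by (simp add: sum.delta)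
  qed
  also have "2 / l'\<^sup>2 = 8 * (real (Suc m))\<^sup>2 / l\<^sup>2"
    by (simp add: l'_def power_divide power_mult_distrib del: of_nat_Suc)
  finally show ?thesis by simp
qed

section \<open>Convergence of independent components\<close>

text \<open>The upper bound comes from
  \<open>(1 - y + y^2 / 2) * (1 + y + y^2 / 2) = 1 + y^4 / 4\<close>, which is at least
  \<open>1\<close>, while the second factor is at most \<open>exp y\<close>.\<close>

lemma exp_minus_quadratic_bound:
  fixes y :: real
  assumes "0 \<le> y"
  shows "\<bar>exp (- y) - (1 - y)\<bar> \<le> y\<^sup>2 / 2"
proof -
  obtain t where "exp y = (\<Sum>m<3. y ^ m / fact m) + exp t / fact 3 * y ^ 3"
    using Maclaurin_exp_le[of y 3] by blast
  then have "exp y = 1 + y + y\<^sup>2 / 2 + exp t / fact 3 * y ^ 3"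
    by (simp add: eval_nat_numeral)
  moreover have "0 \<le> exp t / fact 3 * y ^ 3" using assms by simp
  ultimately have e: "1 + y + y\<^sup>2 / 2 \<le> exp y" by linarith
  have "0 \<le> 1 - y + y\<^sup>2 / 2"
    using zero_le_power2[of "y - 1"] by (simp add: power2_eq_square algebra_simps)
  then have "(1 - y + y\<^sup>2 / 2) * (1 + y + y\<^sup>2 / 2) \<le> (1 - y + y\<^sup>2 / 2) * exp y"
    by (rule mult_left_mono[OF e])
  moreover have "(1 - y + y\<^sup>2 / 2) * (1 + y + y\<^sup>2 / 2) = 1 + y ^ 4 / 4"
    by (simp add: eval_nat_numeral algebra_simps)
  moreover have "0 \<le> y ^ 4 / 4" by simp
  ultimately have "1 \<le> (1 - y + y\<^sup>2 / 2) * exp y" by linarith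
  then have "exp (- y) \<le> 1 - y + y\<^sup>2 / 2"
    by (simp add: exp_minus field_simps)
  moreover have "1 - y \<le> exp (- y)" using exp_ge_add_one_self[of "- y"] by simp
  moreover have "0 \<le> y\<^sup>2 / 2" by simp
  ultimately show ?thesis by linarith
qed

text \<open>Products of numbers of modulus at most \<open>1\<close> differ by no more than the sum
  of the differences of their factors. Each factor is compared with its quadratic Taylor polynomial:
  the characteristic function gives the cubic error, the exponential the quartic one, using that the
  variance is at most \<open>c^2\<close>.\<close>

lemma (in prob_space) char_bounded_indep_sum:
  fixes X :: "'i \<Rightarrow> 'a \<Rightarrow> real"
  assumes fin: "finite I" and ind: "indep_vars (\<lambda>_. borel) X I"
    and bnd: "\<And>i \<omega>. i \<in> I \<Longrightarrow> \<omega> \<in> space M \<Longrightarrow> \<bar>X i \<omega>\<bar> \<le> c"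
    and mean: "\<And>i. i \<in> I \<Longrightarrow> expectation (X i) = 0"
  shows "cmod (char (distr M borel (\<lambda>\<omega>. \<Sum>i\<in>I. X i \<omega>)) \<theta>
      - exp (- (\<theta>\<^sup>2 * (\<Sum>i\<in>I. expectation (\<lambda>\<omega>. (X i \<omega>)\<^sup>2)) / 2)))
    \<le> real (card I) * (\<bar>\<theta>\<bar> ^ 3 * c ^ 3 / 6 + \<theta> ^ 4 * c ^ 4 / 8)"
proof -
  let ?v = "\<lambda>i. expectation (\<lambda>\<omega>. (X i \<omega>)\<^sup>2)"
  have mX: "X i \<in> borel_measurable M" if "i \<in> I" for i
    using ind that by (auto simp: indep_vars_def)
  have single: "cmod (char (distr M borel (X i)) \<theta> - complex_of_real (exp (- (\<theta>\<^sup>2 * ?v i / 2))))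
      \<le> \<bar>\<theta>\<bar> ^ 3 * c ^ 3 / 6 + \<theta> ^ 4 * c ^ 4 / 8" if i: "i \<in> I" for i
  proof -
    note [measurable] = mX[OF i]
    have c0: "0 \<le> c" using bnd[OF i] not_empty by (meson abs_ge_zero ex_in_conv order_trans)
    have iX: "integrable M (X i)"
      by (rule integrable_const_bound[where B = c]) (use bnd i in auto)
    have iX2: "integrable M (\<lambda>\<omega>. (X i \<omega>)\<^sup>2)"
      by (rule integrable_const_bound[where B = "c\<^sup>2"])
         (use bnd[OF i] c0 in \<open>auto simp: abs_le_square_iff[symmetric]\<close>)
    have v: "0 \<le> ?v i" "?v i \<le> c\<^sup>2"
    proof -
      show "?v i \<le> c\<^sup>2"
        by (rule integral_le_const[OF iX2]) (use bnd[OF i] c0 in \<open>auto simp: abs_le_square_iff[symmetric]\<close>)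
    qed simp
    have "cmod (char (distr M borel (X i)) \<theta> - (1 - \<theta>\<^sup>2 * ?v i / 2))
        \<le> (\<theta>\<^sup>2 / 6) * expectation (\<lambda>\<omega>. min (6 * (X i \<omega>)\<^sup>2) (\<bar>\<theta>\<bar> * \<bar>X i \<omega>\<bar> ^ 3))"
      by (rule char_approx3') (use iX iX2 mean[OF i] in auto)
    also have "\<dots> \<le> (\<theta>\<^sup>2 / 6) * (\<bar>\<theta>\<bar> * c ^ 3)"
    proof (rule mult_left_mono)
      have *: "\<bar>X i \<omega>\<bar> ^ 3 \<le> c ^ 3" if "\<omega> \<in> space M" for \<omega>
        by (rule power_mono) (use bnd[OF i that] in auto)
      have le: "min (6 * (X i \<omega>)\<^sup>2) (\<bar>\<theta>\<bar> * \<bar>X i \<omega>\<bar> ^ 3) \<le> \<bar>\<theta>\<bar> * c ^ 3" if "\<omega> \<in> space M" for \<omega>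
        using mult_left_mono[OF *[OF that], of "\<bar>\<theta>\<bar>"] by linarith
      have "0 \<le> min (6 * (X i \<omega>)\<^sup>2) (\<bar>\<theta>\<bar> * \<bar>X i \<omega>\<bar> ^ 3)" for \<omega> by simp
      then have "integrable M (\<lambda>\<omega>. min (6 * (X i \<omega>)\<^sup>2) (\<bar>\<theta>\<bar> * \<bar>X i \<omega>\<bar> ^ 3))"
        using le by (intro integrable_const_bound[where B = "\<bar>\<theta>\<bar> * c ^ 3"]) auto
      then show "expectation (\<lambda>\<omega>. min (6 * (X i \<omega>)\<^sup>2) (\<bar>\<theta>\<bar> * \<bar>X i \<omega>\<bar> ^ 3)) \<le> \<bar>\<theta>\<bar> * c ^ 3"
        by (rule integral_le_const) (use le in auto)
    qed simp
    also have "\<dots> = \<bar>\<theta>\<bar> ^ 3 * c ^ 3 / 6"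
      by (simp add: eval_nat_numeral)
    finally have 1: "cmod (char (distr M borel (X i)) \<theta> - (1 - \<theta>\<^sup>2 * ?v i / 2)) \<le> \<bar>\<theta>\<bar> ^ 3 * c ^ 3 / 6" .
    have "cmod ((1 - \<theta>\<^sup>2 * ?v i / 2) - complex_of_real (exp (- (\<theta>\<^sup>2 * ?v i / 2))))
        = \<bar>exp (- (\<theta>\<^sup>2 * ?v i / 2)) - (1 - \<theta>\<^sup>2 * ?v i / 2)\<bar>"
    proof -
      have "(1 - \<theta>\<^sup>2 * ?v i / 2) - complex_of_real (exp (- (\<theta>\<^sup>2 * ?v i / 2)))
          = complex_of_real ((1 - \<theta>\<^sup>2 * ?v i / 2) - exp (- (\<theta>\<^sup>2 * ?v i / 2)))"
        by simp
      then show ?thesis by (simp only: norm_of_real)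
    qed
    also have "\<dots> \<le> (\<theta>\<^sup>2 * ?v i / 2)\<^sup>2 / 2"
      by (rule exp_minus_quadratic_bound) (use v in simp)
    also have "\<dots> \<le> (\<theta>\<^sup>2 * c\<^sup>2 / 2)\<^sup>2 / 2"
      using v by (intro divide_right_mono power_mono mult_left_mono) auto
    also have "\<dots> = \<theta> ^ 4 * c ^ 4 / 8"
      by (simp add: eval_nat_numeral)
    finally have 2: "cmod ((1 - \<theta>\<^sup>2 * ?v i / 2) - complex_of_real (exp (- (\<theta>\<^sup>2 * ?v i / 2)))) \<le> \<theta> ^ 4 * c ^ 4 / 8" .
    show ?thesis
      using norm_triangle_ineq[of "char (distr M borel (X i)) \<theta> - (1 - \<theta>\<^sup>2 * ?v i / 2)"
          "(1 - \<theta>\<^sup>2 * ?v i / 2) - complex_of_real (exp (- (\<theta>\<^sup>2 * ?v i / 2)))"] 1 2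
      by (simp del: of_real_exp)
  qed
  have "exp (- (\<theta>\<^sup>2 * (\<Sum>i\<in>I. ?v i) / 2)) = (\<Prod>i\<in>I. exp (- (\<theta>\<^sup>2 * ?v i / 2)))"
    by (simp add: exp_sum[OF fin, symmetric] sum_distrib_left sum_divide_distrib sum_negf)
  then have "complex_of_real (exp (- (\<theta>\<^sup>2 * (\<Sum>i\<in>I. ?v i) / 2)))
      = (\<Prod>i\<in>I. complex_of_real (exp (- (\<theta>\<^sup>2 * ?v i / 2))))"
    by (simp only: of_real_prod)
  then have "cmod (char (distr M borel (\<lambda>\<omega>. \<Sum>i\<in>I. X i \<omega>)) \<theta>
      - complex_of_real (exp (- (\<theta>\<^sup>2 * (\<Sum>i\<in>I. ?v i) / 2))))
    = cmod ((\<Prod>i\<in>I. char (distr M borel (X i)) \<theta>) - (\<Prod>i\<in>I. complex_of_real (exp (- (\<theta>\<^sup>2 * ?v i / 2)))))"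
    by (simp only: char_distr_sum[OF ind])
  also have "\<dots> \<le> (\<Sum>i\<in>I. cmod (char (distr M borel (X i)) \<theta> - complex_of_real (exp (- (\<theta>\<^sup>2 * ?v i / 2)))))"
  proof (rule norm_prod_diff)
    show "cmod (char (distr M borel (X i)) \<theta>) \<le> 1" if "i \<in> I" for i
      by (rule real_distribution.cmod_char_le_1[OF real_distribution_distr[OF mX[OF that]]])
    show "cmod (complex_of_real (exp (- (\<theta>\<^sup>2 * ?v i / 2)))) \<le> 1" if "i \<in> I" for i
      by (simp only: norm_of_real) (simp add: zero_le_mult_iff)
  qed
  also have "\<dots> \<le> real (card I) * (\<bar>\<theta>\<bar> ^ 3 * c ^ 3 / 6 + \<theta> ^ 4 * c ^ 4 / 8)"
    by (rule sum_bounded_above) (rule single)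
  finally show ?thesis by simp
qed

text \<open>Scaling a standard normal variable, rather than giving a density, makes variance
  \<open>0\<close> the point mass at \<open>0\<close>; time changes may be constant on intervals, so
  this case occurs.\<close>

definition normal_law :: "real \<Rightarrow> real measure" where
  "normal_law s = distr std_normal_distribution borel (\<lambda>x. sqrt s * x)"

lemma real_distribution_normal_law: "real_distribution (normal_law s)"
  unfolding normal_law_def
  by (rule prob_space.real_distribution_distr)
     (auto intro: real_distribution.axioms(1) real_dist_normal_dist)

lemma char_normal_law:
  assumes "0 \<le> s"
  shows "char (normal_law s) \<theta> = complex_of_real (exp (- (\<theta>\<^sup>2 * s / 2)))"
proof -
  have "char (normal_law s) \<theta> = char std_normal_distribution (\<theta> * sqrt s)"
    unfolding char_def normal_law_def by (subst integral_distr) (auto simp: mult.assoc)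
  then show ?thesis
    using assms by (simp add: char_std_normal_distribution power_mult_distrib)
qed

lemma sup_continuous_psum_cong:
  assumes f: "sup_continuous_D f" and c: "c \<ge> 0" and ab: "\<And>t. t \<in> {1..nat \<lfloor>c\<rfloor>} \<Longrightarrow> a t = b t"
  shows "f (psum c a) = f (psum c b)"
proof (rule sup_continuous_D_cong[OF f cadlag01_psum[OF c] cadlag01_psum[OF c]])
  fix v :: real assume v: "v \<in> {0..1}"
  have "c * v \<le> c" using c v by (simp add: mult_left_le)
  then have "nat \<lfloor>c * v\<rfloor> \<le> nat \<lfloor>c\<rfloor>" by (intro nat_mono floor_mono)
  then show "psum c a v = psum c b v"
    unfolding psum_def by (intro sum.cong ab) auto
qed

lemma sup_continuous_psum_tendsto:
  assumes f: "sup_continuous_D f"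
    and lim: "\<And>i. i \<in> {1..k} \<Longrightarrow> (\<lambda>n. a n i) \<longlonglongrightarrow> b i"
  shows "(\<lambda>n. f (psum (real k) (a n))) \<longlonglongrightarrow> f (psum (real k) b)"
proof (rule sup_continuous_DD[OF f])
  show "sup_near (psum (real k) (a n)) (psum (real k) b) (\<Sum>i = 1..k. \<bar>a n i - b i\<bar>)" for n
  proof (rule sup_near_psum)
    fix j assume j: "j \<le> nat \<lfloor>real k\<rfloor>"
    have "\<bar>(\<Sum>t = 1..j. a n t) - (\<Sum>t = 1..j. b t)\<bar> \<le> (\<Sum>t = 1..j. \<bar>a n t - b t\<bar>)"
      by (simp flip: sum_subtractf)
    also have "\<dots> \<le> (\<Sum>i = 1..k. \<bar>a n i - b i\<bar>)"
      by (rule sum_mono2) (use j in auto)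
    finally show "\<bar>(\<Sum>t = 1..j. a n t) - (\<Sum>t = 1..j. b t)\<bar> \<le> (\<Sum>i = 1..k. \<bar>a n i - b i\<bar>)" .
  qed simp
  have "(\<lambda>n. \<Sum>i = 1..k. \<bar>a n i - b i\<bar>) \<longlonglongrightarrow> (\<Sum>i = 1..k. 0)"
    by (rule tendsto_sum) (use lim in \<open>auto simp: tendsto_rabs_zero_iff LIM_zero_iff\<close>)
  then show "(\<lambda>n. \<Sum>i = 1..k. \<bar>a n i - b i\<bar>) \<longlonglongrightarrow> 0" by simp
qed (auto intro!: cadlag01_psum)

text \<open>The coordinates of a product measure are independent, functions of single coordinates
  remain so, and the law of an independent vector is the product of its marginals.\<close>

lemma distr_PiM_componentwise:
  fixes \<Omega> :: "'i \<Rightarrow> 'a measure" and Y :: "'i \<Rightarrow> 'a \<Rightarrow> real"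
  assumes I: "I \<noteq> {}" and \<Omega>: "\<And>i. i \<in> I \<Longrightarrow> prob_space (\<Omega> i)"
    and Y: "\<And>i. i \<in> I \<Longrightarrow> Y i \<in> borel_measurable (\<Omega> i)"
  shows "distr (PiM I \<Omega>) (PiM I (\<lambda>_. borel)) (\<lambda>\<omega>. \<lambda>i\<in>I. Y i (\<omega> i)) = PiM I (\<lambda>i. distr (\<Omega> i) borel (Y i))"
proof -
  interpret R: prob_space "PiM I \<Omega>" by (rule prob_space_PiM) (rule \<Omega>)
  have comp: "distr (PiM I \<Omega>) (\<Omega> i) (\<lambda>\<omega>. \<omega> i) = \<Omega> i" if "i \<in> I" for i
    by (rule distr_PiM_component[OF \<Omega> that])
  have "distr (PiM I \<Omega>) (PiM I \<Omega>) (\<lambda>\<omega>. \<lambda>i\<in>I. \<omega> i) = distr (PiM I \<Omega>) (PiM I \<Omega>) (\<lambda>\<omega>. \<omega>)"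
    by (rule distr_cong) (auto simp: space_PiM)
  also have "\<dots> = PiM I \<Omega>" by simp
  also have "\<dots> = PiM I (\<lambda>i. distr (PiM I \<Omega>) (\<Omega> i) (\<lambda>\<omega>. \<omega> i))"
    by (rule PiM_cong) (auto simp: comp)
  finally have "R.indep_vars \<Omega> (\<lambda>i \<omega>. \<omega> i) I"
    by (subst R.indep_vars_iff_distr_eq_PiM'[OF I]) auto
  then have "R.indep_vars (\<lambda>_. borel) (\<lambda>i \<omega>. Y i (\<omega> i)) I"
    by (rule R.indep_vars_compose2) (rule Y)
  then have "distr (PiM I \<Omega>) (PiM I (\<lambda>_. borel)) (\<lambda>\<omega>. \<lambda>i\<in>I. Y i (\<omega> i))
      = PiM I (\<lambda>i. distr (PiM I \<Omega>) borel (\<lambda>\<omega>. Y i (\<omega> i)))"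
    by (subst (asm) R.indep_vars_iff_distr_eq_PiM'[OF I])
       (auto intro!: measurable_compose[OF measurable_component_singleton] Y)
  also have "\<dots> = PiM I (\<lambda>i. distr (\<Omega> i) borel (Y i))"
  proof (rule PiM_cong[OF refl])
    fix i assume i: "i \<in> I"
    have "distr (distr (PiM I \<Omega>) (\<Omega> i) (\<lambda>\<omega>. \<omega> i)) borel (Y i) = distr (PiM I \<Omega>) borel (Y i \<circ> (\<lambda>\<omega>. \<omega> i))"
      by (rule distr_distr) (use Y i in auto)
    then show "distr (PiM I \<Omega>) borel (\<lambda>\<omega>. Y i (\<omega> i)) = distr (\<Omega> i) borel (Y i)"
      using comp[OF i] by (simp add: comp_def)
  qed
  finally show ?thesis .
qed

text \<open>Joint convergence of independent components: the product of one-dimensional Skorohod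
  couplings converges pointwise, so no multivariate continuity theorem is needed.\<close>

lemma indep_components_tendsto:
  fixes Q :: "nat \<Rightarrow> 'c measure" and D :: "nat \<Rightarrow> nat \<Rightarrow> 'c \<Rightarrow> real"
  assumes k: "k \<ge> 1" and Q: "\<And>n. prob_space (Q n)"
    and ind: "\<And>n. prob_space.indep_vars (Q n) (\<lambda>_. borel) (D n) {1..k}"
    and nu: "\<And>i. real_distribution (\<nu> i)"
    and conv: "\<And>i. i \<in> {1..k} \<Longrightarrow> weak_conv_m (\<lambda>n. distr (Q n) borel (D n i)) (\<nu> i)"
    and f: "sup_continuous_D f" and bnd: "\<And>x. cadlag01 x \<Longrightarrow> \<bar>f x\<bar> \<le> K"
  shows "(\<lambda>n. \<integral>\<omega>. f (psum (real k) (\<lambda>i. D n i \<omega>)) \<partial>Q n) \<longlonglongrightarrow> (\<integral>x. f (psum (real k) x) \<partial>(PiM {1..k} \<nu>))"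
proof -
  have mD: "D n i \<in> borel_measurable (Q n)" if "i \<in> {1..k}" for n i
    using ind[of n] that by (auto simp: prob_space.indep_vars_def[OF Q])
  \<comment> \<open>The conclusion of the Skorohod representation for one component: copies of the
    given laws on a space \<open>\<Omega>\<close>, converging at every point. Naming it permits
    three successive choices over the components.\<close>
  define P where "P i \<Omega> Y_seq Y \<longleftrightarrow> prob_space \<Omega> \<and> (\<forall>n. Y_seq n \<in> measurable \<Omega> borel) \<and>
      (\<forall>n. distr \<Omega> borel (Y_seq n) = distr (Q n) borel (D n i)) \<and> Y \<in> measurable \<Omega> lborel \<and>
      distr \<Omega> borel Y = \<nu> i \<and> (\<forall>x \<in> space \<Omega>. (\<lambda>n. Y_seq n x) \<longlonglongrightarrow> Y x)"
    for i and \<Omega> :: "real measure" and Y_seq :: "nat \<Rightarrow> real \<Rightarrow> real" and Y :: "real \<Rightarrow> real"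
  have "\<forall>i\<in>{1..k}. \<exists>\<Omega> Y_seq Y. P i \<Omega> Y_seq Y"
    unfolding P_def
    by (intro ballI Skorohod prob_space.real_distribution_distr Q mD nu conv)
  from bchoice[OF this] obtain \<Omega> where "\<forall>i\<in>{1..k}. \<exists>Y_seq Y. P i (\<Omega> i) Y_seq Y" by blast
  from bchoice[OF this] obtain Ys where "\<forall>i\<in>{1..k}. \<exists>Y. P i (\<Omega> i) (Ys i) Y" by blast
  from bchoice[OF this] obtain Y where "\<forall>i\<in>{1..k}. P i (\<Omega> i) (Ys i) (Y i)" by blast
  then have \<Omega>: "\<And>i. i \<in> {1..k} \<Longrightarrow> prob_space (\<Omega> i)"
    and Ys: "\<And>i n. i \<in> {1..k} \<Longrightarrow> Ys i n \<in> borel_measurable (\<Omega> i)"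
    and dYs: "\<And>i n. i \<in> {1..k} \<Longrightarrow> distr (\<Omega> i) borel (Ys i n) = distr (Q n) borel (D n i)"
    and Y: "\<And>i. i \<in> {1..k} \<Longrightarrow> Y i \<in> borel_measurable (\<Omega> i)"
    and dY: "\<And>i. i \<in> {1..k} \<Longrightarrow> distr (\<Omega> i) borel (Y i) = \<nu> i"
    and lim: "\<And>i x. i \<in> {1..k} \<Longrightarrow> x \<in> space (\<Omega> i) \<Longrightarrow> (\<lambda>n. Ys i n x) \<longlonglongrightarrow> Y i x"
    unfolding P_def by auto
  interpret R: prob_space "PiM {1..k} \<Omega>" by (rule prob_space_PiM) (rule \<Omega>)
  have ne: "{1..k} \<noteq> {}" using k by auto
  have fm: "(\<lambda>x. f (psum (real k) x)) \<in> borel_measurable (PiM {1..k} (\<lambda>_. borel))"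
    by (rule measurable_sup_continuous_psum[OF f, where a = "\<lambda>t x. x t"]) auto
  have mY: "(\<lambda>\<omega>. \<lambda>i\<in>{1..k}. Z i (\<omega> i)) \<in> measurable (PiM {1..k} \<Omega>) (PiM {1..k} (\<lambda>_. borel))"
    if "\<And>i. i \<in> {1..k} \<Longrightarrow> Z i \<in> borel_measurable (\<Omega> i)" for Z :: "nat \<Rightarrow> real \<Rightarrow> real"
    by (rule measurable_restrict) (auto intro!: measurable_compose[OF measurable_component_singleton] that)
  \<comment> \<open>An integral over a product of laws becomes one over the product of the coupling
    spaces, where the paths converge pointwise.\<close>
  have transfer: "(\<integral>\<omega>. f (psum (real k) (\<lambda>i. Z i (\<omega> i))) \<partial>(PiM {1..k} \<Omega>))
      = (\<integral>x. f (psum (real k) x) \<partial>(PiM {1..k} (\<lambda>i. distr (\<Omega> i) borel (Z i))))"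
    if Z: "\<And>i. i \<in> {1..k} \<Longrightarrow> Z i \<in> borel_measurable (\<Omega> i)" for Z :: "nat \<Rightarrow> real \<Rightarrow> real"
  proof -
    have "(\<integral>x. f (psum (real k) x) \<partial>(PiM {1..k} (\<lambda>i. distr (\<Omega> i) borel (Z i))))
      = (\<integral>\<omega>. f (psum (real k) (\<lambda>i\<in>{1..k}. Z i (\<omega> i))) \<partial>(PiM {1..k} \<Omega>))"
    proof -
      have eq: "PiM {1..k} (\<lambda>i. distr (\<Omega> i) borel (Z i))
          = distr (PiM {1..k} \<Omega>) (PiM {1..k} (\<lambda>_. borel)) (\<lambda>\<omega>. \<lambda>i\<in>{1..k}. Z i (\<omega> i))"
        by (rule distr_PiM_componentwise[symmetric, OF ne]) (auto intro: \<Omega> Z)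
      show ?thesis
        unfolding eq by (rule integral_distr[OF mY[OF Z] fm])
    qed
    also have "\<dots> = (\<integral>\<omega>. f (psum (real k) (\<lambda>i. Z i (\<omega> i))) \<partial>(PiM {1..k} \<Omega>))"
      by (intro Bochner_Integration.integral_cong refl sup_continuous_psum_cong[OF f]) auto
    finally show ?thesis by simp
  qed
  have left: "(\<integral>\<omega>. f (psum (real k) (\<lambda>i. D n i \<omega>)) \<partial>Q n)
      = (\<integral>\<omega>. f (psum (real k) (\<lambda>i. Ys i n (\<omega> i))) \<partial>(PiM {1..k} \<Omega>))" for n
  proof -
    have "(\<integral>\<omega>. f (psum (real k) (\<lambda>i. D n i \<omega>)) \<partial>Q n)
        = (\<integral>\<omega>. f (psum (real k) (\<lambda>i\<in>{1..k}. D n i \<omega>)) \<partial>Q n)"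
      by (intro Bochner_Integration.integral_cong refl sup_continuous_psum_cong[OF f]) auto
    also have "\<dots> = (\<integral>x. f (psum (real k) x) \<partial>(distr (Q n) (PiM {1..k} (\<lambda>_. borel)) (\<lambda>\<omega>. \<lambda>i\<in>{1..k}. D n i \<omega>)))"
      by (rule integral_distr[symmetric, OF _ fm]) (rule measurable_restrict, rule mD)
    also have "distr (Q n) (PiM {1..k} (\<lambda>_. borel)) (\<lambda>\<omega>. \<lambda>i\<in>{1..k}. D n i \<omega>)
        = PiM {1..k} (\<lambda>i. distr (Q n) borel (D n i))"
      by (rule prob_space.indep_vars_iff_distr_eq_PiM'[THEN iffD1, OF Q ne _ ind]) (rule mD)
    also have "\<dots> = PiM {1..k} (\<lambda>i. distr (\<Omega> i) borel (Ys i n))"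
      by (rule PiM_cong) (auto simp: dYs)
    also have "(\<integral>x. f (psum (real k) x) \<partial>\<dots>) = (\<integral>\<omega>. f (psum (real k) (\<lambda>i. Ys i n (\<omega> i))) \<partial>(PiM {1..k} \<Omega>))"
      by (rule transfer[symmetric]) (rule Ys)
    finally show ?thesis .
  qed
  have right: "(\<integral>x. f (psum (real k) x) \<partial>(PiM {1..k} \<nu>))
      = (\<integral>\<omega>. f (psum (real k) (\<lambda>i. Y i (\<omega> i))) \<partial>(PiM {1..k} \<Omega>))"
  proof -
    have "PiM {1..k} \<nu> = PiM {1..k} (\<lambda>i. distr (\<Omega> i) borel (Y i))"
      by (rule PiM_cong) (auto simp: dY)
    then show ?thesis by (simp only: transfer[OF Y])
  qed
  have meas: "(\<lambda>\<omega>. f (psum (real k) (\<lambda>i. Z i (\<omega> i)))) \<in> borel_measurable (PiM {1..k} \<Omega>)"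
    if "\<And>i. i \<in> {1..k} \<Longrightarrow> Z i \<in> borel_measurable (\<Omega> i)" for Z :: "nat \<Rightarrow> real \<Rightarrow> real"
    by (rule measurable_sup_continuous_psum[OF f])
       (auto intro!: measurable_compose[OF measurable_component_singleton] that)
  show ?thesis
    unfolding left right
  proof (rule integral_dominated_convergence[where w = "\<lambda>_. K"])
    show "AE \<omega> in PiM {1..k} \<Omega>. (\<lambda>n. f (psum (real k) (\<lambda>i. Ys i n (\<omega> i)))) \<longlonglongrightarrow> f (psum (real k) (\<lambda>i. Y i (\<omega> i)))"
    proof (rule AE_I2, rule sup_continuous_psum_tendsto[OF f])
      fix \<omega> i assume "\<omega> \<in> space (PiM {1..k} \<Omega>)" and i: "i \<in> {1..k}"
      then have "\<omega> i \<in> space (\<Omega> i)" by (auto simp: space_PiM)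
      then show "(\<lambda>n. Ys i n (\<omega> i)) \<longlonglongrightarrow> Y i (\<omega> i)" by (rule lim[OF i])
    qed
    show "AE x in PiM {1..k} \<Omega>. norm (f (psum (real k) (\<lambda>i. Ys i n (x i)))) \<le> K" for n
      by (auto intro!: bnd cadlag01_psum)
    show "(\<lambda>\<omega>. f (psum (real k) (\<lambda>i. Y i (\<omega> i)))) \<in> borel_measurable (PiM {1..k} \<Omega>)"
      by (rule meas) (rule Y)
    show "(\<lambda>\<omega>. f (psum (real k) (\<lambda>i. Ys i n (\<omega> i)))) \<in> borel_measurable (PiM {1..k} \<Omega>)" for n
      by (rule meas) (rule Ys)
  qed (rule R.integrable_const)
qed

section \<open>Increments of Brownian motion\<close>

context
  fixes N :: "'b measure" and B :: "real \<Rightarrow> 'b \<Rightarrow> real"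
  assumes BM: "std_brownian_motion N B"
begin

lemma BM_prob_space: "prob_space N"
  using BM by (simp add: std_brownian_motion_def)

lemma BM_measurable: "0 \<le> t \<Longrightarrow> B t \<in> borel_measurable N"
  using BM by (simp add: std_brownian_motion_def)

lemma BM_0: "\<omega> \<in> space N \<Longrightarrow> B 0 \<omega> = 0"
  using BM by (simp add: std_brownian_motion_def)

lemma BM_continuous: "\<omega> \<in> space N \<Longrightarrow> continuous_on {0..} (\<lambda>t. B t \<omega>)"
  using BM by (simp add: std_brownian_motion_def)

lemma BM_increment_law:
  assumes "0 \<le> s" "s < t"
  shows "distr N borel (\<lambda>\<omega>. B t \<omega> - B s \<omega>) = normal_law (t - s)"
proof -
  interpret prob_space N by (rule BM_prob_space)
  let ?s = "sqrt (t - s)" and ?X = "\<lambda>\<omega>. B t \<omega> - B s \<omega>"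
  have pos: "0 < ?s" using assms by simp
  have [measurable]: "B t \<in> borel_measurable N" "B s \<in> borel_measurable N"
    using assms by (auto intro: BM_measurable)
  have "distributed N lborel ?X (normal_density 0 ?s)"
    using BM assms by (simp add: std_brownian_motion_def)
  then have "distributed N lborel (\<lambda>x. (?X x - 0) / ?s) std_normal_density"
    using normal_standard_normal_convert[OF pos, of ?X 0] by blast
  then have "distr N lborel (\<lambda>x. ?X x / ?s) = std_normal_distribution"
    by (simp add: distributed_def)
  moreover have "distr N lborel (\<lambda>x. ?X x / ?s) = distr N borel (\<lambda>x. ?X x / ?s)"
    by (rule distr_cong) auto
  ultimately have "normal_law (t - s) = distr (distr N borel (\<lambda>x. ?X x / ?s)) borel (\<lambda>x. ?s * x)"
    by (simp add: normal_law_def)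
  also have "\<dots> = distr N borel ((\<lambda>x. ?s * x) \<circ> (\<lambda>x. ?X x / ?s))"
    by (rule distr_distr) auto
  also have "\<dots> = distr N borel ?X"
    using pos by (simp add: comp_def)
  finally show ?thesis by simp
qed

text \<open>Independent increments are available only along strictly increasing times, whereas
  \<open>\<tau>\<close> may have ties where the variance vanishes. The times are pushed apart by
  multiples of a spacing that tends to \<open>0\<close>. Convergence of the laws gives one side as
  the limit of the resulting integrals, continuity of the paths gives the other.\<close>

lemma BM_increments_integral:
  assumes k: "k \<ge> 1" and \<tau>0: "0 \<le> \<tau> 0" and mono: "\<And>i. i < k \<Longrightarrow> \<tau> i \<le> \<tau> (Suc i)"
    and f: "sup_continuous_D f" and bnd: "\<And>x. cadlag01 x \<Longrightarrow> \<bar>f x\<bar> \<le> K"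
  shows "(\<integral>\<omega>. f (psum (real k) (\<lambda>i. B (\<tau> i) \<omega> - B (\<tau> (i - 1)) \<omega>)) \<partial>N)
    = (\<integral>x. f (psum (real k) x) \<partial>(PiM {1..k} (\<lambda>i. normal_law (\<tau> i - \<tau> (i - 1)))))"
proof -
  interpret prob_space N by (rule BM_prob_space)
  have \<tau>nn: "0 \<le> \<tau> i" if "i \<le> k" for i
    using that
  proof (induction i)
    case (Suc i)
    then show ?case using mono[of i] by simp
  qed (rule \<tau>0)
  define \<delta> where "\<delta> n = inverse (real (Suc n))" for n
  define ts where "ts n j = \<tau> j + real j * \<delta> n" for n and j :: nat
  define D where "D n i \<omega> = B (ts n i) \<omega> - B (ts n (i - 1)) \<omega>" for n i \<omega>
  have \<delta>: "\<delta> n > 0" for n by (simp add: \<delta>_def)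
  have ts_less: "ts n j < ts n (Suc j)" if "j < k" for n j
    using mono[OF that] \<delta>[of n] by (simp add: ts_def algebra_simps)
  have ts_nn: "0 \<le> ts n j" if "j \<le> k" for n j
    using \<tau>nn[OF that] \<delta>[of n] by (simp add: ts_def)
  have ts_lim: "(\<lambda>n. ts n j) \<longlonglongrightarrow> \<tau> j" for j
    unfolding ts_def \<delta>_def
    using tendsto_add[OF tendsto_const[of "\<tau> j"] tendsto_mult_left[OF LIMSEQ_inverse_real_of_nat, of "real j"]]
    by simp
  \<comment> \<open>Increments are numbered from 0 in \<open>std_brownian_motion\<close> and from 1
    in \<open>psum\<close>; restricting to the singleton \<open>{j - 1}\<close> performs the
    shift.\<close>
  have ind: "indep_vars (\<lambda>_. borel) (D n) {1..k}" for n
  proof -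
    have "indep_vars (\<lambda>_. borel) (\<lambda>i \<omega>. B (ts n (Suc i)) \<omega> - B (ts n i) \<omega>) {..<k}"
      using BM ts_less ts_nn[of 0] unfolding std_brownian_motion_def by blast
    then have "indep_vars (\<lambda>j. PiM {j - 1} (\<lambda>_. borel))
       (\<lambda>j \<omega>. restrict (\<lambda>i. B (ts n (Suc i)) \<omega> - B (ts n i) \<omega>) {j - 1}) {1..k}"
      by (rule indep_vars_restrict) (auto simp: disjoint_family_on_def)
    then have "indep_vars (\<lambda>_. borel) (\<lambda>j \<omega>. (restrict (\<lambda>i. B (ts n (Suc i)) \<omega> - B (ts n i) \<omega>) {j - 1}) (j - 1)) {1..k}"
      by (rule indep_vars_compose2[where Y = "\<lambda>j x. x (j - 1)"]) auto
    then show ?thesis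
      by (rule indep_vars_cong[THEN iffD1, rotated 3]) (auto simp: D_def)
  qed
  have law: "distr N borel (D n i) = normal_law (ts n i - ts n (i - 1))" if "i \<in> {1..k}" for n i
    unfolding D_def using that ts_less[of "i - 1" n] ts_nn[of "i - 1" n] by (intro BM_increment_law) auto
  have incr: "0 \<le> \<tau> i - \<tau> (i - 1)" if "i \<in> {1..k}" for i
    using mono[of "i - 1"] that by auto
  have "(\<lambda>n. \<integral>\<omega>. f (psum (real k) (\<lambda>i. D n i \<omega>)) \<partial>N)
      \<longlonglongrightarrow> (\<integral>x. f (psum (real k) x) \<partial>(PiM {1..k} (\<lambda>i. normal_law (\<tau> i - \<tau> (i - 1)))))"
  proof (rule indep_components_tendsto[OF k _ ind _ _ f bnd])
    fix i assume i: "i \<in> {1..k}"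
    show "weak_conv_m (\<lambda>n. distr N borel (D n i)) (normal_law (\<tau> i - \<tau> (i - 1)))"
    proof (rule levy_continuity)
      show "real_distribution (distr N borel (D n i))" for n
        unfolding law[OF i] by (rule real_distribution_normal_law)
      fix \<theta>
      have "char (distr N borel (D n i)) \<theta> = complex_of_real (exp (- (\<theta>\<^sup>2 * (ts n i - ts n (i - 1)) / 2)))" for n
      proof -
        have "i - 1 < k" "Suc (i - 1) = i" using i by auto
        then have "ts n (i - 1) < ts n i" using ts_less[of "i - 1" n] by simp
        then show ?thesis unfolding law[OF i] by (intro char_normal_law) simp
      qed
      moreover have "(\<lambda>n. complex_of_real (exp (- (\<theta>\<^sup>2 * (ts n i - ts n (i - 1)) / 2))))
        \<longlonglongrightarrow> complex_of_real (exp (- (\<theta>\<^sup>2 * (\<tau> i - \<tau> (i - 1)) / 2)))"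
        by (intro tendsto_of_real tendsto_exp tendsto_minus tendsto_divide tendsto_mult tendsto_diff ts_lim tendsto_const) simp
      ultimately show "(\<lambda>n. char (distr N borel (D n i)) \<theta>) \<longlonglongrightarrow> char (normal_law (\<tau> i - \<tau> (i - 1))) \<theta>"
        by (simp only: char_normal_law[OF incr[OF i]])
    qed (rule real_distribution_normal_law)
  qed (auto intro: real_distribution_normal_law BM_prob_space)
  moreover have "(\<lambda>n. \<integral>\<omega>. f (psum (real k) (\<lambda>i. D n i \<omega>)) \<partial>N)
      \<longlonglongrightarrow> (\<integral>\<omega>. f (psum (real k) (\<lambda>i. B (\<tau> i) \<omega> - B (\<tau> (i - 1)) \<omega>)) \<partial>N)"
  proof (rule integral_dominated_convergence[where w = "\<lambda>_. K"])
    show "(\<lambda>\<omega>. f (psum (real k) (\<lambda>i. B (\<tau> i) \<omega> - B (\<tau> (i - 1)) \<omega>))) \<in> borel_measurable N"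
      by (rule measurable_sup_continuous_psum[OF f]) (auto intro!: borel_measurable_diff BM_measurable \<tau>nn)
    show "(\<lambda>\<omega>. f (psum (real k) (\<lambda>i. D n i \<omega>))) \<in> borel_measurable N" for n
      unfolding D_def by (rule measurable_sup_continuous_psum[OF f]) (auto intro!: borel_measurable_diff BM_measurable ts_nn)
    have lim: "(\<lambda>n. B (ts n j) \<omega>) \<longlonglongrightarrow> B (\<tau> j) \<omega>" if "\<omega> \<in> space N" "j \<le> k" for \<omega> j
      by (rule continuous_on_tendsto_compose[OF BM_continuous[OF that(1)] ts_lim])
         (use \<tau>nn[OF that(2)] ts_nn[OF that(2)] in auto)
    show "AE \<omega> in N. (\<lambda>n. f (psum (real k) (\<lambda>i. D n i \<omega>)))
       \<longlonglongrightarrow> f (psum (real k) (\<lambda>i. B (\<tau> i) \<omega> - B (\<tau> (i - 1)) \<omega>))"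
      unfolding D_def by (intro AE_I2 sup_continuous_psum_tendsto[OF f] tendsto_diff lim) auto
    show "AE x in N. norm (f (psum (real k) (\<lambda>i. D n i x))) \<le> K" for n
      by (auto intro!: bnd cadlag01_psum)
  qed simp
  ultimately show ?thesis by (intro LIMSEQ_unique)
qed

end

section \<open>Invariance principle for bounded independent arrays\<close>

text \<open>Off the event \<open>A\<close> the Lipschitz bound applies, on it the functional changes
  by at most \<open>2 * K\<close>. This turns a maximal inequality into a bound between
  expectations.\<close>

lemma (in prob_space) bounded_lipschitz_diff_le:
  assumes f: "bounded_lipschitz_D L K f"
    and X: "\<And>\<omega>. \<omega> \<in> space M \<Longrightarrow> cadlag01 (X \<omega>)" and Y: "\<And>\<omega>. \<omega> \<in> space M \<Longrightarrow> cadlag01 (Y \<omega>)"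
    and mX: "(\<lambda>\<omega>. f (X \<omega>)) \<in> borel_measurable M" and mY: "(\<lambda>\<omega>. f (Y \<omega>)) \<in> borel_measurable M"
    and A: "A \<in> sets M" and e: "0 \<le> e"
    and near: "\<And>\<omega>. \<omega> \<in> space M \<Longrightarrow> \<omega> \<notin> A \<Longrightarrow> sup_near (X \<omega>) (Y \<omega>) e"
  shows "\<bar>expectation (\<lambda>\<omega>. f (X \<omega>)) - expectation (\<lambda>\<omega>. f (Y \<omega>))\<bar> \<le> L * e + 2 * K * prob A"
proof -
  have K: "\<bar>f x\<bar> \<le> K" if "cadlag01 x" for x using f that by (auto simp: bounded_lipschitz_D_def)
  have L: "0 \<le> L" using f by (auto simp: bounded_lipschitz_D_def)
  have K0: "0 \<le> K" using X K not_empty by (meson abs_ge_zero ex_in_conv order_trans)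
  have iX: "integrable M (\<lambda>\<omega>. f (X \<omega>))"
    by (rule integrable_const_bound[where B = K]) (use mX X K in auto)
  have iY: "integrable M (\<lambda>\<omega>. f (Y \<omega>))"
    by (rule integrable_const_bound[where B = K]) (use mY Y K in auto)
  have iA: "integrable M (\<lambda>\<omega>. L * e + 2 * K * indicator A \<omega>)"
    using A by (auto intro!: Bochner_Integration.integrable_add integrable_mult_right integrable_real_indicator simp: emeasure_eq_measure)
  have "\<bar>expectation (\<lambda>\<omega>. f (X \<omega>)) - expectation (\<lambda>\<omega>. f (Y \<omega>))\<bar> = \<bar>expectation (\<lambda>\<omega>. f (X \<omega>) - f (Y \<omega>))\<bar>"
    using iX iY by simp
  also have "\<dots> \<le> expectation (\<lambda>\<omega>. \<bar>f (X \<omega>) - f (Y \<omega>)\<bar>)"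
    by (rule integral_abs_bound)
  also have "\<dots> \<le> expectation (\<lambda>\<omega>. L * e + 2 * K * indicator A \<omega>)"
  proof (rule integral_mono[OF _ iA])
    show "integrable M (\<lambda>\<omega>. \<bar>f (X \<omega>) - f (Y \<omega>)\<bar>)" using iX iY by auto
    fix \<omega> assume \<omega>: "\<omega> \<in> space M"
    show "\<bar>f (X \<omega>) - f (Y \<omega>)\<bar> \<le> L * e + 2 * K * indicator A \<omega>"
    proof (cases "\<omega> \<in> A")
      case True
      have "0 \<le> L * e" using L e by simp
      then show ?thesis using True K[OF X[OF \<omega>]] K[OF Y[OF \<omega>]] by simp
    next
      case False
      then show ?thesis
        using f X[OF \<omega>] Y[OF \<omega>] near[OF \<omega> False] by (simp add: bounded_lipschitz_D_def)
    qed
  qed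
  also have "\<dots> = L * e + 2 * K * prob A"
    using A by (subst Bochner_Integration.integral_add) (auto simp: prob_space emeasure_eq_measure)
  finally show ?thesis .
qed

text \<open>Sampling the path at \<open>k\<close> grid points changes the expectation little,
  uniformly in large \<open>n\<close>, because the fourth-moment inequality bounds the oscillation
  within the cells. For fixed \<open>k\<close> the cell sums are independent and asymptotically
  normal. So \<open>k\<close> is chosen first and \<open>n\<close> tends to infinity
  afterwards.\<close>

lemma donsker_bounded_array:
  fixes M :: "'a measure" and \<xi> :: "nat \<Rightarrow> nat \<Rightarrow> 'a \<Rightarrow> real" and b c :: real
    and N :: "'b measure" and B :: "real \<Rightarrow> 'b \<Rightarrow> real"
  assumes M: "prob_space M" and BM: "std_brownian_motion N B" and b: "b > 0" and c: "c \<ge> 0"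
    and ind: "\<And>n. prob_space.indep_vars M (\<lambda>_. borel) (\<xi> n) {1..nat \<lfloor>real n / b\<rfloor>}"
    and bnd: "\<And>n r \<omega>. r \<in> {1..nat \<lfloor>real n / b\<rfloor>} \<Longrightarrow> \<omega> \<in> space M \<Longrightarrow> \<bar>\<xi> n r \<omega>\<bar> \<le> c"
    and mean: "\<And>n r. r \<in> {1..nat \<lfloor>real n / b\<rfloor>} \<Longrightarrow> (\<integral>\<omega>. \<xi> n r \<omega> \<partial>M) = 0"
    and var: "\<And>v. v \<in> {0..1} \<Longrightarrow>
      (\<lambda>n. (\<Sum>r = 1..nat \<lfloor>real n / b * v\<rfloor>. \<integral>\<omega>. (\<xi> n r \<omega>)\<^sup>2 \<partial>M) / real n) \<longlonglongrightarrow> \<tau> v"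
    and \<tau>0: "\<tau> 0 = 0" and mono: "mono_on {0..1} \<tau>" and cont: "continuous_on {0..1} \<tau>"
    and f: "bounded_lipschitz_D L K f"
  shows "(\<lambda>n. \<integral>\<omega>. f (psum (real n / b) (\<lambda>r. \<xi> n r \<omega> / sqrt (real n))) \<partial>M)
    \<longlonglongrightarrow> (\<integral>\<omega>. f (\<lambda>v. B (\<tau> v) \<omega>) \<partial>N)"
proof -
  interpret prob_space M by fact
  interpret N: prob_space N by (rule BM_prob_space[OF BM])
  have fc: "sup_continuous_D f" by (rule bounded_lipschitz_imp_sup_continuous[OF f])
  have fK: "\<bar>f x\<bar> \<le> K" if "cadlag01 x" for x using f that by (auto simp: bounded_lipschitz_D_def)
  have L: "0 \<le> L" using f by (auto simp: bounded_lipschitz_D_def)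
  have K0: "0 \<le> K" using fK[OF cadlag01_psum[of 0]] by (meson abs_ge_zero order_refl order_trans)
  define W where "W n \<omega> = psum (real n / b) (\<lambda>r. \<xi> n r \<omega> / sqrt (real n))" for n \<omega>
  \<comment> \<open>The number of summands up to the grid time \<open>j / k\<close>; the summands
    with index in \<open>I n k i\<close> make up the increment over cell \<open>i\<close>.\<close>
  define J where "J n k j = nat \<lfloor>real n / b * (real j / real k)\<rfloor>" for n k j :: nat
  define I where "I n k i = {J n k (i - 1)<..J n k i}" for n k i
  define P where "P n k \<omega> = psum (real k) (grid_increments (W n \<omega>) k)" for n k \<omega>
  have W0: "W n \<omega> 0 = 0" for n \<omega> by (simp add: W_def psum_def)
  have cW: "cadlag01 (W n \<omega>)" for n \<omega> unfolding W_def using b by (intro cadlag01_psum) simp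
  have Wgrid: "W n \<omega> (real j / real k) = (\<Sum>r = 1..J n k j. \<xi> n r \<omega> / sqrt (real n))" for n \<omega> j k
    by (simp add: W_def psum_def J_def)
  have J_mono: "J n k i \<le> J n k j" if "i \<le> j" for n k i j
    unfolding J_def using that b by (intro nat_mono floor_mono mult_left_mono divide_right_mono) auto
  have J_top: "J n k k = nat \<lfloor>real n / b\<rfloor>" if "k \<ge> 1" for n k
    using that by (simp add: J_def)
  have J_le: "J n k j \<le> nat \<lfloor>real n / b\<rfloor>" if "k \<ge> 1" "j \<le> k" for n k j
    using J_mono[OF that(2)] J_top[OF that(1)] by metis
  have I_sub: "I n k i \<subseteq> {1..nat \<lfloor>real n / b\<rfloor>}" if "k \<ge> 1" "i \<le> k" for n k i
    using J_le[OF that, of n] by (auto simp: I_def)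
  have m\<xi>: "\<xi> n r \<in> borel_measurable M" if "r \<in> {1..nat \<lfloor>real n / b\<rfloor>}" for n r
    using ind[of n] that by (auto simp: indep_vars_def)
  have incr: "grid_increments (W n \<omega>) k i = (\<Sum>r\<in>I n k i. \<xi> n r \<omega> / sqrt (real n))"
    if "i \<in> {1..k}" for n \<omega> k i
  proof -
    have "(real i - 1) / real k = real (i - 1) / real k" using that by simp
    then have "grid_increments (W n \<omega>) k i
        = (\<Sum>r = 1..J n k i. \<xi> n r \<omega> / sqrt (real n)) - (\<Sum>r = 1..J n k (i - 1). \<xi> n r \<omega> / sqrt (real n))"
      unfolding grid_increments_def by (simp only: Wgrid)
    moreover have "{1..J n k i} = {1..J n k (i - 1)} \<union> I n k i"
      using J_mono[of "i - 1" i n k] by (auto simp: I_def)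
    moreover have "{1..J n k (i - 1)} \<inter> I n k i = {}" by (auto simp: I_def)
    ultimately show ?thesis
      by (simp add: sum.union_disjoint I_def)
  qed
  have m\<xi>n: "(\<lambda>\<omega>. \<xi> n r \<omega> / sqrt (real n)) \<in> borel_measurable M" if "r \<in> {1..nat \<lfloor>real n / b\<rfloor>}" for n r
    using m\<xi>[OF that] by measurable
  have ind': "indep_vars (\<lambda>_. borel) (\<lambda>r \<omega>. \<xi> n r \<omega> / sqrt (real n)) {1..nat \<lfloor>real n / b\<rfloor>}" for n
    by (rule indep_vars_compose2[OF ind]) auto
  have m_incr: "(\<lambda>\<omega>. grid_increments (W n \<omega>) k i) \<in> borel_measurable M" if "i \<in> {1..k}" for n k i
  proof -
    have "k \<ge> 1" "i \<le> k" using that by auto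
    then show ?thesis
      unfolding incr[OF that] by (intro borel_measurable_sum m\<xi>n) (use I_sub in blast)
  qed
  have mW: "(\<lambda>\<omega>. f (W n \<omega>)) \<in> borel_measurable M" for n
    unfolding W_def using b by (intro measurable_sup_continuous_psum[OF fc] m\<xi>n) auto
  have mP: "(\<lambda>\<omega>. f (P n k \<omega>)) \<in> borel_measurable M" for n k
    unfolding P_def by (intro measurable_sup_continuous_psum[OF fc] m_incr) auto

  have fidi: "(\<lambda>n. \<integral>\<omega>. f (P n k \<omega>) \<partial>M) \<longlonglongrightarrow> (\<integral>\<omega>. f (psum (real k) (grid_increments (\<lambda>v. B (\<tau> v) \<omega>) k)) \<partial>N)"
    if k: "k \<ge> 1" for k
  proof -
    define t where "t i = \<tau> (real i / real k)" for i :: nat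
    have t_mono: "t i \<le> t (Suc i)" if "i < k" for i
      unfolding t_def using that by (intro mono_onD[OF mono]) (auto simp: field_simps)
    have "(\<lambda>n. \<integral>\<omega>. f (psum (real k) (\<lambda>i. grid_increments (W n \<omega>) k i)) \<partial>M)
        \<longlonglongrightarrow> (\<integral>x. f (psum (real k) x) \<partial>(PiM {1..k} (\<lambda>i. normal_law (t i - t (i - 1)))))"
    proof (rule indep_components_tendsto[OF k M _ real_distribution_normal_law _ fc fK])
      fix n
      have "indep_vars (\<lambda>j. PiM (I n k j) (\<lambda>_. borel))
         (\<lambda>j \<omega>. restrict (\<lambda>r. \<xi> n r \<omega> / sqrt (real n)) (I n k j)) {1..k}"
      proof (rule indep_vars_restrict[OF ind'])
        show "I n k j \<subseteq> {1..nat \<lfloor>real n / b\<rfloor>}" if "j \<in> {1..k}" for j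
          using I_sub[OF k] that by auto
        have "I n k i \<inter> I n k j = {}" if "i < j" for i j
        proof -
          have "J n k i \<le> J n k (j - 1)" using that by (intro J_mono) simp
          then show ?thesis by (auto simp: I_def)
        qed
        then show "disjoint_family_on (I n k) {1..k}"
          unfolding disjoint_family_on_def by (metis inf_commute linorder_neqE_nat)
      qed
      then have "indep_vars (\<lambda>_. borel)
         (\<lambda>j \<omega>. \<Sum>r\<in>I n k j. (restrict (\<lambda>r. \<xi> n r \<omega> / sqrt (real n)) (I n k j)) r) {1..k}"
        by (rule indep_vars_compose2[where Y = "\<lambda>j x. \<Sum>r\<in>I n k j. x r"]) auto
      then show "indep_vars (\<lambda>_. borel) (\<lambda>i \<omega>. grid_increments (W n \<omega>) k i) {1..k}"
        by (rule indep_vars_cong[THEN iffD1, rotated 3]) (auto simp: incr intro!: ext sum.cong)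
    next
      fix i assume i: "i \<in> {1..k}"
      have t_inc: "0 \<le> t i - t (i - 1)" using t_mono[of "i - 1"] i by auto
      show "weak_conv_m (\<lambda>n. distr M borel (\<lambda>\<omega>. grid_increments (W n \<omega>) k i)) (normal_law (t i - t (i - 1)))"
      proof (rule levy_continuity)
        fix \<theta> :: real
        define V where "V n = (\<Sum>r\<in>I n k i. expectation (\<lambda>\<omega>. (\<xi> n r \<omega> / sqrt (real n))\<^sup>2))" for n
        have V_eq: "V n = (\<Sum>r = 1..J n k i. expectation (\<lambda>\<omega>. (\<xi> n r \<omega>)\<^sup>2)) / real n
            - (\<Sum>r = 1..J n k (i - 1). expectation (\<lambda>\<omega>. (\<xi> n r \<omega>)\<^sup>2)) / real n" for n
        proof -
          have "{1..J n k i} = {1..J n k (i - 1)} \<union> I n k i"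
            using J_mono[of "i - 1" i n k] by (auto simp: I_def)
          moreover have "{1..J n k (i - 1)} \<inter> I n k i = {}" by (auto simp: I_def)
          moreover have "V n = (\<Sum>r\<in>I n k i. expectation (\<lambda>\<omega>. (\<xi> n r \<omega>)\<^sup>2)) / real n"
            by (simp add: V_def power_divide sum_divide_distrib)
          ultimately show ?thesis
            by (simp add: sum.union_disjoint I_def add_divide_distrib)
        qed
        have "V \<longlonglongrightarrow> t i - t (i - 1)"
          unfolding V_eq t_def J_def using i
          by (intro tendsto_diff var) (auto simp: field_simps)
        then have lim1: "(\<lambda>n. complex_of_real (exp (- (\<theta>\<^sup>2 * V n / 2)))) \<longlonglongrightarrow> complex_of_real (exp (- (\<theta>\<^sup>2 * (t i - t (i - 1)) / 2)))"
          by (intro tendsto_of_real tendsto_exp tendsto_minus tendsto_divide tendsto_mult tendsto_const) auto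
        \<comment> \<open>At most \<open>n / b\<close> summands, each of size at most
          \<open>c / sqrt n\<close>: the cubic error is of order \<open>1 / sqrt n\<close> and the
          quartic one of order \<open>1 / n\<close>.\<close>
        define E where "E n = (1 / b) * (\<bar>\<theta>\<bar> ^ 3 * c ^ 3 / 6 / sqrt (real n) + \<theta> ^ 4 * c ^ 4 / 8 / real n)" for n
        have E0: "E \<longlonglongrightarrow> 0"
        proof -
          have "(\<lambda>n. \<bar>\<theta>\<bar> ^ 3 * c ^ 3 / 6 / sqrt (real n)) \<longlonglongrightarrow> 0"
            by (rule tendsto_divide_0[OF tendsto_const])
               (auto intro!: filterlim_at_top_imp_at_infinity filterlim_compose[OF sqrt_at_top] filterlim_real_sequentially)
          moreover have "(\<lambda>n. \<theta> ^ 4 * c ^ 4 / 8 / real n) \<longlonglongrightarrow> 0"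
            by (rule tendsto_divide_0[OF tendsto_const])
               (auto intro!: filterlim_at_top_imp_at_infinity filterlim_real_sequentially)
          ultimately show ?thesis
            unfolding E_def using tendsto_mult_left[OF tendsto_add, of _ 0 _ _ 0 "1 / b"] by simp
        qed
        have "cmod (char (distr M borel (\<lambda>\<omega>. grid_increments (W n \<omega>) k i)) \<theta> - complex_of_real (exp (- (\<theta>\<^sup>2 * V n / 2)))) \<le> E n"
          if n: "n \<ge> 1" for n
        proof -
          have sub: "I n k i \<subseteq> {1..nat \<lfloor>real n / b\<rfloor>}" using I_sub[OF k] i by auto
          have sn: "sqrt (real n) > 0" using n by simp
          have "cmod (char (distr M borel (\<lambda>\<omega>. \<Sum>r\<in>I n k i. \<xi> n r \<omega> / sqrt (real n))) \<theta>
              - complex_of_real (exp (- (\<theta>\<^sup>2 * V n / 2))))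
             \<le> real (card (I n k i)) * (\<bar>\<theta>\<bar> ^ 3 * (c / sqrt (real n)) ^ 3 / 6 + \<theta> ^ 4 * (c / sqrt (real n)) ^ 4 / 8)"
            unfolding V_def
          proof (rule char_bounded_indep_sum)
            show "indep_vars (\<lambda>_. borel) (\<lambda>r \<omega>. \<xi> n r \<omega> / sqrt (real n)) (I n k i)"
              by (rule indep_vars_subset[OF ind' sub])
            show "\<bar>\<xi> n r \<omega> / sqrt (real n)\<bar> \<le> c / sqrt (real n)" if "r \<in> I n k i" "\<omega> \<in> space M" for r \<omega>
              using bnd[of r n \<omega>] sub that sn by (auto simp: abs_divide intro!: divide_right_mono)
            show "expectation (\<lambda>\<omega>. \<xi> n r \<omega> / sqrt (real n)) = 0" if "r \<in> I n k i" for r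
              using mean[of r n] sub that by auto
          qed (simp add: I_def)
          also have "\<dots> \<le> (real n / b) * (\<bar>\<theta>\<bar> ^ 3 * (c / sqrt (real n)) ^ 3 / 6 + \<theta> ^ 4 * (c / sqrt (real n)) ^ 4 / 8)"
          proof (rule mult_right_mono)
            have "card (I n k i) \<le> nat \<lfloor>real n / b\<rfloor>"
              using card_mono[OF _ sub] by simp
            then have "real (card (I n k i)) \<le> real (nat \<lfloor>real n / b\<rfloor>)" by simp
            also have "\<dots> \<le> real n / b" using b by (intro of_nat_floor) simp
            finally show "real (card (I n k i)) \<le> real n / b" .
            show "0 \<le> \<bar>\<theta>\<bar> ^ 3 * (c / sqrt (real n)) ^ 3 / 6 + \<theta> ^ 4 * (c / sqrt (real n)) ^ 4 / 8"
              using c sn by simp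
          qed
          also have "\<dots> = E n"
          proof -
            have "sqrt (real n) ^ 3 = real n * sqrt (real n)" "sqrt (real n) ^ 4 = (real n)\<^sup>2"
              by (simp_all add: eval_nat_numeral)
            then show ?thesis
              using n b by (simp add: E_def power_divide field_simps power2_eq_square)
          qed
          finally show ?thesis by (simp only: incr[OF i])
        qed
        then have "(\<lambda>n. char (distr M borel (\<lambda>\<omega>. grid_increments (W n \<omega>) k i)) \<theta> - complex_of_real (exp (- (\<theta>\<^sup>2 * V n / 2)))) \<longlonglongrightarrow> 0"
          by (intro Lim_null_comparison[OF _ E0]) (auto simp: eventually_sequentially intro!: exI[of _ 1])
        from tendsto_add[OF this lim1]
        show "(\<lambda>n. char (distr M borel (\<lambda>\<omega>. grid_increments (W n \<omega>) k i)) \<theta>) \<longlonglongrightarrow> char (normal_law (t i - t (i - 1))) \<theta>"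
          by (simp only: char_normal_law[OF t_inc] diff_add_cancel add_0)
      qed (auto intro!: real_distribution_normal_law real_distribution_distr m_incr i)
    qed
    also have "(\<integral>x. f (psum (real k) x) \<partial>(PiM {1..k} (\<lambda>i. normal_law (t i - t (i - 1)))))
        = (\<integral>\<omega>. f (psum (real k) (\<lambda>i. B (t i) \<omega> - B (t (i - 1)) \<omega>)) \<partial>N)"
      by (rule BM_increments_integral[OF BM k _ _ fc fK, symmetric]) (simp add: t_def \<tau>0, rule t_mono)
    also have "\<dots> = (\<integral>\<omega>. f (psum (real k) (grid_increments (\<lambda>v. B (\<tau> v) \<omega>) k)) \<partial>N)"
      by (intro Bochner_Integration.integral_cong refl sup_continuous_psum_cong[OF fc])
         (auto simp: grid_increments_def t_def of_nat_diff)
    finally show ?thesis by (simp add: P_def)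
  qed

  have \<tau>nn: "0 \<le> \<tau> v" if "v \<in> {0..1}" for v
    using mono_onD[OF mono, of 0 v] that \<tau>0 by auto
  have cZ: "continuous_on {0..1} (\<lambda>v. B (\<tau> v) \<omega>)" if "\<omega> \<in> space N" for \<omega>
    by (rule continuous_on_compose2[OF BM_continuous[OF BM that] cont]) (use \<tau>nn in auto)
  have gridZ: "(\<lambda>k. \<integral>\<omega>. f (psum (real (Suc k)) (grid_increments (\<lambda>v. B (\<tau> v) \<omega>) (Suc k))) \<partial>N)
      \<longlonglongrightarrow> (\<integral>\<omega>. f (\<lambda>v. B (\<tau> v) \<omega>) \<partial>N)"
  proof (rule integral_dominated_convergence[where w = "\<lambda>_. K"])
    show "(\<lambda>\<omega>. f (\<lambda>v. B (\<tau> v) \<omega>)) \<in> borel_measurable N"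
      by (rule measurable_sup_continuous_path[OF fc]) (use cZ \<tau>nn \<tau>0 in \<open>auto intro!: BM_measurable[OF BM] simp: BM_0[OF BM]\<close>)
    show "(\<lambda>\<omega>. f (psum (real (Suc k)) (grid_increments (\<lambda>v. B (\<tau> v) \<omega>) (Suc k)))) \<in> borel_measurable N" for k
      unfolding grid_increments_def
      by (intro measurable_sup_continuous_psum[OF fc] borel_measurable_diff BM_measurable[OF BM] \<tau>nn) (auto simp: field_simps)
    show "AE \<omega> in N. (\<lambda>k. f (psum (real (Suc k)) (grid_increments (\<lambda>v. B (\<tau> v) \<omega>) (Suc k)))) \<longlonglongrightarrow> f (\<lambda>v. B (\<tau> v) \<omega>)"
      by (intro AE_I2 sup_continuous_grid_tendsto[OF fc _ cZ]) (auto simp: \<tau>0 BM_0[OF BM])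
    show "AE x in N. norm (f (psum (real (Suc k)) (grid_increments (\<lambda>v. B (\<tau> v) x) (Suc k)))) \<le> K" for k
      by (auto intro!: fK cadlag01_psum)
  qed simp

  \<comment> \<open>The constant is \<open>24 = 2 * 3 * 2^2\<close>, the last factor from cells with
    at most \<open>2 * n / (b * k)\<close> summands; \<open>n \<ge> b * k\<close> absorbs the
    rounding in that number.\<close>
  have tight: "\<bar>(\<integral>\<omega>. f (W n \<omega>) \<partial>M) - (\<integral>\<omega>. f (P n k \<omega>) \<partial>M)\<bar>
      \<le> L * (2 * e) + 2 * K * (24 * c ^ 4 / (b\<^sup>2 * e ^ 4 * real k))"
    if k: "k \<ge> 1" and n: "real n \<ge> b * real k" and e: "e > 0" for n k e
  proof -
    have n0: "real n > 0" using n b k by (smt (verit) mult_pos_pos of_nat_1 of_nat_mono)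
    define Ni where "Ni i = J n k i - J n k (i - 1)" for i
    define X where "X i t \<omega> = \<xi> n (J n k (i - 1) + t) \<omega> / sqrt (real n)" for i t \<omega>
    define A where "A i = {\<omega>\<in>space M. \<exists>j\<le>Ni i. 2 * e < \<bar>\<Sum>t = 1..j. X i t \<omega>\<bar>}" for i
    have range: "J n k (i - 1) + t \<in> {1..nat \<lfloor>real n / b\<rfloor>}" if "i \<in> {1..k}" "t \<in> {1..Ni i}" for i t
      using that J_le[OF k, of i n] J_mono[of "i - 1" i n k] by (auto simp: Ni_def)
    have Ni_le: "real (Ni i) \<le> 2 * (real n / (b * real k))" if "i \<in> {1..k}" for i
    proof -
      have "real (J n k i) \<le> real n / b * (real i / real k)"
        unfolding J_def using b by (intro of_nat_floor) auto
      moreover have "real n / b * (real (i - 1) / real k) < real (J n k (i - 1)) + 1"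
        unfolding J_def by linarith
      moreover have "real n / b * (real i / real k) - real n / b * (real (i - 1) / real k) = real n / (b * real k)"
      proof -
        have "real (i - 1) = real i - 1" using that by simp
        then show ?thesis using b k by (simp add: field_simps)
      qed
      moreover have "1 \<le> real n / (b * real k)" using n b k by (simp add: field_simps)
      moreover have "real (Ni i) = real (J n k i) - real (J n k (i - 1))"
        unfolding Ni_def using J_mono[of "i - 1" i n k] by simp
      ultimately show ?thesis by linarith
    qed
    have indX: "indep_vars (\<lambda>_. borel) (X i) {1..Ni i}" if "i \<in> {1..k}" for i
    proof -
      have "indep_vars (\<lambda>t. PiM {J n k (i - 1) + t} (\<lambda>_. borel))
         (\<lambda>t \<omega>. restrict (\<lambda>r. \<xi> n r \<omega> / sqrt (real n)) {J n k (i - 1) + t}) {1..Ni i}"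
        by (rule indep_vars_restrict[OF ind']) (use range[OF that] in \<open>auto simp: disjoint_family_on_def\<close>)
      then have "indep_vars (\<lambda>_. borel)
         (\<lambda>t \<omega>. (restrict (\<lambda>r. \<xi> n r \<omega> / sqrt (real n)) {J n k (i - 1) + t}) (J n k (i - 1) + t)) {1..Ni i}"
        by (rule indep_vars_compose2[where Y = "\<lambda>t x. x (J n k (i - 1) + t)"]) auto
      then show ?thesis
        by (rule indep_vars_cong[THEN iffD1, rotated 3]) (auto simp: X_def)
    qed
    have PAi: "prob (A i) \<le> 24 * c ^ 4 / (b\<^sup>2 * e ^ 4 * (real k)\<^sup>2)" if "i \<in> {1..k}" for i
    proof -
      have "prob (A i) \<le> 2 * (3 * (real (Ni i))\<^sup>2 * (c / sqrt (real n)) ^ 4 / e ^ 4)"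
        unfolding A_def
      proof (rule indep_sum_maximal_fourth[OF indX[OF that] e])
        show "\<bar>X i t \<omega>\<bar> \<le> c / sqrt (real n)" if "t \<in> {1..Ni i}" "\<omega> \<in> space M" for t \<omega>
          unfolding X_def using bnd[OF range] \<open>i \<in> {1..k}\<close> that by (auto simp: abs_divide intro!: divide_right_mono)
        show "expectation (X i t) = 0" if "t \<in> {1..Ni i}" for t
          unfolding X_def using mean[OF range] \<open>i \<in> {1..k}\<close> that by auto
      qed
      also have "\<dots> \<le> 2 * (3 * (2 * (real n / (b * real k)))\<^sup>2 * (c / sqrt (real n)) ^ 4 / e ^ 4)"
        using Ni_le[OF that] e by (intro mult_left_mono divide_right_mono mult_right_mono power_mono) auto
      also have "\<dots> = 24 * c ^ 4 / (b\<^sup>2 * e ^ 4 * (real k)\<^sup>2)"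
      proof -
        have "sqrt (real n) ^ 4 = (real n)\<^sup>2" by (simp add: eval_nat_numeral)
        then show ?thesis using n0 b e k by (simp add: power_divide power_mult_distrib field_simps)
      qed
      finally show ?thesis .
    qed
    have mA: "A i \<in> sets M" if "i \<in> {1..k}" for i
    proof -
      have "(\<lambda>\<omega>. \<Sum>t = 1..j. X i t \<omega>) \<in> borel_measurable M" if "j \<in> {..Ni i}" for j
        unfolding X_def using that range[OF \<open>i \<in> {1..k}\<close>] by (intro borel_measurable_sum m\<xi>n) auto
      note [measurable] = this
      have eq: "A i = {\<omega>\<in>space M. \<exists>j\<in>{..Ni i}. 2 * e < \<bar>\<Sum>t = 1..j. X i t \<omega>\<bar>}"
        by (auto simp: A_def)
      show ?thesis unfolding eq by measurable
    qed
    have near: "sup_near (W n \<omega>) (P n k \<omega>) (2 * e)" if \<omega>: "\<omega> \<in> space M" "\<omega> \<notin> (\<Union>i\<in>{1..k}. A i)" for \<omega>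
      unfolding sup_near_def
    proof
      fix v :: real assume v: "v \<in> {0..1}"
      have Pv: "P n k \<omega> v = W n \<omega> (real (nat \<lfloor>real k * v\<rfloor>) / real k)"
        unfolding P_def by (rule psum_grid_increments[of "W n \<omega>", OF W0])
      show "\<bar>W n \<omega> v - P n k \<omega> v\<bar> \<le> 2 * e"
      proof (cases "v = 1")
        case True
        then show ?thesis using Pv k e by simp
      next
        case False
        \<comment> \<open>The cell containing \<open>v\<close>. At \<open>v = 1\<close> it would be
          \<open>k + 1\<close>, which is why that endpoint is treated apart: there the two paths
          agree.\<close>
        define i where "i = Suc (nat \<lfloor>real k * v\<rfloor>)"
        have kv: "0 \<le> real k * v" "real k * v < real k" using v False k by auto
        have i: "i \<in> {1..k}" using kv by (auto simp: i_def) linarith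
        define m where "m = nat \<lfloor>real n / b * v\<rfloor>"
        have lo: "real (i - 1) \<le> real k * v" "real k * v < real i"
          using kv by (auto simp: i_def) linarith+
        have "J n k (i - 1) \<le> m"
          unfolding J_def m_def using b lo k
          by (intro nat_mono floor_mono mult_left_mono) (auto simp: field_simps)
        moreover have "m \<le> J n k i"
          unfolding J_def m_def using b lo k
          by (intro nat_mono floor_mono mult_left_mono) (auto simp: field_simps)
        ultimately have m: "J n k (i - 1) \<le> m" "m - J n k (i - 1) \<le> Ni i" by (auto simp: Ni_def)
        have "W n \<omega> v - P n k \<omega> v = (\<Sum>r = 1..m. \<xi> n r \<omega> / sqrt (real n)) - (\<Sum>r = 1..J n k (i - 1). \<xi> n r \<omega> / sqrt (real n))"
          unfolding Pv Wgrid[symmetric] by (simp add: W_def psum_def m_def i_def)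
        also have "\<dots> = (\<Sum>r\<in>{J n k (i - 1) + 1..J n k (i - 1) + (m - J n k (i - 1))}. \<xi> n r \<omega> / sqrt (real n))"
        proof -
          have "{1..m} = {1..J n k (i - 1)} \<union> {J n k (i - 1) + 1..m}" using m by auto
          then show ?thesis using m by (simp add: sum.union_disjoint)
        qed
        also have "\<dots> = (\<Sum>t = 1..m - J n k (i - 1). X i t \<omega>)"
          unfolding X_def using sum.shift_bounds_cl_nat_ivl[of "\<lambda>r. \<xi> n r \<omega> / sqrt (real n)" 1 "J n k (i - 1)" "m - J n k (i - 1)"]
          by (simp add: add.commute)
        finally show ?thesis
          using \<omega> i m(2) by (auto simp: A_def not_less)
      qed
    qed
    have "\<bar>(\<integral>\<omega>. f (W n \<omega>) \<partial>M) - (\<integral>\<omega>. f (P n k \<omega>) \<partial>M)\<bar> \<le> L * (2 * e) + 2 * K * prob (\<Union>i\<in>{1..k}. A i)"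
    proof (rule bounded_lipschitz_diff_le[OF f cW _ mW mP])
      show "cadlag01 (P n k \<omega>)" for \<omega> unfolding P_def by (rule cadlag01_psum) simp
    qed (use near mA e in auto)
    moreover have "prob (\<Union>i\<in>{1..k}. A i) \<le> (\<Sum>i\<in>{1..k}. prob (A i))"
      by (rule finite_measure_subadditive_finite) (use mA in auto)
    moreover have "(\<Sum>i\<in>{1..k}. prob (A i)) \<le> real (card {1..k}) * (24 * c ^ 4 / (b\<^sup>2 * e ^ 4 * (real k)\<^sup>2))"
      by (rule sum_bounded_above) (rule PAi)
    moreover have "real (card {1..k}) * (24 * c ^ 4 / (b\<^sup>2 * e ^ 4 * (real k)\<^sup>2)) = 24 * c ^ 4 / (b\<^sup>2 * e ^ 4 * real k)"
      using k by (simp add: power2_eq_square)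
    ultimately have "prob (\<Union>i\<in>{1..k}. A i) \<le> 24 * c ^ 4 / (b\<^sup>2 * e ^ 4 * real k)" by linarith
    then have "2 * K * prob (\<Union>i\<in>{1..k}. A i) \<le> 2 * K * (24 * c ^ 4 / (b\<^sup>2 * e ^ 4 * real k))"
      using K0 by (intro mult_left_mono) auto
    then show ?thesis
      using \<open>\<bar>(\<integral>\<omega>. f (W n \<omega>) \<partial>M) - (\<integral>\<omega>. f (P n k \<omega>) \<partial>M)\<bar> \<le> L * (2 * e) + 2 * K * prob (\<Union>i\<in>{1..k}. A i)\<close>
      by linarith
  qed

  have "(\<lambda>n. \<integral>\<omega>. f (W n \<omega>) \<partial>M) \<longlonglongrightarrow> (\<integral>\<omega>. f (\<lambda>v. B (\<tau> v) \<omega>) \<partial>N)"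
  proof (rule LIMSEQ_I)
    fix r :: real assume r: "r > 0"
    define e where "e = r / (8 * (L + 1))"
    have e: "e > 0" using r L by (simp add: e_def)
    have Le: "L * (2 * e) \<le> r / 4" using r L by (simp add: e_def field_simps)
    have lim0: "(\<lambda>k. 2 * K * (24 * c ^ 4 / (b\<^sup>2 * e ^ 4 * real (Suc k)))) \<longlonglongrightarrow> 0"
    proof -
      have "(\<lambda>k. 2 * K * (24 * c ^ 4 / (b\<^sup>2 * e ^ 4)) * inverse (real (Suc k))) \<longlonglongrightarrow> 0"
        using tendsto_mult_left[OF LIMSEQ_inverse_real_of_nat, of "2 * K * (24 * c ^ 4 / (b\<^sup>2 * e ^ 4))"] by simp
      then show ?thesis by (simp add: field_simps del: of_nat_Suc)
    qed
    have "\<forall>\<^sub>F k in sequentially. 2 * K * (24 * c ^ 4 / (b\<^sup>2 * e ^ 4 * real (Suc k))) < r / 4"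
      by (rule order_tendstoD[OF lim0]) (use r in simp)
    moreover have "\<forall>\<^sub>F k in sequentially. dist (\<integral>\<omega>. f (psum (real (Suc k)) (grid_increments (\<lambda>v. B (\<tau> v) \<omega>) (Suc k))) \<partial>N) (\<integral>\<omega>. f (\<lambda>v. B (\<tau> v) \<omega>) \<partial>N) < r / 4"
      by (rule tendstoD[OF gridZ]) (use r in simp)
    ultimately have "\<forall>\<^sub>F k in sequentially. 2 * K * (24 * c ^ 4 / (b\<^sup>2 * e ^ 4 * real (Suc k))) < r / 4
      \<and> dist (\<integral>\<omega>. f (psum (real (Suc k)) (grid_increments (\<lambda>v. B (\<tau> v) \<omega>) (Suc k))) \<partial>N) (\<integral>\<omega>. f (\<lambda>v. B (\<tau> v) \<omega>) \<partial>N) < r / 4"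
      by (rule eventually_conj)
    then obtain k' where k': "2 * K * (24 * c ^ 4 / (b\<^sup>2 * e ^ 4 * real (Suc k'))) < r / 4"
      "dist (\<integral>\<omega>. f (psum (real (Suc k')) (grid_increments (\<lambda>v. B (\<tau> v) \<omega>) (Suc k'))) \<partial>N) (\<integral>\<omega>. f (\<lambda>v. B (\<tau> v) \<omega>) \<partial>N) < r / 4"
      by (auto simp: eventually_sequentially simp del: of_nat_Suc)
    define k where "k = Suc k'"
    have k: "k \<ge> 1" by (simp add: k_def)
    have "\<forall>\<^sub>F n in sequentially. dist (\<integral>\<omega>. f (P n k \<omega>) \<partial>M) (\<integral>\<omega>. f (psum (real k) (grid_increments (\<lambda>v. B (\<tau> v) \<omega>) k)) \<partial>N) < r / 4"
      by (rule tendstoD[OF fidi[OF k]]) (use r in simp)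
    moreover have "\<forall>\<^sub>F n in sequentially. b * real k \<le> real n"
      by (rule eventually_sequentiallyI[of "nat \<lceil>b * real k\<rceil>"]) linarith
    ultimately have "\<forall>\<^sub>F n in sequentially. norm ((\<integral>\<omega>. f (W n \<omega>) \<partial>M) - (\<integral>\<omega>. f (\<lambda>v. B (\<tau> v) \<omega>) \<partial>N)) < r"
    proof eventually_elim
      case (elim n)
      then show ?case
        using tight[OF k elim(2) e] k' Le unfolding k_def[symmetric] dist_real_def real_norm_def by linarith
    qed
    then show "\<exists>no. \<forall>n\<ge>no. norm ((\<integral>\<omega>. f (W n \<omega>) \<partial>M) - (\<integral>\<omega>. f (\<lambda>v. B (\<tau> v) \<omega>) \<partial>N)) < r"
      by (simp add: eventually_sequentially)
  qed
  then show ?thesis by (simp add: W_def)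
qed

section \<open>Square-integrable functions and head means\<close>

definition square_int :: "'a measure \<Rightarrow> ('a \<Rightarrow> real) \<Rightarrow> bool" where
  "square_int N f \<longleftrightarrow> f \<in> borel_measurable N \<and> integrable N (\<lambda>x. (f x)\<^sup>2)"

definition L2_norm :: "'a measure \<Rightarrow> ('a \<Rightarrow> real) \<Rightarrow> real" where
  "L2_norm N f = sqrt (\<integral>x. (f x)\<^sup>2 \<partial>N)"

lemma square_intD:
  assumes "square_int N f"
  shows "f \<in> borel_measurable N" "integrable N (\<lambda>x. (f x)\<^sup>2)"
  using assms by (auto simp: square_int_def)

lemma L2_norm_nonneg [simp]: "0 \<le> L2_norm N f"
  by (simp add: L2_norm_def)

lemma L2_norm_sq: "(L2_norm N f)\<^sup>2 = (\<integral>x. (f x)\<^sup>2 \<partial>N)"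
  by (simp add: L2_norm_def)

lemma L2_norm_leI: "(\<integral>x. (f x)\<^sup>2 \<partial>N) \<le> c\<^sup>2 \<Longrightarrow> 0 \<le> c \<Longrightarrow> L2_norm N f \<le> c"
  unfolding L2_norm_def by (rule real_le_lsqrt) auto

lemma L2_norm_minus_commute: "L2_norm N (\<lambda>x. f x - g x) = L2_norm N (\<lambda>x. g x - f x)"
  by (simp add: L2_norm_def power2_commute)

lemma square_int_cmult: "square_int N f \<Longrightarrow> square_int N (\<lambda>x. c * f x)"
  by (auto simp: square_int_def power_mult_distrib)

lemma square_int_mult_integrable:
  assumes "square_int N f" "square_int N g"
  shows "integrable N (\<lambda>x. f x * g x)"
proof (rule Bochner_Integration.integrable_bound)
  show "integrable N (\<lambda>x. (f x)\<^sup>2 + (g x)\<^sup>2)" using assms by (auto simp: square_int_def)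
  show "(\<lambda>x. f x * g x) \<in> borel_measurable N" using assms by (auto simp: square_int_def)
  have "\<bar>f x * g x\<bar> \<le> (f x)\<^sup>2 + (g x)\<^sup>2" for x
  proof -
    have "2 * (\<bar>f x\<bar> * \<bar>g x\<bar>) \<le> (f x)\<^sup>2 + (g x)\<^sup>2"
      using zero_le_power2[of "\<bar>f x\<bar> - \<bar>g x\<bar>"] by (simp add: power2_diff)
    moreover have "0 \<le> \<bar>f x\<bar> * \<bar>g x\<bar>" by simp
    ultimately show ?thesis unfolding abs_mult by linarith
  qed
  then show "AE x in N. norm (f x * g x) \<le> norm ((f x)\<^sup>2 + (g x)\<^sup>2)" by simp
qed

lemma square_int_add:
  assumes "square_int N f" "square_int N g"
  shows "square_int N (\<lambda>x. f x + g x)"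
  using assms square_int_mult_integrable[OF assms]
  by (auto simp: square_int_def power2_sum mult.assoc)

lemma square_int_diff:
  assumes "square_int N f" "square_int N g"
  shows "square_int N (\<lambda>x. f x - g x)"
  using square_int_add[OF assms(1) square_int_cmult[OF assms(2), of "- 1"]] by simp

lemma square_int_sum: "(\<And>i. i \<in> I \<Longrightarrow> square_int N (f i)) \<Longrightarrow> square_int N (\<lambda>x. \<Sum>i\<in>I. f i x)"
proof (induction I rule: infinite_finite_induct)
  case (insert i I)
  then show ?case by (simp add: square_int_add)
qed (auto simp: square_int_def)

text \<open>Discriminant argument with a form in two variables, evaluated at \<open>s = ?b\<close>
  and \<open>t = ?a\<close>, which avoids a quotient. When \<open>?a = 0\<close> the form is affine
  in \<open>s\<close>, and a nonzero slope would make it negative somewhere.\<close>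

lemma L2_Cauchy_Schwarz:
  assumes "square_int N f" "square_int N g"
  shows "\<bar>\<integral>x. f x * g x \<partial>N\<bar> \<le> L2_norm N f * L2_norm N g"
proof -
  let ?a = "\<integral>x. (f x)\<^sup>2 \<partial>N" and ?b = "\<integral>x. f x * g x \<partial>N" and ?c = "\<integral>x. (g x)\<^sup>2 \<partial>N"
  have quad: "0 \<le> ?a * s\<^sup>2 - 2 * ?b * s * t + ?c * t\<^sup>2" for s t
  proof -
    have "0 \<le> (\<integral>x. (s * f x - t * g x)\<^sup>2 \<partial>N)" by simp
    also have "\<dots> = (\<integral>x. s\<^sup>2 * (f x)\<^sup>2 - 2 * s * t * (f x * g x) + t\<^sup>2 * (g x)\<^sup>2 \<partial>N)"
      by (intro Bochner_Integration.integral_cong) (auto simp: power2_diff power_mult_distrib)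
    also have "\<dots> = ?a * s\<^sup>2 - 2 * ?b * s * t + ?c * t\<^sup>2"
      using assms square_int_mult_integrable[OF assms] by (simp add: square_int_def)
    finally show ?thesis .
  qed
  have ac: "0 \<le> ?a" "0 \<le> ?c" by simp_all
  have "?b\<^sup>2 \<le> ?a * ?c"
  proof (cases "?a = 0")
    case True
    have "?b = 0"
    proof (rule ccontr)
      assume b: "?b \<noteq> 0"
      have "0 \<le> - 2 * ?b * ((?c + 1) / (2 * ?b)) * 1 + ?c" using quad[of "(?c + 1) / (2 * ?b)" 1] True by simp
      then show False using b by simp
    qed
    then show ?thesis using True by simp
  next
    case False
    then have a: "?a > 0" using ac by linarith
    have "0 \<le> ?a * ?b\<^sup>2 - 2 * ?b * ?b * ?a + ?c * ?a\<^sup>2" by (rule quad)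
    also have "\<dots> = ?a * (?a * ?c - ?b\<^sup>2)" by (simp add: power2_eq_square algebra_simps)
    finally show ?thesis using a by (simp add: zero_le_mult_iff)
  qed
  then have "sqrt (?b\<^sup>2) \<le> sqrt (?a * ?c)" by (rule real_sqrt_le_mono)
  then show ?thesis by (simp only: L2_norm_def real_sqrt_abs real_sqrt_mult)
qed

lemma L2_norm_triangle:
  assumes "square_int N f" "square_int N g"
  shows "L2_norm N (\<lambda>x. f x + g x) \<le> L2_norm N f + L2_norm N g"
proof (rule L2_norm_leI)
  have "(\<integral>x. (f x + g x)\<^sup>2 \<partial>N) = (\<integral>x. (f x)\<^sup>2 + 2 * (f x * g x) + (g x)\<^sup>2 \<partial>N)"
    by (intro Bochner_Integration.integral_cong) (auto simp: power2_sum)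
  also have "\<dots> = (L2_norm N f)\<^sup>2 + 2 * (\<integral>x. f x * g x \<partial>N) + (L2_norm N g)\<^sup>2"
    using assms square_int_mult_integrable[OF assms] by (simp add: square_int_def L2_norm_sq)
  also have "\<dots> \<le> (L2_norm N f + L2_norm N g)\<^sup>2"
    using L2_Cauchy_Schwarz[OF assms] by (simp add: power2_sum)
  finally show "(\<integral>x. (f x + g x)\<^sup>2 \<partial>N) \<le> (L2_norm N f + L2_norm N g)\<^sup>2" .
qed simp

lemma L2_norm_triangle_diff:
  assumes "square_int N f" "square_int N g" "square_int N h"
  shows "L2_norm N (\<lambda>x. f x - h x) \<le> L2_norm N (\<lambda>x. f x - g x) + L2_norm N (\<lambda>x. g x - h x)"
  using L2_norm_triangle[OF square_int_diff[OF assms(1,2)] square_int_diff[OF assms(2,3)]] by simp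

lemma L2_norm_diff_le:
  assumes "square_int N f" "square_int N g"
  shows "L2_norm N (\<lambda>x. f x - g x) \<le> L2_norm N f + L2_norm N g"
  using L2_norm_triangle[OF assms(1) square_int_cmult[OF assms(2), of "- 1"]]
  by (simp add: L2_norm_def)

lemma L2_norm_reverse_triangle:
  assumes "square_int N f" "square_int N g"
  shows "\<bar>L2_norm N f - L2_norm N g\<bar> \<le> L2_norm N (\<lambda>x. f x - g x)"
  using L2_norm_triangle[OF square_int_diff[OF assms] assms(2)]
    L2_norm_triangle[OF square_int_diff[OF assms(2,1)] assms(1)]
  by (simp add: L2_norm_minus_commute[of N g f])

lemma L2_norm_sum:
  "(\<And>i. i \<in> I \<Longrightarrow> square_int N (f i)) \<Longrightarrow> L2_norm N (\<lambda>x. \<Sum>i\<in>I. f i x) \<le> (\<Sum>i\<in>I. L2_norm N (f i))"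
proof (induction I rule: infinite_finite_induct)
  case (insert i I)
  have "L2_norm N (\<lambda>x. \<Sum>i\<in>insert i I. f i x) = L2_norm N (\<lambda>x. f i x + (\<Sum>i\<in>I. f i x))"
    using insert.hyps by simp
  also have "\<dots> \<le> L2_norm N (f i) + L2_norm N (\<lambda>x. \<Sum>i\<in>I. f i x)"
    by (rule L2_norm_triangle) (use insert.prems in \<open>auto intro: square_int_sum\<close>)
  finally show ?case using insert by fastforce
qed (auto simp: L2_norm_def)

text \<open>Difference of two squares and the reverse triangle inequality. On a ball of radius
  \<open>a\<close> second moments are thus Lipschitz in the \<open>L2\<close> distance, so
  approximating kernels approximates variances.\<close>

lemma L2_sq_diff_le:
  assumes "square_int N f" "square_int N g" "L2_norm N f \<le> a" "L2_norm N g \<le> a"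
  shows "\<bar>(\<integral>x. (f x)\<^sup>2 \<partial>N) - (\<integral>x. (g x)\<^sup>2 \<partial>N)\<bar> \<le> 2 * a * L2_norm N (\<lambda>x. f x - g x)"
proof -
  have "\<bar>(L2_norm N f)\<^sup>2 - (L2_norm N g)\<^sup>2\<bar> = (L2_norm N f + L2_norm N g) * \<bar>L2_norm N f - L2_norm N g\<bar>"
    by (simp add: power2_eq_square square_diff_square_factored abs_mult)
  also have "\<dots> \<le> (2 * a) * L2_norm N (\<lambda>x. f x - g x)"
    using assms L2_norm_reverse_triangle[OF assms(1,2)] L2_norm_nonneg[of N f]
    by (intro mult_mono) (auto simp del: L2_norm_nonneg)
  finally show ?thesis by (simp add: L2_norm_sq)
qed

lemma square_int_distr:
  assumes "h \<in> measurable N N'" "f \<in> borel_measurable N'"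
  shows "square_int (distr N N' h) f \<longleftrightarrow> square_int N (\<lambda>x. f (h x))"
  using assms by (auto simp: square_int_def integrable_distr_eq intro: measurable_compose)

lemma L2_norm_distr:
  assumes "h \<in> measurable N N'" "f \<in> borel_measurable N'"
  shows "L2_norm (distr N N' h) f = L2_norm N (\<lambda>x. f (h x))"
  unfolding L2_norm_def using assms by (subst integral_distr) auto

context prob_space
begin

lemma square_int_const: "square_int M (\<lambda>_. c)"
  by (simp add: square_int_def)

lemma square_int_bounded:
  assumes "f \<in> borel_measurable M" "\<And>x. x \<in> space M \<Longrightarrow> \<bar>f x\<bar> \<le> c"
  shows "square_int M f"
proof -
  have "\<bar>f x\<bar>\<^sup>2 \<le> c\<^sup>2" if "x \<in> space M" for x
    using assms(2)[OF that] by (intro power_mono) auto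
  then show ?thesis
    using assms(1) unfolding square_int_def
    by (auto intro!: integrable_const_bound[where B = "c\<^sup>2"])
qed

lemma square_int_integrable: "square_int M f \<Longrightarrow> integrable M f"
  unfolding square_int_def by (blast intro: square_integrable_imp_integrable)

lemma abs_expectation_le_L2_norm:
  assumes "square_int M f"
  shows "\<bar>expectation f\<bar> \<le> L2_norm M f"
  using L2_Cauchy_Schwarz[OF assms square_int_const[of 1]] by (simp add: L2_norm_def prob_space)

lemma expectation_abs_le_L2_norm:
  assumes "square_int M f"
  shows "expectation (\<lambda>x. \<bar>f x\<bar>) \<le> L2_norm M f"
proof -
  have "square_int M (\<lambda>x. \<bar>f x\<bar>)" using assms by (auto simp: square_int_def)
  from abs_expectation_le_L2_norm[OF this] show ?thesis by (simp add: L2_norm_def)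
qed

lemma expectation_sq_le: "square_int M f \<Longrightarrow> (expectation f)\<^sup>2 \<le> expectation (\<lambda>x. (f x)\<^sup>2)"
  using abs_expectation_le_L2_norm[of f] by (simp add: L2_norm_sq[symmetric] abs_le_square_iff[symmetric])

lemma L2_norm_centered_le:
  assumes "square_int M f"
  shows "L2_norm M (\<lambda>x. f x - expectation f) \<le> L2_norm M f"
proof -
  have "expectation (\<lambda>x. (f x - expectation f)\<^sup>2) \<le> expectation (\<lambda>x. (f x)\<^sup>2)"
    using variance_eq[OF square_int_integrable[OF assms] square_intD(2)[OF assms]] by simp
  then show ?thesis by (simp add: L2_norm_def)
qed

lemma square_int_centered: "square_int M f \<Longrightarrow> square_int M (\<lambda>x. f x - expectation f)"
  by (intro square_int_diff square_int_const)

text \<open>Lets an integral over one sequence be read as an integral over a pair with an idle first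
  entry.\<close>

lemma distr_pair_snd:
  assumes N: "sigma_finite_measure N"
  shows "distr (M \<Otimes>\<^sub>M N) N snd = N"
proof (rule measure_eqI)
  interpret N: sigma_finite_measure N by fact
  fix A assume A: "A \<in> sets (distr (M \<Otimes>\<^sub>M N) N snd)"
  then have "emeasure (distr (M \<Otimes>\<^sub>M N) N snd) A = emeasure (M \<Otimes>\<^sub>M N) (space M \<times> A)"
    by (auto simp: emeasure_distr space_pair_measure dest: sets.sets_into_space intro!: arg_cong2[where f = emeasure])
  also have "\<dots> = emeasure N A"
    using A by (subst N.emeasure_pair_measure_Times) (auto simp: emeasure_space_1)
  finally show "emeasure (distr (M \<Otimes>\<^sub>M N) N snd) A = emeasure N A" .
qed simp

end

lemma (in prob_space) indep_vars_reindex_inj: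
  fixes X :: "'i \<Rightarrow> 'a \<Rightarrow> real" and h :: "'k \<Rightarrow> 'i"
  assumes ind: "indep_vars (\<lambda>_. borel) X UNIV" and h: "inj h"
  shows "indep_vars (\<lambda>_. borel) (\<lambda>k. X (h k)) UNIV"
proof -
  have "indep_vars (\<lambda>k. PiM {h k} (\<lambda>_. borel)) (\<lambda>k \<omega>. restrict (\<lambda>i. X i \<omega>) {h k}) UNIV"
    by (rule indep_vars_restrict[OF ind]) (use h in \<open>auto simp: disjoint_family_on_def inj_def\<close>)
  then have "indep_vars (\<lambda>_. borel) (\<lambda>k \<omega>. (restrict (\<lambda>i. X i \<omega>) {h k}) (h k)) UNIV"
    by (rule indep_vars_compose2[where Y = "\<lambda>k x. x (h k)"]) auto
  then show ?thesis by simp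
qed

text \<open>An injective selection from an i.i.d. family is again i.i.d. Stationarity, the law of
  the past at any time and the law of a coupled past are all obtained by choosing
  \<open>h\<close>.\<close>

lemma (in prob_space) distr_reindexed_iid:
  fixes X :: "'i \<Rightarrow> 'a \<Rightarrow> real" and h :: "'k \<Rightarrow> 'i"
  assumes ind: "indep_vars (\<lambda>_. borel) X UNIV" and law: "\<And>i. distr M borel (X i) = \<mu>" and h: "inj h"
  shows "distr M (PiM UNIV (\<lambda>_. borel)) (\<lambda>\<omega> k. X (h k) \<omega>) = PiM UNIV (\<lambda>_. \<mu>)"
proof -
  have X: "X i \<in> borel_measurable M" for i using ind by (auto simp: indep_vars_def)
  show ?thesis
    using indep_vars_reindex_inj[OF ind h]
    by (subst (asm) indep_vars_iff_distr_eq_PiM) (auto simp: X law restrict_def)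
qed

text \<open>\<open>S\<close> is the infinite product of \<open>\<mu>\<close>, the law of the past at
  every time; kernels are analysed under \<open>S\<close>. Splicing sequences by
  \<open>comb_seq\<close> and peeling off the first entry both preserve this law.\<close>

locale iid_law = sequence_space \<mu> for \<mu> :: "real measure" +
  assumes sets_mu [measurable_cong]: "sets \<mu> = sets borel"
begin

lemma space_mu [simp]: "space \<mu> = UNIV"
  using sets_eq_imp_space_eq[OF sets_mu] by simp

lemma sets_S: "sets S = sets Rinf"
  by (rule sets_PiM_cong) (auto simp: sets_mu)

lemma measurable_S_iff: "f \<in> borel_measurable S \<longleftrightarrow> f \<in> borel_measurable Rinf"
  by (rule arg_cong[where f = "\<lambda>A. f \<in> A"], rule measurable_cong_sets) (auto simp: sets_S)

lemma space_S [simp]: "space S = UNIV"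
  by (auto simp: space_PiM)

text \<open>A conditional expectation given by an actual integral: keep the entries of
  \<open>x\<close> below \<open>j\<close> and integrate over an independent tail. It is thus defined
  at every point, depends on exactly these entries without exceptional null sets, and can be
  measured jointly with a parameter.\<close>

definition head_mean :: "nat \<Rightarrow> ((nat \<Rightarrow> real) \<Rightarrow> real) \<Rightarrow> (nat \<Rightarrow> real) \<Rightarrow> real" where
  "head_mean j g x = (\<integral>z. g (comb_seq j x z) \<partial>S)"

lemma measurable_head_mean_param:
  assumes [measurable]: "(\<lambda>(u, x). G u x) \<in> borel_measurable (A \<Otimes>\<^sub>M S)"
  shows "(\<lambda>(u, x). head_mean j (G u) x) \<in> borel_measurable (A \<Otimes>\<^sub>M S)"
proof -
  have "(\<lambda>p. (fst (fst p), comb_seq j (snd (fst p)) (snd p))) \<in> measurable ((A \<Otimes>\<^sub>M S) \<Otimes>\<^sub>M S) (A \<Otimes>\<^sub>M S)"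
    by measurable
  from measurable_compose[OF this assms]
  have "(\<lambda>(p, z). G (fst p) (comb_seq j (snd p) z)) \<in> borel_measurable ((A \<Otimes>\<^sub>M S) \<Otimes>\<^sub>M S)"
    by (simp add: split_beta')
  from P.borel_measurable_lebesgue_integral[OF this]
  show ?thesis by (simp add: head_mean_def split_beta')
qed

lemma measurable_head_mean:
  assumes [measurable]: "g \<in> borel_measurable S"
  shows "head_mean j g \<in> borel_measurable S"
proof -
  have "(\<lambda>(x, z). g (comb_seq j x z)) \<in> borel_measurable (S \<Otimes>\<^sub>M S)" by measurable
  from P.borel_measurable_lebesgue_integral[OF this]
  show ?thesis unfolding head_mean_def[abs_def] .
qed

lemma head_mean_cong: "(\<And>k. k < j \<Longrightarrow> x k = y k) \<Longrightarrow> head_mean j g x = head_mean j g y"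
  unfolding head_mean_def by (intro Bochner_Integration.integral_cong arg_cong[where f = g]) (auto simp: comb_seq_def)

lemma head_mean_bounded:
  assumes "g \<in> borel_measurable S" "\<And>x. \<bar>g x\<bar> \<le> c"
  shows "\<bar>head_mean j g x\<bar> \<le> c"
proof -
  have "\<bar>head_mean j g x\<bar> \<le> (\<integral>z. \<bar>g (comb_seq j x z)\<bar> \<partial>S)"
    unfolding head_mean_def by (rule integral_abs_bound)
  also have "\<dots> \<le> c"
  proof (rule P.integral_le_const)
    have [measurable]: "(\<lambda>z. g (comb_seq j x z)) \<in> borel_measurable S"
      using assms(1) by measurable
    show "integrable S (\<lambda>z. \<bar>g (comb_seq j x z)\<bar>)"
      by (rule P.integrable_const_bound[where B = c]) (use assms in auto)
  qed (use assms in auto)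
  finally show ?thesis .
qed

text \<open>The head of one sequence followed by an independent tail again has law \<open>S\<close>,
  so Fubini on pairs of sequences takes the place of conditioning.\<close>

lemma integrable_comb_seq:
  fixes g :: "(nat \<Rightarrow> real) \<Rightarrow> real"
  assumes "integrable S g"
  shows "integrable (S \<Otimes>\<^sub>M S) (\<lambda>(x, z). g (comb_seq j x z))"
    "(\<integral>p. (case p of (x, z) \<Rightarrow> g (comb_seq j x z)) \<partial>(S \<Otimes>\<^sub>M S)) = (\<integral>x. g x \<partial>S)"
proof -
  have g: "g \<in> borel_measurable S" using assms by auto
  have m: "(\<lambda>(x, z). comb_seq j x z) \<in> measurable (S \<Otimes>\<^sub>M S) S" by (rule measurable_comb_seq)
  show "integrable (S \<Otimes>\<^sub>M S) (\<lambda>(x, z). g (comb_seq j x z))"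
    using integrable_distr_eq[OF m g, unfolded PiM_comb_seq] assms by (simp add: split_beta')
  show "(\<integral>p. (case p of (x, z) \<Rightarrow> g (comb_seq j x z)) \<partial>(S \<Otimes>\<^sub>M S)) = (\<integral>x. g x \<partial>S)"
    using integral_distr[OF m g, unfolded PiM_comb_seq] by (simp add: split_beta')
qed

sublocale SS: pair_prob_space S S ..

lemma head_mean_integral:
  assumes "integrable S g"
  shows "(\<integral>x. head_mean j g x \<partial>S) = (\<integral>x. g x \<partial>S)"
  unfolding head_mean_def using SS.integral_fst[OF integrable_comb_seq(1)[OF assms]] integrable_comb_seq(2)[OF assms]
  by simp

lemma AE_square_int_comb_seq:
  assumes g: "square_int S g"
  shows "AE x in S. square_int S (\<lambda>z. g (comb_seq j x z))"
proof -
  have m [measurable]: "g \<in> borel_measurable S" using g by (auto simp: square_int_def)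
  have "AE x in S. integrable S (\<lambda>z. (g (comb_seq j x z))\<^sup>2)"
    using SS.AE_integrable_fst[OF integrable_comb_seq(1)[OF square_intD(2)[OF g]]] by simp
  moreover have "(\<lambda>z. g (comb_seq j x z)) \<in> borel_measurable S" for x by measurable
  ultimately show ?thesis by (simp add: square_int_def)
qed

text \<open>Jensen's inequality for the inner integral, then Fubini: averaging out the tail
  contracts the \<open>L2\<close> norm.\<close>

lemma head_mean_square:
  assumes g: "square_int S g"
  shows "square_int S (head_mean j g)" "(\<integral>x. (head_mean j g x)\<^sup>2 \<partial>S) \<le> (\<integral>x. (g x)\<^sup>2 \<partial>S)"
proof -
  have m: "head_mean j g \<in> borel_measurable S"
    by (rule measurable_head_mean) (use g in \<open>auto simp: square_int_def\<close>)
  let ?I = "\<lambda>x. \<integral>z. (g (comb_seq j x z))\<^sup>2 \<partial>S"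
  have I: "integrable S ?I"
    using SS.integrable_fst[OF integrable_comb_seq(1)[OF square_intD(2)[OF g]]] by simp
  have le: "AE x in S. (head_mean j g x)\<^sup>2 \<le> ?I x"
    using AE_square_int_comb_seq[OF g, of j]
    by eventually_elim (unfold head_mean_def, rule P.expectation_sq_le)
  have int: "integrable S (\<lambda>x. (head_mean j g x)\<^sup>2)"
  proof (rule Bochner_Integration.integrable_bound[OF I])
    show "AE x in S. norm ((head_mean j g x)\<^sup>2) \<le> norm (?I x)"
      using le by eventually_elim simp
  qed (use m in simp)
  then show "square_int S (head_mean j g)" using m by (simp add: square_int_def)
  have "(\<integral>x. (head_mean j g x)\<^sup>2 \<partial>S) \<le> (\<integral>x. ?I x \<partial>S)"
    by (rule integral_mono_AE[OF int I le])
  also have "\<dots> = (\<integral>x. (g x)\<^sup>2 \<partial>S)"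
    using SS.integral_fst[OF integrable_comb_seq(1)[OF square_intD(2)[OF g]]]
      integrable_comb_seq(2)[OF square_intD(2)[OF g]] by simp
  finally show "(\<integral>x. (head_mean j g x)\<^sup>2 \<partial>S) \<le> (\<integral>x. (g x)\<^sup>2 \<partial>S)" .
qed

text \<open>Fubini gives integrable sections only for almost every head, so linearity of
  \<open>head_mean\<close> holds almost everywhere.\<close>

lemma head_mean_diff_AE:
  assumes g: "square_int S g" and h: "square_int S h"
  shows "AE x in S. head_mean j (\<lambda>y. g y - h y) x = head_mean j g x - head_mean j h x"
  using AE_square_int_comb_seq[OF g, of j] AE_square_int_comb_seq[OF h, of j]
proof eventually_elim
  case (elim x)
  then show ?case
    unfolding head_mean_def by (intro Bochner_Integration.integral_diff P.square_int_integrable)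
qed

lemma head_mean_diff_le:
  assumes g: "square_int S g" and h: "square_int S h"
  shows "L2_norm S (\<lambda>x. head_mean j g x - head_mean j h x) \<le> L2_norm S (\<lambda>x. g x - h x)"
proof -
  have d: "square_int S (\<lambda>y. g y - h y)" by (rule square_int_diff[OF g h])
  have "(\<integral>x. (head_mean j g x - head_mean j h x)\<^sup>2 \<partial>S) = (\<integral>x. (head_mean j (\<lambda>y. g y - h y) x)\<^sup>2 \<partial>S)"
    by (rule integral_cong_AE)
       (use head_mean_diff_AE[OF g h, of j] square_intD(1)[OF head_mean_square(1)[OF g]]
          square_intD(1)[OF head_mean_square(1)[OF h]] square_intD(1)[OF head_mean_square(1)[OF d]] in auto)
  also have "\<dots> \<le> (\<integral>x. (g x - h x)\<^sup>2 \<partial>S)" by (rule head_mean_square(2)[OF d])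
  finally show ?thesis by (simp add: L2_norm_def)
qed

end

section \<open>Coupling bounds for head means\<close>

context iid_law
begin

text \<open>Entry \<open>j\<close> of the spliced sequence is the first entry of the tail. Splitting
  it off writes the head means of orders \<open>j\<close> and \<open>Suc j\<close> as integrals over
  the same pair.\<close>

lemma comb_seq_case_nat_upd: "comb_seq j x (case_nat y z) = (comb_seq (Suc j) x z)(j := y)"
proof
  fix k
  show "comb_seq j x (case_nat y z) k = ((comb_seq (Suc j) x z)(j := y)) k"
    by (cases "k < j"; cases "k = j") (auto simp: comb_seq_def not_less split: nat.split intro!: arg_cong[where f = z])
qed

text \<open>Put \<open>w = comb_seq (Suc j) x z\<close>. The difference of the two head means at
  \<open>x\<close> is the mean over an independent innovation \<open>y\<close> and tail
  \<open>z\<close> of \<open>g w - g (w(j := y))\<close>. When \<open>x\<close> is averaged too,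
  \<open>w\<close> has law \<open>S\<close> and is independent of \<open>y\<close>, so Jensen and
  Fubini bound the \<open>L2\<close> norm by the coupling distance.\<close>

lemma head_mean_coupling:
  assumes g: "square_int S g" and c: "0 \<le> c"
    and int: "integrable (S \<Otimes>\<^sub>M \<mu>) (\<lambda>(x, y). (g x - g (x(j := y)))\<^sup>2)"
    and le: "(\<integral>p. (case p of (x, y) \<Rightarrow> (g x - g (x(j := y)))\<^sup>2) \<partial>(S \<Otimes>\<^sub>M \<mu>)) \<le> c\<^sup>2"
  shows "L2_norm S (\<lambda>x. head_mean (Suc j) g x - head_mean j g x) \<le> c"
proof -
  have mg [measurable]: "g \<in> borel_measurable S" using g by (auto simp: square_int_def)
  interpret MS: pair_prob_space \<mu> S ..
  interpret SM: pair_prob_space S \<mu> ..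
  define H where "H x p = g (comb_seq (Suc j) x (snd p)) - g ((comb_seq (Suc j) x (snd p))(j := fst p))"
    for x :: "nat \<Rightarrow> real" and p :: "real \<times> (nat \<Rightarrow> real)"
  define D where "D x = head_mean (Suc j) g x - head_mean j g x" for x
  define \<phi> where "\<phi> w y = (g w - g (w(j := y)))\<^sup>2" for w y
  have upd: "(\<lambda>p. (fst p)(j := snd p)) \<in> measurable (S \<Otimes>\<^sub>M \<mu>) S"
    by (rule measurable_PiM_single') (auto simp: space_PiM)
  have m\<phi>: "(\<lambda>p. ennreal (\<phi> (fst p) (snd p))) \<in> borel_measurable (S \<Otimes>\<^sub>M \<mu>)"
    unfolding \<phi>_def using measurable_compose[OF upd mg] by measurable
  have D: "AE x in S. ennreal ((D x)\<^sup>2) \<le> (\<integral>\<^sup>+p. ennreal ((H x p)\<^sup>2) \<partial>(\<mu> \<Otimes>\<^sub>M S))"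
    using AE_square_int_comb_seq[OF g, of j] AE_square_int_comb_seq[OF g, of "Suc j"]
  proof eventually_elim
    case (elim x)
    \<comment> \<open>For order \<open>Suc j\<close> the innovation \<open>y\<close> is idle and
      integrates out; for order \<open>j\<close> it is the first entry of the tail.\<close>
    have snd_eq: "distr (\<mu> \<Otimes>\<^sub>M S) S snd = S"
      by (rule M.distr_pair_snd) unfold_locales
    have m1 [measurable]: "(\<lambda>z. g (comb_seq (Suc j) x z)) \<in> borel_measurable S"
      and m2 [measurable]: "(\<lambda>z. g (comb_seq j x z)) \<in> borel_measurable S" by measurable
    have ms: "snd \<in> measurable (\<mu> \<Otimes>\<^sub>M S) S" by measurable
    have mi: "(\<lambda>(s, \<omega>). case_nat s \<omega>) \<in> measurable (\<mu> \<Otimes>\<^sub>M S) S" by measurable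
    have s1: "square_int (\<mu> \<Otimes>\<^sub>M S) (\<lambda>p. g (comb_seq (Suc j) x (snd p)))"
      using square_int_distr[OF ms m1] elim(2) by (simp only: snd_eq)
    have s2: "square_int (\<mu> \<Otimes>\<^sub>M S) (\<lambda>p. g ((comb_seq (Suc j) x (snd p))(j := fst p)))"
      using square_int_distr[OF mi m2] elim(1)
      by (simp only: PiM_iter) (simp add: split_beta' comb_seq_case_nat_upd)
    have sH: "square_int (\<mu> \<Otimes>\<^sub>M S) (H x)"
      unfolding H_def by (rule square_int_diff[OF s1 s2])
    have "head_mean (Suc j) g x = (\<integral>p. g (comb_seq (Suc j) x (snd p)) \<partial>(\<mu> \<Otimes>\<^sub>M S))"
      using integral_distr[OF ms m1] by (simp only: snd_eq head_mean_def)
    moreover have "head_mean j g x = (\<integral>p. g ((comb_seq (Suc j) x (snd p))(j := fst p)) \<partial>(\<mu> \<Otimes>\<^sub>M S))"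
      using integral_distr[OF mi m2]
      by (simp only: PiM_iter head_mean_def) (simp add: split_beta' comb_seq_case_nat_upd)
    ultimately have "D x = (\<integral>p. H x p \<partial>(\<mu> \<Otimes>\<^sub>M S))"
      unfolding D_def H_def using MS.square_int_integrable[OF s1] MS.square_int_integrable[OF s2] by simp
    then have "(D x)\<^sup>2 \<le> (\<integral>p. (H x p)\<^sup>2 \<partial>(\<mu> \<Otimes>\<^sub>M S))"
      using MS.expectation_sq_le[OF sH] by simp
    then show ?case
      using nn_integral_eq_integral[OF square_intD(2)[OF sH]] by (simp add: ennreal_leI)
  qed
  have sqD: "square_int S D"
    unfolding D_def by (intro square_int_diff head_mean_square[OF g])
  have "ennreal (\<integral>x. (D x)\<^sup>2 \<partial>S) = (\<integral>\<^sup>+x. ennreal ((D x)\<^sup>2) \<partial>S)"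
    by (rule nn_integral_eq_integral[symmetric]) (use sqD in \<open>auto simp: square_int_def\<close>)
  also have "\<dots> \<le> (\<integral>\<^sup>+x. (\<integral>\<^sup>+p. ennreal ((H x p)\<^sup>2) \<partial>(\<mu> \<Otimes>\<^sub>M S)) \<partial>S)"
    by (rule nn_integral_mono_AE[OF D])
  also have "\<dots> = (\<integral>\<^sup>+x. (\<integral>\<^sup>+y. (\<integral>\<^sup>+z. ennreal (\<phi> (comb_seq (Suc j) x z) y) \<partial>S) \<partial>\<mu>) \<partial>S)"
  proof (rule nn_integral_cong)
    fix x
    have "(\<lambda>p. (comb_seq (Suc j) x (snd p), fst p)) \<in> measurable (\<mu> \<Otimes>\<^sub>M S) (S \<Otimes>\<^sub>M \<mu>)" by measurable
    from measurable_compose[OF this m\<phi>]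
    have "(\<lambda>p. ennreal (\<phi> (comb_seq (Suc j) x (snd p)) (fst p))) \<in> borel_measurable (\<mu> \<Otimes>\<^sub>M S)" by simp
    from P.nn_integral_fst[OF this]
    show "(\<integral>\<^sup>+p. ennreal ((H x p)\<^sup>2) \<partial>(\<mu> \<Otimes>\<^sub>M S)) = (\<integral>\<^sup>+y. (\<integral>\<^sup>+z. ennreal (\<phi> (comb_seq (Suc j) x z) y) \<partial>S) \<partial>\<mu>)"
      by (simp add: H_def \<phi>_def)
  qed
  also have "\<dots> = (\<integral>\<^sup>+y. (\<integral>\<^sup>+x. (\<integral>\<^sup>+z. ennreal (\<phi> (comb_seq (Suc j) x z) y) \<partial>S) \<partial>S) \<partial>\<mu>)"
  proof -
    have "(\<lambda>p. (comb_seq (Suc j) (fst (fst p)) (snd p), snd (fst p))) \<in> measurable ((S \<Otimes>\<^sub>M \<mu>) \<Otimes>\<^sub>M S) (S \<Otimes>\<^sub>M \<mu>)" by measurable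
    from measurable_compose[OF this m\<phi>]
    have "(\<lambda>(p, z). ennreal (\<phi> (comb_seq (Suc j) (fst p) z) (snd p))) \<in> borel_measurable ((S \<Otimes>\<^sub>M \<mu>) \<Otimes>\<^sub>M S)"
      by (simp add: split_beta')
    from P.borel_measurable_nn_integral[OF this]
    have "(\<lambda>p. \<integral>\<^sup>+z. ennreal (\<phi> (comb_seq (Suc j) (fst p) z) (snd p)) \<partial>S) \<in> borel_measurable (S \<Otimes>\<^sub>M \<mu>)" .
    from SM.Fubini[OF this] show ?thesis by simp
  qed
  also have "\<dots> = (\<integral>\<^sup>+y. (\<integral>\<^sup>+w. ennreal (\<phi> w y) \<partial>S) \<partial>\<mu>)"
  proof (rule nn_integral_cong)
    fix y assume "y \<in> space \<mu>"
    then have m: "(\<lambda>w. ennreal (\<phi> w y)) \<in> borel_measurable S"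
      using measurable_compose[OF measurable_Pair2' m\<phi>, of y] by simp
    have mc: "(\<lambda>(x, z). comb_seq (Suc j) x z) \<in> measurable (S \<Otimes>\<^sub>M S) S" by (rule measurable_comb_seq)
    have "(\<integral>\<^sup>+w. ennreal (\<phi> w y) \<partial>S) = (\<integral>\<^sup>+p. ennreal (\<phi> (case p of (x, z) \<Rightarrow> comb_seq (Suc j) x z) y) \<partial>(S \<Otimes>\<^sub>M S))"
      using nn_integral_distr[OF mc, of "\<lambda>w. ennreal (\<phi> w y)"] m by (simp only: PiM_comb_seq)
    also have "\<dots> = (\<integral>\<^sup>+x. (\<integral>\<^sup>+z. ennreal (\<phi> (comb_seq (Suc j) x z) y) \<partial>S) \<partial>S)"
      using P.nn_integral_fst[OF measurable_compose[OF mc m]] by simp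
    finally show "(\<integral>\<^sup>+x. (\<integral>\<^sup>+z. ennreal (\<phi> (comb_seq (Suc j) x z) y) \<partial>S) \<partial>S) = (\<integral>\<^sup>+w. ennreal (\<phi> w y) \<partial>S)" by simp
  qed
  also have "\<dots> = (\<integral>\<^sup>+w. (\<integral>\<^sup>+y. ennreal (\<phi> w y) \<partial>\<mu>) \<partial>S)"
    using SM.Fubini[OF m\<phi>] by simp
  also have "\<dots> = (\<integral>\<^sup>+p. ennreal (\<phi> (fst p) (snd p)) \<partial>(S \<Otimes>\<^sub>M \<mu>))"
    using M.nn_integral_fst[OF m\<phi>] by simp
  also have "\<dots> = ennreal (\<integral>p. (case p of (x, y) \<Rightarrow> (g x - g (x(j := y)))\<^sup>2) \<partial>(S \<Otimes>\<^sub>M \<mu>))"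
    using nn_integral_eq_integral[OF int] by (simp add: split_beta' \<phi>_def)
  also have "\<dots> \<le> ennreal (c\<^sup>2)" using le by (rule ennreal_leI)
  finally have "(\<integral>x. (D x)\<^sup>2 \<partial>S) \<le> c\<^sup>2" by simp
  then show ?thesis unfolding D_def using c by (rule L2_norm_leI)
qed

text \<open>The indicator of an event determined by the first \<open>j\<close> entries does not
  notice a change of tail. This is the defining property of conditional expectation.\<close>

lemma head_mean_cylinder:
  fixes g :: "(nat \<Rightarrow> real) \<Rightarrow> real"
  assumes g: "integrable S g" and A: "A \<in> sets S"
    and dep: "\<And>x y. (\<And>k. k < j \<Longrightarrow> x k = y k) \<Longrightarrow> x \<in> A \<longleftrightarrow> y \<in> A"
  shows "(\<integral>x. head_mean j g x * indicator A x \<partial>S) = (\<integral>x. g x * indicator A x \<partial>S)"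
proof -
  have "indicator A (comb_seq j x z) = (indicator A x :: real)" for x z
    using dep[of "comb_seq j x z" x] by (auto simp: indicator_def comb_seq_def)
  then have "head_mean j (\<lambda>y. g y * indicator A y) x = head_mean j g x * indicator A x" for x
    by (simp add: head_mean_def)
  moreover have "integrable S (\<lambda>y. g y * indicator A y)"
    using integrable_real_mult_indicator[OF A g] by (simp add: mult.commute)
  ultimately show ?thesis using head_mean_integral[of "\<lambda>y. g y * indicator A y" j] by simp
qed

text \<open>The signed identity is rewritten between nonnegative densities: \<open>f = h\<close>
  exactly when the positive part of \<open>f\<close> plus the negative part of \<open>h\<close>
  equals the same expression with the roles exchanged. The two finite measures agree on
  finite-dimensional boxes, hence everywhere, and densities are unique.\<close>

lemma AE_eq_of_cylinder_integrals:
  fixes f h :: "(nat \<Rightarrow> real) \<Rightarrow> real"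
  assumes f: "integrable S f" and h: "integrable S h"
    and eq: "\<And>A j. A \<in> sets S \<Longrightarrow> (\<And>x y. (\<And>k. k < j \<Longrightarrow> x k = y k) \<Longrightarrow> x \<in> A \<longleftrightarrow> y \<in> A) \<Longrightarrow>
      (\<integral>x. f x * indicator A x \<partial>S) = (\<integral>x. h x * indicator A x \<partial>S)"
  shows "AE x in S. f x = h x"
proof -
  define p where "p f h x = max 0 (f x) + max 0 (- h x)" for f h :: "(nat \<Rightarrow> real) \<Rightarrow> real" and x
  have ip: "integrable S (p f h)" if "integrable S f" "integrable S h" for f h
    unfolding p_def[abs_def] using that by (intro Bochner_Integration.integrable_add integrable_max) auto
  have p0: "0 \<le> p f h x" for f h x by (simp add: p_def)
  have em: "emeasure (density S (\<lambda>x. ennreal (p f h x))) A = ennreal (\<integral>x. p f h x * indicator A x \<partial>S)"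
    if "integrable S f" "integrable S h" "A \<in> sets S" for f h A
  proof -
    have "emeasure (density S (\<lambda>x. ennreal (p f h x))) A = (\<integral>\<^sup>+x. ennreal (p f h x) * indicator A x \<partial>S)"
      using ip[OF that(1,2)] that(3) by (intro emeasure_density) auto
    also have "\<dots> = (\<integral>\<^sup>+x. ennreal (p f h x * indicator A x) \<partial>S)"
      by (intro nn_integral_cong) (auto simp: indicator_def)
    also have "\<dots> = ennreal (\<integral>x. p f h x * indicator A x \<partial>S)"
      using integrable_real_mult_indicator[OF that(3) ip[OF that(1,2)]] p0
      by (intro nn_integral_eq_integral) (auto simp: mult.commute)
    finally show ?thesis .
  qed
  have "density S (\<lambda>x. ennreal (p f h x)) = density S (\<lambda>x. ennreal (p h f x))"
  proof (rule measure_eqI_PiM_infinite[where I = UNIV and M = "\<lambda>_. \<mu>"])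
    show "finite_measure (density S (\<lambda>x. ennreal (p f h x)))"
    proof (rule finite_measureI)
      show "emeasure (density S (\<lambda>x. ennreal (p f h x))) (space (density S (\<lambda>x. ennreal (p f h x)))) \<noteq> \<infinity>"
        by (simp add: em[OF f h sets.top, simplified])
    qed
    fix J and A :: "nat \<Rightarrow> real set" assume J: "finite J" and A: "\<And>i. i \<in> J \<Longrightarrow> A i \<in> sets \<mu>"
    let ?X = "prod_emb UNIV (\<lambda>_. \<mu>) J (Pi\<^sub>E J A)"
    have X: "?X \<in> sets S" using J A by (intro sets_PiM_I) auto
    obtain m where "\<forall>i\<in>J. i < m"
      using J unfolding finite_nat_set_iff_bounded by (rule exE)
    then have m: "\<And>i. i \<in> J \<Longrightarrow> i < m" by simp
    have "(\<integral>x. f x * indicator ?X x \<partial>S) = (\<integral>x. h x * indicator ?X x \<partial>S)"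
    proof (rule eq[OF X, of m])
      fix x y :: "nat \<Rightarrow> real" assume "\<And>k. k < m \<Longrightarrow> x k = y k"
      then have "x i = y i" if "i \<in> J" for i using m[OF that] by simp
      then show "(x \<in> ?X) = (y \<in> ?X)" by (simp add: prod_emb_def PiE_iff)
    qed
    moreover have "(\<integral>x. p f h x * indicator ?X x \<partial>S) - (\<integral>x. p h f x * indicator ?X x \<partial>S)
        = (\<integral>x. f x * indicator ?X x \<partial>S) - (\<integral>x. h x * indicator ?X x \<partial>S)"
    proof -
      note ii = integrable_real_mult_indicator[OF X]
      have "(\<integral>x. p f h x * indicator ?X x \<partial>S) - (\<integral>x. p h f x * indicator ?X x \<partial>S)
        = (\<integral>x. p f h x * indicator ?X x - p h f x * indicator ?X x \<partial>S)"
        using ii[OF ip[OF f h]] ii[OF ip[OF h f]] by (simp add: mult.commute)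
      also have "\<dots> = (\<integral>x. f x * indicator ?X x - h x * indicator ?X x \<partial>S)"
        by (intro Bochner_Integration.integral_cong refl) (auto simp: p_def indicator_def max_def)
      also have "\<dots> = (\<integral>x. f x * indicator ?X x \<partial>S) - (\<integral>x. h x * indicator ?X x \<partial>S)"
        using ii[OF f] ii[OF h] by (simp add: mult.commute)
      finally show ?thesis .
    qed
    ultimately show "emeasure (density S (\<lambda>x. ennreal (p f h x))) ?X = emeasure (density S (\<lambda>x. ennreal (p h f x))) ?X"
      by (simp add: em[OF f h X] em[OF h f X])
  qed auto
  then have "AE x in S. ennreal (p f h x) = ennreal (p h f x)"
    using ip[OF f h] ip[OF h f] by (intro P.density_unique) auto
  then show ?thesis
    by eventually_elim (use p0 in \<open>auto simp: p_def max_def split: if_splits\<close>)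
qed

lemma head_mean_increment_bound:
  assumes g: "square_int S g" and \<rho>: "0 < \<rho>" "\<rho> < 1" and C: "0 \<le> C"
    and inc: "\<And>j. j \<ge> j0 \<Longrightarrow> L2_norm S (\<lambda>x. head_mean (Suc j) g x - head_mean j g x) \<le> C * \<rho> ^ j"
    and j: "j \<ge> j0"
  shows "L2_norm S (\<lambda>x. head_mean (j + n) g x - head_mean j g x) \<le> C * \<rho> ^ j / (1 - \<rho>)"
proof -
  note sq = head_mean_square(1)[OF g]
  have "L2_norm S (\<lambda>x. head_mean (j + n) g x - head_mean j g x) \<le> (\<Sum>l<n. C * \<rho> ^ (j + l))"
  proof (induction n)
    case (Suc n)
    have "L2_norm S (\<lambda>x. head_mean (j + Suc n) g x - head_mean j g x)
      \<le> L2_norm S (\<lambda>x. head_mean (j + Suc n) g x - head_mean (j + n) g x) + L2_norm S (\<lambda>x. head_mean (j + n) g x - head_mean j g x)"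
      by (rule L2_norm_triangle_diff) (rule sq)+
    also have "\<dots> \<le> C * \<rho> ^ (j + n) + (\<Sum>l<n. C * \<rho> ^ (j + l))"
      using inc[of "j + n"] j Suc.IH by simp
    finally show ?case by simp
  qed (simp add: L2_norm_def)
  also have "\<dots> = C * \<rho> ^ j * (\<Sum>l<n. \<rho> ^ l)"
    by (simp add: power_add sum_distrib_left mult.assoc)
  also have "\<dots> \<le> C * \<rho> ^ j * (1 / (1 - \<rho>))"
  proof (rule mult_left_mono)
    have "(\<Sum>l<n. \<rho> ^ l) \<le> (\<Sum>l. \<rho> ^ l)"
      by (rule sum_le_suminf) (use \<rho> in auto)
    also have "\<dots> = 1 / (1 - \<rho>)" using \<rho> by (intro suminf_geometric) simp
    finally show "(\<Sum>l<n. \<rho> ^ l) \<le> 1 / (1 - \<rho>)" .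
  qed (use C \<rho> in simp)
  finally show ?thesis by simp
qed

text \<open>The increments of the head means are summable in \<open>L1\<close>, so the head means
  converge almost everywhere under an integrable bound. Over an event determined by finitely many
  entries their integrals are eventually those of \<open>g\<close>, which identifies the limit as
  \<open>g\<close>. Fatou's lemma then carries the telescoped bound to the limit.\<close>

lemma head_mean_approx:
  assumes g: "square_int S g" and \<rho>: "0 < \<rho>" "\<rho> < 1" and C: "0 \<le> C"
    and inc: "\<And>j. j \<ge> j0 \<Longrightarrow> L2_norm S (\<lambda>x. head_mean (Suc j) g x - head_mean j g x) \<le> C * \<rho> ^ j"
    and j: "j \<ge> j0"
  shows "L2_norm S (\<lambda>x. g x - head_mean j g x) \<le> C * \<rho> ^ j / (1 - \<rho>)"
proof -
  define a where "a i = head_mean (j + i) g" for i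
  define d where "d i x = a (Suc i) x - a i x" for i x
  have sqa: "square_int S (a i)" for i unfolding a_def by (rule head_mean_square(1)[OF g])
  have sqd: "square_int S (d i)" for i unfolding d_def[abs_def] by (rule square_int_diff[OF sqa sqa])
  note [measurable] = square_intD(1)[OF sqa] square_intD(1)[OF sqd] square_intD(1)[OF g]
  have dn: "(\<integral>x. \<bar>d i x\<bar> \<partial>S) \<le> C * \<rho> ^ j * \<rho> ^ i" for i
  proof -
    have "(\<integral>x. \<bar>d i x\<bar> \<partial>S) \<le> L2_norm S (d i)" by (rule P.expectation_abs_le_L2_norm[OF sqd])
    also have "\<dots> \<le> C * \<rho> ^ (j + i)" unfolding d_def a_def using inc[of "j + i"] j by simp
    finally show ?thesis by (simp add: power_add)
  qed
  have geo: "summable (\<lambda>i. C * \<rho> ^ j * \<rho> ^ i)" using \<rho> by (intro summable_mult summable_geometric) simp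
  have sum1: "summable (\<lambda>i. \<integral>x. norm (d i x) \<partial>S)"
    by (rule summable_comparison_test'[OF geo]) (use dn in auto)
  have AEs: "AE x in S. summable (\<lambda>i. norm (d i x))"
  proof -
    have "(\<integral>\<^sup>+x. (\<Sum>i. ennreal \<bar>d i x\<bar>) \<partial>S) = (\<Sum>i. \<integral>\<^sup>+x. ennreal \<bar>d i x\<bar> \<partial>S)"
      by (rule nn_integral_suminf) measurable
    also have "\<dots> = (\<Sum>i. ennreal (\<integral>x. \<bar>d i x\<bar> \<partial>S))"
      by (intro suminf_cong nn_integral_eq_integral integrable_abs P.square_int_integrable sqd) auto
    also have "\<dots> \<noteq> \<infinity>"
      using sum1 by (subst suminf_ennreal2) auto
    finally have "AE x in S. (\<Sum>i. ennreal \<bar>d i x\<bar>) \<noteq> \<infinity>"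
      by (intro nn_integral_PInf_AE) auto
    then show ?thesis
      by eventually_elim (auto intro: summable_suminf_not_top)
  qed
  \<comment> \<open>Dominates every \<open>a n\<close>: the first term plus all absolute
    increments.\<close>
  define w where "w x = \<bar>a 0 x\<bar> + (\<Sum>i. norm (d i x))" for x
  define b where "b x = a 0 x + (\<Sum>i. d i x)" for x
  have iw: "integrable S w"
    unfolding w_def
    by (intro Bochner_Integration.integrable_add integrable_suminf integrable_abs integrable_norm P.square_int_integrable sqa sqd)
       (use AEs sum1 in auto)
  have a_tele: "a n x = a 0 x + (\<Sum>i<n. d i x)" for n x
    by (induction n) (auto simp: d_def)
  have mb [measurable]: "b \<in> borel_measurable S" unfolding b_def by measurable
  have lim: "AE x in S. (\<lambda>n. a n x) \<longlonglongrightarrow> b x"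
    using AEs
  proof eventually_elim
    case (elim x)
    then have "(\<lambda>n. \<Sum>i<n. d i x) \<longlonglongrightarrow> (\<Sum>i. d i x)"
      by (rule summable_LIMSEQ[OF summable_norm_cancel])
    then have "(\<lambda>n. a 0 x + (\<Sum>i<n. d i x)) \<longlonglongrightarrow> b x" unfolding b_def by (intro tendsto_add tendsto_const)
    then show ?case by (simp only: a_tele[symmetric])
  qed
  have bound: "AE x in S. \<bar>a n x\<bar> \<le> w x" for n
    using AEs
  proof eventually_elim
    case (elim x)
    have "\<bar>\<Sum>i<n. d i x\<bar> \<le> (\<Sum>i<n. norm (d i x))" by (metis real_norm_def norm_sum)
    also have "\<dots> \<le> (\<Sum>i. norm (d i x))" using elim by (intro sum_le_suminf) auto
    finally show ?case unfolding w_def using a_tele[of n x] by linarith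
  qed
  have ib: "integrable S b"
    by (rule integrable_dominated_convergence[OF _ _ iw lim]) (use bound in auto)
  have "AE x in S. g x = b x"
  proof (rule AE_eq_of_cylinder_integrals[OF P.square_int_integrable[OF g] ib])
    fix A m assume A: "A \<in> sets S" and dep: "\<And>x y. (\<And>k. k < m \<Longrightarrow> x k = y k) \<Longrightarrow> x \<in> A \<longleftrightarrow> y \<in> A"
    have "(\<lambda>n. \<integral>x. a n x * indicator A x \<partial>S) \<longlonglongrightarrow> (\<integral>x. b x * indicator A x \<partial>S)"
    proof (rule integral_dominated_convergence[OF _ _ iw])
      show "AE x in S. (\<lambda>n. a n x * indicator A x) \<longlonglongrightarrow> b x * indicator A x"
        using lim by eventually_elim (intro tendsto_mult tendsto_const)
      show "AE x in S. norm (a n x * indicator A x) \<le> w x" for n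
        using bound[of n] by eventually_elim (auto simp: indicator_def abs_mult)
    qed (use A in measurable)
    moreover have "\<forall>\<^sub>F n in sequentially. (\<integral>x. a n x * indicator A x \<partial>S) = (\<integral>x. g x * indicator A x \<partial>S)"
    proof (rule eventually_sequentiallyI[of m])
      fix n assume "m \<le> n"
      then show "(\<integral>x. a n x * indicator A x \<partial>S) = (\<integral>x. g x * indicator A x \<partial>S)"
        unfolding a_def
        by (intro head_mean_cylinder P.square_int_integrable g A dep) auto
    qed
    ultimately have "(\<lambda>n. \<integral>x. g x * indicator A x \<partial>S) \<longlonglongrightarrow> (\<integral>x. b x * indicator A x \<partial>S)"
      by (rule Lim_transform_eventually)
    then show "(\<integral>x. g x * indicator A x \<partial>S) = (\<integral>x. b x * indicator A x \<partial>S)"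
      by (simp add: LIMSEQ_const_iff)
  qed
  then have limg: "AE x in S. (\<lambda>n. a n x) \<longlonglongrightarrow> g x" using lim by eventually_elim simp
  define e where "e = C * \<rho> ^ j / (1 - \<rho>)"
  have e: "0 \<le> e" using C \<rho> by (simp add: e_def)
  have inc_e: "(\<integral>x. (a n x - a 0 x)\<^sup>2 \<partial>S) \<le> e\<^sup>2" for n
  proof -
    have "L2_norm S (\<lambda>x. a n x - a 0 x) \<le> e"
      unfolding a_def e_def using head_mean_increment_bound[OF g \<rho> C inc j, of n] by simp
    then have "(L2_norm S (\<lambda>x. a n x - a 0 x))\<^sup>2 \<le> e\<^sup>2" by (intro power_mono) auto
    then show ?thesis by (simp add: L2_norm_sq)
  qed
  have sq0: "square_int S (\<lambda>x. g x - a 0 x)" by (rule square_int_diff[OF g sqa])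
  have "ennreal (\<integral>x. (g x - a 0 x)\<^sup>2 \<partial>S) = (\<integral>\<^sup>+x. ennreal ((g x - a 0 x)\<^sup>2) \<partial>S)"
    by (rule nn_integral_eq_integral[symmetric]) (use square_intD(2)[OF sq0] in auto)
  also have "\<dots> = (\<integral>\<^sup>+x. liminf (\<lambda>n. ennreal ((a n x - a 0 x)\<^sup>2)) \<partial>S)"
  proof (rule nn_integral_cong_AE)
    show "AE x in S. ennreal ((g x - a 0 x)\<^sup>2) = liminf (\<lambda>n. ennreal ((a n x - a 0 x)\<^sup>2))"
      using limg
    proof eventually_elim
      case (elim x)
      then have "(\<lambda>n. ennreal ((a n x - a 0 x)\<^sup>2)) \<longlonglongrightarrow> ennreal ((g x - a 0 x)\<^sup>2)"
        by (intro tendsto_ennrealI tendsto_intros)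
      then show ?case by (intro lim_imp_Liminf[symmetric]) auto
    qed
  qed
  also have "\<dots> \<le> liminf (\<lambda>n. \<integral>\<^sup>+x. ennreal ((a n x - a 0 x)\<^sup>2) \<partial>S)"
    by (rule nn_integral_liminf) measurable
  also have "\<dots> \<le> ennreal (e\<^sup>2)"
  proof (rule Liminf_le)
    have "(\<integral>\<^sup>+x. ennreal ((a n x - a 0 x)\<^sup>2) \<partial>S) = ennreal (\<integral>x. (a n x - a 0 x)\<^sup>2 \<partial>S)" for n
      by (rule nn_integral_eq_integral) (use square_intD(2)[OF square_int_diff[OF sqa sqa]] in auto)
    then show "\<forall>\<^sub>F n in sequentially. (\<integral>\<^sup>+x. ennreal ((a n x - a 0 x)\<^sup>2) \<partial>S) \<le> ennreal (e\<^sup>2)"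
      using inc_e by (simp add: ennreal_leI)
  qed simp
  finally have "(\<integral>x. (g x - a 0 x)\<^sup>2 \<partial>S) \<le> e\<^sup>2" by simp
  then show ?thesis
    using L2_norm_leI[OF _ e] by (simp add: a_def e_def)
qed

end

section \<open>Finitely dependent approximation\<close>

locale iid_process = iid_law \<mu> + base: prob_space \<Omega> for \<mu> :: "real measure" and \<Omega> :: "'a measure" +
  fixes eps :: "int \<Rightarrow> 'a \<Rightarrow> real"
  assumes indep_eps: "base.indep_vars (\<lambda>_. borel) eps UNIV"
    and law_eps: "\<And>i. distr \<Omega> borel (eps i) = \<mu>"
begin

lemma measurable_eps: "eps i \<in> borel_measurable \<Omega>"
  using indep_eps by (auto simp: base.indep_vars_def)

lemma measurable_shift_vec [measurable]: "shift_vec eps t \<in> measurable \<Omega> Rinf"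
  by (rule measurable_PiM_single') (auto simp: shift_vec_def measurable_eps)

lemma distr_shift_vec: "distr \<Omega> Rinf (shift_vec eps t) = S"
proof -
  have "inj (\<lambda>k::nat. t - int k)" by (auto simp: inj_def)
  from base.distr_reindexed_iid[OF indep_eps law_eps this] show ?thesis
    by (simp add: shift_vec_def[abs_def])
qed

lemma measurable_kernel_shift: "f \<in> borel_measurable S \<Longrightarrow> (\<lambda>\<omega>. f (shift_vec eps t \<omega>)) \<in> borel_measurable \<Omega>"
  by (rule measurable_compose[OF measurable_shift_vec]) (simp add: measurable_S_iff)

lemma expectation_shift:
  fixes f :: "(nat \<Rightarrow> real) \<Rightarrow> real"
  assumes "f \<in> borel_measurable S"
  shows "base.expectation (\<lambda>\<omega>. f (shift_vec eps t \<omega>)) = (\<integral>x. f x \<partial>S)"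
  using integral_distr[OF measurable_shift_vec, of f t] assms by (simp add: distr_shift_vec measurable_S_iff)

lemma square_int_shift: "square_int S f \<Longrightarrow> square_int \<Omega> (\<lambda>\<omega>. f (shift_vec eps t \<omega>))"
  using square_int_distr[OF measurable_shift_vec, of f t]
  by (simp add: distr_shift_vec measurable_S_iff square_int_def)

lemma L2_norm_shift: "square_int S f \<Longrightarrow> L2_norm \<Omega> (\<lambda>\<omega>. f (shift_vec eps t \<omega>)) = L2_norm S f"
  using L2_norm_distr[OF measurable_shift_vec, of f t]
  by (simp add: distr_shift_vec measurable_S_iff square_int_def)

lemma m_dependent_max_L2:
  assumes l: "l > 0" and sq: "\<And>t. t \<in> {1..n} \<Longrightarrow> square_int S (f t)"
    and mean: "\<And>t. t \<in> {1..n} \<Longrightarrow> (\<integral>x. f t x \<partial>S) = 0"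
    and dep: "\<And>t. t \<in> {1..n} \<Longrightarrow> depends_on_first m (f t)"
    and V: "(\<Sum>t = 1..n. (L2_norm S (f t))\<^sup>2) \<le> V"
  shows "base.prob {\<omega>\<in>space \<Omega>. \<exists>k\<le>n. l < \<bar>\<Sum>t = 1..k. f t (shift_vec eps (int t) \<omega>)\<bar>}
    \<le> 8 * (real (Suc m))\<^sup>2 * V / l\<^sup>2"
proof -
  have m: "f t \<in> borel_measurable S" if "t \<in> {1..n}" for t using sq[OF that] by (simp add: square_int_def)
  have "base.prob {\<omega>\<in>space \<Omega>. \<exists>k\<le>n. l < \<bar>\<Sum>t = 1..k. f t (shift_vec eps (int t) \<omega>)\<bar>}
    \<le> 8 * (real (Suc m))\<^sup>2 * (\<Sum>t = 1..n. base.expectation (\<lambda>\<omega>. (f t (shift_vec eps (int t) \<omega>))\<^sup>2)) / l\<^sup>2"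
    by (rule base.m_dependent_maximal_sq[OF indep_eps l])
       (use m mean dep square_intD(2)[OF square_int_shift[OF sq]] in \<open>auto simp: expectation_shift measurable_S_iff\<close>)
  also have "(\<Sum>t = 1..n. base.expectation (\<lambda>\<omega>. (f t (shift_vec eps (int t) \<omega>))\<^sup>2)) = (\<Sum>t = 1..n. (L2_norm S (f t))\<^sup>2)"
  proof (rule sum.cong[OF refl])
    fix t assume t: "t \<in> {1..n}"
    have "(\<lambda>x. (f t x)\<^sup>2) \<in> borel_measurable S" using m[OF t] by simp
    then show "base.expectation (\<lambda>\<omega>. (f t (shift_vec eps (int t) \<omega>))\<^sup>2) = (L2_norm S (f t))\<^sup>2"
      unfolding L2_norm_sq by (rule expectation_shift)
  qed
  also have "8 * (real (Suc m))\<^sup>2 * (\<Sum>t = 1..n. (L2_norm S (f t))\<^sup>2) / l\<^sup>2 \<le> 8 * (real (Suc m))\<^sup>2 * V / l\<^sup>2"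
    using V l by (intro divide_right_mono mult_left_mono) auto
  finally show ?thesis .
qed

lemma depends_on_first_head_mean: "j \<le> Suc m \<Longrightarrow> depends_on_first m (head_mean j g)"
  unfolding depends_on_first_def by (auto intro!: head_mean_cong)

end

section \<open>Weights for summing over the approximation levels\<close>

lemma sum_inverse_pronic_le:
  assumes "1 \<le> m" "m \<le> J"
  shows "(\<Sum>j = m..<J. 1 / (2 * real j * (real j + 1))) \<le> 1 / 2"
proof -
  have "(\<Sum>j = m..<J. 1 / (2 * real j * (real j + 1)))
      = (\<Sum>j = m..<J. (- 1 / (2 * real (Suc j))) - (- 1 / (2 * real j)))"
    by (rule sum.cong) (use assms in \<open>auto simp: field_simps\<close>)
  also have "\<dots> = (- 1 / (2 * real J)) - (- 1 / (2 * real m))"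
    by (rule sum_Suc_diff'[OF assms(2)])
  also have "\<dots> \<le> 1 / 2"
  proof -
    have "1 / (2 * real m) \<le> 1 / 2" using assms by (simp add: field_simps)
    moreover have "0 \<le> 1 / (2 * real J)" by simp
    moreover have "- 1 / (2 * real J) = - (1 / (2 * real J))" "- 1 / (2 * real m) = - (1 / (2 * real m))" by simp_all
    ultimately show ?thesis by linarith
  qed
  finally show ?thesis .
qed

text \<open>This is \<open>8 * (Suc j)^2 * (C * \<rho>^j)^2\<close> divided by the square of the
  weight \<open>1 / (2 * j * (j + 1))\<close>, with the remaining factor \<open>j^2\<close> enlarged
  to \<open>(Suc j)^2\<close>.\<close>

definition decay_weight :: "real \<Rightarrow> real \<Rightarrow> nat \<Rightarrow> real" where
  "decay_weight C \<rho> j = 32 * C\<^sup>2 * real (Suc j) ^ 6 * (\<rho>\<^sup>2) ^ j"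

text \<open>The polynomial factors of successive terms have ratio tending to \<open>1\<close>, so
  the ratio of the terms finally stays below the midpoint \<open>r\<close> between
  \<open>\<rho>^2\<close> and \<open>1\<close>.\<close>

lemma summable_decay_weight:
  assumes "0 < \<rho>" "\<rho> < 1"
  shows "summable (decay_weight C \<rho>)"
proof -
  define r where "r = (\<rho>\<^sup>2 + 1) / 2"
  have r2: "0 < \<rho>\<^sup>2" "\<rho>\<^sup>2 < 1" using assms by (auto simp: power_less_one_iff abs_square_less_1)
  have r: "\<rho>\<^sup>2 < r" "r < 1" using r2 by (auto simp: r_def)
  have "(\<lambda>j. (1 + inverse (real (Suc j))) ^ 6 * \<rho>\<^sup>2) \<longlonglongrightarrow> (1 + 0) ^ 6 * \<rho>\<^sup>2"
    by (intro tendsto_intros LIMSEQ_inverse_real_of_nat)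
  then have "\<forall>\<^sub>F j in sequentially. (1 + inverse (real (Suc j))) ^ 6 * \<rho>\<^sup>2 < r"
    by (rule order_tendstoD) (use r in simp)
  then obtain N where N: "\<And>j. j \<ge> N \<Longrightarrow> (1 + inverse (real (Suc j))) ^ 6 * \<rho>\<^sup>2 < r"
    by (auto simp: eventually_sequentially)
  show ?thesis
  proof (rule summable_ratio_test[OF r(2)])
    fix j assume "j \<ge> N"
    have "1 + inverse (real (Suc j)) = real (Suc (Suc j)) / real (Suc j)" by (simp add: field_simps)
    then have "real (Suc (Suc j)) ^ 6 = (1 + inverse (real (Suc j))) ^ 6 * real (Suc j) ^ 6"
      by (simp add: power_mult_distrib[symmetric])
    then have "decay_weight C \<rho> (Suc j) = ((1 + inverse (real (Suc j))) ^ 6 * \<rho>\<^sup>2) * decay_weight C \<rho> j"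
      by (simp add: decay_weight_def)
    also have "\<dots> \<le> r * decay_weight C \<rho> j"
      using N[OF \<open>j \<ge> N\<close>] by (intro mult_right_mono) (auto simp: decay_weight_def)
    finally show "norm (decay_weight C \<rho> (Suc j)) \<le> r * norm (decay_weight C \<rho> j)"
      by (simp add: decay_weight_def)
  qed
qed

context iid_process
begin

text \<open>The increments of the head means are functions of boundedly many innovations, so the
  maximal inequality for finitely dependent arrays applies to each of them; their geometric size
  beats the polynomial loss in that inequality.\<close>

lemma head_mean_replacement:
  assumes m: "m \<ge> 1" and e: "e > 0" and n: "n \<ge> 1" and \<rho>: "0 < \<rho>" "\<rho> < 1" and C: "0 \<le> C"
    and sq: "\<And>t. t \<in> {1..n} \<Longrightarrow> square_int S (g t)"
    and inc: "\<And>t j. t \<in> {1..n} \<Longrightarrow> j \<ge> 1 \<Longrightarrow>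
       L2_norm S (\<lambda>x. head_mean (Suc j) (g t) x - head_mean j (g t) x) \<le> C * \<rho> ^ j"
  shows "base.prob {\<omega>\<in>space \<Omega>. \<exists>k\<le>n. e * sqrt (real n)
        < \<bar>\<Sum>t = 1..k. g t (shift_vec eps (int t) \<omega>) - head_mean m (g t) (shift_vec eps (int t) \<omega>)\<bar>}
      \<le> (\<Sum>i. decay_weight C \<rho> (i + m)) / e\<^sup>2"
    (is "base.prob ?Bad \<le> _")
proof -
  let ?X = "\<lambda>t \<omega>. shift_vec eps (int t) \<omega>"
  define D where "D j t x = head_mean (Suc j) (g t) x - head_mean j (g t) x" for j t x
  \<comment> \<open>Level \<open>j\<close> may use the fraction \<open>\<theta> j\<close> of the
    allowed deviation. The fractions add up to at most one half; the other half is reserved for the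
    remainder beyond level \<open>J\<close>.\<close>
  define \<theta> where "\<theta> j = 1 / (2 * real j * (real j + 1))" for j
  define l where "l j = e * sqrt (real n) * \<theta> j" for j
  define A where "A j = {\<omega>\<in>space \<Omega>. \<exists>k\<le>n. l j < \<bar>\<Sum>t = 1..k. D j t (?X t \<omega>)\<bar>}" for j
  \<comment> \<open>The remainder is estimated by absolute values: \<open>n\<close> is fixed while
    \<open>J\<close> grows, so the resulting factor \<open>sqrt n * \<rho>^J\<close> still
    vanishes.\<close>
  define R where "R J \<omega> = (\<Sum>t = 1..n. \<bar>g t (?X t \<omega>) - head_mean J (g t) (?X t \<omega>)\<bar>)" for J \<omega>
  define F where "F J = {\<omega>\<in>space \<Omega>. e * sqrt (real n) / 2 \<le> R J \<omega>}" for J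
  have sn: "sqrt (real n) > 0" using n by simp
  have sqD: "square_int S (D j t)" if "t \<in> {1..n}" for j t
    unfolding D_def by (intro square_int_diff head_mean_square(1) sq that)
  have mD: "(\<lambda>\<omega>. D j t (?X t \<omega>)) \<in> borel_measurable \<Omega>" if "t \<in> {1..n}" for j t
    by (rule measurable_kernel_shift) (use sqD[OF that] in \<open>simp add: square_int_def\<close>)
  have mA: "A j \<in> sets \<Omega>" for j
  proof -
    have "(\<lambda>\<omega>. \<Sum>t = 1..k. D j t (?X t \<omega>)) \<in> borel_measurable \<Omega>" if "k \<in> {..n}" for k
      by (rule borel_measurable_sum) (use that in \<open>auto intro!: mD\<close>)
    note [measurable] = this
    have eq: "A j = {\<omega>\<in>space \<Omega>. \<exists>k\<in>{..n}. l j < \<bar>\<Sum>t = 1..k. D j t (?X t \<omega>)\<bar>}" by (auto simp: A_def)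
    show ?thesis unfolding eq by measurable
  qed
  have sqR: "square_int \<Omega> (\<lambda>\<omega>. g t (?X t \<omega>) - head_mean J (g t) (?X t \<omega>))" if "t \<in> {1..n}" for t J
    using square_int_shift[OF square_int_diff[OF sq[OF that] head_mean_square(1)[OF sq[OF that]]]] .
  have iR: "integrable \<Omega> (R J)" for J
    unfolding R_def[abs_def]
    by (intro Bochner_Integration.integrable_sum integrable_abs base.square_int_integrable sqR)
  have mF: "F J \<in> sets \<Omega>" for J
    unfolding F_def using iR[of J] by measurable
  have PA: "base.prob (A j) \<le> decay_weight C \<rho> j / e\<^sup>2" if j: "j \<ge> 1" for j
  proof -
    have lpos: "l j > 0" using e sn j by (simp add: l_def \<theta>_def)
    have "base.prob (A j) \<le> 8 * (real (Suc j))\<^sup>2 * (real n * (C * \<rho> ^ j)\<^sup>2) / (l j)\<^sup>2"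
      unfolding A_def
    proof (rule m_dependent_max_L2[OF lpos sqD])
      fix t assume t: "t \<in> {1..n}"
      have i: "integrable S (head_mean i (g t))" for i
        by (intro P.square_int_integrable head_mean_square(1) sq t)
      show "(\<integral>x. D j t x \<partial>S) = 0"
        unfolding D_def using i head_mean_integral[OF P.square_int_integrable[OF sq[OF t]]] by simp
      show "depends_on_first j (D j t)"
      proof -
        have "depends_on_first j (head_mean (Suc j) (g t))" "depends_on_first j (head_mean j (g t))"
          by (rule depends_on_first_head_mean; simp)+
        then show ?thesis unfolding depends_on_first_def D_def by metis
      qed
    next
      have "(\<Sum>t = 1..n. (L2_norm S (D j t))\<^sup>2) \<le> (\<Sum>t = 1..n. (C * \<rho> ^ j)\<^sup>2)"
        unfolding D_def by (intro sum_mono power_mono inc j) auto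
      then show "(\<Sum>t = 1..n. (L2_norm S (D j t))\<^sup>2) \<le> real n * (C * \<rho> ^ j)\<^sup>2" by simp
    qed
    also have "\<dots> = 32 * C\<^sup>2 * (real j)\<^sup>2 * (real (Suc j)) ^ 4 * (\<rho> ^ j)\<^sup>2 / e\<^sup>2"
    proof -
      have jpos: "0 < real j" using j by simp
      have l2: "(l j)\<^sup>2 = e\<^sup>2 * real n / (4 * (real j)\<^sup>2 * (real (Suc j))\<^sup>2)"
        by (simp add: l_def \<theta>_def power_mult_distrib power_divide add.commute)
      have four: "real (Suc j) ^ 4 = (real (Suc j))\<^sup>2 * (real (Suc j))\<^sup>2" by (simp add: power_add[symmetric])
      show ?thesis
        unfolding l2 four using e n jpos by (simp add: power_mult_distrib field_simps del: of_nat_Suc)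
    qed
    also have "\<dots> \<le> 32 * C\<^sup>2 * (real (Suc j))\<^sup>2 * (real (Suc j)) ^ 4 * (\<rho> ^ j)\<^sup>2 / e\<^sup>2"
      by (intro divide_right_mono mult_right_mono mult_left_mono power_mono) auto
    also have "\<dots> = decay_weight C \<rho> j / e\<^sup>2"
    proof -
      have "real (Suc j) ^ 6 = (real (Suc j))\<^sup>2 * real (Suc j) ^ 4" by (simp add: power_add[symmetric])
      moreover have "(\<rho> ^ j)\<^sup>2 = (\<rho>\<^sup>2) ^ j" by (simp add: power_mult[symmetric] mult.commute)
      ultimately show ?thesis by (simp add: decay_weight_def)
    qed
    finally show ?thesis .
  qed
  have PF: "base.prob (F J) \<le> 2 * sqrt (real n) * C / ((1 - \<rho>) * e) * \<rho> ^ J" if J: "J \<ge> 1" for J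
  proof -
    have "base.prob (F J) \<le> base.expectation (R J) / (e * sqrt (real n) / 2)"
      unfolding F_def
      by (rule integral_Markov_inequality_measure[OF iR sets.top]) (use e sn in \<open>auto simp: R_def intro!: sum_nonneg\<close>)
    also have "base.expectation (R J) = (\<Sum>t = 1..n. base.expectation (\<lambda>\<omega>. \<bar>g t (?X t \<omega>) - head_mean J (g t) (?X t \<omega>)\<bar>))"
      unfolding R_def[abs_def]
      by (rule Bochner_Integration.integral_sum) (intro integrable_abs base.square_int_integrable sqR)
    also have "\<dots> \<le> (\<Sum>t = 1..n. C * \<rho> ^ J / (1 - \<rho>))"
    proof (rule sum_mono)
      fix t assume t: "t \<in> {1..n}"
      have "base.expectation (\<lambda>\<omega>. \<bar>g t (?X t \<omega>) - head_mean J (g t) (?X t \<omega>)\<bar>)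
          \<le> L2_norm \<Omega> (\<lambda>\<omega>. g t (?X t \<omega>) - head_mean J (g t) (?X t \<omega>))"
        by (rule base.expectation_abs_le_L2_norm[OF sqR[OF t]])
      also have "\<dots> = L2_norm S (\<lambda>x. g t x - head_mean J (g t) x)"
        using L2_norm_shift[OF square_int_diff[OF sq[OF t] head_mean_square(1)[OF sq[OF t]]]] .
      also have "\<dots> \<le> C * \<rho> ^ J / (1 - \<rho>)"
        by (rule head_mean_approx[OF sq[OF t] \<rho> C inc[OF t] J])
      finally show "base.expectation (\<lambda>\<omega>. \<bar>g t (?X t \<omega>) - head_mean J (g t) (?X t \<omega>)\<bar>) \<le> C * \<rho> ^ J / (1 - \<rho>)" .
    qed
    also have "(\<Sum>t = 1..n. C * \<rho> ^ J / (1 - \<rho>)) / (e * sqrt (real n) / 2)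
        = 2 * sqrt (real n) * C / ((1 - \<rho>) * e) * \<rho> ^ J"
    proof -
      have "(\<Sum>t = 1..n. C * \<rho> ^ J / (1 - \<rho>)) / (e * sqrt (real n) / 2)
          = (real n / sqrt (real n)) * (2 * (C * \<rho> ^ J / (1 - \<rho>)) / e)" by (simp add: ac_simps)
      also have "real n / sqrt (real n) = sqrt (real n)" by (simp add: real_div_sqrt)
      finally show ?thesis by simp
    qed
    finally show ?thesis using e sn by (simp add: divide_right_mono)
  qed
  have sumD: "summable (\<lambda>i. decay_weight C \<rho> (i + m))"
    using summable_decay_weight[OF \<rho>] by (simp add: summable_iff_shift)
  have bound: "base.prob ?Bad \<le> (\<Sum>i. decay_weight C \<rho> (i + m)) / e\<^sup>2
      + 2 * sqrt (real n) * C / ((1 - \<rho>) * e) * \<rho> ^ J" if J: "m \<le> J" for J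
  proof -
    have "?Bad \<subseteq> (\<Union>j\<in>{m..<J}. A j) \<union> F J"
    proof (rule subsetI, rule ccontr)
      fix \<omega> assume "\<omega> \<in> ?Bad" and nA: "\<omega> \<notin> (\<Union>j\<in>{m..<J}. A j) \<union> F J"
      then obtain k where k: "\<omega> \<in> space \<Omega>" "k \<le> n" "e * sqrt (real n)
        < \<bar>\<Sum>t = 1..k. g t (?X t \<omega>) - head_mean m (g t) (?X t \<omega>)\<bar>" by auto
      have tele: "g t x - head_mean m (g t) x = (\<Sum>j = m..<J. D j t x) + (g t x - head_mean J (g t) x)" for t x
        unfolding D_def using sum_Suc_diff'[OF J, of "\<lambda>j. head_mean j (g t) x"] by simp
      have "(\<Sum>t = 1..k. g t (?X t \<omega>) - head_mean m (g t) (?X t \<omega>))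
          = (\<Sum>t = 1..k. (\<Sum>j = m..<J. D j t (?X t \<omega>)) + (g t (?X t \<omega>) - head_mean J (g t) (?X t \<omega>)))"
        by (intro sum.cong refl tele)
      also have "\<dots> = (\<Sum>j = m..<J. \<Sum>t = 1..k. D j t (?X t \<omega>)) + (\<Sum>t = 1..k. g t (?X t \<omega>) - head_mean J (g t) (?X t \<omega>))"
        by (subst sum.distrib, subst sum.swap) (rule refl)
      finally have "(\<Sum>t = 1..k. g t (?X t \<omega>) - head_mean m (g t) (?X t \<omega>))
          = (\<Sum>j = m..<J. \<Sum>t = 1..k. D j t (?X t \<omega>)) + (\<Sum>t = 1..k. g t (?X t \<omega>) - head_mean J (g t) (?X t \<omega>))" .
      then have "\<bar>\<Sum>t = 1..k. g t (?X t \<omega>) - head_mean m (g t) (?X t \<omega>)\<bar>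
          \<le> (\<Sum>j = m..<J. \<bar>\<Sum>t = 1..k. D j t (?X t \<omega>)\<bar>) + \<bar>\<Sum>t = 1..k. g t (?X t \<omega>) - head_mean J (g t) (?X t \<omega>)\<bar>"
        using sum_abs[of "\<lambda>j. \<Sum>t = 1..k. D j t (?X t \<omega>)" "{m..<J}"] by linarith
      also have "(\<Sum>j = m..<J. \<bar>\<Sum>t = 1..k. D j t (?X t \<omega>)\<bar>) \<le> (\<Sum>j = m..<J. l j)"
        by (rule sum_mono) (use nA k in \<open>auto simp: A_def not_less\<close>)
      also have "(\<Sum>j = m..<J. l j) = e * sqrt (real n) * (\<Sum>j = m..<J. \<theta> j)"
        by (simp add: l_def sum_distrib_left)
      also have "\<dots> \<le> e * sqrt (real n) * (1 / 2)"
        unfolding \<theta>_def using sum_inverse_pronic_le[OF m J] e sn by (intro mult_left_mono) auto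
      also have "\<bar>\<Sum>t = 1..k. g t (?X t \<omega>) - head_mean J (g t) (?X t \<omega>)\<bar> \<le> R J \<omega>"
      proof -
        have "\<bar>\<Sum>t = 1..k. g t (?X t \<omega>) - head_mean J (g t) (?X t \<omega>)\<bar>
            \<le> (\<Sum>t = 1..k. \<bar>g t (?X t \<omega>) - head_mean J (g t) (?X t \<omega>)\<bar>)" by (rule sum_abs)
        also have "\<dots> \<le> R J \<omega>" unfolding R_def by (rule sum_mono2) (use k in auto)
        finally show ?thesis .
      qed
      also have "R J \<omega> < e * sqrt (real n) / 2" using nA k by (auto simp: F_def)
      finally show False using k(3) by simp
    qed
    then have "base.prob ?Bad \<le> base.prob ((\<Union>j\<in>{m..<J}. A j) \<union> F J)"
      by (rule base.finite_measure_mono) (use mA mF in auto)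
    also have "\<dots> \<le> base.prob (\<Union>j\<in>{m..<J}. A j) + base.prob (F J)"
      by (rule measure_Un_le) (use mA mF in auto)
    also have "base.prob (\<Union>j\<in>{m..<J}. A j) \<le> (\<Sum>j = m..<J. base.prob (A j))"
      by (rule base.finite_measure_subadditive_finite) (use mA in auto)
    also have "\<dots> \<le> (\<Sum>j = m..<J. decay_weight C \<rho> j / e\<^sup>2)"
      by (rule sum_mono) (use m in \<open>auto intro!: PA\<close>)
    also have "\<dots> = (\<Sum>i<J - m. decay_weight C \<rho> (i + m)) / e\<^sup>2"
    proof -
      have "(\<Sum>j = m..<J. decay_weight C \<rho> j) = (\<Sum>i = 0..<J - m. decay_weight C \<rho> (i + m))"
        using sum.shift_bounds_nat_ivl[of "decay_weight C \<rho>" 0 m "J - m"] J by simp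
      then show ?thesis by (simp add: sum_divide_distrib[symmetric] atLeast0LessThan)
    qed
    also have "\<dots> \<le> (\<Sum>i. decay_weight C \<rho> (i + m)) / e\<^sup>2"
      by (intro divide_right_mono sum_le_suminf sumD) (auto simp: decay_weight_def)
    finally show ?thesis using PF[of J] m J by simp
  qed
  have "(\<lambda>J. (\<Sum>i. decay_weight C \<rho> (i + m)) / e\<^sup>2 + 2 * sqrt (real n) * C / ((1 - \<rho>) * e) * \<rho> ^ J)
      \<longlonglongrightarrow> (\<Sum>i. decay_weight C \<rho> (i + m)) / e\<^sup>2 + 2 * sqrt (real n) * C / ((1 - \<rho>) * e) * 0"
    using \<rho> by (intro tendsto_intros LIMSEQ_power_zero) auto
  then show ?thesis
    using bound by (intro LIMSEQ_le_const[of _ "(\<Sum>i. decay_weight C \<rho> (i + m)) / e\<^sup>2"]) auto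
qed

end

section \<open>Time-varying kernels\<close>

definition trunc :: "real \<Rightarrow> real \<Rightarrow> real" where
  "trunc K x = max (- K) (min K x)"

lemma trunc_bounded: "0 \<le> K \<Longrightarrow> \<bar>trunc K x\<bar> \<le> K"
  by (auto simp: trunc_def)

lemma abs_trunc_le: "0 \<le> K \<Longrightarrow> \<bar>trunc K x\<bar> \<le> \<bar>x\<bar>"
  by (auto simp: trunc_def)

lemma trunc_lipschitz: "\<bar>trunc K x - trunc K y\<bar> \<le> \<bar>x - y\<bar>"
  by (auto simp: trunc_def max_def min_def)

lemma measurable_trunc [measurable]: "trunc K \<in> borel_measurable borel"
  unfolding trunc_def[abs_def] by measurable

text \<open>Either \<open>d \<le> \<eta>\<close>, or \<open>d powr p / \<eta> powr p\<close> is at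
  least \<open>1\<close> and pays for the crude bound \<open>D\<close>. Summed over a chain, the
  second term is controlled by the \<open>p\<close>-variation for every \<open>p\<close>; comparing
  \<open>d^2\<close> with \<open>d powr p\<close> directly would fail for
  \<open>p > 2\<close>.\<close>

lemma powr_split_bound:
  fixes d :: real
  assumes "0 \<le> d" "d \<le> D" "0 < \<eta>" "0 < p"
  shows "d \<le> \<eta> + D * (d powr p / \<eta> powr p)" "d\<^sup>2 \<le> \<eta>\<^sup>2 + D\<^sup>2 * (d powr p / \<eta> powr p)"
proof -
  have "d \<le> \<eta> \<or> 1 \<le> d powr p / \<eta> powr p"
    using assms by (auto simp: field_simps intro!: powr_mono2)
  then show "d \<le> \<eta> + D * (d powr p / \<eta> powr p)"
  proof
    assume "d \<le> \<eta>"
    moreover have "0 \<le> D * (d powr p / \<eta> powr p)" using assms by simp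
    ultimately show ?thesis by linarith
  next
    assume "1 \<le> d powr p / \<eta> powr p"
    then have "D * 1 \<le> D * (d powr p / \<eta> powr p)" using assms by (intro mult_left_mono) auto
    then show ?thesis using assms by linarith
  qed
  from \<open>d \<le> \<eta> \<or> 1 \<le> d powr p / \<eta> powr p\<close>
  show "d\<^sup>2 \<le> \<eta>\<^sup>2 + D\<^sup>2 * (d powr p / \<eta> powr p)"
  proof
    assume "d \<le> \<eta>"
    then have "d\<^sup>2 \<le> \<eta>\<^sup>2" using assms by (intro power_mono) auto
    moreover have "0 \<le> D\<^sup>2 * (d powr p / \<eta> powr p)" by simp
    ultimately show ?thesis by linarith
  next
    assume "1 \<le> d powr p / \<eta> powr p"
    then have "D\<^sup>2 * 1 \<le> D\<^sup>2 * (d powr p / \<eta> powr p)" by (intro mult_left_mono) auto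
    moreover have "d\<^sup>2 \<le> D\<^sup>2" using assms by (intro power_mono) auto
    moreover have "0 \<le> \<eta>\<^sup>2" by simp
    ultimately show ?thesis by linarith
  qed
qed

text \<open>Collects the consequences of the assumptions in \<open>L2\<close>. The
  \<open>p\<close>-variation bound concerns the limit kernel, is stated for the sum of powers
  without the root, and admits chains that stop before \<open>1\<close>. The condition
  \<open>trunc_G\<close> is square integrability uniformly in time.\<close>

locale kernel_array = iid_process \<mu> \<Omega> eps
  for \<mu> :: "real measure" and \<Omega> :: "'a measure" and eps :: "int \<Rightarrow> 'a \<Rightarrow> real" +
  fixes Gn :: "nat \<Rightarrow> real \<Rightarrow> (nat \<Rightarrow> real) \<Rightarrow> real" and G :: "real \<Rightarrow> (nat \<Rightarrow> real) \<Rightarrow> real"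
    and A p Vp C \<rho> :: real
  assumes meas_G: "(\<lambda>(u, x). G u x) \<in> borel_measurable (borel \<Otimes>\<^sub>M S)"
    and sq_Gn: "\<And>n u. n \<ge> 1 \<Longrightarrow> u \<in> {0..1} \<Longrightarrow> square_int S (Gn n u)"
    and sq_G: "\<And>u. u \<in> {0..1} \<Longrightarrow> square_int S (G u)"
    and norm_Gn: "\<And>n u. n \<ge> 1 \<Longrightarrow> u \<in> {0..1} \<Longrightarrow> L2_norm S (Gn n u) \<le> A"
    and norm_G: "\<And>u. u \<in> {0..1} \<Longrightarrow> L2_norm S (G u) \<le> A"
    and Gn_to_G: "\<And>e. e > 0 \<Longrightarrow> \<exists>n0. \<forall>n\<ge>n0. \<forall>u\<in>{0..1}. L2_norm S (\<lambda>x. Gn n u x - G u x) \<le> e"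
    and p_pos: "p > 0"
    and pvar: "\<And>w m. w 0 = 0 \<Longrightarrow> w m \<le> 1 \<Longrightarrow> (\<And>i. i < m \<Longrightarrow> w i < w (Suc i)) \<Longrightarrow>
       (\<Sum>i = 1..m. L2_norm S (\<lambda>x. G (w i) x - G (w (i - 1)) x) powr p) \<le> Vp"
    and rho: "0 < \<rho>" "\<rho> < 1" and C_nonneg: "0 \<le> C"
    and dep_Gn: "\<And>n u j. n \<ge> 1 \<Longrightarrow> u \<in> {0..1} \<Longrightarrow> j \<ge> 1 \<Longrightarrow>
       L2_norm S (\<lambda>x. head_mean (Suc j) (Gn n u) x - head_mean j (Gn n u) x) \<le> C * \<rho> ^ j"
    and trunc_G: "\<And>e. e > 0 \<Longrightarrow> \<exists>K\<ge>0. \<forall>u\<in>{0..1}. L2_norm S (\<lambda>x. G u x - trunc K (G u x)) \<le> e"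
begin

text \<open>A pseudometric on times, possibly with jumps; regularity in time is always expressed
  through it.\<close>

definition gdist :: "real \<Rightarrow> real \<Rightarrow> real" where
  "gdist u v = L2_norm S (\<lambda>x. G u x - G v x)"

lemma gdist_nonneg [simp]: "0 \<le> gdist u v"
  by (simp add: gdist_def)

lemma gdist_self [simp]: "gdist u u = 0"
  by (simp add: gdist_def L2_norm_def)

lemma gdist_triangle:
  assumes "u \<in> {0..1}" "v \<in> {0..1}" "w \<in> {0..1}"
  shows "gdist u w \<le> gdist u v + gdist v w"
  unfolding gdist_def by (rule L2_norm_triangle_diff) (rule sq_G assms)+

lemma gdist_le:
  assumes "u \<in> {0..1}" "v \<in> {0..1}"
  shows "gdist u v \<le> 2 * A"
  using L2_norm_diff_le[OF sq_G[OF assms(1)] sq_G[OF assms(2)]] norm_G[OF assms(1)] norm_G[OF assms(2)]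
  unfolding gdist_def by linarith

lemma A_nonneg: "0 \<le> A"
  using norm_G[of 0] L2_norm_nonneg[of S "G 0"] by (simp del: L2_norm_nonneg)

lemma Vp_nonneg: "0 \<le> Vp"
  using pvar[of "\<lambda>_. 0" 0] by simp

text \<open>Increments up to \<open>\<eta>\<close> contribute at most
  \<open>\<eta>^2 = r / 2\<close> to the mean. The larger ones contribute a total bounded by
  \<open>c\<close>, which is independent of \<open>n\<close>, hence at most
  \<open>c / n\<close>.\<close>

lemma grid_increments_sq_tendsto:
  "(\<lambda>n. (\<Sum>i = 1..n. (gdist (real i / real n) ((real i - 1) / real n))\<^sup>2) / real n) \<longlonglongrightarrow> 0"
proof (rule LIMSEQ_I)
  fix r :: real assume r: "r > 0"
  define \<eta> where "\<eta> = sqrt (r / 2)"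
  have \<eta>: "\<eta> > 0" "\<eta>\<^sup>2 = r / 2" using r by (auto simp: \<eta>_def)
  define c where "c = (2 * A)\<^sup>2 * (Vp / \<eta> powr p)"
  have c: "0 \<le> c" using Vp_nonneg by (simp add: c_def)
  obtain n0 :: nat where n0: "c / (r / 2) < real n0" using reals_Archimedean2 by blast
  have "\<bar>(\<Sum>i = 1..n. (gdist (real i / real n) ((real i - 1) / real n))\<^sup>2) / real n\<bar> < r" if n: "n \<ge> Suc n0" for n
  proof -
    let ?d = "\<lambda>i. gdist (real i / real n) ((real i - 1) / real n)"
    have npos: "0 < real n" using n by simp
    have pv: "(\<Sum>i = 1..n. ?d i powr p) \<le> Vp"
    proof -
      have "(\<Sum>i = 1..n. L2_norm S (\<lambda>x. G (real i / real n) x - G (real (i - 1) / real n) x) powr p) \<le> Vp"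
        by (rule pvar[of "\<lambda>i. real i / real n"]) (use npos in \<open>auto simp: divide_strict_right_mono\<close>)
      moreover have "(\<Sum>i = 1..n. L2_norm S (\<lambda>x. G (real i / real n) x - G (real (i - 1) / real n) x) powr p)
          = (\<Sum>i = 1..n. ?d i powr p)"
        by (rule sum.cong) (auto simp: gdist_def of_nat_diff)
      ultimately show ?thesis by simp
    qed
    have "(\<Sum>i = 1..n. (?d i)\<^sup>2) \<le> (\<Sum>i = 1..n. \<eta>\<^sup>2 + (2 * A)\<^sup>2 * (?d i powr p / \<eta> powr p))"
      by (intro sum_mono powr_split_bound(2) gdist_le \<eta> p_pos) (use npos in \<open>auto simp: field_simps\<close>)
    also have "\<dots> = real n * \<eta>\<^sup>2 + (2 * A)\<^sup>2 * ((\<Sum>i = 1..n. ?d i powr p) / \<eta> powr p)"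
      by (simp add: sum.distrib sum_distrib_left sum_divide_distrib)
    also have "\<dots> \<le> real n * (r / 2) + c"
      unfolding c_def \<eta>(2) using pv by (intro add_left_mono mult_left_mono divide_right_mono) auto
    finally have "(\<Sum>i = 1..n. (?d i)\<^sup>2) / real n \<le> r / 2 + c / real n"
      using npos by (simp add: field_simps)
    also have "c / real n < r / 2"
    proof -
      have "c / (r / 2) < real n" using n0 n by linarith
      then show ?thesis using npos r by (simp add: field_simps)
    qed
    finally show ?thesis using npos by (simp add: sum_nonneg)
  qed
  then show "\<exists>no. \<forall>n\<ge>no. norm ((\<Sum>i = 1..n. (gdist (real i / real n) ((real i - 1) / real n))\<^sup>2) / real n - 0) < r"
    unfolding real_norm_def diff_zero by blast
qed

text \<open>Subtraction of naturals stops at \<open>0\<close>, and \<open>f 0 = 0\<close> makes the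
  truncated terms vanish.\<close>

lemma sum_shifted_le:
  fixes f :: "nat \<Rightarrow> real"
  assumes "f 0 = 0" "\<And>i. 0 \<le> f i"
  shows "(\<Sum>t = 1..n. f (t - l)) \<le> (\<Sum>t = 1..n. f t)"
proof -
  have "(\<Sum>t = 1..n. f (t - l)) = (\<Sum>i = 1..n - l. f i)"
  proof (induction n)
    case (Suc n)
    show ?case
    proof (cases "l \<le> n")
      case True
      then show ?thesis using Suc by (simp add: Suc_diff_le)
    next
      case False
      then show ?thesis using Suc assms(1) by simp
    qed
  qed simp
  also have "\<dots> \<le> (\<Sum>t = 1..n. f t)" by (rule sum_mono2) (use assms in auto)
  finally show ?thesis .
qed

text \<open>At most \<open>b\<close> unit steps lead from the start of a block to \<open>t\<close>,
  so Cauchy-Schwarz gives one factor \<open>b\<close>; each unit increment serves at most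
  \<open>b\<close> values of \<open>t\<close>, which gives the other.\<close>

lemma block_start_deviation:
  assumes n: "n \<ge> 1" and b: "b \<ge> 1"
  shows "(\<Sum>t = 1..n. (gdist (real t / real n) (real ((t - 1) div b * b) / real n))\<^sup>2)
    \<le> (real b)\<^sup>2 * (\<Sum>i = 1..n. (gdist (real i / real n) ((real i - 1) / real n))\<^sup>2)"
proof -
  define d where "d i = (if i = 0 then 0 else gdist (real i / real n) ((real i - 1) / real n))" for i :: nat
  have npos: "0 < real n" using n by simp
  have tele: "gdist (real (s + k) / real n) (real s / real n) \<le> (\<Sum>i = s + 1..s + k. d i)" if "s + k \<le> n" for s k
    using that
  proof (induction k)
    case (Suc k)
    have "gdist (real (s + Suc k) / real n) (real s / real n)
        \<le> gdist (real (s + Suc k) / real n) (real (s + k) / real n) + gdist (real (s + k) / real n) (real s / real n)"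
      by (rule gdist_triangle) (use Suc.prems npos in \<open>auto simp: field_simps\<close>)
    also have "gdist (real (s + Suc k) / real n) (real (s + k) / real n) = d (s + Suc k)" by (simp add: d_def)
    finally show ?case using Suc by simp
  qed simp
  have one: "(gdist (real t / real n) (real ((t - 1) div b * b) / real n))\<^sup>2 \<le> real b * (\<Sum>l<b. (d (t - l))\<^sup>2)"
    if t: "t \<in> {1..n}" for t
  proof -
    define s where "s = (t - 1) div b * b"
    have s: "s < t" "t - s \<le> b"
    proof -
      have "s \<le> t - 1" by (simp add: s_def)
      then show "s < t" using t by auto
      have "t - 1 - s = (t - 1) mod b" by (simp add: s_def minus_div_mult_eq_mod)
      moreover have "(t - 1) mod b < b" using b by simp
      ultimately show "t - s \<le> b" by linarith
    qed
    have "gdist (real t / real n) (real s / real n) \<le> (\<Sum>i = s + 1..t. d i)"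
      using tele[of s "t - s"] s t by simp
    also have "\<dots> = (\<Sum>l<t - s. d (t - l))"
      by (rule sum.reindex_bij_witness[of _ "\<lambda>l. t - l" "\<lambda>i. t - i"]) (use s in auto)
    finally have le: "gdist (real t / real n) (real s / real n) \<le> (\<Sum>l<t - s. d (t - l))" .
    have "(gdist (real t / real n) (real s / real n))\<^sup>2 \<le> (\<Sum>l<t - s. 1 * d (t - l))\<^sup>2"
      using power_mono[OF le, of 2] by simp
    also have "\<dots> \<le> (\<Sum>l<t - s. 1\<^sup>2) * (\<Sum>l<t - s. (d (t - l))\<^sup>2)"
      by (rule Cauchy_Schwarz_ineq_sum)
    also have "\<dots> \<le> real b * (\<Sum>l<b. (d (t - l))\<^sup>2)"
      using s by (intro mult_mono sum_mono2) (auto intro: sum_nonneg)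
    finally show ?thesis by (simp add: s_def)
  qed
  have "(\<Sum>t = 1..n. (gdist (real t / real n) (real ((t - 1) div b * b) / real n))\<^sup>2)
      \<le> (\<Sum>t = 1..n. real b * (\<Sum>l<b. (d (t - l))\<^sup>2))"
    by (rule sum_mono) (rule one)
  also have "\<dots> = real b * (\<Sum>l<b. \<Sum>t = 1..n. (d (t - l))\<^sup>2)"
    by (simp add: sum_distrib_left[symmetric]) (subst sum.swap, simp)
  also have "\<dots> \<le> real b * (\<Sum>l<b. \<Sum>t = 1..n. (d t)\<^sup>2)"
    by (intro mult_left_mono sum_mono sum_shifted_le[of "\<lambda>i. (d i)\<^sup>2"]) (auto simp: d_def)
  also have "\<dots> = (real b)\<^sup>2 * (\<Sum>i = 1..n. (d i)\<^sup>2)" by (simp add: power2_eq_square)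
  also have "(\<Sum>i = 1..n. (d i)\<^sup>2) = (\<Sum>i = 1..n. (gdist (real i / real n) ((real i - 1) / real n))\<^sup>2)"
    by (rule sum.cong) (auto simp: d_def)
  finally show ?thesis .
qed

text \<open>For a fixed offset the points \<open>r * h\<close> and \<open>r * h + x\<close>
  interleave into one increasing chain, so a single application of the \<open>p\<close>-variation
  bounds the sum over all cells, uniformly in \<open>x\<close>.\<close>

lemma offset_deviation:
  assumes h: "0 < h" and R: "real R * h \<le> 1" and x: "0 \<le> x" "x < h" and \<eta>: "\<eta> > 0"
  shows "(\<Sum>r<R. gdist (real r * h + x) (real r * h)) \<le> real R * \<eta> + 2 * A * (Vp / \<eta> powr p)"
proof (cases "x = 0")
  case True
  then show ?thesis using \<eta> A_nonneg Vp_nonneg by simp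
next
  case False
  with x have x0: "0 < x" by simp
  \<comment> \<open>Even indices are the cell starts, odd ones the shifted points; the offset
    increments are the steps that end at odd indices.\<close>
  define w where "w i = real (i div 2) * h + (if odd i then x else 0)" for i :: nat
  have inc: "w i < w (Suc i)" for i
  proof (cases "odd i")
    case True
    then have "Suc i div 2 = Suc (i div 2)" by (auto elim!: oddE)
    then show ?thesis using True x by (simp add: w_def algebra_simps)
  next
    case False
    then have "Suc i div 2 = i div 2" by auto
    then show ?thesis using False x0 by (simp add: w_def)
  qed
  let ?f = "\<lambda>i. L2_norm S (\<lambda>y. G (w i) y - G (w (i - 1)) y) powr p"
  have "(\<Sum>r<R. gdist (real r * h + x) (real r * h) powr p) = (\<Sum>r<R. ?f (Suc (2 * r)))"
    by (rule sum.cong) (auto simp: w_def gdist_def)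
  also have "\<dots> = sum ?f ((\<lambda>r. Suc (2 * r)) ` {..<R})"
    by (subst sum.reindex) (auto simp: inj_on_def)
  also have "\<dots> \<le> (\<Sum>i = 1..2 * R. ?f i)"
    by (rule sum_mono2) auto
  also have "\<dots> \<le> Vp"
    by (rule pvar) (use inc R in \<open>auto simp: w_def\<close>)
  finally have pv: "(\<Sum>r<R. gdist (real r * h + x) (real r * h) powr p) \<le> Vp" .
  have mem: "real r * h + x \<in> {0..1}" "real r * h \<in> {0..1}" if "r < R" for r
  proof -
    have "(real r + 1) * h \<le> real R * h" using that h by (intro mult_right_mono) auto
    then have "real r * h + h \<le> 1" using R by (simp add: algebra_simps)
    then show "real r * h + x \<in> {0..1}" "real r * h \<in> {0..1}" using x h by auto
  qed
  have "(\<Sum>r<R. gdist (real r * h + x) (real r * h))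
      \<le> (\<Sum>r<R. \<eta> + 2 * A * (gdist (real r * h + x) (real r * h) powr p / \<eta> powr p))"
    by (intro sum_mono powr_split_bound(1) gdist_le \<eta> p_pos mem) auto
  also have "\<dots> = real R * \<eta> + 2 * A * ((\<Sum>r<R. gdist (real r * h + x) (real r * h) powr p) / \<eta> powr p)"
    by (simp add: sum.distrib sum_distrib_left sum_divide_distrib)
  also have "\<dots> \<le> real R * \<eta> + 2 * A * (Vp / \<eta> powr p)"
    using pv A_nonneg by (intro add_left_mono mult_left_mono divide_right_mono) auto
  finally show ?thesis .
qed

text \<open>The integrand may jump, being Lipschitz only for \<open>gdist\<close>. The error is
  written as an integral over the offset \<open>x\<close> within one cell, with the sum over all
  cells inside; there \<open>offset_deviation\<close> applies for each fixed \<open>x\<close>, and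
  integrating over a cell of length \<open>h\<close> compensates the number of cells.\<close>

lemma riemann_sum_tendsto:
  fixes \<psi> :: "real \<Rightarrow> real" and b :: real
  assumes b: "b > 0" and D: "D \<ge> 0"
    and meas: "(\<lambda>u. indicator {0..1} u * \<psi> u) \<in> borel_measurable borel"
    and bnd: "\<And>u. u \<in> {0..1} \<Longrightarrow> \<bar>\<psi> u\<bar> \<le> Bd"
    and lip: "\<And>u v. u \<in> {0..1} \<Longrightarrow> v \<in> {0..1} \<Longrightarrow> \<bar>\<psi> u - \<psi> v\<bar> \<le> D * gdist u v"
    and v: "v \<in> {0..1}"
  shows "(\<lambda>n. (b / real n) * (\<Sum>r = 1..nat \<lfloor>real n / b * v\<rfloor>. \<psi> ((real r - 1) * b / real n)))
    \<longlonglongrightarrow> (\<integral>u\<in>{0..v}. \<psi> u \<partial>lborel)"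
proof (rule LIMSEQ_I)
  fix \<epsilon> :: real assume \<epsilon>: "\<epsilon> > 0"
  \<comment> \<open>Extension by \<open>0\<close>, since nothing is assumed about
    \<open>\<psi>\<close> outside the unit interval.\<close>
  define \<psi>' where "\<psi>' u = indicator {0..1} u * \<psi> u" for u
  have m\<psi> [measurable]: "\<psi>' \<in> borel_measurable borel" using meas by (simp add: \<psi>'_def[abs_def])
  have Bd: "0 \<le> Bd" using bnd[of 0] by simp
  have b\<psi>: "\<bar>\<psi>' u\<bar> \<le> Bd" for u using bnd[of u] Bd by (auto simp: \<psi>'_def indicator_def)
  have fin: "emeasure lborel {a..<c} < \<infinity>" for a c :: real
    by (cases "a \<le> c") auto
  have int: "integrable lborel (\<lambda>u. indicator {a..<c} u * \<psi>' (s + u))" for a c s :: real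
  proof (rule Bochner_Integration.integrable_bound[where f = "\<lambda>u. indicator {a..<c} u * Bd"])
    show "integrable lborel (\<lambda>u. indicator {a..<c} u * Bd)"
      by (intro integrable_mult_left integrable_real_indicator fin) auto
    show "AE u in lborel. norm (indicator {a..<c} u * \<psi>' (s + u)) \<le> norm (indicator {a..<c} u * Bd)"
      using b\<psi> Bd by (auto simp: indicator_def)
    have "(\<lambda>u. \<psi>' (s + u)) \<in> borel_measurable borel"
      by (rule measurable_compose[OF _ m\<psi>]) simp
    then show "(\<lambda>u. indicator {a..<c} u * \<psi>' (s + u)) \<in> borel_measurable lborel"
      by (intro borel_measurable_times) auto
  qed
  define I where "I a = (\<integral>u. indicator {0..<a} u * \<psi>' u \<partial>lborel)" for a
  have I_split: "I (a + h) = I a + (\<integral>x. indicator {0..<h} x * \<psi>' (a + x) \<partial>lborel)" if "0 \<le> a" "0 \<le> h" for a h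
  proof -
    have "I (a + h) = (\<integral>u. indicator {0..<a} u * \<psi>' u + indicator {a..<a + h} u * \<psi>' u \<partial>lborel)"
      unfolding I_def using that by (intro Bochner_Integration.integral_cong) (auto simp: indicator_def)
    also have "\<dots> = I a + (\<integral>u. indicator {a..<a + h} u * \<psi>' u \<partial>lborel)"
      unfolding I_def using int[of 0 a 0] int[of a "a + h" 0] by simp
    also have "(\<integral>u. indicator {a..<a + h} u * \<psi>' u \<partial>lborel) = (\<integral>x. indicator {a..<a + h} (a + 1 * x) * \<psi>' (a + 1 * x) \<partial>lborel)"
      using lborel_integral_real_affine[of 1 "\<lambda>u. indicator {a..<a + h} u * \<psi>' u" a] by simp
    also have "\<dots> = (\<integral>x. indicator {0..<h} x * \<psi>' (a + x) \<partial>lborel)"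
      by (intro Bochner_Integration.integral_cong) (auto simp: indicator_def)
    finally show ?thesis .
  qed
  have I_sum: "I (real R * h) = (\<Sum>r<R. \<integral>x. indicator {0..<h} x * \<psi>' (real r * h + x) \<partial>lborel)" if "0 \<le> h" for R h
  proof (induction R)
    case 0
    then show ?case by (simp add: I_def)
  next
    case (Suc R)
    have "real (Suc R) * h = real R * h + h" by (simp add: algebra_simps)
    then show ?case using I_split[of "real R * h" h] Suc that by simp
  qed
  have lim_set: "(\<integral>u\<in>{0..v}. \<psi> u \<partial>lborel) = I v"
    unfolding I_def set_lebesgue_integral_def
  proof (rule integral_cong_AE)
    have "AE u in lborel. u \<noteq> v" by (rule AE_lborel_singleton)
    then show "AE u in lborel. indicator {0..v} u *\<^sub>R \<psi> u = indicator {0..<v} u * \<psi>' u"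
      by eventually_elim (use v in \<open>auto simp: \<psi>'_def indicator_def\<close>)
    have "(\<lambda>u. indicator {0..v} u * \<psi>' u) \<in> borel_measurable borel"
      using m\<psi> by (intro borel_measurable_times) auto
    moreover have "(\<lambda>u. indicator {0..v} u * \<psi>' u) = (\<lambda>u. indicator {0..v} u *\<^sub>R \<psi> u)"
      using v by (auto simp: \<psi>'_def indicator_def)
    ultimately show "(\<lambda>u. indicator {0..v} u *\<^sub>R \<psi> u) \<in> borel_measurable lborel" by simp
    show "(\<lambda>u. indicator {0..<v} u * \<psi>' u) \<in> borel_measurable lborel"
      using m\<psi> by (intro borel_measurable_times) auto
  qed
  define \<eta> where "\<eta> = \<epsilon> / (3 * (D + 1))"
  have \<eta>: "\<eta> > 0" using \<epsilon> D by (simp add: \<eta>_def)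
  have D\<eta>: "D * \<eta> \<le> \<epsilon> / 3" using \<epsilon> D by (simp add: \<eta>_def field_simps)
  \<comment> \<open>Collects the errors that come with a single factor \<open>h\<close>: the large
    increments and the last incomplete cell.\<close>
  define c where "c = D * (2 * A * (Vp / \<eta> powr p)) + Bd"
  have c: "0 \<le> c" using D A_nonneg Vp_nonneg Bd by (simp add: c_def)
  obtain n0 :: nat where n0: "(b * c) / (\<epsilon> / 3) < real n0" using reals_Archimedean2 by blast
  have "\<bar>(b / real n) * (\<Sum>r = 1..nat \<lfloor>real n / b * v\<rfloor>. \<psi> ((real r - 1) * b / real n)) - I v\<bar> < \<epsilon>"
    if n: "n \<ge> Suc n0" for n
  proof -
    define h where "h = b / real n"
    have npos: "0 < real n" using n by simp
    have h: "0 < h" using npos b by (simp add: h_def)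
    define R where "R = nat \<lfloor>real n / b * v\<rfloor>"
    have "real R \<le> real n / b * v" unfolding R_def using v b by (intro of_nat_floor) auto
    then have Rh: "real R * h \<le> v" using npos b by (simp add: h_def field_simps)
    have "real n / b * v < real R + 1" unfolding R_def by linarith
    then have Rh': "v < real R * h + h" using npos b by (simp add: h_def field_simps)
    have Rh1: "real R * h \<le> 1" using Rh v by simp
    have mem: "real r * h + x \<in> {0..1}" if "r < R" "x \<in> {0..<h}" for r x
    proof -
      have "(real r + 1) * h \<le> real R * h" using that h by (intro mult_right_mono) auto
      then have "real r * h + h \<le> 1" using Rh1 by (simp add: algebra_simps)
      then show ?thesis using that h by auto
    qed
    have sum_eq: "(b / real n) * (\<Sum>r = 1..R. \<psi> ((real r - 1) * b / real n))
        = (\<Sum>r<R. \<integral>x. indicator {0..<h} x * \<psi>' (real r * h) \<partial>lborel)"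
    proof -
      have "(\<Sum>r = 1..R. \<psi> ((real r - 1) * b / real n)) = (\<Sum>r<R. \<psi> (real r * h))"
        by (rule sum.reindex_bij_witness[of _ Suc "\<lambda>r. r - 1"]) (auto simp: h_def of_nat_diff)
      moreover have "(\<integral>x. indicator {0..<h} x * \<psi>' (real r * h) \<partial>lborel) = h * \<psi> (real r * h)" if "r < R" for r
        using mem[OF that, of 0] h by (simp add: \<psi>'_def)
      ultimately show ?thesis by (simp add: sum_distrib_left h_def)
    qed
    define q where "q r x = indicator {0..<h} x * \<psi>' (real r * h) - indicator {0..<h} x * \<psi>' (real r * h + x)" for r :: nat and x
    define Q where "Q = D * (real R * \<eta> + 2 * A * (Vp / \<eta> powr p))"
    have main: "\<bar>(\<Sum>r<R. \<integral>x. indicator {0..<h} x * \<psi>' (real r * h) \<partial>lborel) - I (real R * h)\<bar>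
        \<le> h * Q"
    proof -
      have ic: "integrable lborel (\<lambda>x. indicator {0..<h} x * k)" for k :: real
        by (intro integrable_mult_left integrable_real_indicator fin) auto
      have "(\<Sum>r<R. \<integral>x. indicator {0..<h} x * \<psi>' (real r * h) \<partial>lborel) - I (real R * h)
          = (\<integral>x. (\<Sum>r<R. q r x) \<partial>lborel)"
      proof -
        have "(\<integral>x. (\<Sum>r<R. q r x) \<partial>lborel)
          = (\<Sum>r<R. (\<integral>x. q r x \<partial>lborel))"
          unfolding q_def by (rule Bochner_Integration.integral_sum) (rule Bochner_Integration.integrable_diff[OF ic int])
        also have "\<dots> = (\<Sum>r<R. (\<integral>x. indicator {0..<h} x * \<psi>' (real r * h) \<partial>lborel)
            - (\<integral>x. indicator {0..<h} x * \<psi>' (real r * h + x) \<partial>lborel))"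
          unfolding q_def by (rule sum.cong[OF refl]) (rule Bochner_Integration.integral_diff[OF ic int])
        finally show ?thesis
          unfolding I_sum[OF less_imp_le[OF h]] sum_subtractf by (rule sym)
      qed
      also have "\<bar>\<dots>\<bar> \<le> (\<integral>x. \<bar>\<Sum>r<R. q r x\<bar> \<partial>lborel)"
        by (rule integral_abs_bound)
      also have "\<dots> \<le> (\<integral>x. indicator {0..<h} x * Q \<partial>lborel)"
      proof (rule integral_mono[OF _ ic])
        have "integrable lborel (\<lambda>x. q r x)" for r
          unfolding q_def using Bochner_Integration.integrable_diff[OF ic[of "\<psi>' (real r * h)"] int[of 0 h "real r * h"]] .
        then show "integrable lborel (\<lambda>x. \<bar>\<Sum>r<R. q r x\<bar>)"
          by (intro integrable_abs Bochner_Integration.integrable_sum)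
        fix x :: real
        show "\<bar>\<Sum>r<R. q r x\<bar> \<le> indicator {0..<h} x * Q"
        proof (cases "x \<in> {0..<h}")
          case True
          have "\<bar>\<Sum>r<R. q r x\<bar> \<le> (\<Sum>r<R. \<bar>q r x\<bar>)" by (rule sum_abs)
          also have "\<dots> \<le> (\<Sum>r<R. D * gdist (real r * h + x) (real r * h))"
          proof (rule sum_mono)
            fix r assume "r \<in> {..<R}"
            then have r: "real r * h + x \<in> {0..1}" "real r * h \<in> {0..1}"
              using mem[of r x] mem[of r 0] True h by auto
            then show "\<bar>q r x\<bar> \<le> D * gdist (real r * h + x) (real r * h)"
              using lip[OF r] True by (simp add: q_def \<psi>'_def abs_minus_commute)
          qed
          also have "\<dots> = D * (\<Sum>r<R. gdist (real r * h + x) (real r * h))" by (simp add: sum_distrib_left)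
          also have "\<dots> \<le> Q"
            unfolding Q_def using offset_deviation[OF h Rh1 _ _ \<eta>, of x] True D by (intro mult_left_mono) auto
          finally show ?thesis using True by simp
        qed (simp add: q_def)
      qed
      also have "\<dots> = h * Q" using h by simp
      finally show ?thesis .
    qed
    have rest: "\<bar>I (real R * h) - I v\<bar> \<le> h * Bd"
    proof -
      have "I v = I (real R * h) + (\<integral>x. indicator {0..<v - real R * h} x * \<psi>' (real R * h + x) \<partial>lborel)"
        using I_split[of "real R * h" "v - real R * h"] h Rh by simp
      then have "\<bar>I (real R * h) - I v\<bar> = \<bar>\<integral>x. indicator {0..<v - real R * h} x * \<psi>' (real R * h + x) \<partial>lborel\<bar>" by simp
      also have "\<dots> \<le> (\<integral>x. \<bar>indicator {0..<v - real R * h} x * \<psi>' (real R * h + x)\<bar> \<partial>lborel)"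
        by (rule integral_abs_bound)
      also have "\<dots> \<le> (\<integral>x. indicator {0..<v - real R * h} x * Bd \<partial>lborel)"
      proof (rule integral_mono[OF integrable_abs[OF int]])
        show "integrable lborel (\<lambda>x. indicator {0..<v - real R * h} x * Bd)"
          by (intro integrable_mult_left integrable_real_indicator fin) auto
      qed (use b\<psi> in \<open>auto simp: indicator_def\<close>)
      also have "\<dots> = (v - real R * h) * Bd" using Rh by simp
      also have "\<dots> \<le> h * Bd" using Rh' Bd by (intro mult_right_mono) auto
      finally show ?thesis .
    qed
    have "\<bar>(b / real n) * (\<Sum>r = 1..R. \<psi> ((real r - 1) * b / real n)) - I v\<bar>
        \<le> h * (D * (real R * \<eta> + 2 * A * (Vp / \<eta> powr p))) + h * Bd"
      using main rest unfolding sum_eq Q_def by linarith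
    also have "\<dots> = (real R * h) * (D * \<eta>) + h * c" by (simp add: c_def algebra_simps)
    also have "\<dots> \<le> 1 * (\<epsilon> / 3) + h * c"
      using Rh1 D\<eta> D \<eta> h by (intro add_right_mono mult_mono) auto
    also have "h * c < \<epsilon> / 3"
    proof -
      have "b * c / (\<epsilon> / 3) < real n" using n0 n by linarith
      then show ?thesis using npos \<epsilon> by (simp add: h_def field_simps)
    qed
    finally show ?thesis using \<epsilon> by (simp add: R_def)
  qed
  then show "\<exists>no. \<forall>n\<ge>no. norm ((b / real n) * (\<Sum>r = 1..nat \<lfloor>real n / b * v\<rfloor>. \<psi> ((real r - 1) * b / real n))
      - (\<integral>u\<in>{0..v}. \<psi> u \<partial>lborel)) < \<epsilon>"
    unfolding lim_set real_norm_def by blast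
qed

end

section \<open>Autocovariances and long-run variance\<close>

lemma (in prob_space) L2_norm_centered_diff_le:
  assumes "square_int M f" "square_int M g"
  shows "L2_norm M (\<lambda>x. (f x - expectation f) - (g x - expectation g)) \<le> L2_norm M (\<lambda>x. f x - g x)"
proof -
  have "expectation (\<lambda>x. f x - g x) = expectation f - expectation g"
    using assms by (intro Bochner_Integration.integral_diff square_int_integrable)
  then have "(\<lambda>x. (f x - expectation f) - (g x - expectation g)) = (\<lambda>x. (f x - g x) - expectation (\<lambda>x. f x - g x))"
    by auto
  then show ?thesis
    using L2_norm_centered_le[OF square_int_diff[OF assms]] by simp
qed

context iid_process
begin

lemma measurable_all_eps: "(\<lambda>\<omega> i. eps (h i) \<omega>) \<in> measurable \<Omega> (PiM UNIV (\<lambda>_. borel))"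
  by (rule measurable_PiM_single') (auto simp: measurable_eps)

text \<open>Stationarity of the whole two-sided sequence, translation being an injective
  reindexing.\<close>

lemma expectation_translate:
  fixes F :: "(int \<Rightarrow> real) \<Rightarrow> real"
  assumes F: "F \<in> borel_measurable (PiM UNIV (\<lambda>_. borel))"
  shows "base.expectation (\<lambda>\<omega>. F (\<lambda>i. eps (i + c) \<omega>)) = base.expectation (\<lambda>\<omega>. F (\<lambda>i. eps i \<omega>))"
proof -
  have "base.expectation (\<lambda>\<omega>. F (\<lambda>i. eps (i + d) \<omega>)) = (\<integral>x. F x \<partial>(PiM UNIV (\<lambda>_. \<mu>)))" for d
  proof -
    have "inj (\<lambda>i. i + d)" by (auto simp: inj_def)
    from base.distr_reindexed_iid[OF indep_eps law_eps this]
    have "distr \<Omega> (PiM UNIV (\<lambda>_. borel)) (\<lambda>\<omega> i. eps (i + d) \<omega>) = PiM UNIV (\<lambda>_. \<mu>)" .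
    then show ?thesis
      using integral_distr[OF measurable_all_eps F, of "\<lambda>i. i + d"] by simp
  qed
  from this[of c] this[of 0] show ?thesis by simp
qed

lemma measurable_kernel_coords:
  assumes "f \<in> borel_measurable S"
  shows "(\<lambda>x. f (\<lambda>k. x (t - int k))) \<in> borel_measurable (PiM UNIV (\<lambda>_::int. borel))"
  using measurable_compose[OF measurable_shift_coords, of f] assms by (simp add: measurable_S_iff)

text \<open>At time \<open>h\<close> the kernel \<open>f\<close> reads only the innovations
  \<open>1..h\<close>, while \<open>g\<close> at time \<open>0\<close> reads those up to
  \<open>0\<close>.\<close>

lemma expectation_head_past:
  assumes f: "square_int S f" and g: "square_int S g"
    and dep: "\<And>x y. (\<And>k. k < h \<Longrightarrow> x k = y k) \<Longrightarrow> f x = f y"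
  shows "base.expectation (\<lambda>\<omega>. f (shift_vec eps (int h) \<omega>) * g (shift_vec eps 0 \<omega>)) = (\<integral>x. f x \<partial>S) * (\<integral>x. g x \<partial>S)"
proof -
  \<comment> \<open>Indexing the two factors by truth values makes them a family of functions of
    disjoint sets of coordinates.\<close>
  define F where "F b x = (if b then f (\<lambda>k. x (int h - int k)) else g (\<lambda>k. x (0 - int k)))" for b and x :: "int \<Rightarrow> real"
  define K where "K b = (if b then {1..int h} else {..0})" for b
  have ind: "base.indep_vars (\<lambda>_. borel) (\<lambda>b \<omega>. F b (\<lambda>i. eps i \<omega>)) UNIV"
  proof (rule base.indep_vars_local[OF indep_eps, where K = K])
    show "disjoint_family_on K UNIV" by (auto simp: disjoint_family_on_def K_def)
    show "F b \<in> borel_measurable (PiM UNIV (\<lambda>_. borel))" for b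
      unfolding F_def using measurable_kernel_coords[OF square_intD(1)[OF f], of "int h"]
        measurable_kernel_coords[OF square_intD(1)[OF g], of 0] by (cases b) simp_all
    fix b and x y :: "int \<Rightarrow> real" assume xy: "\<And>i. i \<in> K b \<Longrightarrow> x i = y i"
    show "F b x = F b y"
    proof (cases b)
      case True
      have "f (\<lambda>k. x (int h - int k)) = f (\<lambda>k. y (int h - int k))"
        by (rule dep) (use xy True in \<open>auto simp: K_def\<close>)
      then show ?thesis using True by (simp add: F_def)
    next
      case False
      then have "(\<lambda>k. x (0 - int k)) = (\<lambda>k. y (0 - int k))"
        using xy by (auto simp: K_def)
      then show ?thesis using False by (simp add: F_def)
    qed
  qed
  have eq: "F b (\<lambda>i. eps i \<omega>) = (if b then f (shift_vec eps (int h) \<omega>) else g (shift_vec eps 0 \<omega>))" for b \<omega>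
    by (simp add: F_def shift_vec_def)
  have int: "integrable \<Omega> (\<lambda>\<omega>. F b (\<lambda>i. eps i \<omega>))" for b
    unfolding eq using base.square_int_integrable[OF square_int_shift[OF f, of "int h"]]
      base.square_int_integrable[OF square_int_shift[OF g, of 0]] by (cases b) auto
  have "base.expectation (\<lambda>\<omega>. \<Prod>b\<in>UNIV. F b (\<lambda>i. eps i \<omega>)) = (\<Prod>b\<in>UNIV. base.expectation (\<lambda>\<omega>. F b (\<lambda>i. eps i \<omega>)))"
    by (rule base.indep_vars_lebesgue_integral[OF _ ind]) (auto intro: int)
  then have "base.expectation (\<lambda>\<omega>. f (shift_vec eps (int h) \<omega>) * g (shift_vec eps 0 \<omega>))
    = base.expectation (\<lambda>\<omega>. f (shift_vec eps (int h) \<omega>)) * base.expectation (\<lambda>\<omega>. g (shift_vec eps 0 \<omega>))"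
    by (simp add: UNIV_bool eq mult.commute)
  then show ?thesis
    using f g by (simp add: expectation_shift square_int_def)
qed

text \<open>A bare product moment; it is an autocovariance because the kernels put into it are
  centred. The same convention makes \<open>block_var\<close> a variance.\<close>

definition acov :: "((nat \<Rightarrow> real) \<Rightarrow> real) \<Rightarrow> int \<Rightarrow> real" where
  "acov f h = base.expectation (\<lambda>\<omega>. f (shift_vec eps h \<omega>) * f (shift_vec eps 0 \<omega>))"

definition block_var :: "nat \<Rightarrow> ((nat \<Rightarrow> real) \<Rightarrow> real) \<Rightarrow> real" where
  "block_var L f = base.expectation (\<lambda>\<omega>. (\<Sum>t = 1..L. f (shift_vec eps (int t) \<omega>))\<^sup>2)"

lemma expectation_product_acov:
  assumes f: "f \<in> borel_measurable S"
  shows "base.expectation (\<lambda>\<omega>. f (shift_vec eps s \<omega>) * f (shift_vec eps t \<omega>)) = acov f (s - t)"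
proof -
  let ?F = "\<lambda>x. f (\<lambda>k. x (s - t - int k)) * f (\<lambda>k. x (0 - int k))"
  have "?F \<in> borel_measurable (PiM UNIV (\<lambda>_::int. borel))"
    by (intro borel_measurable_times measurable_kernel_coords f)
  from expectation_translate[OF this, of t] show ?thesis
    by (simp add: acov_def shift_vec_def algebra_simps)
qed

lemma acov_minus: "f \<in> borel_measurable S \<Longrightarrow> acov f (- h) = acov f h"
  using expectation_product_acov[of f 0 h] by (simp add: acov_def mult.commute)

lemma abs_acov_le:
  assumes "square_int S f"
  shows "\<bar>acov f h\<bar> \<le> (L2_norm S f)\<^sup>2"
  using L2_Cauchy_Schwarz[OF square_int_shift[OF assms, of h] square_int_shift[OF assms, of 0]]
  by (simp add: acov_def L2_norm_shift[OF assms] power2_eq_square)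

lemma square_int_block_nat: "square_int S f \<Longrightarrow> square_int \<Omega> (\<lambda>\<omega>. \<Sum>t\<in>I. f (shift_vec eps (int t) \<omega>))"
  by (intro square_int_sum square_int_shift)

lemma block_var_translate:
  assumes f: "f \<in> borel_measurable S"
  shows "base.expectation (\<lambda>\<omega>. (\<Sum>t = 1..L. f (shift_vec eps (int (s + t)) \<omega>))\<^sup>2) = block_var L f"
proof -
  let ?F = "\<lambda>x. (\<Sum>t = 1..L. f (\<lambda>k. x (int t - int k)))\<^sup>2"
  have "?F \<in> borel_measurable (PiM UNIV (\<lambda>_::int. borel))"
    by (intro borel_measurable_power borel_measurable_sum measurable_kernel_coords f)
  from expectation_translate[OF this, of "int s"] show ?thesis
    by (simp add: block_var_def shift_vec_def algebra_simps)
qed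

text \<open>Opening the square at the last term. By symmetry in \<open>h\<close> the increment is
  the sum of the autocovariances over \<open>- L..L\<close>; approximation and measurability of the
  long-run variance both rest on this.\<close>

lemma block_var_Suc:
  assumes f: "square_int S f"
  shows "block_var (Suc L) f = block_var L f + (acov f 0 + 2 * (\<Sum>h = 1..L. acov f (int h)))"
proof -
  define X where "X t \<omega> = f (shift_vec eps (int t) \<omega>)" for t \<omega>
  have m: "f \<in> borel_measurable S" using f by (simp add: square_int_def)
  have sq: "square_int \<Omega> (X t)" for t unfolding X_def by (rule square_int_shift[OF f])
  have sqs: "square_int \<Omega> (\<lambda>\<omega>. \<Sum>t = 1..L. X t \<omega>)" by (rule square_int_sum) (rule sq)
  note ii = square_intD(2)[OF sqs] square_int_mult_integrable[OF sq sq] square_intD(2)[OF sq]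
  have bv: "block_var l f = base.expectation (\<lambda>\<omega>. (\<Sum>t = 1..l. X t \<omega>)\<^sup>2)" for l
    by (simp add: block_var_def X_def)
  have "block_var (Suc L) f = base.expectation (\<lambda>\<omega>. (\<Sum>t = 1..L. X t \<omega>)\<^sup>2 + 2 * (\<Sum>t = 1..L. X (Suc L) \<omega> * X t \<omega>) + (X (Suc L) \<omega>)\<^sup>2)"
    unfolding bv sum_distrib_left[symmetric]
    by (intro Bochner_Integration.integral_cong refl) (simp add: power2_eq_square algebra_simps)
  also have "\<dots> = block_var L f + 2 * (\<Sum>t = 1..L. base.expectation (\<lambda>\<omega>. X (Suc L) \<omega> * X t \<omega>)) + base.expectation (\<lambda>\<omega>. (X (Suc L) \<omega>)\<^sup>2)"
    unfolding bv using ii by simp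
  also have "(\<Sum>t = 1..L. base.expectation (\<lambda>\<omega>. X (Suc L) \<omega> * X t \<omega>)) = (\<Sum>t = 1..L. acov f (int (Suc L) - int t))"
    unfolding X_def by (intro sum.cong refl expectation_product_acov m)
  also have "\<dots> = (\<Sum>h = 1..L. acov f (int h))"
    by (rule sum.reindex_bij_witness[of _ "\<lambda>h. Suc L - h" "\<lambda>t. Suc L - t"]) (auto simp: of_nat_diff)
  also have "base.expectation (\<lambda>\<omega>. (X (Suc L) \<omega>)\<^sup>2) = acov f 0"
    unfolding X_def using expectation_product_acov[OF m, of "int (Suc L)" "int (Suc L)"] by (simp add: power2_eq_square)
  finally show ?thesis by simp
qed

lemma L2_norm_block_le:
  assumes "square_int S f"
  shows "L2_norm \<Omega> (\<lambda>\<omega>. \<Sum>t = 1..L. f (shift_vec eps (int t) \<omega>)) \<le> real L * L2_norm S f"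
proof -
  have "L2_norm \<Omega> (\<lambda>\<omega>. \<Sum>t = 1..L. f (shift_vec eps (int t) \<omega>)) \<le> (\<Sum>t = 1..L. L2_norm \<Omega> (\<lambda>\<omega>. f (shift_vec eps (int t) \<omega>)))"
    by (rule L2_norm_sum) (rule square_int_shift[OF assms])
  then show ?thesis by (simp add: L2_norm_shift[OF assms])
qed

lemma block_var_nonneg: "0 \<le> block_var L f"
  by (simp add: block_var_def)

lemma block_var_le:
  assumes "square_int S f" "L2_norm S f \<le> a"
  shows "block_var L f \<le> (real L * a)\<^sup>2"
proof -
  have "block_var L f = (L2_norm \<Omega> (\<lambda>\<omega>. \<Sum>t = 1..L. f (shift_vec eps (int t) \<omega>)))\<^sup>2"
    by (simp add: block_var_def L2_norm_sq)
  also have "\<dots> \<le> (real L * L2_norm S f)\<^sup>2" by (intro power_mono L2_norm_block_le assms) auto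
  also have "\<dots> \<le> (real L * a)\<^sup>2" using assms by (intro power_mono mult_left_mono) auto
  finally show ?thesis .
qed

text \<open>Both factors \<open>L\<close> come from the triangle inequality along the block. The
  loss is affordable because the kernel distance can be made small compared with
  \<open>1 / L\<close>.\<close>

lemma block_var_diff_le:
  assumes f: "square_int S f" "L2_norm S f \<le> a" and g: "square_int S g" "L2_norm S g \<le> a"
  shows "\<bar>block_var L f - block_var L g\<bar> \<le> 2 * a * (real L)\<^sup>2 * L2_norm S (\<lambda>x. f x - g x)"
proof -
  have a: "0 \<le> a" using f(2) L2_norm_nonneg[of S f] by linarith
  let ?f = "\<lambda>\<omega>. \<Sum>t = 1..L. f (shift_vec eps (int t) \<omega>)" and ?g = "\<lambda>\<omega>. \<Sum>t = 1..L. g (shift_vec eps (int t) \<omega>)"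
  have "\<bar>block_var L f - block_var L g\<bar> \<le> 2 * (real L * a) * L2_norm \<Omega> (\<lambda>\<omega>. ?f \<omega> - ?g \<omega>)"
    unfolding block_var_def
    by (rule L2_sq_diff_le)
       (use square_int_block_nat f g order_trans[OF L2_norm_block_le[OF f(1)] mult_left_mono[OF f(2)]]
          order_trans[OF L2_norm_block_le[OF g(1)] mult_left_mono[OF g(2)]] in auto)
  also have "\<dots> \<le> 2 * (real L * a) * (real L * L2_norm S (\<lambda>x. f x - g x))"
    using L2_norm_block_le[OF square_int_diff[OF f(1) g(1)], of L] a
    by (intro mult_left_mono) (simp_all add: sum_subtractf)
  finally show ?thesis by (simp add: power2_eq_square ac_simps)
qed

lemma measurable_block_var:
  assumes F: "(\<lambda>(u, x). F u x) \<in> borel_measurable (borel \<Otimes>\<^sub>M S)"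
  shows "(\<lambda>u::real. block_var L (F u)) \<in> borel_measurable borel"
proof -
  have "(\<lambda>p. (fst p, shift_vec eps t (snd p))) \<in> measurable (borel \<Otimes>\<^sub>M \<Omega>) (borel \<Otimes>\<^sub>M S)" for t
    using measurable_shift_vec[of t]
    by (intro measurable_Pair measurable_fst measurable_compose[OF measurable_snd]) (simp add: measurable_cong_sets[OF refl sets_S])
  from measurable_compose[OF this F]
  have "(\<lambda>p. F (fst p) (shift_vec eps t (snd p))) \<in> borel_measurable (borel \<Otimes>\<^sub>M \<Omega>)" for t by simp
  then have "(\<lambda>p. (\<Sum>t = 1..L. F (fst p) (shift_vec eps (int t) (snd p)))\<^sup>2) \<in> borel_measurable (borel \<Otimes>\<^sub>M \<Omega>)"
    by (intro borel_measurable_power borel_measurable_sum)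
  then have "(\<lambda>(u, \<omega>). (\<Sum>t = 1..L. F u (shift_vec eps (int t) \<omega>))\<^sup>2) \<in> borel_measurable (borel \<Otimes>\<^sub>M \<Omega>)"
    by (simp add: split_beta')
  from base.borel_measurable_lebesgue_integral[OF this] show ?thesis by (simp add: block_var_def)
qed

lemma measurable_centered_kernel:
  fixes F :: "real \<Rightarrow> (nat \<Rightarrow> real) \<Rightarrow> real"
  assumes F: "(\<lambda>(u, x). F u x) \<in> borel_measurable (borel \<Otimes>\<^sub>M S)"
  shows "(\<lambda>(u::real, x). F u x - (\<integral>y. F u y \<partial>S)) \<in> borel_measurable (borel \<Otimes>\<^sub>M S)"
proof -
  have "(\<lambda>u. \<integral>y. F u y \<partial>S) \<in> borel_measurable borel"
    using P.borel_measurable_lebesgue_integral[OF F] by simp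
  from measurable_compose[OF measurable_fst this]
  have "(\<lambda>p. \<integral>y. F (fst p) y \<partial>S) \<in> borel_measurable (borel \<Otimes>\<^sub>M S)" .
  moreover have "(\<lambda>p. F (fst p) (snd p)) \<in> borel_measurable (borel \<Otimes>\<^sub>M S)"
    using F by (simp add: split_beta')
  ultimately have "(\<lambda>p. F (fst p) (snd p) - (\<integral>y. F (fst p) y \<partial>S)) \<in> borel_measurable (borel \<Otimes>\<^sub>M S)"
    by (rule borel_measurable_diff[rotated])
  then show ?thesis by (simp add: split_beta')
qed

end

section \<open>Two-sided sums with geometric decay\<close>

lemma sum_int_symmetric: "(\<Sum>h = - int L..int L. f h) = f 0 + (\<Sum>h = 1..L. f (int h) + f (- int h))"
  for f :: "int \<Rightarrow> real"
proof (induction L)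
  case (Suc L)
  have "{- int (Suc L)..int (Suc L)} = insert (int (Suc L)) (insert (- int (Suc L)) {- int L..int L})" by auto
  then show ?case using Suc by simp
qed simp

lemma abs_summable_int_geometric:
  fixes f :: "int \<Rightarrow> real"
  assumes \<rho>: "0 < \<rho>" "\<rho> < 1" and c: "0 \<le> c" and f: "\<And>h. \<bar>f h\<bar> \<le> c * \<rho> ^ nat \<bar>h\<bar>"
  shows "f summable_on UNIV"
proof (rule abs_summable_summable)
  show "(\<lambda>h. norm (f h)) summable_on UNIV"
  proof (rule nonneg_bdd_above_summable_on)
    show "bdd_above (sum (\<lambda>h. norm (f h)) ` {F. F \<subseteq> UNIV \<and> finite F})"
    proof (rule bdd_aboveI2)
      fix F :: "int set" assume "F \<in> {F. F \<subseteq> UNIV \<and> finite F}"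
      then have F: "finite F" by simp
      \<comment> \<open>Half-width of a symmetric window containing \<open>F\<close>: the sum of the
        absolute values is at least each of them.\<close>
      define L where "L = nat (\<Sum>h\<in>F. \<bar>h\<bar>)"
      have sub: "F \<subseteq> {- int L..int L}"
      proof
        fix h assume "h \<in> F"
        then have "\<bar>h\<bar> \<le> (\<Sum>h\<in>F. \<bar>h\<bar>)" using F by (intro member_le_sum) auto
        then show "h \<in> {- int L..int L}" by (auto simp: L_def)
      qed
      have "sum (\<lambda>h. norm (f h)) F \<le> (\<Sum>h = - int L..int L. norm (f h))"
        by (rule sum_mono2) (use sub in auto)
      also have "\<dots> = norm (f 0) + (\<Sum>h = 1..L. norm (f (int h)) + norm (f (- int h)))"
        by (rule sum_int_symmetric)
      also have "\<dots> \<le> c + (\<Sum>h = 1..L. 2 * c * \<rho> ^ h)"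
      proof (intro add_mono sum_mono)
        show "norm (f 0) \<le> c" using f[of 0] by simp
        fix h assume "h \<in> {1..L}"
        show "norm (f (int h)) + norm (f (- int h)) \<le> 2 * c * \<rho> ^ h"
          using f[of "int h"] f[of "- int h"] by simp
      qed
      also have "(\<Sum>h = 1..L. 2 * c * \<rho> ^ h) = 2 * c * (\<Sum>h = 1..L. \<rho> ^ h)" by (simp add: sum_distrib_left)
      also have "(\<Sum>h = 1..L. \<rho> ^ h) \<le> (\<Sum>h. \<rho> ^ h)"
        by (rule sum_le_suminf) (use \<rho> in auto)
      finally show "sum (\<lambda>h. norm (f h)) F \<le> c + 2 * c * (\<Sum>h. \<rho> ^ h)" using c by (simp add: mult_left_mono)
    qed
  qed simp
qed

text \<open>\<open>infsum\<close> is a limit along all finite sets of integers. The symmetric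
  windows are cofinal among these, so it is also the limit of the symmetric partial sums, whose tail
  is geometric.\<close>

lemma int_partial_sums_approx_infsum:
  fixes f :: "int \<Rightarrow> real"
  assumes \<rho>: "0 < \<rho>" "\<rho> < 1" and c: "0 \<le> c" and f: "\<And>h. \<bar>f h\<bar> \<le> c * \<rho> ^ nat \<bar>h\<bar>"
  shows "(\<lambda>L. \<Sum>h = - int L..int L. f h) \<longlonglongrightarrow> infsum f UNIV"
    "\<bar>(\<Sum>h = - int L..int L. f h) - infsum f UNIV\<bar> \<le> 2 * c / (1 - \<rho>) * \<rho> ^ L"
proof -
  let ?s = "\<lambda>L. \<Sum>h = - int L..int L. f h"
  have "(f has_sum infsum f UNIV) UNIV"
    using abs_summable_int_geometric[OF assms] by simp
  moreover have "filterlim (\<lambda>L. {- int L..int L}) (finite_subsets_at_top UNIV) sequentially"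
    unfolding filterlim_finite_subsets_at_top
  proof (intro allI impI)
    fix F :: "int set" assume F: "finite F \<and> F \<subseteq> UNIV"
    show "\<forall>\<^sub>F L in sequentially. finite {- int L..int L} \<and> F \<subseteq> {- int L..int L} \<and> {- int L..int L} \<subseteq> UNIV"
    proof (rule eventually_sequentiallyI[of "nat (\<Sum>h\<in>F. \<bar>h\<bar>)"], intro conjI subsetI)
      fix L h assume L: "nat (\<Sum>h\<in>F. \<bar>h\<bar>) \<le> L" and h: "h \<in> F"
      have "\<bar>h\<bar> \<le> (\<Sum>h\<in>F. \<bar>h\<bar>)" using F h by (intro member_le_sum) auto
      then show "h \<in> {- int L..int L}" using L by auto
    qed auto
  qed
  ultimately show lim: "?s \<longlonglongrightarrow> infsum f UNIV"
    unfolding has_sum_def by (rule filterlim_compose)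
  have step: "\<bar>?s (L + n) - ?s L\<bar> \<le> 2 * c / (1 - \<rho>) * \<rho> ^ L" for n
  proof -
    have "\<bar>?s (L + n) - ?s L\<bar> \<le> (\<Sum>i<n. 2 * c * \<rho> ^ (L + Suc i))"
    proof (induction n)
      case (Suc n)
      have "?s (L + Suc n) = ?s (L + n) + (f (int (L + Suc n)) + f (- int (L + Suc n)))"
        by (simp only: sum_int_symmetric) simp
      moreover have "\<bar>f (int (L + Suc n)) + f (- int (L + Suc n))\<bar> \<le> 2 * c * \<rho> ^ (L + Suc n)"
        using f[of "int (L + Suc n)"] f[of "- int (L + Suc n)"] by (simp del: of_nat_Suc of_nat_add)
      ultimately have "\<bar>?s (L + Suc n) - ?s L\<bar> \<le> (\<Sum>i<n. 2 * c * \<rho> ^ (L + Suc i)) + 2 * c * \<rho> ^ (L + Suc n)"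
        using Suc by linarith
      then show ?case by simp
    qed simp
    also have "\<dots> = 2 * c * \<rho> ^ L * (\<rho> * (\<Sum>i<n. \<rho> ^ i))"
      by (simp add: power_add sum_distrib_left ac_simps)
    also have "\<dots> \<le> 2 * c * \<rho> ^ L * (1 * (1 / (1 - \<rho>)))"
    proof (intro mult_left_mono mult_mono)
      have "(\<Sum>i<n. \<rho> ^ i) \<le> (\<Sum>i. \<rho> ^ i)" by (rule sum_le_suminf) (use \<rho> in auto)
      then show "(\<Sum>i<n. \<rho> ^ i) \<le> 1 / (1 - \<rho>)" using \<rho> by (simp add: suminf_geometric)
    qed (use \<rho> c in \<open>auto intro!: sum_nonneg\<close>)
    finally show ?thesis by simp
  qed
  have "(\<lambda>n. \<bar>?s (n + L) - ?s L\<bar>) \<longlonglongrightarrow> \<bar>infsum f UNIV - ?s L\<bar>"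
    by (intro tendsto_rabs tendsto_diff tendsto_const LIMSEQ_ignore_initial_segment lim)
  then have "\<bar>infsum f UNIV - ?s L\<bar> \<le> 2 * c / (1 - \<rho>) * \<rho> ^ L"
    by (rule LIMSEQ_le_const2) (use step in \<open>auto simp: add.commute\<close>)
  then show "\<bar>?s L - infsum f UNIV\<bar> \<le> 2 * c / (1 - \<rho>) * \<rho> ^ L" by (simp add: abs_minus_commute)
qed

section \<open>Long-run variance of the limit kernel\<close>

context kernel_array
begin

definition Gc :: "real \<Rightarrow> (nat \<Rightarrow> real) \<Rightarrow> real" where
  "Gc u x = G u x - (\<integral>y. G u y \<partial>S)"

definition long_run_var :: "real \<Rightarrow> real" where
  "long_run_var u = infsum (acov (Gc u)) UNIV"

text \<open>\<open>A^2\<close> covers lag \<open>0\<close> and the second term the other lags, so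
  that one geometric bound serves all of them.\<close>

definition c1 :: real where "c1 = A\<^sup>2 + A * (C / (1 - \<rho>))"

lemma c1_nonneg: "0 \<le> c1"
  using A_nonneg C_nonneg rho by (simp add: c1_def)

lemma square_int_Gc: "u \<in> {0..1} \<Longrightarrow> square_int S (Gc u)"
  unfolding Gc_def[abs_def] by (intro P.square_int_centered sq_G)

lemma L2_norm_Gc: "u \<in> {0..1} \<Longrightarrow> L2_norm S (Gc u) \<le> A"
  unfolding Gc_def[abs_def] using P.L2_norm_centered_le[OF sq_G] norm_G by (meson order_trans)

text \<open>The dependence hypothesis concerns \<open>Gn\<close>, so the estimate is made for one
  \<open>Gn\<close> close to \<open>G\<close> and transferred; head means are contractions, so this
  costs twice the distance.\<close>

lemma head_mean_approx_G:
  assumes u: "u \<in> {0..1}" and j: "j \<ge> 1"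
  shows "L2_norm S (\<lambda>x. G u x - head_mean j (G u) x) \<le> C / (1 - \<rho>) * \<rho> ^ j"
proof (rule field_le_epsilon)
  fix e :: real assume "e > 0"
  then obtain n0 where "\<forall>n\<ge>n0. \<forall>u\<in>{0..1}. L2_norm S (\<lambda>x. Gn n u x - G u x) \<le> e / 2"
    using Gn_to_G[of "e / 2"] by auto
  then have e: "L2_norm S (\<lambda>x. Gn (Suc n0) u x - G u x) \<le> e / 2" using u by auto
  let ?g = "Gn (Suc n0) u"
  have g: "square_int S ?g" by (rule sq_Gn) (use u in auto)
  note G = sq_G[OF u]
  note T = head_mean_square(1)[OF g, of j] head_mean_square(1)[OF G, of j]
  have "L2_norm S (\<lambda>x. G u x - head_mean j (G u) x)
      \<le> L2_norm S (\<lambda>x. G u x - ?g x) + L2_norm S (\<lambda>x. ?g x - head_mean j (G u) x)"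
    by (rule L2_norm_triangle_diff[OF G g T(2)])
  also have "L2_norm S (\<lambda>x. ?g x - head_mean j (G u) x)
      \<le> L2_norm S (\<lambda>x. ?g x - head_mean j ?g x) + L2_norm S (\<lambda>x. head_mean j ?g x - head_mean j (G u) x)"
    by (rule L2_norm_triangle_diff[OF g T])
  also have "L2_norm S (\<lambda>x. ?g x - head_mean j ?g x) \<le> C * \<rho> ^ j / (1 - \<rho>)"
    by (rule head_mean_approx[OF g rho C_nonneg dep_Gn j]) (use u in auto)
  also have "L2_norm S (\<lambda>x. head_mean j ?g x - head_mean j (G u) x) \<le> L2_norm S (\<lambda>x. ?g x - G u x)"
    by (rule head_mean_diff_le[OF g G])
  finally show "L2_norm S (\<lambda>x. G u x - head_mean j (G u) x) \<le> C / (1 - \<rho>) * \<rho> ^ j + e"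
    using e L2_norm_minus_commute[of S "G u" ?g] by simp
qed

text \<open>Split the kernel at time \<open>j\<close> into its head mean of order \<open>j\<close>
  and the rest. The head reads only innovations after time \<open>0\<close>, so its product with the
  centred kernel at time \<open>0\<close> has mean zero. Cauchy-Schwarz applies to the rest, whose
  norm decays geometrically; negative lags follow by symmetry.\<close>

lemma acov_Gc_decay:
  assumes u: "u \<in> {0..1}"
  shows "\<bar>acov (Gc u) h\<bar> \<le> c1 * \<rho> ^ nat \<bar>h\<bar>"
proof -
  have m: "Gc u \<in> borel_measurable S" using square_int_Gc[OF u] by (simp add: square_int_def)
  have pos: "\<bar>acov (Gc u) (int j)\<bar> \<le> c1 * \<rho> ^ j" for j
  proof (cases "j = 0")
    case True
    have "\<bar>acov (Gc u) 0\<bar> \<le> (L2_norm S (Gc u))\<^sup>2" by (rule abs_acov_le[OF square_int_Gc[OF u]])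
    also have "\<dots> \<le> A\<^sup>2" by (intro power_mono L2_norm_Gc[OF u]) auto
    also have "\<dots> \<le> c1" using A_nonneg C_nonneg rho unfolding c1_def by simp
    finally show ?thesis using True by simp
  next
    case False
    let ?T = "head_mean j (G u)" and ?X = "\<lambda>f \<omega>. f (shift_vec eps (int j) \<omega>)" and ?Y = "\<lambda>\<omega>. Gc u (shift_vec eps 0 \<omega>)"
    have sT: "square_int S ?T" by (rule head_mean_square(1)[OF sq_G[OF u]])
    have sD: "square_int S (\<lambda>x. G u x - ?T x)" by (rule square_int_diff[OF sq_G[OF u] sT])
    have c0: "(\<integral>x. Gc u x \<partial>S) = 0"
      unfolding Gc_def using P.square_int_integrable[OF sq_G[OF u]] P.prob_space by simp
    have sY: "square_int \<Omega> ?Y" by (rule square_int_shift[OF square_int_Gc[OF u]])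
    have sc: "square_int S (\<lambda>x. - (\<integral>y. G u y \<partial>S))" by (rule P.square_int_const)
    have "acov (Gc u) (int j) = base.expectation (\<lambda>\<omega>. ?X (\<lambda>x. G u x - ?T x) \<omega> * ?Y \<omega> + ?X ?T \<omega> * ?Y \<omega> + (- (\<integral>y. G u y \<partial>S)) * ?Y \<omega>)"
      unfolding acov_def by (intro Bochner_Integration.integral_cong refl) (simp add: Gc_def algebra_simps)
    also have "\<dots> = base.expectation (\<lambda>\<omega>. ?X (\<lambda>x. G u x - ?T x) \<omega> * ?Y \<omega>) + base.expectation (\<lambda>\<omega>. ?X ?T \<omega> * ?Y \<omega>)
        + base.expectation (\<lambda>\<omega>. (- (\<integral>y. G u y \<partial>S)) * ?Y \<omega>)"
      using square_int_mult_integrable[OF square_int_shift[OF sD] sY] square_int_mult_integrable[OF square_int_shift[OF sT] sY]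
        base.square_int_integrable[OF sY] by simp
    also have "base.expectation (\<lambda>\<omega>. ?X ?T \<omega> * ?Y \<omega>) = 0"
    proof -
      have "base.expectation (\<lambda>\<omega>. ?X ?T \<omega> * ?Y \<omega>) = (\<integral>x. ?T x \<partial>S) * (\<integral>x. Gc u x \<partial>S)"
        by (rule expectation_head_past[OF sT square_int_Gc[OF u]]) (rule head_mean_cong)
      then show ?thesis by (simp only: c0 mult_zero_right)
    qed
    also have "base.expectation (\<lambda>\<omega>. (- (\<integral>y. G u y \<partial>S)) * ?Y \<omega>) = 0"
      using expectation_shift[OF m, of 0] c0 by simp
    finally have "\<bar>acov (Gc u) (int j)\<bar> \<le> L2_norm \<Omega> (\<lambda>\<omega>. ?X (\<lambda>x. G u x - ?T x) \<omega>) * L2_norm \<Omega> ?Y"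
      using L2_Cauchy_Schwarz[OF square_int_shift[OF sD] sY, of "int j"] by simp
    also have "\<dots> = L2_norm S (\<lambda>x. G u x - ?T x) * L2_norm S (Gc u)"
      using L2_norm_shift[OF sD, of "int j"] L2_norm_shift[OF square_int_Gc[OF u], of 0] by simp
    also have "\<dots> \<le> (C / (1 - \<rho>) * \<rho> ^ j) * A"
      using head_mean_approx_G[OF u, of j] False L2_norm_Gc[OF u] C_nonneg rho by (intro mult_mono) auto
    also have "\<dots> \<le> c1 * \<rho> ^ j" using rho A_nonneg by (simp add: c1_def algebra_simps)
    finally show ?thesis .
  qed
  show ?thesis
  proof (cases "0 \<le> h")
    case True
    then show ?thesis using pos[of "nat h"] by simp
  next
    case False
    then show ?thesis using pos[of "nat (- h)"] acov_minus[OF m, of h] by simp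
  qed
qed

text \<open>In the telescoped sum of \<open>block_var_Suc\<close> the error of step \<open>l\<close>
  is the tail of the autocovariances beyond lag \<open>l\<close>. These tails form a geometric
  series, so the total is bounded uniformly in \<open>L\<close> and \<open>u\<close>.\<close>

lemma block_var_approx:
  assumes u: "u \<in> {0..1}"
  shows "\<bar>block_var L (Gc u) - real L * long_run_var u\<bar> \<le> 2 * c1 / (1 - \<rho>)\<^sup>2"
proof -
  have m: "Gc u \<in> borel_measurable S" using square_int_Gc[OF u] by (simp add: square_int_def)
  have BSuc: "block_var (Suc l) (Gc u) - block_var l (Gc u) = (\<Sum>h = - int l..int l. acov (Gc u) h)" for l
    unfolding block_var_Suc[OF square_int_Gc[OF u]] sum_int_symmetric
    by (simp add: acov_minus[OF m] sum_distrib_left)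
  have "\<bar>block_var L (Gc u) - real L * long_run_var u\<bar> \<le> (\<Sum>l<L. 2 * c1 / (1 - \<rho>) * \<rho> ^ l)"
  proof (induction L)
    case 0
    then show ?case by (simp add: block_var_def)
  next
    case (Suc L)
    have "\<bar>(\<Sum>h = - int L..int L. acov (Gc u) h) - long_run_var u\<bar> \<le> 2 * c1 / (1 - \<rho>) * \<rho> ^ L"
      unfolding long_run_var_def by (rule int_partial_sums_approx_infsum(2)[OF rho c1_nonneg acov_Gc_decay[OF u]])
    then show ?case using Suc.IH BSuc[of L] by (simp add: algebra_simps)
  qed
  also have "\<dots> = 2 * c1 / (1 - \<rho>) * (\<Sum>l<L. \<rho> ^ l)" by (simp add: sum_distrib_left)
  also have "\<dots> \<le> 2 * c1 / (1 - \<rho>) * (1 / (1 - \<rho>))"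
  proof (rule mult_left_mono)
    have "(\<Sum>i<L. \<rho> ^ i) \<le> (\<Sum>i. \<rho> ^ i)" by (rule sum_le_suminf) (use rho in auto)
    then show "(\<Sum>i<L. \<rho> ^ i) \<le> 1 / (1 - \<rho>)" using rho by (simp add: suminf_geometric)
  qed (use rho c1_nonneg in simp)
  finally show ?thesis by (simp add: power2_eq_square)
qed

text \<open>A negative value would drive \<open>L * long_run_var u\<close> to minus infinity, yet it
  stays within a bounded distance of nonnegative block variances.\<close>

lemma long_run_var_nonneg:
  assumes u: "u \<in> {0..1}"
  shows "0 \<le> long_run_var u"
proof (rule ccontr)
  assume neg: "\<not> 0 \<le> long_run_var u"
  obtain L :: nat where "2 * c1 / (1 - \<rho>)\<^sup>2 / (- long_run_var u) < real L" using reals_Archimedean2 by blast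
  moreover have "0 < - long_run_var u" using neg by simp
  ultimately have "2 * c1 / (1 - \<rho>)\<^sup>2 < - (real L * long_run_var u)" by (simp only: pos_divide_less_eq)
  then show False using block_var_approx[OF u, of L] block_var_nonneg[of L "Gc u"] by linarith
qed

lemma long_run_var_le:
  assumes u: "u \<in> {0..1}"
  shows "long_run_var u \<le> c1 + 2 * c1 / (1 - \<rho>)"
  using int_partial_sums_approx_infsum(2)[OF rho c1_nonneg acov_Gc_decay[OF u], of 0] acov_Gc_decay[OF u, of 0]
  unfolding long_run_var_def by (simp add: abs_le_iff)

lemma measurable_Gc: "(\<lambda>(u, x). Gc u x) \<in> borel_measurable (borel \<Otimes>\<^sub>M S)"
  unfolding Gc_def by (rule measurable_centered_kernel[OF meas_G])

text \<open>Differences of consecutive block variances are measurable in \<open>u\<close> and, being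
  symmetric partial sums of autocovariances, converge pointwise to the long-run variance.\<close>

lemma measurable_long_run_var: "(\<lambda>u. indicator {0..1} u * long_run_var u) \<in> borel_measurable borel"
proof (rule borel_measurable_LIMSEQ_real)
  show "(\<lambda>L. indicator {0..1} u * (block_var (Suc L) (Gc u) - block_var L (Gc u))) \<longlonglongrightarrow> indicator {0..1} u * long_run_var u"
    for u :: real
  proof (cases "u \<in> {0..1}")
    case True
    have m: "Gc u \<in> borel_measurable S" using square_int_Gc[OF True] by (simp add: square_int_def)
    have "block_var (Suc l) (Gc u) - block_var l (Gc u) = (\<Sum>h = - int l..int l. acov (Gc u) h)" for l
      unfolding block_var_Suc[OF square_int_Gc[OF True]] sum_int_symmetric
      by (simp add: acov_minus[OF m] sum_distrib_left)
    then show ?thesis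
      unfolding long_run_var_def
      using int_partial_sums_approx_infsum(1)[OF rho c1_nonneg acov_Gc_decay[OF True]]
      by (auto intro!: tendsto_mult)
  qed simp
  show "(\<lambda>u. indicator {0..1} u * (block_var (Suc L) (Gc u) - block_var L (Gc u))) \<in> borel_measurable borel" for L
    by (intro borel_measurable_times borel_measurable_diff measurable_block_var measurable_Gc) auto
qed

end

section \<open>Big blocks\<close>

lemma L2_norm_mono:
  assumes g: "square_int N g" and f: "f \<in> borel_measurable N" and le: "\<And>x. \<bar>f x\<bar> \<le> \<bar>g x\<bar>"
  shows "L2_norm N f \<le> L2_norm N g"
proof -
  have sq: "(f x)\<^sup>2 \<le> (g x)\<^sup>2" for x using le[of x] by (simp add: abs_le_square_iff)
  have "integrable N (\<lambda>x. (f x)\<^sup>2)"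
    by (rule Bochner_Integration.integrable_bound[OF square_intD(2)[OF g]]) (use f sq in auto)
  then have "(\<integral>x. (f x)\<^sup>2 \<partial>N) \<le> (\<integral>x. (g x)\<^sup>2 \<partial>N)"
    using square_intD(2)[OF g] sq by (intro integral_mono) auto
  then show ?thesis by (simp add: L2_norm_def)
qed

lemma bounded_lipschitz_tendsto:
  assumes f: "bounded_lipschitz_D L K f" and x: "cadlag01 x" and xs: "\<And>k. cadlag01 (xs k)"
    and near: "\<And>r. r > 0 \<Longrightarrow> \<forall>\<^sub>F k in sequentially. sup_near (xs k) x r"
  shows "(\<lambda>k. f (xs k)) \<longlonglongrightarrow> f x"
proof (rule tendstoI)
  fix e :: real assume e: "e > 0"
  have L: "0 \<le> L" using f by (simp add: bounded_lipschitz_D_def)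
  have "0 < e / (L + 1)" using e L by simp
  from near[OF this] show "\<forall>\<^sub>F k in sequentially. dist (f (xs k)) (f x) < e"
  proof eventually_elim
    case (elim k)
    have "\<bar>f (xs k) - f x\<bar> \<le> L * (e / (L + 1))" using f x xs[of k] elim unfolding bounded_lipschitz_D_def by blast
    also have "\<dots> < e" using e L by (simp add: field_simps)
    finally show ?case by (simp add: dist_real_def)
  qed
qed

text \<open>The indicator in the measurability hypothesis confines everything to the unit interval,
  the only place where the kernels are bounded in norm.\<close>

lemma set_integral_properties:
  fixes \<psi> :: "real \<Rightarrow> real"
  assumes meas: "(\<lambda>u. indicator {0..1} u * \<psi> u) \<in> borel_measurable borel"
    and bnd: "\<And>u. u \<in> {0..1} \<Longrightarrow> \<bar>\<psi> u\<bar> \<le> Bd"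
  shows set_integrable_bounded: "\<And>a c. 0 \<le> a \<Longrightarrow> c \<le> 1 \<Longrightarrow> set_integrable lborel {a..c} \<psi>"
    and set_integral_Icc_diff: "\<And>v w. 0 \<le> v \<Longrightarrow> v \<le> w \<Longrightarrow> w \<le> 1 \<Longrightarrow>
      (\<integral>u\<in>{0..w}. \<psi> u \<partial>lborel) - (\<integral>u\<in>{0..v}. \<psi> u \<partial>lborel) = (\<integral>u\<in>{v..w}. \<psi> u \<partial>lborel)"
    and abs_set_integral_le: "\<And>v w. 0 \<le> v \<Longrightarrow> v \<le> w \<Longrightarrow> w \<le> 1 \<Longrightarrow> \<bar>\<integral>u\<in>{v..w}. \<psi> u \<partial>lborel\<bar> \<le> Bd * (w - v)"
proof -
  have si: "set_integrable lborel {a..c} \<psi>" if ac: "0 \<le> a" "c \<le> 1" for a c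
    unfolding set_integrable_def
  proof (rule Bochner_Integration.integrable_bound[where f = "\<lambda>u. indicator {a..c} u * Bd"])
    have "emeasure lborel {a..c} < \<infinity>" by (cases "a \<le> c") auto
    then show "integrable lborel (\<lambda>u. indicator {a..c} u * Bd)"
      by (intro integrable_mult_left integrable_real_indicator) auto
    have "(\<lambda>u. indicator {a..c} u *\<^sub>R \<psi> u) = (\<lambda>u. indicator {a..c} u * (indicator {0..1} u * \<psi> u))"
      using ac by (auto simp: indicator_def)
    moreover have "(\<lambda>u. indicator {a..c} u * (indicator {0..1} u * \<psi> u)) \<in> borel_measurable borel"
      by (rule borel_measurable_times[OF _ meas]) auto
    ultimately show "(\<lambda>u. indicator {a..c} u *\<^sub>R \<psi> u) \<in> borel_measurable lborel" by simp
    have "\<bar>\<psi> u\<bar> \<le> \<bar>Bd\<bar>" if "u \<in> {a..c}" for u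
    proof -
      have "u \<in> {0..1}" using that ac by auto
      from bnd[OF this] show ?thesis by linarith
    qed
    then show "AE u in lborel. norm (indicator {a..c} u *\<^sub>R \<psi> u) \<le> norm (indicator {a..c} u * Bd)"
      by (auto simp: indicator_def abs_mult)
  qed
  then show "\<And>a c. 0 \<le> a \<Longrightarrow> c \<le> 1 \<Longrightarrow> set_integrable lborel {a..c} \<psi>" .
  fix v w :: real assume vw: "0 \<le> v" "v \<le> w" "w \<le> 1"
  have i1: "integrable lborel (\<lambda>u. indicator {0..v} u *\<^sub>R \<psi> u)"
    using si[of 0 v] vw by (simp add: set_integrable_def)
  have i2: "integrable lborel (\<lambda>u. indicator {v..w} u *\<^sub>R \<psi> u)"
    using si[of v w] vw by (simp add: set_integrable_def)
  have i3: "integrable lborel (\<lambda>u. indicator {0..w} u *\<^sub>R \<psi> u)"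
    using si[of 0 w] vw by (simp add: set_integrable_def)
  have "(\<integral>u. indicator {0..w} u *\<^sub>R \<psi> u \<partial>lborel) = (\<integral>u. indicator {0..v} u *\<^sub>R \<psi> u + indicator {v..w} u *\<^sub>R \<psi> u \<partial>lborel)"
  proof (rule integral_cong_AE)
    have "AE u in lborel. u \<noteq> v" by (rule AE_lborel_singleton)
    then show "AE u in lborel. indicator {0..w} u *\<^sub>R \<psi> u = indicator {0..v} u *\<^sub>R \<psi> u + indicator {v..w} u *\<^sub>R \<psi> u"
      by eventually_elim (use vw in \<open>auto simp: indicator_def\<close>)
  qed (use i1 i2 i3 in auto)
  then show "(\<integral>u\<in>{0..w}. \<psi> u \<partial>lborel) - (\<integral>u\<in>{0..v}. \<psi> u \<partial>lborel) = (\<integral>u\<in>{v..w}. \<psi> u \<partial>lborel)"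
    using i1 i2 by (simp add: set_lebesgue_integral_def)
  have "\<bar>\<integral>u\<in>{v..w}. \<psi> u \<partial>lborel\<bar> \<le> (\<integral>u. \<bar>indicator {v..w} u *\<^sub>R \<psi> u\<bar> \<partial>lborel)"
    unfolding set_lebesgue_integral_def by (rule integral_abs_bound)
  also have "\<dots> \<le> (\<integral>u. indicator {v..w} u * Bd \<partial>lborel)"
  proof (rule integral_mono[OF integrable_abs[OF i2]])
    show "integrable lborel (\<lambda>u. indicator {v..w} u * Bd)"
      using vw by (intro integrable_mult_left integrable_real_indicator) auto
    show "\<bar>indicator {v..w} u *\<^sub>R \<psi> u\<bar> \<le> indicator {v..w} u * Bd" for u
      using bnd[of u] vw by (auto simp: indicator_def)
  qed
  also have "\<dots> = Bd * (w - v)" using vw by simp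
  finally show "\<bar>\<integral>u\<in>{v..w}. \<psi> u \<partial>lborel\<bar> \<le> Bd * (w - v)" .
qed

lemma set_integral_continuous:
  fixes \<psi> :: "real \<Rightarrow> real"
  assumes meas: "(\<lambda>u. indicator {0..1} u * \<psi> u) \<in> borel_measurable borel"
    and bnd: "\<And>u. u \<in> {0..1} \<Longrightarrow> \<bar>\<psi> u\<bar> \<le> Bd"
  shows "continuous_on {0..1} (\<lambda>v. \<integral>u\<in>{0..v}. \<psi> u \<partial>lborel)"
proof -
  let ?F = "\<lambda>v. \<integral>u\<in>{0..v}. \<psi> u \<partial>lborel"
  have Bd: "0 \<le> Bd" using bnd[of 0] by simp
  have le: "\<bar>?F w - ?F v\<bar> \<le> Bd * \<bar>w - v\<bar>" if "v \<in> {0..1}" "w \<in> {0..1}" for v w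
  proof (cases "v \<le> w")
    case True
    then show ?thesis
      using set_integral_Icc_diff[OF meas bnd, of v w] abs_set_integral_le[OF meas bnd, of v w] that by simp
  next
    case False
    then show ?thesis
      using set_integral_Icc_diff[OF meas bnd, of w v] abs_set_integral_le[OF meas bnd, of w v] that
      by (simp add: abs_minus_commute)
  qed
  have "Bd-lipschitz_on {0..1} ?F"
    by (rule lipschitz_onI) (use le Bd in \<open>auto simp: dist_real_def\<close>)
  then show ?thesis by (rule lipschitz_on_continuous_on)
qed

lemma set_integral_mono_on:
  fixes \<psi> :: "real \<Rightarrow> real"
  assumes meas: "(\<lambda>u. indicator {0..1} u * \<psi> u) \<in> borel_measurable borel"
    and bnd: "\<And>u. u \<in> {0..1} \<Longrightarrow> \<bar>\<psi> u\<bar> \<le> Bd" and nn: "\<And>u. u \<in> {0..1} \<Longrightarrow> 0 \<le> \<psi> u"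
  shows "mono_on {0..1} (\<lambda>v. \<integral>u\<in>{0..v}. \<psi> u \<partial>lborel)"
proof (rule mono_onI)
  fix v w :: real assume vw: "v \<in> {0..1}" "w \<in> {0..1}" "v \<le> w"
  have "0 \<le> (\<integral>u\<in>{v..w}. \<psi> u \<partial>lborel)"
    unfolding set_lebesgue_integral_def
    by (rule integral_nonneg_AE) (use vw nn in \<open>auto simp: indicator_def\<close>)
  then show "(\<integral>u\<in>{0..v}. \<psi> u \<partial>lborel) \<le> (\<integral>u\<in>{0..w}. \<psi> u \<partial>lborel)"
    using set_integral_Icc_diff[OF meas bnd, of v w] vw by simp
qed

lemma set_integral_zero:
  fixes \<psi> :: "real \<Rightarrow> real"
  shows "(\<integral>u\<in>{0..0}. \<psi> u \<partial>lborel) = 0"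
proof -
  have "(\<integral>u\<in>{0..0}. \<psi> u \<partial>lborel) = (\<integral>u. 0 \<partial>(lborel :: real measure))"
    unfolding set_lebesgue_integral_def
  proof (rule integral_cong_AE)
    have "AE u in lborel. u \<noteq> (0::real)" by (rule AE_lborel_singleton)
    then show "AE u in lborel. indicator {0..0} u *\<^sub>R \<psi> u = 0"
      by eventually_elim auto
    have "(\<lambda>u. indicator {0..0} u *\<^sub>R \<psi> u) = (\<lambda>u::real. indicator {0} u * \<psi> 0)"
      by (auto simp: indicator_def)
    then show "(\<lambda>u. indicator {0..0} u *\<^sub>R \<psi> u) \<in> borel_measurable lborel" by simp
  qed simp
  then show ?thesis by simp
qed

lemma set_integral_close:
  fixes \<psi> \<phi> :: "real \<Rightarrow> real"
  assumes \<psi>: "(\<lambda>u. indicator {0..1} u * \<psi> u) \<in> borel_measurable borel" "\<And>u. u \<in> {0..1} \<Longrightarrow> \<bar>\<psi> u\<bar> \<le> B1"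
    and \<phi>: "(\<lambda>u. indicator {0..1} u * \<phi> u) \<in> borel_measurable borel" "\<And>u. u \<in> {0..1} \<Longrightarrow> \<bar>\<phi> u\<bar> \<le> B2"
    and e: "\<And>u. u \<in> {0..1} \<Longrightarrow> \<bar>\<psi> u - \<phi> u\<bar> \<le> e" and v: "v \<in> {0..1}"
  shows "\<bar>(\<integral>u\<in>{0..v}. \<psi> u \<partial>lborel) - (\<integral>u\<in>{0..v}. \<phi> u \<partial>lborel)\<bar> \<le> e"
proof -
  have e0: "0 \<le> e" using e[of 0] by simp
  have m: "(\<lambda>u. indicator {0..1} u * (\<psi> u - \<phi> u)) \<in> borel_measurable borel"
    using borel_measurable_diff[OF \<psi>(1) \<phi>(1)] by (simp add: right_diff_distrib)
  have "(\<integral>u\<in>{0..v}. \<psi> u \<partial>lborel) - (\<integral>u\<in>{0..v}. \<phi> u \<partial>lborel) = (\<integral>u\<in>{0..v}. \<psi> u - \<phi> u \<partial>lborel)"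
    by (rule set_integral_diff(2)[symmetric]; rule set_integrable_bounded) (use \<psi> \<phi> v in auto)
  also have "\<bar>\<dots>\<bar> \<le> e * (v - 0)"
    by (rule abs_set_integral_le[OF m]) (use e v in auto)
  also have "\<dots> \<le> e" using v e0 by (simp add: mult_left_le)
  finally show ?thesis .
qed

section \<open>Truncated and averaged kernels\<close>

context kernel_array
begin

lemma measurable_G: "G u \<in> borel_measurable S"
  using measurable_compose[OF measurable_Pair1' meas_G, of u] by simp

lemma measurable_trunc_G: "(\<lambda>x. trunc K (G u x)) \<in> borel_measurable S"
  by (rule measurable_compose[OF measurable_G measurable_trunc])

text \<open>Truncation gives boundedness, averaging gives dependence on \<open>m\<close> entries,
  and centring restores mean zero. Each of the three operations is a contraction in
  \<open>L2\<close>, so the estimates in that norm do not deteriorate with \<open>m\<close> or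
  \<open>K\<close>.\<close>

definition hK :: "nat \<Rightarrow> real \<Rightarrow> real \<Rightarrow> (nat \<Rightarrow> real) \<Rightarrow> real" where
  "hK m K u x = head_mean m (\<lambda>y. trunc K (G u y)) x - (\<integral>y. head_mean m (\<lambda>y. trunc K (G u y)) y \<partial>S)"

lemma measurable_hK: "(\<lambda>(u, x). hK m K u x) \<in> borel_measurable (borel \<Otimes>\<^sub>M S)"
proof -
  have "(\<lambda>(u, x). trunc K (G u x)) \<in> borel_measurable (borel \<Otimes>\<^sub>M S)"
    using measurable_compose[OF meas_G measurable_trunc] by (simp add: split_beta')
  from measurable_centered_kernel[OF measurable_head_mean_param[OF this, of m]]
  show ?thesis by (simp add: hK_def)
qed

lemma hK_cong: "(\<And>k. k < m \<Longrightarrow> x k = y k) \<Longrightarrow> hK m K u x = hK m K u y"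
  unfolding hK_def using head_mean_cong[of m x y "\<lambda>y. trunc K (G u y)"] by simp

context
  fixes K :: real
  assumes K: "0 \<le> K"
begin

lemma square_int_trunc_G: "square_int S (\<lambda>x. trunc K (G u x))"
  by (rule P.square_int_bounded[OF measurable_trunc_G, of _ _ K]) (use K in \<open>auto intro: trunc_bounded\<close>)

lemma hK_bounded: "\<bar>hK m K u x\<bar> \<le> 2 * K"
proof -
  have h: "\<bar>head_mean m (\<lambda>y. trunc K (G u y)) x\<bar> \<le> K" for x
    by (rule head_mean_bounded[OF measurable_trunc_G]) (rule trunc_bounded[OF K])
  have "\<bar>\<integral>y. head_mean m (\<lambda>y. trunc K (G u y)) y \<partial>S\<bar> \<le> (\<integral>y. \<bar>head_mean m (\<lambda>y. trunc K (G u y)) y\<bar> \<partial>S)"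
    by (rule integral_abs_bound)
  also have "\<dots> \<le> K"
    by (rule P.integral_le_const[OF integrable_abs[OF P.square_int_integrable[OF head_mean_square(1)[OF square_int_trunc_G]]]])
       (use h in auto)
  finally show ?thesis using h[of x] unfolding hK_def by linarith
qed

lemma square_int_hK: "square_int S (hK m K u)"
  unfolding hK_def[abs_def] by (intro P.square_int_centered head_mean_square(1) square_int_trunc_G)

lemma hK_mean: "(\<integral>x. hK m K u x \<partial>S) = 0"
  unfolding hK_def using P.square_int_integrable[OF head_mean_square(1)[OF square_int_trunc_G]] P.prob_space by simp

lemma L2_norm_trunc_G: "u \<in> {0..1} \<Longrightarrow> L2_norm S (\<lambda>x. trunc K (G u x)) \<le> A"
  using L2_norm_mono[OF sq_G measurable_trunc_G abs_trunc_le[OF K]] norm_G by (meson order_trans)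

lemma L2_norm_hK:
  assumes "u \<in> {0..1}"
  shows "L2_norm S (hK m K u) \<le> A"
proof -
  have "L2_norm S (hK m K u) \<le> L2_norm S (head_mean m (\<lambda>x. trunc K (G u x)))"
    unfolding hK_def[abs_def] by (rule P.L2_norm_centered_le[OF head_mean_square(1)[OF square_int_trunc_G]])
  also have "\<dots> \<le> L2_norm S (\<lambda>x. trunc K (G u x))"
    unfolding L2_norm_def using head_mean_square(2)[OF square_int_trunc_G] by simp
  also have "\<dots> \<le> A" by (rule L2_norm_trunc_G[OF assms])
  finally show ?thesis .
qed

text \<open>The kernel \<open>g\<close> is arbitrary: taken from the array it measures the cost of
  freezing and truncating, taken as the truncation at another time it gives regularity in
  time.\<close>

lemma hK_diff_le:
  assumes g: "square_int S g"
  shows "L2_norm S (\<lambda>x. (head_mean m g x - (\<integral>y. head_mean m g y \<partial>S)) - hK m K u x)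
    \<le> L2_norm S (\<lambda>x. g x - trunc K (G u x))"
  unfolding hK_def
  using P.L2_norm_centered_diff_le[OF head_mean_square(1)[OF g] head_mean_square(1)[OF square_int_trunc_G]]
    head_mean_diff_le[OF g square_int_trunc_G] by (meson order_trans)

lemma hK_lipschitz:
  assumes "u \<in> {0..1}" "v \<in> {0..1}"
  shows "L2_norm S (\<lambda>x. hK m K u x - hK m K v x) \<le> gdist u v"
proof -
  have "L2_norm S (\<lambda>x. hK m K u x - hK m K v x) \<le> L2_norm S (\<lambda>x. trunc K (G u x) - trunc K (G v x))"
    using hK_diff_le[OF square_int_trunc_G, of m u v] by (simp add: hK_def)
  also have "\<dots> \<le> gdist u v"
    unfolding gdist_def
    by (rule L2_norm_mono[OF square_int_diff[OF sq_G[OF assms(1)] sq_G[OF assms(2)]]])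
       (auto intro!: borel_measurable_diff measurable_trunc_G trunc_lipschitz)
  finally show ?thesis .
qed

lemma hK_approx:
  assumes u: "u \<in> {0..1}" and m: "m \<ge> 1"
  shows "L2_norm S (\<lambda>x. hK m K u x - Gc u x)
    \<le> L2_norm S (\<lambda>x. G u x - trunc K (G u x)) + C / (1 - \<rho>) * \<rho> ^ m"
proof -
  let ?T = "\<lambda>x. trunc K (G u x)"
  note sT = square_int_trunc_G[of u] and sG = sq_G[OF u]
  have "L2_norm S (\<lambda>x. hK m K u x - Gc u x) \<le> L2_norm S (\<lambda>x. head_mean m ?T x - G u x)"
    unfolding hK_def Gc_def by (rule P.L2_norm_centered_diff_le[OF head_mean_square(1)[OF sT] sG])
  also have "\<dots> \<le> L2_norm S (\<lambda>x. head_mean m ?T x - head_mean m (G u) x) + L2_norm S (\<lambda>x. head_mean m (G u) x - G u x)"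
    by (rule L2_norm_triangle_diff[OF head_mean_square(1)[OF sT] head_mean_square(1)[OF sG] sG])
  also have "L2_norm S (\<lambda>x. head_mean m ?T x - head_mean m (G u) x) \<le> L2_norm S (\<lambda>x. ?T x - G u x)"
    by (rule head_mean_diff_le[OF sT sG])
  also have "\<dots> = L2_norm S (\<lambda>x. G u x - ?T x)" by (rule L2_norm_minus_commute)
  also have "L2_norm S (\<lambda>x. head_mean m (G u) x - G u x) = L2_norm S (\<lambda>x. G u x - head_mean m (G u) x)"
    by (rule L2_norm_minus_commute)
  also have "\<dots> \<le> C / (1 - \<rho>) * \<rho> ^ m" by (rule head_mean_approx_G[OF u m])
  finally show ?thesis by simp
qed

end

text \<open>The kernel is frozen at the rescaled time just before the block. The positions
  \<open>L + 1..L + m\<close> of each block are left out to separate consecutive blocks.\<close>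

definition block_sum :: "nat \<Rightarrow> real \<Rightarrow> nat \<Rightarrow> nat \<Rightarrow> nat \<Rightarrow> 'a \<Rightarrow> real" where
  "block_sum m K L n r \<omega> =
     (\<Sum>t = 1..L. hK m K ((real r - 1) * real (L + m) / real n) (shift_vec eps (int ((r - 1) * (L + m) + t)) \<omega>))"

text \<open>The block sums spread out over time, with \<open>0\<close> in the gaps, so that they can
  be compared with the original array term by term. The shift \<open>t - 1\<close> lets positions
  within a block start at 0.\<close>

definition block_term :: "nat \<Rightarrow> real \<Rightarrow> nat \<Rightarrow> nat \<Rightarrow> nat \<Rightarrow> (nat \<Rightarrow> real) \<Rightarrow> real" where
  "block_term m K L n t x =
     (if (t - 1) mod (L + m) < L then hK m K (real ((t - 1) div (L + m) * (L + m)) / real n) x else 0)"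

lemma block_term_sums:
  assumes b: "L + m \<ge> 1"
  shows "(\<Sum>t = 1..q * (L + m). block_term m K L n t (shift_vec eps (int t) \<omega>)) = (\<Sum>r = 1..q. block_sum m K L n r \<omega>)"
proof (induction q)
  case (Suc q)
  let ?b = "L + m"
  let ?f = "\<lambda>t. block_term m K L n t (shift_vec eps (int t) \<omega>)"
  have dm: "(q * ?b + s - 1) mod ?b = s - 1 \<and> (q * ?b + s - 1) div ?b = q" if s: "1 \<le> s" "s \<le> ?b" for s
  proof -
    obtain r where r: "s = Suc r" using s(1) by (cases s) auto
    have lt: "r < ?b" using s(2) r by simp
    have nz: "?b \<noteq> 0" using lt by linarith
    have "(q * ?b + r) mod ?b = r" using lt by simp
    moreover have "(q * ?b + r) div ?b = q" by (simp only: div_mult_self3[OF nz] div_less[OF lt] add_0_right)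
    ultimately have "(q * ?b + r) mod ?b = r" "(q * ?b + r) div ?b = q" by auto
    then show ?thesis using r by simp
  qed
  have "{1..Suc q * ?b} = {1..q * ?b} \<union> {q * ?b + 1..q * ?b + ?b}" by auto
  then have "(\<Sum>t = 1..Suc q * ?b. ?f t) = (\<Sum>t = 1..q * ?b. ?f t) + (\<Sum>t = q * ?b + 1..q * ?b + ?b. ?f t)"
    by (simp add: sum.union_disjoint)
  also have "(\<Sum>t = q * ?b + 1..q * ?b + ?b. ?f t) = (\<Sum>s = 1..?b. ?f (q * ?b + s))"
    using sum.shift_bounds_cl_nat_ivl[of ?f 1 "q * ?b" ?b] by (simp add: add.commute)
  also have "\<dots> = (\<Sum>s = 1..L. ?f (q * ?b + s))"
  proof (rule sum.mono_neutral_right)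
    show "\<forall>s\<in>{1..?b} - {1..L}. ?f (q * ?b + s) = 0"
    proof
      fix s assume s: "s \<in> {1..?b} - {1..L}"
      then have "\<not> (q * ?b + s - 1) mod ?b < L" using dm[of s] by auto
      then show "?f (q * ?b + s) = 0" by (simp add: block_term_def)
    qed
  qed auto
  also have "\<dots> = block_sum m K L n (Suc q) \<omega>"
    unfolding block_sum_def
  proof (rule sum.cong[OF refl])
    fix s assume s: "s \<in> {1..L}"
    have "(q * ?b + s - 1) mod ?b = s - 1" "(q * ?b + s - 1) div ?b = q"
      using dm[of s] s by auto
    moreover have "s - 1 < L" using s by auto
    ultimately show "?f (q * ?b + s) = hK m K ((real (Suc q) - 1) * real ?b / real n) (shift_vec eps (int ((Suc q - 1) * ?b + s)) \<omega>)"
      by (simp add: block_term_def)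
  qed
  finally show ?case using Suc by simp
qed simp

text \<open>The floor of \<open>n * v / (L + m)\<close> is the number of blocks completed by time
  \<open>n * v\<close>, so the two paths differ only by an incomplete block of at most
  \<open>L + m\<close> terms bounded by \<open>2 * K\<close>.\<close>

lemma block_term_near:
  assumes K: "0 \<le> K" and n: "n \<ge> 1" and b: "L + m \<ge> 1"
  shows "sup_near (psum (real n) (\<lambda>t. block_term m K L n t (shift_vec eps (int t) \<omega>) / sqrt (real n)))
     (psum (real n / real (L + m)) (\<lambda>r. block_sum m K L n r \<omega> / sqrt (real n)))
     (2 * K * real (L + m) / sqrt (real n))"
  unfolding sup_near_def
proof
  fix v :: real assume v: "v \<in> {0..1}"
  let ?b = "L + m"
  let ?f = "\<lambda>t. block_term m K L n t (shift_vec eps (int t) \<omega>)"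
  define k where "k = nat \<lfloor>real n * v\<rfloor>"
  define q where "q = k div ?b"
  have "\<lfloor>real n / real ?b * v\<rfloor> = \<lfloor>(real n * v) / real_of_int (int ?b)\<rfloor>" by (simp add: mult.commute)
  also have "\<dots> = \<lfloor>real n * v\<rfloor> div int ?b" by (rule floor_divide_real_eq_div) simp
  finally have q: "nat \<lfloor>real n / real ?b * v\<rfloor> = q"
    using v by (simp add: q_def k_def nat_div_distrib del: of_nat_add)
  have "k - q * ?b = k mod ?b" by (simp add: q_def minus_div_mult_eq_mod)
  moreover have "k mod ?b < ?b" by (rule mod_less_divisor) (use b in linarith)
  ultimately have qk: "q * ?b \<le> k" "k - q * ?b \<le> ?b"
    unfolding q_def by auto
  have fb: "\<bar>?f t\<bar> \<le> 2 * K" for t using hK_bounded[OF K] K by (auto simp: block_term_def)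
  have "{1..k} = {1..q * ?b} \<union> {q * ?b + 1..k}" using qk by auto
  then have "(\<Sum>t = 1..k. ?f t) = (\<Sum>t = 1..q * ?b. ?f t) + (\<Sum>t = q * ?b + 1..k. ?f t)"
    by (simp add: sum.union_disjoint)
  then have "(\<Sum>t = 1..k. ?f t) = (\<Sum>r = 1..q. block_sum m K L n r \<omega>) + (\<Sum>t = q * ?b + 1..k. ?f t)"
    unfolding block_term_sums[OF b] .
  moreover have "\<bar>\<Sum>t = q * ?b + 1..k. ?f t\<bar> \<le> 2 * K * real ?b"
  proof -
    have "\<bar>\<Sum>t = q * ?b + 1..k. ?f t\<bar> \<le> (\<Sum>t = q * ?b + 1..k. 2 * K)"
      by (rule order_trans[OF sum_abs sum_mono]) (rule fb)
    also have "\<dots> = real (k - q * ?b) * (2 * K)" by simp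
    also have "\<dots> \<le> real ?b * (2 * K)"
    proof (rule mult_right_mono)
      show "real (k - q * ?b) \<le> real ?b" using qk(2) by (simp only: of_nat_le_iff)
    qed (use K in simp)
    finally show ?thesis by (simp add: mult.commute)
  qed
  moreover have "psum (real n) (\<lambda>t. ?f t / sqrt (real n)) v - psum (real n / real ?b) (\<lambda>r. block_sum m K L n r \<omega> / sqrt (real n)) v
      = ((\<Sum>t = 1..k. ?f t) - (\<Sum>r = 1..q. block_sum m K L n r \<omega>)) / sqrt (real n)"
    unfolding psum_def q k_def[symmetric] by (simp only: sum_divide_distrib[symmetric] diff_divide_distrib)
  ultimately show "\<bar>psum (real n) (\<lambda>t. ?f t / sqrt (real n)) v - psum (real n / real ?b) (\<lambda>r. block_sum m K L n r \<omega> / sqrt (real n)) v\<bar>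
      \<le> 2 * K * real ?b / sqrt (real n)"
    by (simp add: abs_divide divide_right_mono)
qed

text \<open>A block reads at most \<open>m\<close> innovations before its first time, and the
  preceding block leaves its last \<open>m\<close> times free; the windows \<open>W r\<close> are
  therefore disjoint.\<close>

lemma indep_block_sum:
  "base.indep_vars (\<lambda>_. borel) (block_sum m K L n) {1..N}"
proof -
  let ?b = "L + m"
  define F where "F r x = (\<Sum>t = 1..L. hK m K ((real r - 1) * real ?b / real n) (\<lambda>k. x (int ((r - 1) * ?b + t) - int k)))"
    for r and x :: "int \<Rightarrow> real"
  define W where "W r = {int ((r - 1) * ?b) + 1 - int m..int ((r - 1) * ?b + L)}" for r
  have "base.indep_vars (\<lambda>_. borel) (\<lambda>r \<omega>. F r (\<lambda>i. eps i \<omega>)) {1..N}"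
  proof (rule base.indep_vars_local[OF indep_eps, where K = W])
    have "W r \<inter> W s = {}" if "r < s" "1 \<le> r" for r s
    proof -
      have "r * ?b \<le> (s - 1) * ?b" using that by (intro mult_right_mono) auto
      moreover have "r * ?b = (r - 1) * ?b + ?b" using that by (cases r) auto
      ultimately have "int ((r - 1) * ?b) + int L + int m \<le> int ((s - 1) * ?b)" by linarith
      then show ?thesis unfolding W_def by auto
    qed
    then show "disjoint_family_on W {1..N}"
      unfolding disjoint_family_on_def by (metis atLeastAtMost_iff inf_commute linorder_neqE_nat)
    have mh: "hK m K u \<in> borel_measurable S" for u
      using measurable_compose[OF measurable_Pair1' measurable_hK, of u] by simp
    show "F r \<in> borel_measurable (PiM UNIV (\<lambda>_. borel))" for r
      unfolding F_def by (intro borel_measurable_sum measurable_kernel_coords mh)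
    fix r and x y :: "int \<Rightarrow> real" assume xy: "\<And>i. i \<in> W r \<Longrightarrow> x i = y i"
    show "F r x = F r y"
      unfolding F_def by (intro sum.cong refl hK_cong xy) (auto simp: W_def)
  qed
  then show ?thesis
    by (rule base.indep_vars_cong[THEN iffD1, rotated 3]) (auto simp: F_def block_sum_def shift_vec_def)
qed

lemma expectation_block_sum:
  assumes K: "0 \<le> K"
  shows "base.expectation (block_sum m K L n r) = 0"
proof -
  have "base.expectation (block_sum m K L n r) = (\<Sum>t = 1..L. base.expectation (\<lambda>\<omega>.
     hK m K ((real r - 1) * real (L + m) / real n) (shift_vec eps (int ((r - 1) * (L + m) + t)) \<omega>)))"
    unfolding block_sum_def[abs_def]
    by (rule Bochner_Integration.integral_sum) (intro base.square_int_integrable square_int_shift square_int_hK K)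
  also have "\<dots> = 0"
    by (rule sum.neutral) (simp add: expectation_shift[OF square_intD(1)[OF square_int_hK[OF K]]] hK_mean[OF K])
  finally show ?thesis .
qed

text \<open>Variance per unit of time: the divisor includes the gap, because blocks occur at rate
  \<open>1 / (L + m)\<close>.\<close>

definition block_rate :: "nat \<Rightarrow> real \<Rightarrow> nat \<Rightarrow> real \<Rightarrow> real" where
  "block_rate m K L u = block_var L (hK m K u) / real (L + m)"

lemma measurable_block_rate: "(\<lambda>u. indicator {0..1} u * block_rate m K L u) \<in> borel_measurable borel"
  unfolding block_rate_def
  by (intro borel_measurable_times borel_measurable_divide measurable_block_var measurable_hK) auto

lemma block_rate_bounds:
  assumes K: "0 \<le> K" and u: "u \<in> {0..1}"
  shows "0 \<le> block_rate m K L u" "\<bar>block_rate m K L u\<bar> \<le> (real L * A)\<^sup>2 / real (L + m)"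
  unfolding block_rate_def using block_var_nonneg block_var_le[OF square_int_hK[OF K] L2_norm_hK[OF K u], of L m]
  by (auto intro: divide_right_mono simp del: of_nat_add)

text \<open>The invariance principle with \<open>b = L + m\<close> and summands bounded by
  \<open>2 * K * L\<close>. By stationarity the variance of block \<open>r\<close> is
  \<open>b\<close> times the block rate at its starting time, so the variance condition is the
  convergence of a Riemann sum.\<close>

lemma block_process_tendsto:
  assumes BM: "std_brownian_motion N B" and K: "0 \<le> K" and b: "L + m \<ge> 1"
    and f: "bounded_lipschitz_D Lf Kf f"
  shows "(\<lambda>n. base.expectation (\<lambda>\<omega>. f (psum (real n / real (L + m)) (\<lambda>r. block_sum m K L n r \<omega> / sqrt (real n)))))
    \<longlonglongrightarrow> (\<integral>\<omega>. f (\<lambda>v. B (\<integral>u\<in>{0..v}. block_rate m K L u \<partial>lborel) \<omega>) \<partial>N)"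
proof (rule donsker_bounded_array[OF base.prob_space_axioms BM _ _ _ _ _ _ _ _ _ f, where c = "real L * (2 * K)"])
  let ?b = "real (L + m)"
  show b0: "0 < ?b" using b by simp
  show "0 \<le> real L * (2 * K)" using K by simp
  show "base.indep_vars (\<lambda>_. borel) (block_sum m K L n) {1..nat \<lfloor>real n / ?b\<rfloor>}" for n
    by (rule indep_block_sum)
  show "\<bar>block_sum m K L n r \<omega>\<bar> \<le> real L * (2 * K)" for n r \<omega>
  proof -
    have "\<bar>block_sum m K L n r \<omega>\<bar> \<le> (\<Sum>t = 1..L. 2 * K)"
      unfolding block_sum_def by (rule order_trans[OF sum_abs sum_mono]) (rule hK_bounded[OF K])
    then show ?thesis by simp
  qed
  show "base.expectation (block_sum m K L n r) = 0" for n r by (rule expectation_block_sum[OF K])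
  fix v :: real assume v: "v \<in> {0..1}"
  have var: "base.expectation (\<lambda>\<omega>. (block_sum m K L n r \<omega>)\<^sup>2) = ?b * block_rate m K L ((real r - 1) * ?b / real n)" for n r
    unfolding block_sum_def block_rate_def
    using block_var_translate[OF square_intD(1)[OF square_int_hK[OF K, of m "(real r - 1) * ?b / real n"]], of "(r - 1) * (L + m)" L] b0
    by (simp del: of_nat_add of_nat_mult)
  have "(\<lambda>n. (?b / real n) * (\<Sum>r = 1..nat \<lfloor>real n / ?b * v\<rfloor>. block_rate m K L ((real r - 1) * ?b / real n)))
    \<longlonglongrightarrow> (\<integral>u\<in>{0..v}. block_rate m K L u \<partial>lborel)"
  proof (rule riemann_sum_tendsto[OF b0 _ measurable_block_rate block_rate_bounds(2)[OF K] _ v])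
    show "0 \<le> 2 * A * (real L)\<^sup>2 / ?b" using A_nonneg by simp
    fix u w :: real assume u: "u \<in> {0..1}" and w: "w \<in> {0..1}"
    have "\<bar>block_var L (hK m K u) - block_var L (hK m K w)\<bar> \<le> 2 * A * (real L)\<^sup>2 * L2_norm S (\<lambda>x. hK m K u x - hK m K w x)"
      by (intro block_var_diff_le square_int_hK K L2_norm_hK u w)
    also have "\<dots> \<le> 2 * A * (real L)\<^sup>2 * gdist u w"
      using hK_lipschitz[OF K u w] A_nonneg by (intro mult_left_mono) auto
    finally show "\<bar>block_rate m K L u - block_rate m K L w\<bar> \<le> 2 * A * (real L)\<^sup>2 / ?b * gdist u w"
      unfolding block_rate_def diff_divide_distrib[symmetric] abs_divide using b0
      by (simp add: divide_right_mono del: of_nat_add)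
  qed
  then show "(\<lambda>n. (\<Sum>r = 1..nat \<lfloor>real n / ?b * v\<rfloor>. base.expectation (\<lambda>\<omega>. (block_sum m K L n r \<omega>)\<^sup>2)) / real n)
      \<longlonglongrightarrow> (\<integral>u\<in>{0..v}. block_rate m K L u \<partial>lborel)"
    unfolding var by (simp add: sum_distrib_left sum_divide_distrib del: of_nat_add)
next
  show "(\<integral>u\<in>{0..0}. block_rate m K L u \<partial>lborel) = 0" by (rule set_integral_zero)
  show "mono_on {0..1} (\<lambda>v. \<integral>u\<in>{0..v}. block_rate m K L u \<partial>lborel)"
    by (rule set_integral_mono_on[OF measurable_block_rate block_rate_bounds(2)[OF K] block_rate_bounds(1)[OF K]])
  show "continuous_on {0..1} (\<lambda>v. \<integral>u\<in>{0..v}. block_rate m K L u \<partial>lborel)"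
    by (rule set_integral_continuous[OF measurable_block_rate block_rate_bounds(2)[OF K]])
qed

text \<open>Three errors: the replaced kernel, whose cost is multiplied by \<open>L\<close>; the
  finite block length, with an error bounded before division by \<open>L\<close>; and the gap, which
  dilutes the variance by a share of at most \<open>m / L\<close>.\<close>

lemma block_rate_close:
  assumes K: "0 \<le> K" and u: "u \<in> {0..1}" and m: "m \<ge> 1" and L: "L \<ge> 1"
    and kap: "L2_norm S (\<lambda>x. G u x - trunc K (G u x)) \<le> kap"
  shows "\<bar>block_rate m K L u - long_run_var u\<bar>
    \<le> 2 * A * real L * (kap + C / (1 - \<rho>) * \<rho> ^ m) + 2 * c1 / (1 - \<rho>)\<^sup>2 / real L
      + (c1 + 2 * c1 / (1 - \<rho>)) * (real m / real L)"
proof -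
  let ?b = "real (L + m)" and ?s = "long_run_var u"
  define d where "d = kap + C / (1 - \<rho>) * \<rho> ^ m"
  have d0: "0 \<le> d" using order_trans[OF L2_norm_nonneg kap] C_nonneg rho by (simp add: d_def)
  have Lp: "0 < real L" using L by simp
  have bL: "real L \<le> ?b" by simp
  have "\<bar>block_var L (hK m K u) - block_var L (Gc u)\<bar> \<le> 2 * A * (real L)\<^sup>2 * L2_norm S (\<lambda>x. hK m K u x - Gc u x)"
    by (intro block_var_diff_le square_int_hK K L2_norm_hK u square_int_Gc L2_norm_Gc)
  also have "\<dots> \<le> 2 * A * (real L)\<^sup>2 * d"
    using hK_approx[OF K u m] kap A_nonneg by (intro mult_left_mono) (auto simp: d_def)
  finally have 1: "\<bar>block_var L (hK m K u) - block_var L (Gc u)\<bar> \<le> 2 * A * (real L)\<^sup>2 * d" .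
  note 2 = block_var_approx[OF u, of L]
  have 3: "\<bar>real L * ?s - ?b * ?s\<bar> \<le> real m * (c1 + 2 * c1 / (1 - \<rho>))"
  proof -
    have "\<bar>real L * ?s - ?b * ?s\<bar> = real m * ?s"
      using long_run_var_nonneg[OF u] by (simp add: algebra_simps)
    also have "\<dots> \<le> real m * (c1 + 2 * c1 / (1 - \<rho>))"
      by (rule mult_left_mono[OF long_run_var_le[OF u]]) simp
    finally show ?thesis .
  qed
  have "\<bar>block_rate m K L u - ?s\<bar> = \<bar>block_var L (hK m K u) - ?b * ?s\<bar> / ?b"
  proof -
    have "block_rate m K L u - ?s = (block_var L (hK m K u) - ?b * ?s) / ?b"
      unfolding block_rate_def using Lp by (simp add: field_simps)
    then show ?thesis by (simp add: abs_divide)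
  qed
  also have "\<dots> \<le> (2 * A * (real L)\<^sup>2 * d + 2 * c1 / (1 - \<rho>)\<^sup>2 + real m * (c1 + 2 * c1 / (1 - \<rho>))) / ?b"
    using 1 2 3 by (intro divide_right_mono) linarith+
  also have "\<dots> \<le> (2 * A * (real L)\<^sup>2 * d + 2 * c1 / (1 - \<rho>)\<^sup>2 + real m * (c1 + 2 * c1 / (1 - \<rho>))) / real L"
  proof (rule divide_left_mono[OF bL])
    show "0 \<le> 2 * A * (real L)\<^sup>2 * d + 2 * c1 / (1 - \<rho>)\<^sup>2 + real m * (c1 + 2 * c1 / (1 - \<rho>))"
      using A_nonneg d0 c1_nonneg rho by (intro add_nonneg_nonneg mult_nonneg_nonneg divide_nonneg_nonneg) auto
  qed (use Lp in simp)
  also have "\<dots> = 2 * A * real L * d + 2 * c1 / (1 - \<rho>)\<^sup>2 / real L + (c1 + 2 * c1 / (1 - \<rho>)) * (real m / real L)"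
    using Lp by (simp add: add_divide_distrib power2_eq_square mult.commute)
  finally show ?thesis by (simp add: d_def)
qed

end

section \<open>Replacing the process by its blocks\<close>

text \<open>A time in a gap is determined by its block number and its position in the gap; the
  \<open>+ 1\<close> accounts for the last, incomplete block.\<close>

lemma gap_count:
  assumes b: "L + m \<ge> 1"
  shows "card {t \<in> {1..n}. \<not> (t - 1) mod (L + m) < L} \<le> (n div (L + m) + 1) * m"
proof -
  let ?b = "L + m"
  have "{t \<in> {1..n}. \<not> (t - 1) mod ?b < L} \<subseteq> (\<lambda>(q, s). q * ?b + s + 1) ` ({..n div ?b} \<times> {L..<?b})"
  proof
    fix t assume t: "t \<in> {t \<in> {1..n}. \<not> (t - 1) mod ?b < L}"
    have "(t - 1) div ?b * ?b + (t - 1) mod ?b = t - 1" by (rule div_mult_mod_eq)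
    moreover have "1 \<le> t" using t by simp
    ultimately have "t = (t - 1) div ?b * ?b + (t - 1) mod ?b + 1" by linarith
    moreover have "(t - 1) div ?b \<le> n div ?b" using t by (intro div_le_mono) auto
    moreover have "(t - 1) mod ?b < ?b" by (rule mod_less_divisor) (use b in linarith)
    ultimately show "t \<in> (\<lambda>(q, s). q * ?b + s + 1) ` ({..n div ?b} \<times> {L..<?b})"
      using t by (intro image_eqI[of _ _ "((t - 1) div ?b, (t - 1) mod ?b)"]) auto
  qed
  then have "card {t \<in> {1..n}. \<not> (t - 1) mod ?b < L} \<le> card ((\<lambda>(q, s). q * ?b + s + 1) ` ({..n div ?b} \<times> {L..<?b}))"
    by (rule card_mono[rotated]) simp
  also have "\<dots> \<le> card ({..n div ?b} \<times> {L..<?b})" by (rule card_image_le) simp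
  also have "\<dots> = (n div ?b + 1) * m" by (simp add: card_cartesian_product)
  finally show ?thesis .
qed

text \<open>The base \<open>sqrt \<rho>\<close> is chosen because \<open>decay_weight\<close>
  squares its base; a summable sequence then dominates.\<close>

lemma poly_geometric_tendsto_zero:
  fixes \<rho> :: real
  assumes "0 < \<rho>" "\<rho> < 1"
  shows "(\<lambda>m. real m ^ 4 * \<rho> ^ m) \<longlonglongrightarrow> 0"
proof -
  have "summable (decay_weight 1 (sqrt \<rho>))"
    by (rule summable_decay_weight) (use assms in auto)
  then have lim: "decay_weight 1 (sqrt \<rho>) \<longlonglongrightarrow> 0" by (rule summable_LIMSEQ_zero)
  have "real m ^ 4 * \<rho> ^ m \<le> decay_weight 1 (sqrt \<rho>) m" for m
  proof -
    have "real m ^ 4 \<le> real (Suc m) ^ 4" by (rule power_mono) auto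
    also have "\<dots> \<le> real (Suc m) ^ 6" by (rule power_increasing) auto
    also have "\<dots> \<le> 32 * real (Suc m) ^ 6" by simp
    finally have "real m ^ 4 * \<rho> ^ m \<le> 32 * real (Suc m) ^ 6 * \<rho> ^ m"
      using assms by (intro mult_right_mono) auto
    then show ?thesis using assms by (simp add: decay_weight_def)
  qed
  then show ?thesis
    using assms by (intro tendsto_sandwich[OF always_eventually always_eventually tendsto_const lim]) auto
qed

context kernel_array
begin

text \<open>The gaps between blocks have density m / (L + m), and the regularity in the time
  variable controls freezing it at the start of each block.\<close>

lemma block_replacement:
  assumes m: "m \<ge> 1" and n: "n \<ge> 1" and K: "0 \<le> K" and e: "e > 0"
    and kap: "\<And>u. u \<in> {0..1} \<Longrightarrow> L2_norm S (\<lambda>x. G u x - trunc K (G u x)) \<le> kap"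
    and en: "\<And>u. u \<in> {0..1} \<Longrightarrow> L2_norm S (\<lambda>x. Gn n u x - G u x) \<le> en"
  shows "base.prob {\<omega>\<in>space \<Omega>. \<exists>k\<le>n. e * sqrt (real n) < \<bar>\<Sum>t = 1..k.
       (head_mean m (Gn n (real t / real n)) (shift_vec eps (int t) \<omega>) - (\<integral>x. Gn n (real t / real n) x \<partial>S))
       - block_term m K L n t (shift_vec eps (int t) \<omega>)\<bar>}
     \<le> 8 * (real (Suc m))\<^sup>2 * (3 * en\<^sup>2 + 3 * kap\<^sup>2
          + 3 * (real (L + m))\<^sup>2 * ((\<Sum>i = 1..n. (gdist (real i / real n) ((real i - 1) / real n))\<^sup>2) / real n)
          + A\<^sup>2 * real m * (1 / real (L + m) + 1 / real n)) / e\<^sup>2"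
    (is "_ \<le> 8 * (real (Suc m))\<^sup>2 * ?v / e\<^sup>2")
proof -
  let ?b = "L + m"
  have b: "?b \<ge> 1" using m by simp
  have npos: "0 < real n" using n by simp
  define g where "g t = Gn n (real t / real n)" for t
  define u where "u t = real ((t - 1) div ?b * ?b) / real n" for t
  define F where "F t x = (head_mean m (g t) x - (\<integral>x. g t x \<partial>S)) - block_term m K L n t x" for t x
  have t01: "real t / real n \<in> {0..1}" if "t \<in> {1..n}" for t using that npos by auto
  have u01: "u t \<in> {0..1}" if "t \<in> {1..n}" for t
  proof -
    have "(t - 1) div ?b * ?b \<le> t - 1" by (rule div_times_less_eq_dividend)
    also have "\<dots> \<le> n" using that by auto
    finally have "real ((t - 1) div ?b * ?b) \<le> real n" by (simp only: of_nat_le_iff)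
    then show ?thesis using npos by (simp add: u_def del: of_nat_mult)
  qed
  have sg: "square_int S (g t)" if "t \<in> {1..n}" for t
    unfolding g_def by (rule sq_Gn[OF n t01[OF that]])
  have sb: "square_int S (block_term m K L n t)" for t
    unfolding block_term_def[abs_def] using square_int_hK[OF K] P.square_int_const[of 0]
    by (cases "(t - 1) mod ?b < L") auto
  have sF: "square_int S (F t)" if "t \<in> {1..n}" for t
    unfolding F_def[abs_def]
    by (intro square_int_diff sb P.square_int_const head_mean_square(1) sg that)
  have mb: "(\<integral>x. block_term m K L n t x \<partial>S) = 0" for t
    by (cases "(t - 1) mod ?b < L") (simp_all add: block_term_def hK_mean[OF K])
  have hm: "(\<integral>x. head_mean m (g t) x \<partial>S) = (\<integral>x. g t x \<partial>S)" if "t \<in> {1..n}" for t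
    by (rule head_mean_integral[OF P.square_int_integrable[OF sg[OF that]]])
  define d where "d t = gdist (real t / real n) (u t)" for t
  \<comment> \<open>Inside a block the error has three sources, the distance of \<open>Gn\<close>
    from \<open>G\<close>, freezing and truncation, and the square of a sum of three terms is at
    most three times the sum of squares. In a gap only the norm bound \<open>A\<close> is
    available.\<close>
  have norm1: "(L2_norm S (F t))\<^sup>2 \<le> 3 * en\<^sup>2 + 3 * (d t)\<^sup>2 + 3 * kap\<^sup>2 + (if (t - 1) mod ?b < L then 0 else A\<^sup>2)"
    if t: "t \<in> {1..n}" for t
  proof (cases "(t - 1) mod ?b < L")
    case True
    let ?T = "\<lambda>x. trunc K (G (u t) x)"
    note sT = square_int_trunc_G[OF K, of "u t"] and sG1 = sq_G[OF t01[OF t]] and sG2 = sq_G[OF u01[OF t]]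
    have "F t = (\<lambda>x. (head_mean m (g t) x - (\<integral>y. head_mean m (g t) y \<partial>S)) - hK m K (u t) x)"
      using True by (auto simp: F_def block_term_def u_def hm[OF t])
    then have "L2_norm S (F t) \<le> L2_norm S (\<lambda>x. g t x - ?T x)"
      using hK_diff_le[OF K sg[OF t], of m "u t"] by simp
    also have "\<dots> \<le> L2_norm S (\<lambda>x. g t x - G (real t / real n) x) + L2_norm S (\<lambda>x. G (real t / real n) x - ?T x)"
      by (rule L2_norm_triangle_diff[OF sg[OF t] sG1 sT])
    also have "L2_norm S (\<lambda>x. G (real t / real n) x - ?T x) \<le> d t + L2_norm S (\<lambda>x. G (u t) x - ?T x)"
      unfolding d_def gdist_def by (rule L2_norm_triangle_diff[OF sG1 sG2 sT])
    finally have "L2_norm S (F t) \<le> en + d t + kap"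
      using en[OF t01[OF t]] kap[OF u01[OF t]] by (simp add: g_def)
    then have "(L2_norm S (F t))\<^sup>2 \<le> (en + d t + kap)\<^sup>2" by (rule power_mono) simp
    also have "\<dots> \<le> 3 * en\<^sup>2 + 3 * (d t)\<^sup>2 + 3 * kap\<^sup>2"
      using zero_le_power2[of "en - d t"] zero_le_power2[of "en - kap"] zero_le_power2[of "d t - kap"]
      by (simp add: power2_eq_square algebra_simps)
    finally show ?thesis using True by simp
  next
    case False
    have "F t = (\<lambda>x. head_mean m (g t) x - (\<integral>y. head_mean m (g t) y \<partial>S))"
      using False by (auto simp: F_def block_term_def hm[OF t])
    then have "L2_norm S (F t) \<le> L2_norm S (head_mean m (g t))"
      using P.L2_norm_centered_le[OF head_mean_square(1)[OF sg[OF t]], of m] by simp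
    also have "\<dots> \<le> L2_norm S (g t)" unfolding L2_norm_def using head_mean_square(2)[OF sg[OF t]] by simp
    also have "\<dots> \<le> A" unfolding g_def by (rule norm_Gn[OF n t01[OF t]])
    finally have "(L2_norm S (F t))\<^sup>2 \<le> A\<^sup>2" by (rule power_mono) simp
    then show ?thesis using False by (simp add: add_increasing)
  qed
  have "(\<Sum>t = 1..n. (L2_norm S (F t))\<^sup>2) \<le> (\<Sum>t = 1..n. 3 * en\<^sup>2 + 3 * (d t)\<^sup>2 + 3 * kap\<^sup>2 + (if (t - 1) mod ?b < L then 0 else A\<^sup>2))"
    by (rule sum_mono) (rule norm1)
  also have "\<dots> = real n * (3 * en\<^sup>2) + 3 * (\<Sum>t = 1..n. (d t)\<^sup>2) + real n * (3 * kap\<^sup>2)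
      + real (card {t \<in> {1..n}. \<not> (t - 1) mod ?b < L}) * A\<^sup>2"
  proof -
    have "(\<Sum>t = 1..n. if (t - 1) mod ?b < L then 0 else A\<^sup>2) = (\<Sum>t\<in>{t \<in> {1..n}. \<not> (t - 1) mod ?b < L}. A\<^sup>2)"
      by (rule sum.mono_neutral_cong_right) auto
    then show ?thesis by (simp add: sum.distrib sum_distrib_left)
  qed
  also have "\<dots> \<le> real n * ?v"
  proof -
    have "(\<Sum>t = 1..n. (d t)\<^sup>2) \<le> (real ?b)\<^sup>2 * (\<Sum>i = 1..n. (gdist (real i / real n) ((real i - 1) / real n))\<^sup>2)"
      unfolding d_def u_def by (rule block_start_deviation[OF n b])
    moreover have "real (card {t \<in> {1..n}. \<not> (t - 1) mod ?b < L}) * A\<^sup>2 \<le> (real n / real ?b + 1) * real m * A\<^sup>2"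
    proof (rule mult_right_mono)
      have "real (card {t \<in> {1..n}. \<not> (t - 1) mod ?b < L}) \<le> real ((n div ?b + 1) * m)"
        using gap_count[OF b, of n] by (simp only: of_nat_le_iff)
      also have "\<dots> = (real (n div ?b) + 1) * real m" by (simp add: algebra_simps)
      also have "\<dots> \<le> (real n / real ?b + 1) * real m"
      proof (intro mult_right_mono add_right_mono)
        show "real (n div ?b) \<le> real n / real ?b" by (rule of_nat_div_le_of_nat)
      qed simp
      finally show "real (card {t \<in> {1..n}. \<not> (t - 1) mod ?b < L}) \<le> (real n / real ?b + 1) * real m" .
    qed simp
    moreover have "real n * ?v = real n * (3 * en\<^sup>2) + 3 * ((real ?b)\<^sup>2 * (\<Sum>i = 1..n. (gdist (real i / real n) ((real i - 1) / real n))\<^sup>2))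
        + real n * (3 * kap\<^sup>2) + (real n / real ?b + 1) * real m * A\<^sup>2"
      using npos by (simp add: distrib_left add_divide_distrib del: of_nat_add) (simp add: algebra_simps)
    ultimately show ?thesis by linarith
  qed
  finally have V: "(\<Sum>t = 1..n. (L2_norm S (F t))\<^sup>2) \<le> real n * ?v" .
  have "base.prob {\<omega>\<in>space \<Omega>. \<exists>k\<le>n. e * sqrt (real n) < \<bar>\<Sum>t = 1..k. F t (shift_vec eps (int t) \<omega>)\<bar>}
      \<le> 8 * (real (Suc m))\<^sup>2 * (real n * ?v) / (e * sqrt (real n))\<^sup>2"
  proof (rule m_dependent_max_L2[OF _ sF _ _ V])
    show "0 < e * sqrt (real n)" using e npos by simp
    fix t assume t: "t \<in> {1..n}"
    have i: "integrable S (head_mean m (g t))" "integrable S (block_term m K L n t)"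
      using P.square_int_integrable head_mean_square(1)[OF sg[OF t]] sb by auto
    show "(\<integral>x. F t x \<partial>S) = 0"
      unfolding F_def using i mb[of t] hm[OF t] P.prob_space by simp
    show "depends_on_first m (F t)"
      unfolding depends_on_first_def
    proof (intro allI impI)
      fix x y :: "nat \<Rightarrow> real" assume xy: "\<forall>k\<le>m. x k = y k"
      have "head_mean m (g t) x = head_mean m (g t) y" by (rule head_mean_cong) (use xy in auto)
      moreover have "hK m K w x = hK m K w y" for w by (rule hK_cong) (use xy in auto)
      ultimately show "F t x = F t y" by (simp add: F_def block_term_def)
    qed
  qed
  also have "\<dots> = 8 * (real (Suc m))\<^sup>2 * ?v / e\<^sup>2"
    using npos by (simp add: power_mult_distrib)
  finally show ?thesis by (simp add: F_def g_def)
qed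

definition scaled_sum :: "nat \<Rightarrow> 'a \<Rightarrow> real \<Rightarrow> real" where
  "scaled_sum n \<omega> = psum (real n) (\<lambda>t. (Gn n (real t / real n) (shift_vec eps (int t) \<omega>)
      - (\<integral>x. Gn n (real t / real n) x \<partial>S)) / sqrt (real n))"

lemma measurable_scaled_sum:
  assumes "sup_continuous_D f"
  shows "(\<lambda>\<omega>. f (scaled_sum n \<omega>)) \<in> borel_measurable \<Omega>"
  unfolding scaled_sum_def
proof (rule measurable_sup_continuous_psum[OF assms])
  fix t assume "t \<in> {1..nat \<lfloor>real n\<rfloor>}"
  then have n: "n \<ge> 1" "real t / real n \<in> {0..1}" by auto
  show "(\<lambda>\<omega>. (Gn n (real t / real n) (shift_vec eps (int t) \<omega>) - (\<integral>x. Gn n (real t / real n) x \<partial>S)) / sqrt (real n))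
     \<in> borel_measurable \<Omega>"
    using measurable_kernel_shift[OF square_intD(1)[OF sq_Gn[OF n]], of "int t"]
    by (intro borel_measurable_divide borel_measurable_diff) auto
qed simp

text \<open>Three passages, each within \<open>e\<close> in uniform distance: to head means, to
  frozen truncated kernels, and to whole blocks. The first two fail only on \<open>B1\<close> and
  \<open>B2\<close>; the third holds surely by \<open>small\<close>.\<close>

lemma scaled_sum_block_diff:
  assumes m: "m \<ge> 1" and n: "n \<ge> 1" and K: "0 \<le> K" and e: "e > 0"
    and kap: "\<And>u. u \<in> {0..1} \<Longrightarrow> L2_norm S (\<lambda>x. G u x - trunc K (G u x)) \<le> kap"
    and en: "\<And>u. u \<in> {0..1} \<Longrightarrow> L2_norm S (\<lambda>x. Gn n u x - G u x) \<le> en"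
    and small: "2 * K * real (L + m) / sqrt (real n) \<le> e"
    and v: "3 * en\<^sup>2 + 3 * kap\<^sup>2
          + 3 * (real (L + m))\<^sup>2 * ((\<Sum>i = 1..n. (gdist (real i / real n) ((real i - 1) / real n))\<^sup>2) / real n)
          + A\<^sup>2 * real m * (1 / real (L + m) + 1 / real n) \<le> v"
    and f: "bounded_lipschitz_D Lf Kf f"
  shows "\<bar>base.expectation (\<lambda>\<omega>. f (scaled_sum n \<omega>))
      - base.expectation (\<lambda>\<omega>. f (psum (real n / real (L + m)) (\<lambda>r. block_sum m K L n r \<omega> / sqrt (real n))))\<bar>
    \<le> Lf * (3 * e) + 2 * Kf * (((\<Sum>i. decay_weight C \<rho> (i + m)) + 8 * (real (Suc m))\<^sup>2 * v) / e\<^sup>2)"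
proof -
  let ?X = "\<lambda>t \<omega>. shift_vec eps (int t) \<omega>"
  define g where "g t = Gn n (real t / real n)" for t
  define D1 where "D1 t x = g t x - head_mean m (g t) x" for t x
  define D2 where "D2 t x = (head_mean m (g t) x - (\<integral>x. g t x \<partial>S)) - block_term m K L n t x" for t x
  define B1 where "B1 = {\<omega>\<in>space \<Omega>. \<exists>k\<le>n. e * sqrt (real n) < \<bar>\<Sum>t = 1..k. D1 t (?X t \<omega>)\<bar>}"
  define B2 where "B2 = {\<omega>\<in>space \<Omega>. \<exists>k\<le>n. e * sqrt (real n) < \<bar>\<Sum>t = 1..k. D2 t (?X t \<omega>)\<bar>}"
  have sn: "0 < sqrt (real n)" using n by simp
  have b: "L + m \<ge> 1" using m by simp
  have t01: "real t / real n \<in> {0..1}" if "t \<in> {1..n}" for t using that by auto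
  have sg: "square_int S (g t)" if "t \<in> {1..n}" for t
    unfolding g_def by (rule sq_Gn[OF n t01[OF that]])
  have sb: "square_int S (block_term m K L n t)" for t
    unfolding block_term_def[abs_def] using square_int_hK[OF K] P.square_int_const[of 0]
    by (cases "(t - 1) mod (L + m) < L") auto
  have m1: "(\<lambda>\<omega>. D1 t (?X t \<omega>)) \<in> borel_measurable \<Omega>" if "t \<in> {1..n}" for t
    by (rule measurable_kernel_shift, rule square_intD(1), unfold D1_def)
       (intro square_int_diff head_mean_square(1) sg that)
  have m2: "(\<lambda>\<omega>. D2 t (?X t \<omega>)) \<in> borel_measurable \<Omega>" if "t \<in> {1..n}" for t
    by (rule measurable_kernel_shift, rule square_intD(1), unfold D2_def)
       (intro square_int_diff sb P.square_int_const head_mean_square(1) sg that)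
  have max_sets: "{\<omega>\<in>space \<Omega>. \<exists>k\<le>n. c < \<bar>\<Sum>t = 1..k. h t \<omega>\<bar>} \<in> sets \<Omega>"
    if "\<And>t. t \<in> {1..n} \<Longrightarrow> h t \<in> borel_measurable \<Omega>" for c and h :: "nat \<Rightarrow> 'a \<Rightarrow> real"
  proof -
    have "(\<lambda>\<omega>. \<Sum>t = 1..k. h t \<omega>) \<in> borel_measurable \<Omega>" if "k \<in> {..n}" for k
      by (rule borel_measurable_sum) (use that in \<open>auto intro!: \<open>\<And>t. t \<in> {1..n} \<Longrightarrow> h t \<in> borel_measurable \<Omega>\<close>\<close>)
    note [measurable] = this
    have eq: "{\<omega>\<in>space \<Omega>. \<exists>k\<le>n. c < \<bar>\<Sum>t = 1..k. h t \<omega>\<bar>} = {\<omega>\<in>space \<Omega>. \<exists>k\<in>{..n}. c < \<bar>\<Sum>t = 1..k. h t \<omega>\<bar>}"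
      by auto
    show ?thesis unfolding eq by measurable
  qed
  have B1m: "B1 \<in> sets \<Omega>" unfolding B1_def by (rule max_sets) (rule m1)
  have B2m: "B2 \<in> sets \<Omega>" unfolding B2_def by (rule max_sets) (rule m2)
  have P1: "base.prob B1 \<le> (\<Sum>i. decay_weight C \<rho> (i + m)) / e\<^sup>2"
    unfolding B1_def D1_def
    by (rule head_mean_replacement[OF m e n rho C_nonneg sg]) (auto simp: g_def intro!: dep_Gn n t01)
  have P2: "base.prob B2 \<le> 8 * (real (Suc m))\<^sup>2 * v / e\<^sup>2"
  proof -
    have "base.prob B2 \<le> 8 * (real (Suc m))\<^sup>2 * (3 * en\<^sup>2 + 3 * kap\<^sup>2
          + 3 * (real (L + m))\<^sup>2 * ((\<Sum>i = 1..n. (gdist (real i / real n) ((real i - 1) / real n))\<^sup>2) / real n)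
          + A\<^sup>2 * real m * (1 / real (L + m) + 1 / real n)) / e\<^sup>2"
      unfolding B2_def D2_def g_def by (rule block_replacement[OF m n K e kap en])
    also have "\<dots> \<le> 8 * (real (Suc m))\<^sup>2 * v / e\<^sup>2"
      using v by (intro divide_right_mono mult_left_mono) auto
    finally show ?thesis .
  qed
  have near: "sup_near (scaled_sum n \<omega>) (psum (real n / real (L + m)) (\<lambda>r. block_sum m K L n r \<omega> / sqrt (real n))) (3 * e)"
    if \<omega>: "\<omega> \<in> space \<Omega>" "\<omega> \<notin> B1 \<union> B2" for \<omega>
  proof -
    have "sup_near (scaled_sum n \<omega>) (psum (real n) (\<lambda>t. block_term m K L n t (?X t \<omega>) / sqrt (real n))) (2 * e)"
      unfolding scaled_sum_def
    proof (rule sup_near_psum)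
      fix k assume "k \<le> nat \<lfloor>real n\<rfloor>"
      then have k: "k \<le> n" by simp
      define a where "a t = Gn n (real t / real n) (?X t \<omega>) - (\<integral>x. Gn n (real t / real n) x \<partial>S)" for t
      define c where "c t = block_term m K L n t (?X t \<omega>)" for t
      have "(\<Sum>t = 1..k. D1 t (?X t \<omega>)) + (\<Sum>t = 1..k. D2 t (?X t \<omega>)) = (\<Sum>t = 1..k. D1 t (?X t \<omega>) + D2 t (?X t \<omega>))"
        by (rule sum.distrib[symmetric])
      also have "\<dots> = (\<Sum>t = 1..k. a t - c t)"
        by (intro sum.cong refl) (simp add: D1_def D2_def g_def a_def c_def)
      also have "\<dots> = (\<Sum>t = 1..k. a t) - (\<Sum>t = 1..k. c t)" by (rule sum_subtractf)
      finally have "(\<Sum>t = 1..k. a t / sqrt (real n)) - (\<Sum>t = 1..k. c t / sqrt (real n))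
        = ((\<Sum>t = 1..k. D1 t (?X t \<omega>)) + (\<Sum>t = 1..k. D2 t (?X t \<omega>))) / sqrt (real n)"
        by (simp only: sum_divide_distrib[symmetric] diff_divide_distrib)
      also have "\<bar>\<dots>\<bar> \<le> (e * sqrt (real n) + e * sqrt (real n)) / sqrt (real n)"
      proof -
        have "\<bar>\<Sum>t = 1..k. D1 t (?X t \<omega>)\<bar> \<le> e * sqrt (real n)" "\<bar>\<Sum>t = 1..k. D2 t (?X t \<omega>)\<bar> \<le> e * sqrt (real n)"
          using \<omega> k by (auto simp: B1_def B2_def not_less)
        then show ?thesis unfolding abs_divide using sn by (intro frac_le) auto
      qed
      also have "\<dots> = 2 * e" using sn by (simp add: add_divide_distrib)
      finally show "\<bar>(\<Sum>t = 1..k. (Gn n (real t / real n) (?X t \<omega>) - (\<integral>x. Gn n (real t / real n) x \<partial>S)) / sqrt (real n))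
          - (\<Sum>t = 1..k. block_term m K L n t (?X t \<omega>) / sqrt (real n))\<bar> \<le> 2 * e"
        unfolding a_def c_def .
    qed simp
    from sup_near_trans[OF this block_term_near[OF K n b]]
    show ?thesis using small unfolding sup_near_def by (smt (verit))
  qed
  have "\<bar>base.expectation (\<lambda>\<omega>. f (scaled_sum n \<omega>))
      - base.expectation (\<lambda>\<omega>. f (psum (real n / real (L + m)) (\<lambda>r. block_sum m K L n r \<omega> / sqrt (real n))))\<bar>
    \<le> Lf * (3 * e) + 2 * Kf * base.prob (B1 \<union> B2)"
  proof (rule base.bounded_lipschitz_diff_le[OF f])
    show "cadlag01 (scaled_sum n \<omega>)" for \<omega> unfolding scaled_sum_def by (rule cadlag01_psum) simp
    show "cadlag01 (psum (real n / real (L + m)) (\<lambda>r. block_sum m K L n r \<omega> / sqrt (real n)))" for \<omega>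
      by (rule cadlag01_psum) simp
    show "(\<lambda>\<omega>. f (scaled_sum n \<omega>)) \<in> borel_measurable \<Omega>"
      by (rule measurable_scaled_sum[OF bounded_lipschitz_imp_sup_continuous[OF f]])
    have "block_sum m K L n r \<in> borel_measurable \<Omega>" for r
      unfolding block_sum_def[abs_def]
      by (intro borel_measurable_sum measurable_kernel_shift square_intD(1)[OF square_int_hK[OF K]])
    then show "(\<lambda>\<omega>. f (psum (real n / real (L + m)) (\<lambda>r. block_sum m K L n r \<omega> / sqrt (real n)))) \<in> borel_measurable \<Omega>"
      by (intro measurable_sup_continuous_psum[OF bounded_lipschitz_imp_sup_continuous[OF f]] borel_measurable_divide) auto
  qed (use B1m B2m e near in auto)
  moreover have "2 * Kf * base.prob (B1 \<union> B2)
      \<le> 2 * Kf * (((\<Sum>i. decay_weight C \<rho> (i + m)) + 8 * (real (Suc m))\<^sup>2 * v) / e\<^sup>2)"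
  proof (rule mult_left_mono)
    show "base.prob (B1 \<union> B2) \<le> ((\<Sum>i. decay_weight C \<rho> (i + m)) + 8 * (real (Suc m))\<^sup>2 * v) / e\<^sup>2"
      using measure_Un_le[OF B1m B2m] P1 P2 by (simp add: add_divide_distrib)
    have "0 \<le> Kf"
      using f cadlag01_psum[of 0] unfolding bounded_lipschitz_D_def by (meson abs_ge_zero order_refl order_trans)
    then show "0 \<le> 2 * Kf" by simp
  qed
  ultimately show ?thesis by linarith
qed

lemma decay_tail_tendsto_zero: "(\<lambda>m. \<Sum>i. decay_weight C \<rho> (i + m)) \<longlonglongrightarrow> 0"
proof -
  have s: "summable (decay_weight C \<rho>)" by (rule summable_decay_weight[OF rho])
  have "(\<lambda>m. (\<Sum>i. decay_weight C \<rho> i) - (\<Sum>i<m. decay_weight C \<rho> i)) \<longlonglongrightarrow> (\<Sum>i. decay_weight C \<rho> i) - (\<Sum>i. decay_weight C \<rho> i)"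
    by (intro tendsto_diff tendsto_const summable_LIMSEQ[OF s])
  then show ?thesis by (simp add: suminf_minus_initial_segment[OF s])
qed

text \<open>Two limits in succession. The index \<open>i\<close> fixes window, block length and
  truncation level so that the limit of the block process and the replacement error are already
  within tolerance; only then does \<open>n\<close> tend to infinity.\<close>

lemma lipschitz_convergence:
  assumes BM: "std_brownian_motion N B" and f: "bounded_lipschitz_D Lf Kf f"
  shows "(\<lambda>n. base.expectation (\<lambda>\<omega>. f (scaled_sum n \<omega>)))
    \<longlonglongrightarrow> (\<integral>\<omega>. f (\<lambda>v. B (\<integral>u\<in>{0..v}. long_run_var u \<partial>lborel) \<omega>) \<partial>N)"
proof -
  interpret N: prob_space N by (rule BM_prob_space[OF BM])
  define m where "m i = Suc i" for i
  define L where "L i = m i ^ 4" for i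
  \<comment> \<open>Chosen so that \<open>L * kap = 1 / m\<close>: the truncation error survives its
    multiplication by the block length.\<close>
  define kap where "kap i = 1 / real (m i) ^ 5" for i
  have mpos: "0 < real (m i)" "m i \<ge> 1" "1 \<le> real (m i)" for i by (auto simp: m_def)
  have Lreal: "real (L i) = real (m i) ^ 4" for i by (simp add: L_def)
  have Lpos: "L i \<ge> 1" for i using mpos(2)[of i] by (simp add: L_def)
  have kpos: "0 < kap i" for i using mpos(1)[of i] by (simp add: kap_def)
  have "\<forall>i. \<exists>K. 0 \<le> K \<and> (\<forall>u\<in>{0..1}. L2_norm S (\<lambda>x. G u x - trunc K (G u x)) \<le> kap i)"
    using trunc_G[OF kpos] by blast
  from choice[OF this] obtain K where "\<forall>i. 0 \<le> K i \<and> (\<forall>u\<in>{0..1}. L2_norm S (\<lambda>x. G u x - trunc (K i) (G u x)) \<le> kap i)" by blast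
  then have K: "0 \<le> K i" and Kk: "u \<in> {0..1} \<Longrightarrow> L2_norm S (\<lambda>x. G u x - trunc (K i) (G u x)) \<le> kap i" for i u by auto
  define c3 where "c3 = 2 * c1 / (1 - \<rho>)\<^sup>2"
  define c4 where "c4 = c1 + 2 * c1 / (1 - \<rho>)"
  have c34: "0 \<le> c3" "0 \<le> c4" using c1_nonneg rho by (auto simp: c3_def c4_def)
  \<comment> \<open>Bounds the distance of the block rate from the long-run variance uniformly in
    time; the terms in \<open>1 / L\<close> and \<open>m / L\<close> are both absorbed into
    \<open>1 / m\<close>.\<close>
  define s where "s i = (2 * A + c3 + c4) * (1 / real (m i)) + 2 * A * (C / (1 - \<rho>)) * (real (m i) ^ 4 * \<rho> ^ m i)" for i
  define R where "R i = block_rate (m i) (K i) (L i)" for i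
  define \<tau> where "\<tau> i v = (\<integral>u\<in>{0..v}. R i u \<partial>lborel)" for i v
  define \<tau>0 where "\<tau>0 v = (\<integral>u\<in>{0..v}. long_run_var u \<partial>lborel)" for v
  have inv_m: "(\<lambda>i. 1 / real (m i)) \<longlonglongrightarrow> 0"
    using LIMSEQ_inverse_real_of_nat by (simp add: m_def inverse_eq_divide)
  have s0: "s \<longlonglongrightarrow> 0"
  proof -
    have "(\<lambda>i. real (m i) ^ 4 * \<rho> ^ m i) \<longlonglongrightarrow> 0"
      using LIMSEQ_Suc[OF poly_geometric_tendsto_zero[OF rho]] by (simp only: m_def)
    then have "s \<longlonglongrightarrow> (2 * A + c3 + c4) * 0 + 2 * A * (C / (1 - \<rho>)) * 0"
      unfolding s_def by (intro tendsto_add tendsto_mult tendsto_const inv_m)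
    then show ?thesis by simp
  qed
  have lrv: "\<bar>long_run_var u\<bar> \<le> c4" if "u \<in> {0..1}" for u
    using long_run_var_nonneg[OF that] long_run_var_le[OF that] by (simp add: c4_def)
  have Rm: "(\<lambda>u. indicator {0..1} u * R i u) \<in> borel_measurable borel" for i
    unfolding R_def by (rule measurable_block_rate)
  have Rb: "\<bar>R i u\<bar> \<le> (real (L i) * A)\<^sup>2 / real (L i + m i)" "0 \<le> R i u" if "u \<in> {0..1}" for i u
    unfolding R_def using block_rate_bounds[OF K that] by auto
  have close: "\<bar>R i u - long_run_var u\<bar> \<le> s i" if u: "u \<in> {0..1}" for i u
  proof -
    have "\<bar>R i u - long_run_var u\<bar> \<le> 2 * A * real (L i) * (kap i + C / (1 - \<rho>) * \<rho> ^ m i) + c3 / real (L i) + c4 * (real (m i) / real (L i))"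
      unfolding R_def c3_def c4_def by (rule block_rate_close[OF K u mpos(2) Lpos Kk[OF u]])
    also have "2 * A * real (L i) * (kap i + C / (1 - \<rho>) * \<rho> ^ m i)
        = 2 * A * (1 / real (m i)) + 2 * A * (C / (1 - \<rho>)) * (real (m i) ^ 4 * \<rho> ^ m i)"
    proof -
      have "real (L i) * kap i = 1 / real (m i)"
        unfolding Lreal kap_def using mpos(1)[of i] by (simp add: field_simps eval_nat_numeral)
      then have "2 * A * (real (L i) * kap i) = 2 * A * (1 / real (m i))" by simp
      then show ?thesis unfolding Lreal by (simp add: algebra_simps)
    qed
    also have "c3 / real (L i) \<le> c3 * (1 / real (m i))"
    proof -
      have "real (m i) ^ 1 \<le> real (m i) ^ 4" by (rule power_increasing) (use mpos(3)[of i] in auto)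
      then have "1 / real (L i) \<le> 1 / real (m i)" unfolding Lreal using mpos(1)[of i] by (intro divide_left_mono) auto
      then show ?thesis using mult_left_mono[OF _ c34(1)] by fastforce
    qed
    also have "c4 * (real (m i) / real (L i)) \<le> c4 * (1 / real (m i))"
    proof (rule mult_left_mono[OF _ c34(2)])
      have "real (m i) ^ 2 \<le> real (m i) ^ 4" by (rule power_increasing) (use mpos(3)[of i] in auto)
      then show "real (m i) / real (L i) \<le> 1 / real (m i)"
        unfolding Lreal using mpos(1)[of i] by (simp add: field_simps power2_eq_square)
    qed
    finally show ?thesis by (simp add: s_def algebra_simps)
  qed
  have \<tau>close: "\<bar>\<tau> i v - \<tau>0 v\<bar> \<le> s i" if "v \<in> {0..1}" for i v
    unfolding \<tau>_def \<tau>0_def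
    by (rule set_integral_close[OF Rm Rb(1) measurable_long_run_var lrv close that])
  have \<tau>cont: "continuous_on {0..1} (\<tau> i)" for i
    unfolding \<tau>_def by (rule set_integral_continuous[OF Rm Rb(1)])
  have \<tau>0cont: "continuous_on {0..1} \<tau>0"
    unfolding \<tau>0_def by (rule set_integral_continuous[OF measurable_long_run_var lrv])
  have zero: "\<tau> i 0 = 0" "\<tau>0 0 = 0" for i
    unfolding \<tau>_def \<tau>0_def by (rule set_integral_zero)+
  have mono: "mono_on {0..1} (\<tau> i)" for i
    unfolding \<tau>_def by (rule set_integral_mono_on[OF Rm Rb(1) Rb(2)])
  have mono0: "mono_on {0..1} \<tau>0"
    unfolding \<tau>0_def by (rule set_integral_mono_on[OF measurable_long_run_var lrv long_run_var_nonneg])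
  have \<tau>nn: "0 \<le> \<tau> i v" if "v \<in> {0..1}" for i v
    using mono_onD[OF mono, of 0 v i] zero that by simp
  have \<tau>0nn: "0 \<le> \<tau>0 v" if "v \<in> {0..1}" for v
    using mono_onD[OF mono0, of 0 v] zero that by simp
  have \<tau>0le: "\<tau>0 v \<le> c4" if v: "v \<in> {0..1}" for v
  proof -
    have "\<tau>0 v \<le> c4 * (v - 0)"
      unfolding \<tau>0_def using abs_set_integral_le[OF measurable_long_run_var lrv, of 0 v] v by simp
    also have "\<dots> \<le> c4" using v c34(2) by (simp add: mult_left_le)
    finally show ?thesis .
  qed
  have cB: "continuous_on {0..1} (\<lambda>v. B (\<tau> i v) \<omega>)" if "\<omega> \<in> space N" for i \<omega>
    by (rule continuous_on_compose2[OF BM_continuous[OF BM that] \<tau>cont]) (use \<tau>nn in auto)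
  have cB0: "continuous_on {0..1} (\<lambda>v. B (\<tau>0 v) \<omega>)" if "\<omega> \<in> space N" for \<omega>
    by (rule continuous_on_compose2[OF BM_continuous[OF BM that] \<tau>0cont]) (use \<tau>0nn in auto)
  have fc: "sup_continuous_D f" by (rule bounded_lipschitz_imp_sup_continuous[OF f])
  have Zconv: "(\<lambda>i. \<integral>\<omega>. f (\<lambda>v. B (\<tau> i v) \<omega>) \<partial>N) \<longlonglongrightarrow> (\<integral>\<omega>. f (\<lambda>v. B (\<tau>0 v) \<omega>) \<partial>N)"
  proof (rule integral_dominated_convergence[where w = "\<lambda>_. Kf"])
    show "(\<lambda>\<omega>. f (\<lambda>v. B (\<tau>0 v) \<omega>)) \<in> borel_measurable N"
      by (rule measurable_sup_continuous_path[OF fc])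
         (use cB0 \<tau>0nn zero in \<open>auto intro!: BM_measurable[OF BM] simp: BM_0[OF BM]\<close>)
    show "(\<lambda>\<omega>. f (\<lambda>v. B (\<tau> i v) \<omega>)) \<in> borel_measurable N" for i
      by (rule measurable_sup_continuous_path[OF fc])
         (use cB \<tau>nn zero in \<open>auto intro!: BM_measurable[OF BM] simp: BM_0[OF BM]\<close>)
    show "AE \<omega> in N. norm (f (\<lambda>v. B (\<tau> i v) \<omega>)) \<le> Kf" for i
      using f cadlag01_continuous[OF cB] by (auto simp: bounded_lipschitz_D_def)
    show "AE \<omega> in N. (\<lambda>i. f (\<lambda>v. B (\<tau> i v) \<omega>)) \<longlonglongrightarrow> f (\<lambda>v. B (\<tau>0 v) \<omega>)"
    proof (rule AE_I2)
      fix \<omega> assume \<omega>: "\<omega> \<in> space N"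
      show "(\<lambda>i. f (\<lambda>v. B (\<tau> i v) \<omega>)) \<longlonglongrightarrow> f (\<lambda>v. B (\<tau>0 v) \<omega>)"
      proof (rule bounded_lipschitz_tendsto[OF f cadlag01_continuous[OF cB0[OF \<omega>]] cadlag01_continuous[OF cB[OF \<omega>]]])
        fix r :: real assume r: "r > 0"
        \<comment> \<open>The limiting time change is at most \<open>c4\<close>, and the block time
          changes are eventually within \<open>1\<close> of it, so all arguments of \<open>B\<close>
          lie in one compact interval.\<close>
        have "uniformly_continuous_on {0..c4 + 1} (\<lambda>t. B t \<omega>)"
          by (rule compact_uniformly_continuous[OF continuous_on_subset[OF BM_continuous[OF BM \<omega>]]]) auto
        then obtain \<delta> where \<delta>: "\<delta> > 0"
          "\<And>x y. x \<in> {0..c4 + 1} \<Longrightarrow> y \<in> {0..c4 + 1} \<Longrightarrow> dist y x < \<delta> \<Longrightarrow> dist (B y \<omega>) (B x \<omega>) < r"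
          using r unfolding uniformly_continuous_on_def by blast
        have "\<forall>\<^sub>F i in sequentially. s i < min \<delta> 1"
          by (rule order_tendstoD[OF s0]) (use \<delta>(1) in simp)
        then show "\<forall>\<^sub>F i in sequentially. sup_near (\<lambda>v. B (\<tau> i v) \<omega>) (\<lambda>v. B (\<tau>0 v) \<omega>) r"
        proof eventually_elim
          case (elim i)
          show ?case
            unfolding sup_near_def
          proof
            fix v :: real assume v: "v \<in> {0..1}"
            have d: "\<bar>\<tau> i v - \<tau>0 v\<bar> < \<delta>" "\<bar>\<tau> i v - \<tau>0 v\<bar> < 1" using \<tau>close[OF v, of i] elim by auto
            have "dist (B (\<tau> i v) \<omega>) (B (\<tau>0 v) \<omega>) < r"
            proof (rule \<delta>(2))
              show "\<tau>0 v \<in> {0..c4 + 1}" using \<tau>0nn[OF v] \<tau>0le[OF v] by simp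
              show "\<tau> i v \<in> {0..c4 + 1}" using \<tau>nn[OF v, of i] \<tau>0le[OF v] d(2) by (simp add: abs_less_iff)
              show "dist (\<tau> i v) (\<tau>0 v) < \<delta>" using d(1) by (simp add: dist_real_def)
            qed
            then show "\<bar>B (\<tau> i v) \<omega> - B (\<tau>0 v) \<omega>\<bar> \<le> r" by (simp add: dist_real_def)
          qed
        qed
      qed
    qed
  qed simp
  \<comment> \<open>\<open>7 = 3 + 3 + 1\<close>: the distance of \<open>Gn\<close> from
    \<open>G\<close>, the truncation, and the part that vanishes as \<open>n\<close> grows;
    \<open>A^2\<close> is the share of the gaps. The maximal inequality multiplies by order
    \<open>m^2\<close>, which leaves order \<open>1 / m\<close>.\<close>
  define vv where "vv i = (7 + A\<^sup>2) / real (m i) ^ 3" for i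
  define q where "q i = (\<Sum>j. decay_weight C \<rho> (j + m i)) + 8 * (real (Suc (m i)))\<^sup>2 * vv i" for i
  have q0: "q \<longlonglongrightarrow> 0"
  proof (rule tendsto_sandwich[OF always_eventually always_eventually tendsto_const])
    have "(\<lambda>i. (\<Sum>j. decay_weight C \<rho> (j + m i)) + 32 * (7 + A\<^sup>2) * (1 / real (m i))) \<longlonglongrightarrow> 0 + 32 * (7 + A\<^sup>2) * 0"
      using LIMSEQ_Suc[OF decay_tail_tendsto_zero] by (intro tendsto_add tendsto_mult tendsto_const inv_m) (simp only: m_def)
    then show "(\<lambda>i. (\<Sum>j. decay_weight C \<rho> (j + m i)) + 32 * (7 + A\<^sup>2) * (1 / real (m i))) \<longlonglongrightarrow> 0" by simp
    show "\<forall>i. 0 \<le> q i"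
    proof
      fix i
      have "0 \<le> (\<Sum>j. decay_weight C \<rho> (j + m i))"
      proof (rule suminf_nonneg)
        show "summable (\<lambda>j. decay_weight C \<rho> (j + m i))"
          by (rule summable_ignore_initial_segment[OF summable_decay_weight[OF rho]])
        show "0 \<le> decay_weight C \<rho> (j + m i)" for j using rho by (simp add: decay_weight_def)
      qed
      moreover have "0 \<le> vv i" using mpos(1)[of i] by (simp add: vv_def)
      ultimately show "0 \<le> q i" by (simp add: q_def)
    qed
    show "\<forall>i. q i \<le> (\<Sum>j. decay_weight C \<rho> (j + m i)) + 32 * (7 + A\<^sup>2) * (1 / real (m i))"
    proof
      fix i
      have "(real (Suc (m i)))\<^sup>2 \<le> (2 * real (m i))\<^sup>2" using mpos(3)[of i] by (intro power_mono) auto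
      then have "8 * (real (Suc (m i)))\<^sup>2 * vv i \<le> 8 * (2 * real (m i))\<^sup>2 * vv i"
        using mpos(1)[of i] by (intro mult_right_mono mult_left_mono) (auto simp: vv_def)
      also have "\<dots> = 32 * (7 + A\<^sup>2) * (1 / real (m i))"
        using mpos(1)[of i] by (simp add: vv_def field_simps eval_nat_numeral)
      finally show "q i \<le> (\<Sum>j. decay_weight C \<rho> (j + m i)) + 32 * (7 + A\<^sup>2) * (1 / real (m i))" by (simp add: q_def)
    qed
  qed
  have Lf: "0 \<le> Lf" using f by (simp add: bounded_lipschitz_D_def)
  show ?thesis
    unfolding \<tau>0_def[symmetric]
  proof (rule LIMSEQ_I)
    fix r :: real assume r: "r > 0"
    define e where "e = r / (12 * (Lf + 1))"
    have e: "e > 0" using r Lf by (simp add: e_def)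
    have Le: "Lf * (3 * e) \<le> r / 4" using r Lf by (simp add: e_def field_simps)
    have lim0: "(\<lambda>i. 2 * Kf * (q i / e\<^sup>2)) \<longlonglongrightarrow> 0"
      using tendsto_mult_left[OF tendsto_divide[OF q0 tendsto_const, of "e\<^sup>2"], of "2 * Kf"] e by simp
    have "\<forall>\<^sub>F i in sequentially. 2 * Kf * (q i / e\<^sup>2) < r / 4"
      by (rule order_tendstoD[OF lim0]) (use r in simp)
    moreover have "\<forall>\<^sub>F i in sequentially. dist (\<integral>\<omega>. f (\<lambda>v. B (\<tau> i v) \<omega>) \<partial>N) (\<integral>\<omega>. f (\<lambda>v. B (\<tau>0 v) \<omega>) \<partial>N) < r / 4"
      by (rule tendstoD[OF Zconv]) (use r in simp)
    ultimately have "\<forall>\<^sub>F i in sequentially. 2 * Kf * (q i / e\<^sup>2) < r / 4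
        \<and> dist (\<integral>\<omega>. f (\<lambda>v. B (\<tau> i v) \<omega>) \<partial>N) (\<integral>\<omega>. f (\<lambda>v. B (\<tau>0 v) \<omega>) \<partial>N) < r / 4"
      by (rule eventually_conj)
    then obtain i where i: "2 * Kf * (q i / e\<^sup>2) < r / 4"
      "dist (\<integral>\<omega>. f (\<lambda>v. B (\<tau> i v) \<omega>) \<partial>N) (\<integral>\<omega>. f (\<lambda>v. B (\<tau>0 v) \<omega>) \<partial>N) < r / 4"
      by (auto simp: eventually_sequentially)
    let ?b = "L i + m i"
    have b: "?b \<ge> 1" using mpos(2)[of i] by simp
    \<comment> \<open>The distance of \<open>Gn\<close> from \<open>G\<close> is asked to be as
      small as the truncation error, so that both enter \<open>vv\<close> alike.\<close>
    obtain n0 where n0: "\<forall>n\<ge>n0. \<forall>u\<in>{0..1}. L2_norm S (\<lambda>x. Gn n u x - G u x) \<le> kap i"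
      using Gn_to_G[OF kpos] by blast
    have "\<forall>\<^sub>F n in sequentially. dist (base.expectation (\<lambda>\<omega>. f (psum (real n / real ?b) (\<lambda>r. block_sum (m i) (K i) (L i) n r \<omega> / sqrt (real n)))))
        (\<integral>\<omega>. f (\<lambda>v. B (\<tau> i v) \<omega>) \<partial>N) < r / 4"
      unfolding \<tau>_def R_def by (rule tendstoD[OF block_process_tendsto[OF BM K b f]]) (use r in simp)
    moreover have "\<forall>\<^sub>F n in sequentially. 2 * K i * real ?b / sqrt (real n) < e"
    proof -
      have "(\<lambda>n. 2 * K i * real ?b / sqrt (real n)) \<longlonglongrightarrow> 0"
        by (rule tendsto_divide_0[OF tendsto_const])
           (auto intro!: filterlim_at_top_imp_at_infinity filterlim_compose[OF sqrt_at_top] filterlim_real_sequentially)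
      then show ?thesis by (rule order_tendstoD) (rule e)
    qed
    moreover have "\<forall>\<^sub>F n in sequentially. 3 * (real ?b)\<^sup>2 * ((\<Sum>i = 1..n. (gdist (real i / real n) ((real i - 1) / real n))\<^sup>2) / real n)
        + A\<^sup>2 * real (m i) * (1 / real n) < kap i"
    proof -
      have "(\<lambda>n. 3 * (real ?b)\<^sup>2 * ((\<Sum>i = 1..n. (gdist (real i / real n) ((real i - 1) / real n))\<^sup>2) / real n)
          + A\<^sup>2 * real (m i) * (1 / real n)) \<longlonglongrightarrow> 3 * (real ?b)\<^sup>2 * 0 + A\<^sup>2 * real (m i) * 0"
        by (intro tendsto_add tendsto_mult tendsto_const grid_increments_sq_tendsto lim_1_over_n)
      then show ?thesis by (rule order_tendstoD) (simp add: kpos)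
    qed
    moreover have "\<forall>\<^sub>F n in sequentially. n \<ge> max 1 n0" by (rule eventually_ge_at_top)
    ultimately have "\<forall>\<^sub>F n in sequentially. norm (base.expectation (\<lambda>\<omega>. f (scaled_sum n \<omega>)) - (\<integral>\<omega>. f (\<lambda>v. B (\<tau>0 v) \<omega>) \<partial>N)) < r"
    proof eventually_elim
      case (elim n)
      have n: "n \<ge> 1" "n \<ge> n0" using elim by auto
      have v: "3 * (kap i)\<^sup>2 + 3 * (kap i)\<^sup>2
          + 3 * (real ?b)\<^sup>2 * ((\<Sum>i = 1..n. (gdist (real i / real n) ((real i - 1) / real n))\<^sup>2) / real n)
          + A\<^sup>2 * real (m i) * (1 / real ?b + 1 / real n) \<le> vv i"
      proof -
        have k1: "kap i \<le> 1 / real (m i) ^ 3"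
        proof -
          have "real (m i) ^ 3 \<le> real (m i) ^ 5" by (rule power_increasing) (use mpos(3)[of i] in auto)
          then show ?thesis unfolding kap_def using mpos(1)[of i] by (intro divide_left_mono) auto
        qed
        have "1 / real (m i) ^ 3 \<le> 1" using mpos(3)[of i] by simp
        then have "kap i \<le> 1" using k1 by linarith
        then have k2: "(kap i)\<^sup>2 \<le> 1 / real (m i) ^ 3"
          using k1 kpos[of i] mult_left_le[of "kap i" "kap i"] unfolding power2_eq_square by linarith
        have k3: "A\<^sup>2 * real (m i) * (1 / real ?b) \<le> A\<^sup>2 * (1 / real (m i) ^ 3)"
        proof -
          have "real (m i) ^ 4 \<le> real ?b" by (simp add: Lreal)
          then have "real (m i) * (1 / real ?b) \<le> real (m i) * (1 / real (m i) ^ 4)"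
            using mpos(1)[of i] by (intro mult_left_mono divide_left_mono) auto
          also have "\<dots> = 1 / real (m i) ^ 3" using mpos(1)[of i] by (simp add: eval_nat_numeral)
          finally have "A\<^sup>2 * (real (m i) * (1 / real ?b)) \<le> A\<^sup>2 * (1 / real (m i) ^ 3)"
            by (rule mult_left_mono) simp
          then show ?thesis by (simp only: mult.assoc)
        qed
        have "vv i = 7 * (1 / real (m i) ^ 3) + A\<^sup>2 * (1 / real (m i) ^ 3)"
          by (simp add: vv_def add_divide_distrib)
        then show ?thesis using k1 k2 k3 elim(3) by (simp add: distrib_left)
      qed
      have "\<bar>base.expectation (\<lambda>\<omega>. f (scaled_sum n \<omega>))
          - base.expectation (\<lambda>\<omega>. f (psum (real n / real ?b) (\<lambda>r. block_sum (m i) (K i) (L i) n r \<omega> / sqrt (real n))))\<bar>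
        \<le> Lf * (3 * e) + 2 * Kf * (((\<Sum>j. decay_weight C \<rho> (j + m i)) + 8 * (real (Suc (m i)))\<^sup>2 * vv i) / e\<^sup>2)"
        by (rule scaled_sum_block_diff[OF mpos(2) n(1) K e Kk _ _ v f]) (use n0 n elim in auto)
      then show ?case
        using Le i elim(1) unfolding q_def[symmetric] dist_real_def real_norm_def by linarith
    qed
    then show "\<exists>no. \<forall>n\<ge>no. norm (base.expectation (\<lambda>\<omega>. f (scaled_sum n \<omega>)) - (\<integral>\<omega>. f (\<lambda>v. B (\<tau>0 v) \<omega>) \<partial>N)) < r"
      by (simp add: eventually_sequentially)
  qed
qed

lemma long_run_path_continuous: "continuous_on {0..1} (\<lambda>v. \<integral>u\<in>{0..v}. long_run_var u \<partial>lborel)"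
proof (rule set_integral_continuous[OF measurable_long_run_var])
  show "\<bar>long_run_var u\<bar> \<le> c1 + 2 * c1 / (1 - \<rho>)" if "u \<in> {0..1}" for u
    using long_run_var_nonneg[OF that] long_run_var_le[OF that] by simp
qed

lemma long_run_path_nonneg:
  assumes "v \<in> {0..1}"
  shows "0 \<le> (\<integral>u\<in>{0..v}. long_run_var u \<partial>lborel)"
  unfolding set_lebesgue_integral_def
  by (rule integral_nonneg_AE) (use assms long_run_var_nonneg in \<open>auto simp: indicator_def\<close>)

theorem scaled_sum_weak_convergence:
  assumes BM: "std_brownian_motion N B"
  shows "weak_conv_D \<Omega> scaled_sum N (\<lambda>\<omega> v. B (\<integral>u\<in>{0..v}. long_run_var u \<partial>lborel) \<omega>)"
proof (rule weak_conv_D_if_lipschitz[OF base.prob_space_axioms BM_prob_space[OF BM]])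
  have cB: "continuous_on {0..1} (\<lambda>v. B (\<integral>u\<in>{0..v}. long_run_var u \<partial>lborel) \<omega>)" if "\<omega> \<in> space N" for \<omega>
    by (rule continuous_on_compose2[OF BM_continuous[OF BM that] long_run_path_continuous]) (use long_run_path_nonneg in auto)
  then show "cadlag01 (\<lambda>v. B (\<integral>u\<in>{0..v}. long_run_var u \<partial>lborel) \<omega>)" if "\<omega> \<in> space N" for \<omega>
    using that by (intro cadlag01_continuous)
  show "(\<lambda>\<omega>. f (\<lambda>v. B (\<integral>u\<in>{0..v}. long_run_var u \<partial>lborel) \<omega>)) \<in> borel_measurable N" if "sup_continuous_D f" for f
  proof (rule measurable_sup_continuous_path[OF that])
    show "(\<lambda>\<omega>. B (\<integral>u\<in>{0..v}. long_run_var u \<partial>lborel) \<omega>) \<in> borel_measurable N" if "v \<in> {0..1}" for v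
      by (rule BM_measurable[OF BM long_run_path_nonneg[OF that]])
    show "B (\<integral>u\<in>{0..0}. long_run_var u \<partial>lborel) \<omega> = 0" if "\<omega> \<in> space N" for \<omega>
      unfolding set_integral_zero by (rule BM_0[OF BM that])
  qed (rule cB)
  show "cadlag01 (scaled_sum n \<omega>)" for n \<omega>
    unfolding scaled_sum_def by (rule cadlag01_psum) simp
qed (rule measurable_scaled_sum lipschitz_convergence[OF BM], assumption)+

end

section \<open>Verifying the square-integrable hypotheses\<close>

text \<open>Young's inequality with weights \<open>2 / q\<close> and \<open>1 - 2 / q\<close>,
  applied to \<open>\<bar>x\<bar> / a\<close>. With the scale \<open>a\<close> just above the
  \<open>L_q\<close> norm, the mean of the right-hand side is at most \<open>a^2\<close>.\<close>

lemma square_le_powr_mix: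
  fixes x a q :: real
  assumes a: "a > 0" and q: "q > 2"
  shows "x\<^sup>2 \<le> a\<^sup>2 * (2 / q * (\<bar>x\<bar> powr q / a powr q) + (1 - 2 / q))"
proof (cases "x = 0")
  case True
  have "0 \<le> a\<^sup>2 * (1 - 2 / q)" using q by (intro mult_nonneg_nonneg) auto
  then show ?thesis using True by simp
next
  case False
  define w where "w = \<bar>x\<bar> / a"
  have w: "w > 0" using False a by (simp add: w_def)
  have "(w powr q) powr (2 / q) * 1 powr (1 - 2 / q) \<le> 2 / q * (w powr q) + (1 - 2 / q) * 1"
    by (rule Youngs_inequality_0) (use q w in auto)
  moreover have "(w powr q) powr (2 / q) = w\<^sup>2"
    using q w by (simp add: powr_powr powr_numeral)
  ultimately have "a\<^sup>2 * w\<^sup>2 \<le> a\<^sup>2 * (2 / q * (w powr q) + (1 - 2 / q))"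
    by (intro mult_left_mono) auto
  moreover have "w powr q = \<bar>x\<bar> powr q / a powr q" using a by (simp add: w_def powr_divide)
  moreover have "a\<^sup>2 * w\<^sup>2 = x\<^sup>2" using a by (simp add: w_def power_divide)
  ultimately show ?thesis by simp
qed

lemma abs_diff_powr_le:
  fixes a b q :: real
  assumes "q \<ge> 0"
  shows "\<bar>a - b\<bar> powr q \<le> 2 powr q * (\<bar>a\<bar> powr q + \<bar>b\<bar> powr q)"
proof -
  have "\<bar>a - b\<bar> powr q \<le> (2 * max \<bar>a\<bar> \<bar>b\<bar>) powr q"
    by (rule powr_mono2) (use assms in auto)
  also have "\<dots> = 2 powr q * (max \<bar>a\<bar> \<bar>b\<bar>) powr q" by (simp add: powr_mult)
  also have "\<dots> \<le> 2 powr q * (\<bar>a\<bar> powr q + \<bar>b\<bar> powr q)"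
    by (intro mult_left_mono) (auto simp: max_def)
  finally show ?thesis .
qed

lemma integrable_powr_diff:
  fixes f g :: "'a \<Rightarrow> real"
  assumes [measurable]: "f \<in> borel_measurable N" "g \<in> borel_measurable N" and q: "q \<ge> 0"
    and int: "integrable N (\<lambda>x. \<bar>f x\<bar> powr q)" "integrable N (\<lambda>x. \<bar>g x\<bar> powr q)"
  shows "integrable N (\<lambda>x. \<bar>f x - g x\<bar> powr q)"
proof (rule Bochner_Integration.integrable_bound)
  show "integrable N (\<lambda>x. 2 powr q * (\<bar>f x\<bar> powr q + \<bar>g x\<bar> powr q))"
    using int by simp
  show "AE x in N. norm (\<bar>f x - g x\<bar> powr q) \<le> norm (2 powr q * (\<bar>f x\<bar> powr q + \<bar>g x\<bar> powr q))"
    using abs_diff_powr_le[OF q] by auto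
qed measurable

lemma Lq_norm_nonneg: "0 \<le> Lq_norm N q f"
  by (simp add: Lq_norm_def)

lemma Lq_norm_powr: "q > 0 \<Longrightarrow> Lq_norm N q f powr q = (\<integral>x. \<bar>f x\<bar> powr q \<partial>N)"
  by (simp add: Lq_norm_def powr_powr)

lemma (in prob_space) L2_norm_le_Lq_norm:
  assumes [measurable]: "f \<in> borel_measurable M" and q: "q > 2"
    and int: "integrable M (\<lambda>x. \<bar>f x\<bar> powr q)"
  shows "square_int M f" "L2_norm M f \<le> Lq_norm M q f"
proof -
  have "integrable M (\<lambda>x. (f x)\<^sup>2)"
  proof (rule Bochner_Integration.integrable_bound)
    show "integrable M (\<lambda>x. 1\<^sup>2 * (2 / q * (\<bar>f x\<bar> powr q / 1 powr q) + (1 - 2 / q)))"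
      using int by simp
    show "AE x in M. norm ((f x)\<^sup>2) \<le> norm (1\<^sup>2 * (2 / q * (\<bar>f x\<bar> powr q / 1 powr q) + (1 - 2 / q)))"
    proof (rule AE_I2)
      fix x
      show "norm ((f x)\<^sup>2) \<le> norm (1\<^sup>2 * (2 / q * (\<bar>f x\<bar> powr q / 1 powr q) + (1 - 2 / q)))"
        unfolding real_norm_def abs_power2 by (rule order_trans[OF square_le_powr_mix[OF zero_less_one q] abs_ge_self])
    qed
  qed measurable
  then show sq: "square_int M f" by (simp add: square_int_def)
  show "L2_norm M f \<le> Lq_norm M q f"
  proof (rule field_le_epsilon)
    fix e :: real assume e: "e > 0"
    \<comment> \<open>The added \<open>e\<close> keeps the scale positive when the norm is
      \<open>0\<close>.\<close>
    define a where "a = Lq_norm M q f + e"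
    have a: "a > 0" using e Lq_norm_nonneg[of M q f] by (simp add: a_def)
    have "expectation (\<lambda>x. \<bar>f x\<bar> powr q) \<le> a powr q"
      using powr_mono2[of q "Lq_norm M q f" a] q e
      by (simp add: Lq_norm_powr Lq_norm_nonneg a_def)
    then have le: "expectation (\<lambda>x. \<bar>f x\<bar> powr q) / a powr q \<le> 1" using a by simp
    have "expectation (\<lambda>x. (f x)\<^sup>2) \<le> expectation (\<lambda>x. a\<^sup>2 * (2 / q * (\<bar>f x\<bar> powr q / a powr q) + (1 - 2 / q)))"
      by (rule integral_mono) (use sq int square_le_powr_mix[OF a q] in \<open>auto simp: square_int_def\<close>)
    also have "\<dots> = a\<^sup>2 * (2 / q * (expectation (\<lambda>x. \<bar>f x\<bar> powr q) / a powr q) + (1 - 2 / q))"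
      using int by (simp add: prob_space)
    also have "\<dots> \<le> a\<^sup>2 * (2 / q * 1 + (1 - 2 / q))"
      using le q by (intro mult_left_mono add_right_mono) auto
    finally show "L2_norm M f \<le> Lq_norm M q f + e"
      unfolding a_def[symmetric] using a by (intro L2_norm_leI) auto
  qed
qed

text \<open>Above the level \<open>K\<close> the negative exponent \<open>2 - q\<close> makes
  \<open>\<bar>x\<bar> powr (2 - q)\<close> at most \<open>K powr (2 - q)\<close>. The truncation
  error is thus governed by the \<open>q\<close>-th moment alone.\<close>

lemma trunc_error_sq_le:
  fixes x q K :: real
  assumes K: "K > 0" and q: "q > 2"
  shows "(x - trunc K x)\<^sup>2 \<le> \<bar>x\<bar> powr q * K powr (2 - q)"
proof (cases "\<bar>x\<bar> \<le> K")
  case True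
  then have "trunc K x = x" by (auto simp: trunc_def)
  then show ?thesis by simp
next
  case False
  have "\<bar>x - trunc K x\<bar> \<le> \<bar>x\<bar>" using K by (auto simp: trunc_def)
  then have "(x - trunc K x)\<^sup>2 \<le> \<bar>x\<bar>\<^sup>2" by (simp add: abs_le_square_iff)
  also have "\<dots> = \<bar>x\<bar> powr q * \<bar>x\<bar> powr (2 - q)"
    using False K by (simp add: powr_add[symmetric] powr_numeral)
  also have "\<dots> \<le> \<bar>x\<bar> powr q * K powr (2 - q)"
    by (intro mult_left_mono powr_mono2') (use False K q in auto)
  finally show ?thesis .
qed

text \<open>A chain that stops early is completed by the point \<open>1\<close>, which only adds a
  nonnegative term. Such chains arise from cells that do not fill the unit interval.\<close>

lemma pvar_sum_initial_le:
  fixes w :: "nat \<Rightarrow> real"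
  assumes p: "p > 0" and V: "\<And>m u. is_partition01 m u \<Longrightarrow> pvar_sum N q p F m u \<le> V"
    and w0: "w 0 = 0" and w1: "w m \<le> 1" and inc: "\<And>i. i < m \<Longrightarrow> w i < w (Suc i)"
  shows "(\<Sum>i = 1..m. Lq_norm N q (\<lambda>\<omega>. F (w i) \<omega> - F (w (i - 1)) \<omega>) powr p) \<le> V powr p"
proof -
  have bound: "(\<Sum>i = 1..k. Lq_norm N q (\<lambda>\<omega>. F (u i) \<omega> - F (u (i - 1)) \<omega>) powr p) \<le> V powr p"
    if "is_partition01 k u" for k u
  proof -
    let ?s = "\<Sum>i = 1..k. Lq_norm N q (\<lambda>\<omega>. F (u i) \<omega> - F (u (i - 1)) \<omega>) powr p"
    have s: "0 \<le> ?s" by (intro sum_nonneg) auto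
    have "?s powr (1 / p) \<le> V" using V[OF that] by (simp add: pvar_sum_def)
    then have "(?s powr (1 / p)) powr p \<le> V powr p" using p by (intro powr_mono2) auto
    then show ?thesis using s p by (simp add: powr_powr)
  qed
  show ?thesis
  proof (cases "w m = 1")
    case True
    then have "is_partition01 m w" using w0 inc by (cases m) (auto simp: is_partition01_def)
    then show ?thesis by (rule bound)
  next
    case False
    define u where "u i = (if i \<le> m then w i else 1)" for i
    have "is_partition01 (Suc m) u"
      using w0 w1 inc False by (auto simp: is_partition01_def u_def less_Suc_eq Suc_le_eq)
    from bound[OF this]
    have "(\<Sum>i = 1..Suc m. Lq_norm N q (\<lambda>\<omega>. F (u i) \<omega> - F (u (i - 1)) \<omega>) powr p) \<le> V powr p" .
    moreover have "(\<Sum>i = 1..m. Lq_norm N q (\<lambda>\<omega>. F (w i) \<omega> - F (w (i - 1)) \<omega>) powr p)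
        = (\<Sum>i = 1..m. Lq_norm N q (\<lambda>\<omega>. F (u i) \<omega> - F (u (i - 1)) \<omega>) powr p)"
      by (intro sum.cong) (auto simp: u_def)
    moreover have "\<dots> \<le> (\<Sum>i = 1..Suc m. Lq_norm N q (\<lambda>\<omega>. F (u i) \<omega> - F (u (i - 1)) \<omega>) powr p)"
      by (intro sum_mono2) auto
    ultimately show ?thesis by linarith
  qed
qed

section \<open>Laws of the past and of the coupled past\<close>

context iid_process
begin

lemma L2_norm_le_Lq_shift:
  assumes f: "f \<in> borel_measurable S" and q: "q > 2"
    and int: "integrable \<Omega> (\<lambda>\<omega>. \<bar>f (shift_vec eps t \<omega>)\<bar> powr q)"
  shows "square_int S f" "L2_norm S f \<le> Lq_norm \<Omega> q (\<lambda>\<omega>. f (shift_vec eps t \<omega>))"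
proof -
  note * = base.L2_norm_le_Lq_norm[OF measurable_kernel_shift[OF f] q int]
  have f': "f \<in> borel_measurable Rinf" using f by (simp add: measurable_S_iff)
  show "square_int S f"
    using *(1) square_int_distr[OF measurable_shift_vec f', of t] by (simp add: distr_shift_vec)
  show "L2_norm S f \<le> Lq_norm \<Omega> q (\<lambda>\<omega>. f (shift_vec eps t \<omega>))"
    using *(2) L2_norm_distr[OF measurable_shift_vec f', of t] by (simp add: distr_shift_vec)
qed

context
  fixes eps' :: "int \<Rightarrow> 'a \<Rightarrow> real"
  assumes indep_copy: "base.indep_vars (\<lambda>_. borel) (\<lambda>i. case i of Inl j \<Rightarrow> eps j | Inr j \<Rightarrow> eps' j) (UNIV :: (int + int) set)"
    and law_copy: "\<And>i. distr \<Omega> borel (eps' i) = \<mu>"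
begin

lemma measurable_eps': "eps' i \<in> borel_measurable \<Omega>"
  using indep_copy by (auto simp: base.indep_vars_def dest!: spec[where x = "Inr i"])

text \<open>Replacing one entry by its copy is still an injective selection from the joint family,
  so the coupled past has the law of the past.\<close>

lemma distr_shift_vec_coupled: "distr \<Omega> Rinf (shift_vec_coupled eps eps' t j) = S"
proof -
  define h where "h k = (if k = j then Inr (t - int j) else Inl (t - int k))" for k
  have h: "inj h" by (auto simp: inj_def h_def split: if_splits)
  have law: "distr \<Omega> borel (case i of Inl j \<Rightarrow> eps j | Inr j \<Rightarrow> eps' j) = \<mu>" for i
    by (cases i) (auto simp: law_eps law_copy)
  have "(\<lambda>\<omega> k. (case h k of Inl j \<Rightarrow> eps j | Inr j \<Rightarrow> eps' j) \<omega>) = shift_vec_coupled eps eps' t j"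
    by (auto simp: fun_eq_iff h_def shift_vec_coupled_def)
  with base.distr_reindexed_iid[OF indep_copy law h] show ?thesis by simp
qed

lemma measurable_shift_vec_coupled: "shift_vec_coupled eps eps' t j \<in> measurable \<Omega> Rinf"
proof (rule measurable_PiM_single')
  show "(\<lambda>\<omega>. shift_vec_coupled eps eps' t j \<omega> k) \<in> borel_measurable \<Omega>" for k
    by (cases "k = j") (auto simp: shift_vec_coupled_def measurable_eps measurable_eps')
qed auto

text \<open>Putting the copied innovation in front of the past is an injective selection from the
  joint family, hence has law \<open>S\<close>; peeling off the first entry gives the
  product.\<close>

lemma distr_shift_vec_copy:
  "distr \<Omega> (Rinf \<Otimes>\<^sub>M borel) (\<lambda>\<omega>. (shift_vec eps t \<omega>, eps' i \<omega>)) = S \<Otimes>\<^sub>M \<mu>"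
proof -
  define h :: "nat \<Rightarrow> int + int" where "h k = (case k of 0 \<Rightarrow> Inr i | Suc k \<Rightarrow> Inl (t - int k))" for k
  define Y where "Y \<omega> = case_nat (eps' i \<omega>) (shift_vec eps t \<omega>)" for \<omega>
  define dec where "dec z = (\<lambda>k. z (Suc k), z 0)" for z :: "nat \<Rightarrow> real"
  have h: "inj h" by (auto simp: inj_def h_def split: nat.splits)
  have law: "distr \<Omega> borel (case i of Inl j \<Rightarrow> eps j | Inr j \<Rightarrow> eps' j) = \<mu>" for i
    by (cases i) (auto simp: law_eps law_copy)
  have Y_eq: "(\<lambda>\<omega> k. (case h k of Inl j \<Rightarrow> eps j | Inr j \<Rightarrow> eps' j) \<omega>) = Y"
    by (auto simp: fun_eq_iff h_def Y_def shift_vec_def split: nat.split)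
  have Y_law: "distr \<Omega> Rinf Y = S"
    using base.distr_reindexed_iid[OF indep_copy law h] unfolding Y_eq .
  have Y: "Y \<in> measurable \<Omega> Rinf"
  proof (rule measurable_PiM_single')
    show "(\<lambda>\<omega>. Y \<omega> k) \<in> borel_measurable \<Omega>" for k
      by (cases k) (auto simp: Y_def shift_vec_def measurable_eps measurable_eps')
  qed auto
  have dec: "dec \<in> measurable Rinf (Rinf \<Otimes>\<^sub>M borel)"
    unfolding dec_def by (intro measurable_Pair measurable_PiM_single' measurable_component_singleton) auto
  have sets_eq: "sets (Rinf \<Otimes>\<^sub>M borel) = sets (S \<Otimes>\<^sub>M \<mu>)"
    by (intro sets_pair_measure_cong) (auto simp: sets_S sets_mu)
  have dec': "dec \<in> measurable S (S \<Otimes>\<^sub>M \<mu>)"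
    using dec measurable_cong_sets[OF sets_S sets_eq[symmetric]] by blast
  interpret SM: pair_prob_space S \<mu> ..
  have "distr \<Omega> (Rinf \<Otimes>\<^sub>M borel) (\<lambda>\<omega>. (shift_vec eps t \<omega>, eps' i \<omega>)) = distr \<Omega> (Rinf \<Otimes>\<^sub>M borel) (dec \<circ> Y)"
    by (rule arg_cong[where f = "distr \<Omega> (Rinf \<Otimes>\<^sub>M borel)"]) (auto simp: dec_def Y_def)
  also have "\<dots> = distr S (Rinf \<Otimes>\<^sub>M borel) dec"
    using distr_distr[OF dec Y] by (simp add: Y_law)
  also have "\<dots> = distr S (S \<Otimes>\<^sub>M \<mu>) dec"
    by (rule distr_cong) (auto simp: sets_eq)
  also have "\<dots> = distr (distr (\<mu> \<Otimes>\<^sub>M S) S (\<lambda>(s, \<omega>). case_nat s \<omega>)) (S \<Otimes>\<^sub>M \<mu>) dec"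
    by (simp only: PiM_iter)
  also have "\<dots> = distr (\<mu> \<Otimes>\<^sub>M S) (S \<Otimes>\<^sub>M \<mu>) (dec \<circ> (\<lambda>(s, \<omega>). case_nat s \<omega>))"
    by (rule distr_distr[OF dec']) measurable
  also have "dec \<circ> (\<lambda>(s, \<omega>). case_nat s \<omega>) = (\<lambda>(x, y). (y, x))"
    by (auto simp: fun_eq_iff dec_def)
  also have "distr (\<mu> \<Otimes>\<^sub>M S) (S \<Otimes>\<^sub>M \<mu>) (\<lambda>(x, y). (y, x)) = S \<Otimes>\<^sub>M \<mu>"
    by (rule SM.distr_pair_swap[symmetric])
  finally show ?thesis .
qed

text \<open>The coupled past is the past with entry \<open>j\<close> overwritten by an independent
  innovation, which is the pair occurring in \<open>head_mean_coupling\<close>; the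
  \<open>L_q\<close> bound is used through the comparison of norms.\<close>

lemma head_mean_increment_le_coupling:
  assumes g: "g \<in> borel_measurable S" and q: "q > 2"
    and int: "integrable \<Omega> (\<lambda>\<omega>. \<bar>g (shift_vec eps 0 \<omega>)\<bar> powr q)"
    and le: "Lq_norm \<Omega> q (\<lambda>\<omega>. g (shift_vec eps 0 \<omega>) - g (shift_vec_coupled eps eps' 0 j \<omega>)) \<le> c"
  shows "L2_norm S (\<lambda>x. head_mean (Suc j) g x - head_mean j g x) \<le> c"
proof -
  have g' [measurable]: "g \<in> borel_measurable Rinf" using g by (simp add: measurable_S_iff)
  define D where "D p = g (fst p) - g ((fst p)(j := snd p))" for p :: "(nat \<Rightarrow> real) \<times> real"
  have upd: "(\<lambda>p. (fst p)(j := snd p)) \<in> measurable (Rinf \<Otimes>\<^sub>M borel) Rinf"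
    by (rule measurable_PiM_single') (auto simp: space_PiM)
  have D: "D \<in> borel_measurable (Rinf \<Otimes>\<^sub>M borel)"
    unfolding D_def using measurable_compose[OF upd g'] by measurable
  let ?P = "\<lambda>\<omega>. (shift_vec eps 0 \<omega>, eps' (0 - int j) \<omega>)"
  have P: "?P \<in> measurable \<Omega> (Rinf \<Otimes>\<^sub>M borel)"
    by (intro measurable_Pair measurable_shift_vec measurable_eps')
  have DP: "D (?P \<omega>) = g (shift_vec eps 0 \<omega>) - g (shift_vec_coupled eps eps' 0 j \<omega>)" for \<omega>
  proof -
    have "(shift_vec eps 0 \<omega>)(j := eps' (0 - int j) \<omega>) = shift_vec_coupled eps eps' 0 j \<omega>"
      by (auto simp: fun_eq_iff shift_vec_def shift_vec_coupled_def)
    then show ?thesis by (simp add: D_def)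
  qed
  have mc: "(\<lambda>\<omega>. g (shift_vec_coupled eps eps' 0 j \<omega>)) \<in> borel_measurable \<Omega>"
    by (rule measurable_compose[OF measurable_shift_vec_coupled g'])
  have "integrable (distr \<Omega> Rinf (shift_vec eps 0)) (\<lambda>x. \<bar>g x\<bar> powr q)"
    using int by (subst integrable_distr_eq) auto
  then have "integrable (distr \<Omega> Rinf (shift_vec_coupled eps eps' 0 j)) (\<lambda>x. \<bar>g x\<bar> powr q)"
    by (simp add: distr_shift_vec distr_shift_vec_coupled)
  then have intc: "integrable \<Omega> (\<lambda>\<omega>. \<bar>g (shift_vec_coupled eps eps' 0 j \<omega>)\<bar> powr q)"
    by (subst (asm) integrable_distr_eq[OF measurable_shift_vec_coupled]) auto
  have intd: "integrable \<Omega> (\<lambda>\<omega>. \<bar>g (shift_vec eps 0 \<omega>) - g (shift_vec_coupled eps eps' 0 j \<omega>)\<bar> powr q)"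
    by (rule integrable_powr_diff[OF measurable_kernel_shift[OF g] mc _ int intc]) (use q in simp)
  have md: "(\<lambda>\<omega>. g (shift_vec eps 0 \<omega>) - g (shift_vec_coupled eps eps' 0 j \<omega>)) \<in> borel_measurable \<Omega>"
    by (intro borel_measurable_diff measurable_kernel_shift[OF g] mc)
  note * = base.L2_norm_le_Lq_norm[OF md q intd]
  have sq: "square_int (S \<Otimes>\<^sub>M \<mu>) D"
    using *(1) square_int_distr[OF P D] unfolding distr_shift_vec_copy DP by simp
  have nm: "L2_norm (S \<Otimes>\<^sub>M \<mu>) D \<le> c"
    using *(2) le L2_norm_distr[OF P D] unfolding distr_shift_vec_copy DP by simp
  have Dsq: "(\<lambda>(x, y). (g x - g (x(j := y)))\<^sup>2) = (\<lambda>p. (D p)\<^sup>2)"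
    by (auto simp: D_def fun_eq_iff)
  have c: "0 \<le> c" using le Lq_norm_nonneg order_trans by blast
  show ?thesis
  proof (rule head_mean_coupling[OF L2_norm_le_Lq_shift(1)[OF g q int] c])
    show "integrable (S \<Otimes>\<^sub>M \<mu>) (\<lambda>(x, y). (g x - g (x(j := y)))\<^sup>2)"
      unfolding Dsq using sq by (simp add: square_int_def)
    show "(\<integral>p. (case p of (x, y) \<Rightarrow> (g x - g (x(j := y)))\<^sup>2) \<partial>(S \<Otimes>\<^sub>M \<mu>)) \<le> c\<^sup>2"
      unfolding Dsq L2_norm_sq[symmetric] using nm by (intro power_mono) auto
  qed
qed

text \<open>The limit kernel inherits its bounds from the array: norms and
  \<open>p\<close>-variation sums pass to the limit along fixed times and fixed chains, and one
  \<open>Gn\<close> near \<open>G\<close> bounds the \<open>q\<close>-th moments of \<open>G\<close>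
  uniformly in time, which yields the uniform truncation.\<close>

lemma kernel_array_of_Lq_conditions:
  fixes Gn :: "nat \<Rightarrow> real \<Rightarrow> (nat \<Rightarrow> real) \<Rightarrow> real" and G :: "real \<Rightarrow> (nat \<Rightarrow> real) \<Rightarrow> real"
  assumes meas_Gn: "\<And>n. (\<lambda>(u, x). Gn n u x) \<in> borel_measurable (borel \<Otimes>\<^sub>M Rinf)"
    and meas_G: "(\<lambda>(u, x). G u x) \<in> borel_measurable (borel \<Otimes>\<^sub>M Rinf)"
    and q: "q > 2" and p: "p > 0"
    and Lq_Gn: "\<And>n u. n \<ge> 1 \<Longrightarrow> u \<in> {0..1} \<Longrightarrow> integrable \<Omega> (\<lambda>\<omega>. \<bar>Gn n u (shift_vec eps 0 \<omega>)\<bar> powr q)"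
    and Lq_G: "\<And>u. u \<in> {0..1} \<Longrightarrow> integrable \<Omega> (\<lambda>\<omega>. \<bar>G u (shift_vec eps 0 \<omega>)\<bar> powr q)"
    and A1: "\<And>e. e > 0 \<Longrightarrow> \<exists>n0. \<forall>n\<ge>n0. \<forall>u\<in>{0..1}.
               Lq_norm \<Omega> q (\<lambda>\<omega>. Gn n u (shift_vec eps 0 \<omega>) - G u (shift_vec eps 0 \<omega>)) \<le> e"
    and norm: "\<And>n u. n \<ge> 1 \<Longrightarrow> u \<in> {0..1} \<Longrightarrow> Lq_norm \<Omega> q (\<lambda>\<omega>. Gn n u (shift_vec eps 0 \<omega>)) \<le> A"
    and var: "\<And>n m u. n \<ge> 1 \<Longrightarrow> is_partition01 m u \<Longrightarrow>
               pvar_sum \<Omega> q p (\<lambda>v \<omega>. Gn n v (shift_vec eps 0 \<omega>)) m u \<le> V"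
    and rho: "0 < \<rho>" "\<rho> < 1"
    and dep: "\<And>n u j. j \<ge> 1 \<Longrightarrow> n \<ge> 1 \<Longrightarrow> u \<in> {0..1} \<Longrightarrow>
               Lq_norm \<Omega> q (\<lambda>\<omega>. Gn n u (shift_vec eps 0 \<omega>) - Gn n u (shift_vec_coupled eps eps' 0 j \<omega>)) \<le> C * \<rho> ^ j"
  shows "kernel_array \<mu> \<Omega> eps Gn G A p (V powr p) C \<rho>"
proof -
  have mGn: "Gn n u \<in> borel_measurable S" for n u
    unfolding measurable_S_iff using measurable_compose[OF measurable_Pair1' meas_Gn, of u n] by simp
  have mG: "G u \<in> borel_measurable S" for u
    unfolding measurable_S_iff using measurable_compose[OF measurable_Pair1' meas_G, of u] by simp
  have diff: "square_int S (\<lambda>x. f x - g x)"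
    "L2_norm S (\<lambda>x. f x - g x) \<le> Lq_norm \<Omega> q (\<lambda>\<omega>. f (shift_vec eps 0 \<omega>) - g (shift_vec eps 0 \<omega>))"
    "integrable \<Omega> (\<lambda>\<omega>. \<bar>f (shift_vec eps 0 \<omega>) - g (shift_vec eps 0 \<omega>)\<bar> powr q)"
    if f: "f \<in> borel_measurable S" and g: "g \<in> borel_measurable S"
      and intf: "integrable \<Omega> (\<lambda>\<omega>. \<bar>f (shift_vec eps 0 \<omega>)\<bar> powr q)"
      and intg: "integrable \<Omega> (\<lambda>\<omega>. \<bar>g (shift_vec eps 0 \<omega>)\<bar> powr q)" for f g
  proof -
    show int: "integrable \<Omega> (\<lambda>\<omega>. \<bar>f (shift_vec eps 0 \<omega>) - g (shift_vec eps 0 \<omega>)\<bar> powr q)"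
      by (rule integrable_powr_diff[OF measurable_kernel_shift[OF f] measurable_kernel_shift[OF g] _ intf intg])
         (use q in simp)
    have m: "(\<lambda>x. f x - g x) \<in> borel_measurable S" by (rule borel_measurable_diff[OF f g])
    show "square_int S (\<lambda>x. f x - g x)"
      "L2_norm S (\<lambda>x. f x - g x) \<le> Lq_norm \<Omega> q (\<lambda>\<omega>. f (shift_vec eps 0 \<omega>) - g (shift_vec eps 0 \<omega>))"
      using L2_norm_le_Lq_shift[OF m q int] by auto
  qed
  have sq_Gn: "square_int S (Gn n u)" if "n \<ge> 1" "u \<in> {0..1}" for n u
    by (rule L2_norm_le_Lq_shift(1)[OF mGn q Lq_Gn[OF that]])
  have sq_G: "square_int S (G u)" if "u \<in> {0..1}" for u
    by (rule L2_norm_le_Lq_shift(1)[OF mG q Lq_G[OF that]])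
  have norm_Gn: "L2_norm S (Gn n u) \<le> A" if "n \<ge> 1" "u \<in> {0..1}" for n u
    using L2_norm_le_Lq_shift(2)[OF mGn q Lq_Gn[OF that]] norm[OF that] by linarith
  have conv: "\<exists>n0\<ge>1. \<forall>n\<ge>n0. \<forall>u\<in>{0..1}. L2_norm S (\<lambda>x. Gn n u x - G u x) \<le> e" if e: "e > 0" for e
  proof -
    obtain n0 where n0: "\<forall>n\<ge>n0. \<forall>u\<in>{0..1}.
        Lq_norm \<Omega> q (\<lambda>\<omega>. Gn n u (shift_vec eps 0 \<omega>) - G u (shift_vec eps 0 \<omega>)) \<le> e"
      using A1[OF e] by blast
    have "L2_norm S (\<lambda>x. Gn n u x - G u x) \<le> e" if n: "n \<ge> max n0 1" and u: "u \<in> {0..1}" for n u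
    proof -
      have "n \<ge> 1" "n \<ge> n0" using n by auto
      then show ?thesis using diff(2)[OF mGn mG Lq_Gn[OF _ u] Lq_G[OF u], of n] n0 u by fastforce
    qed
    then show ?thesis by (intro exI[of _ "max n0 1"]) auto
  qed
  show ?thesis
  proof (rule kernel_array.intro[OF iid_process_axioms], unfold_locales)
    have "sets (borel \<Otimes>\<^sub>M S) = sets (borel \<Otimes>\<^sub>M Rinf)"
      by (rule sets_pair_measure_cong[OF refl sets_S])
    then show "(\<lambda>(u, x). G u x) \<in> borel_measurable (borel \<Otimes>\<^sub>M S)"
      using meas_G measurable_cong_sets[OF _ refl] by blast
    show "L2_norm S (G u) \<le> A" if u: "u \<in> {0..1}" for u
    proof (rule field_le_epsilon)
      fix e :: real assume "e > 0"
      from conv[OF this] obtain n where n: "n \<ge> 1" "L2_norm S (\<lambda>x. Gn n u x - G u x) \<le> e"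
        using u by blast
      show "L2_norm S (G u) \<le> A + e"
        using L2_norm_reverse_triangle[OF sq_Gn[OF n(1) u] sq_G[OF u]] n(2) norm_Gn[OF n(1) u] by linarith
    qed
    show "\<exists>n0. \<forall>n\<ge>n0. \<forall>u\<in>{0..1}. L2_norm S (\<lambda>x. Gn n u x - G u x) \<le> e" if "e > 0" for e
      using conv[OF that] by blast
    show "(\<Sum>i = 1..m. L2_norm S (\<lambda>x. G (w i) x - G (w (i - 1)) x) powr p) \<le> V powr p"
      if w0: "w 0 = 0" and w1: "w m \<le> 1" and inc: "\<And>i. i < m \<Longrightarrow> w i < w (Suc i)" for w :: "nat \<Rightarrow> real" and m
    proof -
      have le: "w i \<le> w j" if "i \<le> j" "j \<le> m" for i j
        using that
      proof (induction rule: dec_induct)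
        case (step n)
        then show ?case using inc[of n] by simp
      qed simp
      have wi: "w i \<in> {0..1}" if "i \<le> m" for i
        using le[of 0 i] le[of i m] w0 w1 that by auto
      show ?thesis
      proof (rule LIMSEQ_le_const2)
        show "(\<lambda>n. \<Sum>i = 1..m. L2_norm S (\<lambda>x. Gn n (w i) x - Gn n (w (i - 1)) x) powr p)
            \<longlonglongrightarrow> (\<Sum>i = 1..m. L2_norm S (\<lambda>x. G (w i) x - G (w (i - 1)) x) powr p)"
        proof (intro tendsto_sum tendsto_powr')
          fix i assume i: "i \<in> {1..m}"
          have u: "w i \<in> {0..1}" "w (i - 1) \<in> {0..1}" by (rule wi; use i in force)+
          show "(\<lambda>n. L2_norm S (\<lambda>x. Gn n (w i) x - Gn n (w (i - 1)) x))
              \<longlonglongrightarrow> L2_norm S (\<lambda>x. G (w i) x - G (w (i - 1)) x)"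
          proof (rule LIMSEQ_I)
            fix r :: real assume r: "r > 0"
            then have "r / 3 > 0" by simp
            from conv[OF this] obtain n0 where n0: "n0 \<ge> 1"
              "\<And>n u. n \<ge> n0 \<Longrightarrow> u \<in> {0..1} \<Longrightarrow> L2_norm S (\<lambda>x. Gn n u x - G u x) \<le> r / 3" by blast
            have "norm (L2_norm S (\<lambda>x. Gn n (w i) x - Gn n (w (i - 1)) x)
                - L2_norm S (\<lambda>x. G (w i) x - G (w (i - 1)) x)) < r" if n: "n \<ge> n0" for n
            proof -
              have n1: "n \<ge> 1" using n n0 by simp
              have "\<bar>L2_norm S (\<lambda>x. Gn n (w i) x - Gn n (w (i - 1)) x) - L2_norm S (\<lambda>x. G (w i) x - G (w (i - 1)) x)\<bar>
                  \<le> L2_norm S (\<lambda>x. (Gn n (w i) x - Gn n (w (i - 1)) x) - (G (w i) x - G (w (i - 1)) x))"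
                by (intro L2_norm_reverse_triangle square_int_diff sq_Gn sq_G n1 u)
              also have "\<dots> = L2_norm S (\<lambda>x. (Gn n (w i) x - G (w i) x) - (Gn n (w (i - 1)) x - G (w (i - 1)) x))"
                by (simp add: algebra_simps)
              also have "\<dots> \<le> L2_norm S (\<lambda>x. Gn n (w i) x - G (w i) x) + L2_norm S (\<lambda>x. Gn n (w (i - 1)) x - G (w (i - 1)) x)"
                by (intro L2_norm_diff_le square_int_diff sq_Gn sq_G n1 u)
              finally show ?thesis using n0(2)[OF n u(1)] n0(2)[OF n u(2)] r by simp
            qed
            then show "\<exists>no. \<forall>n\<ge>no. norm (L2_norm S (\<lambda>x. Gn n (w i) x - Gn n (w (i - 1)) x)
                - L2_norm S (\<lambda>x. G (w i) x - G (w (i - 1)) x)) < r" by blast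
          qed
        qed (use p in auto)
        have "(\<Sum>i = 1..m. L2_norm S (\<lambda>x. Gn n (w i) x - Gn n (w (i - 1)) x) powr p) \<le> V powr p" if n: "n \<ge> 1" for n
        proof -
          have "(\<Sum>i = 1..m. L2_norm S (\<lambda>x. Gn n (w i) x - Gn n (w (i - 1)) x) powr p)
              \<le> (\<Sum>i = 1..m. Lq_norm \<Omega> q (\<lambda>\<omega>. Gn n (w i) (shift_vec eps 0 \<omega>) - Gn n (w (i - 1)) (shift_vec eps 0 \<omega>)) powr p)"
          proof (intro sum_mono powr_mono2)
            fix i assume i: "i \<in> {1..m}"
            have u: "w i \<in> {0..1}" "w (i - 1) \<in> {0..1}" by (rule wi; use i in force)+
            show "L2_norm S (\<lambda>x. Gn n (w i) x - Gn n (w (i - 1)) x)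
                \<le> Lq_norm \<Omega> q (\<lambda>\<omega>. Gn n (w i) (shift_vec eps 0 \<omega>) - Gn n (w (i - 1)) (shift_vec eps 0 \<omega>))"
              by (rule diff(2)[OF mGn mGn Lq_Gn[OF n u(1)] Lq_Gn[OF n u(2)]])
          qed (use p in auto)
          also have "\<dots> \<le> V powr p"
            by (rule pvar_sum_initial_le[OF p var[OF n] w0 w1 inc])
          finally show ?thesis .
        qed
        then show "\<exists>N. \<forall>n\<ge>N. (\<Sum>i = 1..m. L2_norm S (\<lambda>x. Gn n (w i) x - Gn n (w (i - 1)) x) powr p) \<le> V powr p"
          by blast
      qed
    qed
    show "0 \<le> C"
    proof -
      \<comment> \<open>The sign of \<open>C\<close> is read off the dependence bound at
        \<open>j = 1\<close>, norms being nonnegative.\<close>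
      have "0 \<le> C * \<rho> ^ 1" by (rule order_trans[OF Lq_norm_nonneg dep[of 1 1 0]]) auto
      then show ?thesis using rho by (simp add: zero_le_mult_iff)
    qed
    show "L2_norm S (\<lambda>x. head_mean (Suc j) (Gn n u) x - head_mean j (Gn n u) x) \<le> C * \<rho> ^ j"
      if "n \<ge> 1" "u \<in> {0..1}" "j \<ge> 1" for n u j
    proof (rule head_mean_increment_le_coupling[where q = q])
      show "integrable \<Omega> (\<lambda>\<omega>. \<bar>Gn n u (shift_vec eps 0 \<omega>)\<bar> powr q)" by (rule Lq_Gn[OF that(1,2)])
      show "Lq_norm \<Omega> q (\<lambda>\<omega>. Gn n u (shift_vec eps 0 \<omega>) - Gn n u (shift_vec_coupled eps eps' 0 j \<omega>)) \<le> C * \<rho> ^ j"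
        by (rule dep[OF that(3,1,2)])
    qed (rule mGn q)+
    show "\<exists>K\<ge>0. \<forall>u\<in>{0..1}. L2_norm S (\<lambda>x. G u x - trunc K (G u x)) \<le> e" if e: "e > 0" for e
    proof -
      obtain n0 where "\<forall>n\<ge>n0. \<forall>u\<in>{0..1}.
          Lq_norm \<Omega> q (\<lambda>\<omega>. Gn n u (shift_vec eps 0 \<omega>) - G u (shift_vec eps 0 \<omega>)) \<le> 1"
        using A1[of 1] by auto
      then obtain n where n: "n \<ge> 1"
        and nd: "\<And>u. u \<in> {0..1} \<Longrightarrow> Lq_norm \<Omega> q (\<lambda>\<omega>. Gn n u (shift_vec eps 0 \<omega>) - G u (shift_vec eps 0 \<omega>)) \<le> 1"
        by (metis max.cobounded1 max.cobounded2)
      \<comment> \<open>Bounds the \<open>q\<close>-th moment of \<open>G\<close> at every time: the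
        chosen \<open>Gn\<close> has \<open>q\<close>-th moment at most \<open>A powr q\<close>, and
        its distance to \<open>G\<close> at most \<open>1\<close>.\<close>
      define D where "D = 2 powr q * (A powr q + 1)"
      have D: "0 \<le> D" by (simp add: D_def)
      have Dle: "base.expectation (\<lambda>\<omega>. \<bar>G u (shift_vec eps 0 \<omega>)\<bar> powr q) \<le> D" if u: "u \<in> {0..1}" for u
      proof -
        let ?f = "\<lambda>\<omega>. Gn n u (shift_vec eps 0 \<omega>)" and ?g = "\<lambda>\<omega>. G u (shift_vec eps 0 \<omega>)"
        have intd: "integrable \<Omega> (\<lambda>\<omega>. \<bar>?f \<omega> - ?g \<omega>\<bar> powr q)"
          by (rule diff(3)[OF mGn mG Lq_Gn[OF n u] Lq_G[OF u]])
        have "base.expectation (\<lambda>\<omega>. \<bar>?g \<omega>\<bar> powr q)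
            \<le> base.expectation (\<lambda>\<omega>. 2 powr q * (\<bar>?f \<omega>\<bar> powr q + \<bar>?f \<omega> - ?g \<omega>\<bar> powr q))"
        proof (rule integral_mono[OF Lq_G[OF u]])
          show "integrable \<Omega> (\<lambda>\<omega>. 2 powr q * (\<bar>?f \<omega>\<bar> powr q + \<bar>?f \<omega> - ?g \<omega>\<bar> powr q))"
            using intd Lq_Gn[OF n u] by simp
          show "\<bar>?g \<omega>\<bar> powr q \<le> 2 powr q * (\<bar>?f \<omega>\<bar> powr q + \<bar>?f \<omega> - ?g \<omega>\<bar> powr q)" for \<omega>
            using abs_diff_powr_le[of q "?f \<omega>" "?f \<omega> - ?g \<omega>"] q by simp
        qed
        also have "\<dots> = 2 powr q * (base.expectation (\<lambda>\<omega>. \<bar>?f \<omega>\<bar> powr q) + base.expectation (\<lambda>\<omega>. \<bar>?f \<omega> - ?g \<omega>\<bar> powr q))"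
          using intd Lq_Gn[OF n u] by simp
        also have "\<dots> \<le> D"
        proof -
          have "base.expectation (\<lambda>\<omega>. \<bar>?f \<omega>\<bar> powr q) \<le> A powr q"
            using powr_mono2[OF _ Lq_norm_nonneg norm[OF n u], of q] q by (simp add: Lq_norm_powr)
          moreover have "base.expectation (\<lambda>\<omega>. \<bar>?f \<omega> - ?g \<omega>\<bar> powr q) \<le> 1"
            using powr_mono2[OF _ Lq_norm_nonneg nd[OF u], of q] q by (simp add: Lq_norm_powr)
          ultimately show ?thesis unfolding D_def by (intro mult_left_mono add_mono) auto
        qed
        finally show ?thesis .
      qed
      have "((\<lambda>K::real. D * K powr (2 - q)) \<longlongrightarrow> D * 0) at_top"
        by (intro tendsto_mult tendsto_const tendsto_neg_powr filterlim_ident) (use q in simp)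
      then have "\<forall>\<^sub>F K::real in at_top. D * K powr (2 - q) < e\<^sup>2"
        by (rule order_tendstoD) (use e in simp)
      with eventually_gt_at_top[of 0] have "\<forall>\<^sub>F K::real in at_top. 0 < K \<and> D * K powr (2 - q) < e\<^sup>2"
        by (rule eventually_conj)
      then obtain K :: real where K: "0 < K" "D * K powr (2 - q) < e\<^sup>2"
        using eventually_happens[of _ "at_top :: real filter"] by auto
      have "L2_norm S (\<lambda>x. G u x - trunc K (G u x)) \<le> e" if u: "u \<in> {0..1}" for u
      proof (rule L2_norm_leI)
        have mG' [measurable]: "G u \<in> borel_measurable S" by (rule mG)
        have mt: "(\<lambda>x. (G u x - trunc K (G u x))\<^sup>2) \<in> borel_measurable S"
          unfolding trunc_def by measurable
        have "(\<integral>x. (G u x - trunc K (G u x))\<^sup>2 \<partial>S)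
            = base.expectation (\<lambda>\<omega>. (G u (shift_vec eps 0 \<omega>) - trunc K (G u (shift_vec eps 0 \<omega>)))\<^sup>2)"
          using expectation_shift[OF mt, of 0] by simp
        also have "\<dots> \<le> base.expectation (\<lambda>\<omega>. \<bar>G u (shift_vec eps 0 \<omega>)\<bar> powr q * K powr (2 - q))"
          by (rule integral_mono') (use Lq_G[OF u] trunc_error_sq_le[OF K(1) q] in auto)
        also have "\<dots> \<le> D * K powr (2 - q)"
          using Dle[OF u] by (simp add: mult_right_mono)
        finally show "(\<integral>x. (G u x - trunc K (G u x))\<^sup>2 \<partial>S) \<le> e\<^sup>2" using K(2) by linarith
      qed (use e in simp)
      then show ?thesis using K(1) by (intro exI[of _ K]) auto
    qed
  qed (use sq_Gn sq_G norm_Gn rho p in auto)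
qed

end

end

text \<open>The Bochner integral of a non-integrable function is \<open>0\<close>, so the
  integrability hypotheses make \<open>Lq_norm\<close> the genuine norm of the kernels. The numbers
  \<open>A\<close> and \<open>V\<close> bound the two suprema whose sum is at most
  \<open>C_G\<close>.\<close>

theorem theorem2p1:
  fixes M :: "'a measure"
    and eps eps' :: "int \<Rightarrow> 'a \<Rightarrow> real"
    and Gn :: "nat \<Rightarrow> real \<Rightarrow> (nat \<Rightarrow> real) \<Rightarrow> real"
    and G :: "real \<Rightarrow> (nat \<Rightarrow> real) \<Rightarrow> real"
    and q p C_G :: real
    and N :: "'b measure"
    and B :: "real \<Rightarrow> 'b \<Rightarrow> real"
  assumes prob: "prob_space M"
    (* (eps_i) i.i.d., (eps'_i) an independent copy *)
    and indep: "prob_space.indep_vars M (\<lambda>_. borel)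
                  (\<lambda>i. case i of Inl j \<Rightarrow> eps j | Inr j \<Rightarrow> eps' j) (UNIV :: (int + int) set)"
    and ident: "\<And>i. distr M borel (eps i) = distr M borel (eps 0)"
    and ident': "\<And>i. distr M borel (eps' i) = distr M borel (eps 0)"
    (* measurability of the kernels *)
    and meas_Gn: "\<And>n. (\<lambda>(u, x). Gn n u x) \<in> borel_measurable (borel \<Otimes>\<^sub>M Rinf)"
    and meas_G: "(\<lambda>(u, x). G u x) \<in> borel_measurable (borel \<Otimes>\<^sub>M Rinf)"
    and q: "q > 2" and p: "p \<ge> 1"
    (* the L_q norms occurring below are finite *)
    and Lq_Gn: "\<And>n u. n \<ge> 1 \<Longrightarrow> u \<in> {0..1} \<Longrightarrow>
                  integrable M (\<lambda>\<omega>. \<bar>Gn n u (shift_vec eps 0 \<omega>)\<bar> powr q)"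
    and Lq_G: "\<And>u. u \<in> {0..1} \<Longrightarrow> integrable M (\<lambda>\<omega>. \<bar>G u (shift_vec eps 0 \<omega>)\<bar> powr q)"
    (* (A.1) *)
    and A1: "\<forall>e>0. \<exists>n0. \<forall>n\<ge>n0. \<forall>u\<in>{0..1}.
               Lq_norm M q (\<lambda>\<omega>. Gn n u (shift_vec eps 0 \<omega>) - G u (shift_vec eps 0 \<omega>)) \<le> e"
    (* (A.2) *)
    and A2: "\<exists>A V. A + V \<le> C_G \<and>
               (\<forall>n\<ge>1. \<forall>u\<in>{0..1}. Lq_norm M q (\<lambda>\<omega>. Gn n u (shift_vec eps 0 \<omega>)) \<le> A) \<and>
               (\<forall>n\<ge>1. \<forall>m u. is_partition01 m u \<longrightarrow>
                  pvar_sum M q p (\<lambda>v \<omega>. Gn n v (shift_vec eps 0 \<omega>)) m u \<le> V)"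
    (* (A.3) *)
    and A3: "\<exists>\<rho>. 0 < \<rho> \<and> \<rho> < 1 \<and>
               (\<forall>t j n u. j \<ge> 1 \<longrightarrow> n \<ge> 1 \<longrightarrow> u \<in> {0..1} \<longrightarrow>
                  Lq_norm M q (\<lambda>\<omega>. Gn n u (shift_vec eps t \<omega>)
                                     - Gn n u (shift_vec_coupled eps eps' t j \<omega>)) \<le> C_G * \<rho> ^ j)"
    and BM: "std_brownian_motion N B"
  shows
    "let \<sigma>2 = (\<lambda>u. infsum (\<lambda>h::int. covariance M (\<lambda>\<omega>. G u (shift_vec eps h \<omega>))
                                                  (\<lambda>\<omega>. G u (shift_vec eps 0 \<omega>))) UNIV);
         X = (\<lambda>t n \<omega>. Gn n (real t / real n) (shift_vec eps (int t) \<omega>));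
         S = (\<lambda>n \<omega> v. (1 / sqrt (real n)) *
                (\<Sum>t = 1..nat \<lfloor>real n * v\<rfloor>. X t n \<omega> - (\<integral>\<omega>'. X t n \<omega>' \<partial>M)));
         Z = (\<lambda>\<omega> v. B (\<integral>u\<in>{0..v}. \<sigma>2 u \<partial>lborel) \<omega>)
     in weak_conv_D M S N Z"
proof -
  interpret M: prob_space M by (rule prob)
  define \<mu> where "\<mu> = distr M borel (eps 0)"
  have indep_eps: "M.indep_vars (\<lambda>_. borel) eps UNIV"
    using M.indep_vars_reindex_inj[OF indep, of Inl] by simp
  have meas_eps: "eps i \<in> borel_measurable M" for i
    using indep_eps by (auto simp: M.indep_vars_def)
  have mu: "prob_space \<mu>" unfolding \<mu>_def by (rule M.prob_space_distr[OF meas_eps])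
  have iid: "iid_process \<mu> M eps"
  proof (intro iid_process.intro iid_law.intro sequence_space.intro product_prob_spaceI mu
      iid_law_axioms.intro iid_process_axioms.intro prob indep_eps)
    show "sets \<mu> = sets borel" by (simp add: \<mu>_def)
    show "distr M borel (eps i) = \<mu>" for i using ident by (simp add: \<mu>_def)
  qed
  obtain A V where AV: "\<forall>n\<ge>1. \<forall>u\<in>{0..1}. Lq_norm M q (\<lambda>\<omega>. Gn n u (shift_vec eps 0 \<omega>)) \<le> A"
      "\<forall>n\<ge>1. \<forall>m u. is_partition01 m u \<longrightarrow> pvar_sum M q p (\<lambda>v \<omega>. Gn n v (shift_vec eps 0 \<omega>)) m u \<le> V"
    using A2 by blast
  obtain \<rho> where \<rho>: "0 < \<rho>" "\<rho> < 1"
      "\<forall>t j n u. j \<ge> 1 \<longrightarrow> n \<ge> 1 \<longrightarrow> u \<in> {0..1} \<longrightarrow>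
         Lq_norm M q (\<lambda>\<omega>. Gn n u (shift_vec eps t \<omega>) - Gn n u (shift_vec_coupled eps eps' t j \<omega>)) \<le> C_G * \<rho> ^ j"
    using A3 by blast
  have law': "distr M borel (eps' i) = \<mu>" for i using ident' by (simp add: \<mu>_def)
  interpret K: kernel_array \<mu> M eps Gn G A p "V powr p" C_G \<rho>
    by (rule iid_process.kernel_array_of_Lq_conditions[OF iid indep law' meas_Gn meas_G q _ Lq_Gn Lq_G _ _ _ \<rho>(1,2)])
       (use p A1 AV \<rho>(3) in auto)
  have mGn: "Gn n u \<in> borel_measurable K.S" for n u
    unfolding K.measurable_S_iff using measurable_compose[OF measurable_Pair1' meas_Gn, of u n] by simp
  have mG: "G u \<in> borel_measurable K.S" for u
    unfolding K.measurable_S_iff using measurable_compose[OF measurable_Pair1' meas_G, of u] by simp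
  \<comment> \<open>The covariance centres each factor at its own mean; by stationarity both means
    are the integral of \<open>G u\<close> under the product law, so the terms are the
    autocovariances of \<open>Gc u\<close>.\<close>
  have \<sigma>: "(\<lambda>u. infsum (\<lambda>h::int. covariance M (\<lambda>\<omega>. G u (shift_vec eps h \<omega>)) (\<lambda>\<omega>. G u (shift_vec eps 0 \<omega>))) UNIV)
      = K.long_run_var"
    by (simp add: fun_eq_iff K.long_run_var_def K.acov_def[abs_def] K.Gc_def covariance_def K.expectation_shift[OF mG])
  have sum: "(\<lambda>n \<omega> v. (1 / sqrt (real n)) * (\<Sum>t = 1..nat \<lfloor>real n * v\<rfloor>.
        Gn n (real t / real n) (shift_vec eps (int t) \<omega>) - (\<integral>\<omega>'. Gn n (real t / real n) (shift_vec eps (int t) \<omega>') \<partial>M)))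
      = K.scaled_sum"
    by (simp add: fun_eq_iff K.scaled_sum_def psum_def K.expectation_shift[OF mGn] sum_divide_distrib)
  show ?thesis
    unfolding Let_def \<sigma> sum by (rule K.scaled_sum_weak_convergence[OF BM])
qed

end
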